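(* Let $X$ be a compact metric space, $T\colon X\to X$ a homeomorphism, $\mathbb{E}$ a $d$-dimensional vector bundle over $X$, and $\Phi$ an automorphism of $\mathbb{E}$ covering $T$. Suppose $\Phi$ admits an extremal norm $|\!|\!|\cdot|\!|\!|$. Let $p\in\{1,\dots,d\}$. Suppose $Y$ is a nonempty compact $T$-invariant set contained in $M_p(\Phi)\setminus M_{p+1}(\Phi)$. Then the restricted bundle $\mathbb{E}_Y$ admits a dominated splitting $\mathbb{F}\oplus\mathbb{G}$ where the dominating bundle $\mathbb{F}$ has fibers of dimension $p$ and is calibrated in the sense that $|\!|\!|\Phi(u)|\!|\!|=e^{\beta(\Phi)}|\!|\!|u|\!|\!|$ for every $u\in\mathbb{F}$.
   Context: $\pi\colon\mathbb{E}\to X$ is a real vector bundle with fibers $\mathbb{E}_x$; an automorphism $\Phi$ covering $T$ is a continuous map $\mathbb{E}\to\mathbb{E}$ with $\pi\circ\Phi=T\circ\pi$ restricting to linear isomorphisms $\Phi_x\colon\mathbb{E}_x\to\mathbb{E}_{Tx}$; $\Phi^n_x$ is the restriction of $\Phi^n$ to $\mathbb{E}_x$. A Finsler norm on $\mathbb{E}$ is a continuous function $\mathbb{E}\to\mathbb{R}$ restricting to a norm on each fiber; the same symbol denotes induced operator norms. For a $T$-invariant Borel probability $\mu$, $\chi_1(\Phi,\mu)=\int\lim_{n\to\infty}\frac1n\log\|\Phi^n_x\|\,d\mu(x)$ (any Finsler norm), and $\beta(\Phi)=\sup_\mu\chi_1(\Phi,\mu)$ over all such $\mu$. A Finsler norm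 $|\!|\!|\cdot|\!|\!|$ is extremal for $\Phi$ if $\beta(\Phi)=\log\sup_{x\in X}|\!|\!|\Phi_x|\!|\!|$. Lyapunov exponents: $\chi_1(\Phi,\mu)\ge\dots\ge\chi_d(\Phi,\mu)$ are defined by $\sum_{i=1}^p\chi_i(\Phi,\mu)=\chi_1(\Lambda^p\Phi,\mu)$ for $p=1,\dots,d$, where $\Lambda^p\Phi\colon\Lambda^p\mathbb{E}\to\Lambda^p\mathbb{E}$ is the $p$-fold exterior power of $\Phi$. The $p$-th Mather set $M_p(\Phi)$, $1\le p\le d$, is the union of the supports of all $T$-invariant probability measures $\mu$ with $\chi_1(\Phi,\mu)=\dots=\chi_p(\Phi,\mu)=\beta(\Phi)$; $M_{d+1}(\Phi)=\emptyset$. $\mathbb{E}_Y=\pi^{-1}(Y)$. A dominated splitting of $\mathbb{E}_Y$ is a direct sum decomposition $\mathbb{E}_Y=\mathbb{F}\oplus\mathbb{G}$ into continuous subbundles (of constant dimension; $\mathbb{G}$ may be zero) with $\Phi_x(\mathbb{F}_x)=\mathbb{F}_{Tx}$, $\Phi_x(\mathbb{G}_x)=\mathbb{G}_{Tx}$, such that for a Finsler norm $\|\cdot\|$ there are $c,\tau>0$ with $\|\Phi^n_x(v)\|\le ce^{-\tau n}\|\Phi^n_x(u)\|$ for all $x\in Y$, unit vectors $u\in\mathbb{F}_x$, $v\in\mathbb{G}_x$, and $n\ge0$. $\mathbb{F}$ is called the dominating bundle and $\mathbb{G}$ the dominated bundle. *)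

theory Defs
  imports "HOL-Probability.Probability"
begin

section \<open>Real vector bundles\<close>

text \<open>
  The total space is the carrier (\<open>topspace\<close>) of an abstract topology and the base is a subset of a
  metric type, so that exterior powers, restrictions and subbundles are again bundle records.
  The operations are only meaningful for vectors of a common fiber.
\<close>

record ('x, 'e) vbundle =
  base_set :: "'x set"
  tot_space :: "'e topology"
  bproj :: "'e \<Rightarrow> 'x"
  vadd :: "'e \<Rightarrow> 'e \<Rightarrow> 'e"
  vscale :: "real \<Rightarrow> 'e \<Rightarrow> 'e"
  vzero :: "'x \<Rightarrow> 'e"

definition fiber :: "('x, 'e) vbundle \<Rightarrow> 'x \<Rightarrow> 'e set" where
  "fiber B x = {v \<in> topspace (tot_space B). bproj B v = x}"

definition real_vector_space_on ::
    "'e set \<Rightarrow> ('e \<Rightarrow> 'e \<Rightarrow> 'e) \<Rightarrow> (real \<Rightarrow> 'e \<Rightarrow> 'e) \<Rightarrow> 'e \<Rightarrow> bool" where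
  "real_vector_space_on V add smul nul \<longleftrightarrow>
     nul \<in> V \<and>
     (\<forall>u\<in>V. \<forall>v\<in>V. add u v \<in> V \<and> add u v = add v u) \<and>
     (\<forall>u\<in>V. \<forall>v\<in>V. \<forall>w\<in>V. add (add u v) w = add u (add v w)) \<and>
     (\<forall>v\<in>V. add nul v = v \<and> (\<exists>w\<in>V. add v w = nul)) \<and>
     (\<forall>c. \<forall>v\<in>V. smul c v \<in> V) \<and>
     (\<forall>c. \<forall>u\<in>V. \<forall>v\<in>V. smul c (add u v) = add (smul c u) (smul c v)) \<and>
     (\<forall>b c. \<forall>v\<in>V. smul (b + c) v = add (smul b v) (smul c v) \<and>
                   smul (b * c) v = smul b (smul c v)) \<and>
     (\<forall>v\<in>V. smul 1 v = v)"

text \<open>\<open>Euclidean_space d\<close> is the library's model of $d$-space inside the type \<open>nat \<Rightarrow> real\<close>.\<close>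

definition local_trivialization ::
    "('x::topological_space, 'e) vbundle \<Rightarrow> nat \<Rightarrow> 'x set \<Rightarrow> ('e \<Rightarrow> 'x \<times> (nat \<Rightarrow> real)) \<Rightarrow> bool" where
  "local_trivialization B d U h \<longleftrightarrow>
     openin (top_of_set (base_set B)) U \<and>
     homeomorphic_map (subtopology (tot_space B) {v. bproj B v \<in> U})
                      (prod_topology (top_of_set U) (Euclidean_space d)) h \<and>
     (\<forall>x\<in>U. \<forall>u\<in>fiber B x. \<forall>v\<in>fiber B x. \<forall>c i.
        fst (h u) = x \<and>
        snd (h (vadd B u v)) i = snd (h u) i + snd (h v) i \<and>
        snd (h (vscale B c v)) i = c * snd (h v) i)"

definition vector_bundle :: "('x::topological_space, 'e) vbundle \<Rightarrow> nat \<Rightarrow> bool" where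
  "vector_bundle B d \<longleftrightarrow>
     continuous_map (tot_space B) (top_of_set (base_set B)) (bproj B) \<and>
     (\<forall>x\<in>base_set B. real_vector_space_on (fiber B x) (vadd B) (vscale B) (vzero B x)) \<and>
     (\<forall>x\<in>base_set B. \<exists>U h. x \<in> U \<and> local_trivialization B d U h)"

definition bundle_over :: "('x, 'e) vbundle \<Rightarrow> 'x set \<Rightarrow> 'e set" where
  "bundle_over B Y = {v \<in> topspace (tot_space B). bproj B v \<in> Y}"

definition subbundle_over ::
    "('x::topological_space, 'e) vbundle \<Rightarrow> 'x set \<Rightarrow> 'e set \<Rightarrow> nat \<Rightarrow> bool" where
  "subbundle_over B Y F k \<longleftrightarrow>
     F \<subseteq> bundle_over B Y \<and>
     vector_bundle (B\<lparr>base_set := Y, tot_space := subtopology (tot_space B) F\<rparr>) k"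

definition bundle_automorphism ::
    "('x::topological_space, 'e) vbundle \<Rightarrow> ('x \<Rightarrow> 'x) \<Rightarrow> ('e \<Rightarrow> 'e) \<Rightarrow> bool" where
  "bundle_automorphism B T \<Phi> \<longleftrightarrow>
     continuous_map (tot_space B) (tot_space B) \<Phi> \<and>
     (\<forall>v\<in>topspace (tot_space B). bproj B (\<Phi> v) = T (bproj B v)) \<and>
     (\<forall>x\<in>base_set B.
        bij_betw \<Phi> (fiber B x) (fiber B (T x)) \<and>
        (\<forall>u\<in>fiber B x. \<forall>v\<in>fiber B x. \<Phi> (vadd B u v) = vadd B (\<Phi> u) (\<Phi> v)) \<and>
        (\<forall>c. \<forall>v\<in>fiber B x. \<Phi> (vscale B c v) = vscale B c (\<Phi> v)))"

section \<open>Finsler norms and the top Lyapunov exponent\<close>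

definition finsler_norm :: "('x, 'e) vbundle \<Rightarrow> ('e \<Rightarrow> real) \<Rightarrow> bool" where
  "finsler_norm B N \<longleftrightarrow>
     continuous_map (tot_space B) euclideanreal N \<and>
     (\<forall>x\<in>base_set B.
        (\<forall>v\<in>fiber B x. 0 \<le> N v \<and> (N v = 0 \<longleftrightarrow> v = vzero B x)) \<and>
        (\<forall>c. \<forall>v\<in>fiber B x. N (vscale B c v) = \<bar>c\<bar> * N v) \<and>
        (\<forall>u\<in>fiber B x. \<forall>v\<in>fiber B x. N (vadd B u v) \<le> N u + N v))"

definition fiber_opnorm :: "('x, 'e) vbundle \<Rightarrow> ('e \<Rightarrow> real) \<Rightarrow> ('e \<Rightarrow> 'e) \<Rightarrow> 'x \<Rightarrow> real" where
  "fiber_opnorm B N \<Phi> x = (SUP v\<in>{v \<in> fiber B x. N v \<le> 1}. N (\<Phi> v))"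

definition invariant_measures :: "('x::topological_space \<Rightarrow> 'x) \<Rightarrow> 'x measure set" where
  "invariant_measures T =
     {\<mu>. prob_space \<mu> \<and> sets \<mu> = sets borel \<and> distr \<mu> borel T = \<mu>}"

text \<open>
  Over a compact base any two Finsler norms are uniformly equivalent, so the choice of the norm is
  immaterial. Where the limit does not exist (a null set, by Kingman's theorem), \<open>lim\<close> is a fixed
  constant, so the integrand is Borel measurable.
\<close>

definition top_exponent ::
    "('x::topological_space, 'e) vbundle \<Rightarrow> ('e \<Rightarrow> 'e) \<Rightarrow> 'x measure \<Rightarrow> real" where
  "top_exponent B \<Phi> \<mu> =
     (let N = (SOME N. finsler_norm B N)
      in LINT x|\<mu>. lim (\<lambda>n. (1 / real n) * ln (fiber_opnorm B N (\<Phi> ^^ n) x)))"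

definition max_exponent ::
    "('x::topological_space, 'e) vbundle \<Rightarrow> ('x \<Rightarrow> 'x) \<Rightarrow> ('e \<Rightarrow> 'e) \<Rightarrow> real" where
  "max_exponent B T \<Phi> = (SUP \<mu>\<in>invariant_measures T. top_exponent B \<Phi> \<mu>)"

definition extremal_norm ::
    "('x::topological_space, 'e) vbundle \<Rightarrow> ('x \<Rightarrow> 'x) \<Rightarrow> ('e \<Rightarrow> 'e) \<Rightarrow> ('e \<Rightarrow> real) \<Rightarrow> bool" where
  "extremal_norm B T \<Phi> N \<longleftrightarrow>
     finsler_norm B N \<and>
     max_exponent B T \<Phi> = ln (SUP x\<in>base_set B. fiber_opnorm B N \<Phi> x)"

section \<open>Exterior powers\<close>

definition fiber_tuples :: "('x, 'e) vbundle \<Rightarrow> nat \<Rightarrow> 'x \<Rightarrow> 'e list set" where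
  "fiber_tuples B p x = {us. length us = p \<and> set us \<subseteq> fiber B x}"

text \<open>Alternating \<open>p\<close>-linear forms on the fiber over \<open>x\<close>, extended by zero.\<close>

definition alt_forms :: "('x, 'e) vbundle \<Rightarrow> nat \<Rightarrow> 'x \<Rightarrow> ('e list \<Rightarrow> real) set" where
  "alt_forms B p x =
     {\<omega>. (\<forall>us. us \<notin> fiber_tuples B p x \<longrightarrow> \<omega> us = 0) \<and>
         (\<forall>us\<in>fiber_tuples B p x. \<forall>i<p.
            (\<forall>a\<in>fiber B x. \<forall>b\<in>fiber B x.
               \<omega> (us[i := vadd B a b]) = \<omega> (us[i := a]) + \<omega> (us[i := b])) \<and>
            (\<forall>c. \<forall>a\<in>fiber B x. \<omega> (us[i := vscale B c a]) = c * \<omega> (us[i := a]))) \<and>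
         (\<forall>us\<in>fiber_tuples B p x. \<not> distinct us \<longrightarrow> \<omega> us = 0)}"

text \<open>
  The exterior power of a real vector space embeds canonically into the dual of the space of
  alternating \<open>p\<close>-forms, a decomposable element $u_1 \wedge \dots \wedge u_p$ acting by evaluation
  at $(u_1, \dots, u_p)$; it is realized here as its image, the span of the decomposable elements.
\<close>

definition wedge :: "('x, 'e) vbundle \<Rightarrow> nat \<Rightarrow> 'x \<Rightarrow> 'e list \<Rightarrow> ('e list \<Rightarrow> real) \<Rightarrow> real" where
  "wedge B p x us = (\<lambda>\<omega>. if \<omega> \<in> alt_forms B p x then \<omega> us else 0)"

definition ext_power :: "('x, 'e) vbundle \<Rightarrow> nat \<Rightarrow> 'x \<Rightarrow> (('e list \<Rightarrow> real) \<Rightarrow> real) set" where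
  "ext_power B p x =
     {\<xi>. \<exists>(m::nat) c u. (\<forall>j<m. u j \<in> fiber_tuples B p x) \<and>
                         \<xi> = (\<lambda>\<omega>. \<Sum>j<m. c j * wedge B p x (u j) \<omega>)}"

definition frame ::
    "('x, 'e) vbundle \<Rightarrow> 'x set \<Rightarrow> ('e \<Rightarrow> 'x \<times> (nat \<Rightarrow> real)) \<Rightarrow> nat \<Rightarrow> 'x \<Rightarrow> 'e" where
  "frame B U h i x = inv_into (bundle_over B U) h (x, \<lambda>j. if j = i then 1 else 0)"

text \<open>
  A local frame $e_0, \dots, e_{d-1}$ over \<open>U\<close> induces the chart
  $(x, c) \mapsto \sum_I c_I\, e_I(x)$ of the exterior power, where
  $e_I = e_{i_1} \wedge \dots \wedge e_{i_p}$ for $I = \{i_1 < \dots < i_p\}$; the topology of the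
  exterior power is the one for which all these charts are homeomorphisms onto open sets.
\<close>

definition index_sets :: "nat \<Rightarrow> nat \<Rightarrow> nat set set" where
  "index_sets d p = {I. I \<subseteq> {..<d} \<and> card I = p}"

definition ext_chart ::
    "('x, 'e) vbundle \<Rightarrow> nat \<Rightarrow> nat \<Rightarrow> 'x set \<Rightarrow> ('e \<Rightarrow> 'x \<times> (nat \<Rightarrow> real)) \<Rightarrow>
     'x \<times> (nat set \<Rightarrow> real) \<Rightarrow> 'x \<times> (('e list \<Rightarrow> real) \<Rightarrow> real)" where
  "ext_chart B d p U h =
     (\<lambda>(x, c). (x, \<lambda>\<omega>. \<Sum>I\<in>index_sets d p.
        c I * wedge B p x (map (\<lambda>i. frame B U h i x) (sorted_list_of_set I)) \<omega>))"

definition ext_bundle ::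
    "('x::topological_space, 'e) vbundle \<Rightarrow> nat \<Rightarrow> nat \<Rightarrow>
     ('x, 'x \<times> (('e list \<Rightarrow> real) \<Rightarrow> real)) vbundle" where
  "ext_bundle B d p =
     \<lparr>base_set = base_set B,
      tot_space = subtopology
        (topology_generated_by
          {ext_chart B d p U h ` W | U h W.
             local_trivialization B d U h \<and>
             openin (prod_topology (top_of_set U) (powertop_real (index_sets d p))) W})
        {(x, \<xi>). x \<in> base_set B \<and> \<xi> \<in> ext_power B p x},
      bproj = fst,
      vadd = (\<lambda>(x, \<xi>) (y, \<eta>). (x, \<lambda>\<omega>. \<xi> \<omega> + \<eta> \<omega>)),
      vscale = (\<lambda>c (x, \<xi>). (x, \<lambda>\<omega>. c * \<xi> \<omega>)),
      vzero = (\<lambda>x. (x, \<lambda>\<omega>. 0))\<rparr>"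

definition form_pullback ::
    "('x, 'e) vbundle \<Rightarrow> nat \<Rightarrow> ('e \<Rightarrow> 'e) \<Rightarrow> 'x \<Rightarrow> ('e list \<Rightarrow> real) \<Rightarrow> 'e list \<Rightarrow> real" where
  "form_pullback B p \<Phi> x \<omega> = (\<lambda>us. if us \<in> fiber_tuples B p x then \<omega> (map \<Phi> us) else 0)"

definition ext_map ::
    "('x, 'e) vbundle \<Rightarrow> nat \<Rightarrow> ('x \<Rightarrow> 'x) \<Rightarrow> ('e \<Rightarrow> 'e) \<Rightarrow>
     'x \<times> (('e list \<Rightarrow> real) \<Rightarrow> real) \<Rightarrow> 'x \<times> (('e list \<Rightarrow> real) \<Rightarrow> real)" where
  "ext_map B p T \<Phi> =
     (\<lambda>(x, \<xi>). (T x, \<lambda>\<omega>. if \<omega> \<in> alt_forms B p (T x)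
                        then \<xi> (form_pullback B p \<Phi> x \<omega>) else 0))"

text \<open>The defining property of the exterior power of a map, on decomposable elements:\<close>

lemma ext_map_wedge:
  assumes B: "vector_bundle B d" and \<Phi>: "bundle_automorphism B T \<Phi>"
    and x: "x \<in> base_set B" and us: "us \<in> fiber_tuples B p x"
  shows "ext_map B p T \<Phi> (x, wedge B p x us) = (T x, wedge B p (T x) (map \<Phi> us))"
proof -
  have lin: "\<Phi> (vadd B a b) = vadd B (\<Phi> a) (\<Phi> b)" "\<Phi> (vscale B c a) = vscale B c (\<Phi> a)"
    if "a \<in> fiber B x" "b \<in> fiber B x" for a b c
    using \<Phi> x that unfolding bundle_automorphism_def by blast+
  have maps: "\<Phi> a \<in> fiber B (T x)" if "a \<in> fiber B x" for a
    using \<Phi> x that unfolding bundle_automorphism_def bij_betw_def by blast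
  have closed: "vadd B a b \<in> fiber B x" "vscale B c a \<in> fiber B x"
    if "a \<in> fiber B x" "b \<in> fiber B x" for a b c
    using B x that unfolding vector_bundle_def real_vector_space_on_def by blast+
  have tup: "map \<Phi> vs \<in> fiber_tuples B p (T x)" if "vs \<in> fiber_tuples B p x" for vs
    using that maps by (auto simp: fiber_tuples_def)
  have upd: "vs[i := a] \<in> fiber_tuples B p x" if "vs \<in> fiber_tuples B p x" "a \<in> fiber B x" for vs i a
    using that set_update_subset_insert[of vs i a] by (auto simp: fiber_tuples_def)
  have "form_pullback B p \<Phi> x \<omega> \<in> alt_forms B p x" if \<omega>: "\<omega> \<in> alt_forms B p (T x)" for \<omega>
    unfolding alt_forms_def mem_Collect_eq
  proof (intro conjI ballI allI impI)
    fix vs i a b assume "vs \<in> fiber_tuples B p x" "i < p" "a \<in> fiber B x" "b \<in> fiber B x"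
    then show "form_pullback B p \<Phi> x \<omega> (vs[i := vadd B a b]) =
        form_pullback B p \<Phi> x \<omega> (vs[i := a]) + form_pullback B p \<Phi> x \<omega> (vs[i := b])"
      using \<omega> tup[of vs] maps by (simp add: form_pullback_def upd closed lin map_update alt_forms_def)
  next
    fix vs i c a assume "vs \<in> fiber_tuples B p x" "i < p" "a \<in> fiber B x"
    then show "form_pullback B p \<Phi> x \<omega> (vs[i := vscale B c a]) = c * form_pullback B p \<Phi> x \<omega> (vs[i := a])"
      using \<omega> tup[of vs] maps by (simp add: form_pullback_def upd closed lin map_update alt_forms_def)
  next
    fix vs assume "vs \<in> fiber_tuples B p x" "\<not> distinct vs"
    then show "form_pullback B p \<Phi> x \<omega> vs = 0"
      using \<omega> tup[of vs] by (auto simp: form_pullback_def alt_forms_def distinct_map)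
  qed (simp add: form_pullback_def)
  then show ?thesis
    using us by (auto simp: ext_map_def wedge_def form_pullback_def)
qed

section \<open>Lyapunov exponents and Mather sets\<close>

text \<open>Sum of the \<open>p\<close> largest exponents; the first exterior power is identified with the bundle.\<close>

definition exponent_sum ::
    "('x::topological_space, 'e) vbundle \<Rightarrow> nat \<Rightarrow> ('x \<Rightarrow> 'x) \<Rightarrow> ('e \<Rightarrow> 'e) \<Rightarrow> 'x measure \<Rightarrow>
     nat \<Rightarrow> real" where
  "exponent_sum B d T \<Phi> \<mu> p =
     (if p = 0 then 0
      else if p = 1 then top_exponent B \<Phi> \<mu>
      else top_exponent (ext_bundle B d p) (ext_map B p T \<Phi>) \<mu>)"

definition lyapunov_exponent ::
    "('x::topological_space, 'e) vbundle \<Rightarrow> nat \<Rightarrow> ('x \<Rightarrow> 'x) \<Rightarrow> ('e \<Rightarrow> 'e) \<Rightarrow> 'x measure \<Rightarrow>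
     nat \<Rightarrow> real" where
  "lyapunov_exponent B d T \<Phi> \<mu> i = exponent_sum B d T \<Phi> \<mu> i - exponent_sum B d T \<Phi> \<mu> (i - 1)"

definition measure_support :: "'x::topological_space measure \<Rightarrow> 'x set" where
  "measure_support \<mu> = {x. \<forall>U. open U \<longrightarrow> x \<in> U \<longrightarrow> emeasure \<mu> U > 0}"

definition mather_set ::
    "('x::topological_space, 'e) vbundle \<Rightarrow> nat \<Rightarrow> ('x \<Rightarrow> 'x) \<Rightarrow> ('e \<Rightarrow> 'e) \<Rightarrow> nat \<Rightarrow> 'x set" where
  "mather_set B d T \<Phi> p =
     (if p \<le> d then
        \<Union>{measure_support \<mu> | \<mu>. \<mu> \<in> invariant_measures T \<and>
            (\<forall>i\<in>{1..p}. lyapunov_exponent B d T \<Phi> \<mu> i = max_exponent B T \<Phi>)}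
      else {})"

section \<open>Dominated splittings\<close>

definition dominated_splitting ::
    "('x::topological_space, 'e) vbundle \<Rightarrow> ('x \<Rightarrow> 'x) \<Rightarrow> ('e \<Rightarrow> 'e) \<Rightarrow> 'x set \<Rightarrow>
     'e set \<Rightarrow> nat \<Rightarrow> 'e set \<Rightarrow> nat \<Rightarrow> bool" where
  "dominated_splitting B T \<Phi> Y F k G l \<longleftrightarrow>
     subbundle_over B Y F k \<and> subbundle_over B Y G l \<and>
     (\<forall>x\<in>Y. \<forall>w\<in>fiber B x.
        \<exists>!(u, v). u \<in> F \<inter> fiber B x \<and> v \<in> G \<inter> fiber B x \<and> w = vadd B u v) \<and>
     (\<forall>x\<in>Y. \<Phi> ` (F \<inter> fiber B x) = F \<inter> fiber B (T x) \<and>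
             \<Phi> ` (G \<inter> fiber B x) = G \<inter> fiber B (T x)) \<and>
     (\<exists>N. finsler_norm B N \<and>
       (\<exists>c>0. \<exists>\<tau>>0. \<forall>x\<in>Y. \<forall>u\<in>F \<inter> fiber B x. \<forall>v\<in>G \<inter> fiber B x. \<forall>n::nat.
          N u = 1 \<longrightarrow> N v = 1 \<longrightarrow>
          N ((\<Phi> ^^ n) v) \<le> c * exp (- \<tau> * real n) * N ((\<Phi> ^^ n) u)))"

end

theory Submission
  imports Defs
begin

text \<open>
  Let $L = e^{\beta}$, so that $N(\Phi v) \le L\,N(v)$, and let $\rho_n(v) = L^{-n} N(\Phi^n v)$, which decreases
  in $n$. A tuple $u_1, \dots, u_k$ over $x$ is called expanding if $\rho_n(\sum_j t_j u_j) \ge \kappa \max_j |t_j|$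
  for all $n$ and $t$, with some $\kappa > 0$.

  The growth of the exterior power $\Lambda^k \Phi^n$ is comparable to the maximal $k$-volume of the image of the unit
  ball under $\Phi^n$. If the $k$ largest exponents of $\mu$ all equal $\beta$, the logarithm of this volume, normalized
  by $L^{-nk}$, is bounded above, subadditive, and has growth rate zero; with Kingman's theorem and a Markov type estimate
  it is bounded below along $\mu$-almost every orbit, and then $\mu$-almost every fiber contains an expanding $k$-tuple.
  Conversely, the points of $Y$ that carry an expanding $k$-tuple of bounded length with a given $\kappa$ form a compact
  forward invariant set, and any invariant measure on it (Krylov--Bogoliubov) has its first $k$ exponents equal to
  $\beta$.

  Hence no point of $Y$ carries an expanding $(p+1)$-tuple. At a recurrent point with an expanding $p$-tuple, limits of
  Auerbach bases of the images of its span give $p$-frames over nearby points, and finally over each $x \in Y$, whose span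
  consists of vectors with $N(\Phi^n u) = L^n N(u)$ for all $n \in \mathbb{Z}$. These vectors form the bundle
  $\mathbb{F}$. The bundle $\mathbb{G}$ consists of the vectors with $\rho_n(v) \to 0$. Since no $(p+1)$-tuple is
  expanding, $\mathbb{F}_x$ and $\mathbb{G}_x$ span the fiber, and by compactness $\rho_n$ contracts $\mathbb{G}$
  uniformly.
\<close>

section \<open>Kingman's theorem\<close>

text \<open>Equal exponents are an asymptotic property of almost every orbit and tolerate
  subexponential losses, whereas the splitting is a uniform property at every point of
  \<open>Y\<close>. The extremal norm closes this gap: the normalized logarithmic volume is bounded
  above by a constant, and a function that is bounded above and has nonnegative mean is rarely very
  negative. Expansion at all times with a fixed constant is then a closed condition, which
  compactness carries to limits. Two more obstacles shape the construction. Points of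
  \<open>Y\<close> may lie in the supports of different measures, so the fibers are found pointwise;
  that they fit together is due to the bound \<open>p\<close> on the number of independent
  bicalibrated vectors. And bicalibrated vectors are not evidently closed under addition, since a
  sum may lose norm under iteration. Linearity is supplied by calibrated frames, all of whose
  combinations are bicalibrated, and an additional vector is excluded by following the tuple
  backwards in time to a limit point of \<open>Y\<close>.\<close>

text \<open>Cut the orbit into blocks: a good time starts a block of length at most \<open>k\<close> on which \<open>s\<close> grows at rate
  \<open>a\<close>, a bad time is a block of length 1.\<close>

lemma subadditive_orbit_bound:
  fixes s :: "nat \<Rightarrow> nat \<Rightarrow> real"
  assumes sub: "\<And>i m n. s i (m + n) \<le> s i m + s (i + m) n"
    and zero: "\<And>i. s i 0 \<le> 0" and one: "\<And>i. s i 1 \<le> C" and C: "0 \<le> C"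
    and good: "\<And>i. \<not> bad i \<Longrightarrow> \<exists>n\<in>{1..k}. s i n \<le> a * real n"
  shows "s i N \<le> a * real N + (C + \<bar>a\<bar>) * (\<Sum>j<N. of_bool (bad (i + j))) + (C + \<bar>a\<bar>) * real k"
proof (induction N arbitrary: i rule: less_induct)
  case (less N)
  have triv: "s i n \<le> C * real n" for i n
  proof (induction n arbitrary: i)
    case 0 then show ?case using zero by simp
  next
    case (Suc n)
    have "s i (Suc n) \<le> s i n + s (i + n) 1" using sub[of i n 1] by simp
    also have "\<dots> \<le> C * real n + C" using Suc one by (intro add_mono) auto
    finally show ?case by (simp add: algebra_simps)
  qed
  have pos: "0 \<le> (C + \<bar>a\<bar>) * (\<Sum>j<n. of_bool (bad (i + j)))" for i n
    using C by (intro mult_nonneg_nonneg sum_nonneg) auto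
  show ?case
  proof (cases "N \<le> k")
    \<comment> \<open>A remaining piece of length at most \<open>k\<close> is paid for by the last
      summand, since \<open>C \<le> a + (C + \<bar>a\<bar>)\<close>.\<close>
    case True
    have "s i N \<le> C * real N" by (rule triv)
    also have "\<dots> \<le> a * real N + (C + \<bar>a\<bar>) * real N"
      by (smt (verit, best) distrib_right mult_right_mono of_nat_0_le_iff)
    also have "\<dots> \<le> a * real N + (C + \<bar>a\<bar>) * real k"
      using True C by (intro add_left_mono mult_left_mono) auto
    finally show ?thesis using pos[of i N] by linarith
  next
    case False
    show ?thesis
    proof (cases "bad i")
      \<comment> \<open>A bad step costs \<open>C\<close> instead of \<open>a\<close>; the excess is
        charged to the indicator of time \<open>i\<close>.\<close>
      case True
      obtain M where M: "N = Suc M" using False by (cases N) auto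
      have "s i N \<le> s i 1 + s (i + 1) M" using sub[of i 1 M] M by simp
      also have "\<dots> \<le> C + (a * real M + (C + \<bar>a\<bar>) * (\<Sum>j<M. of_bool (bad (i + 1 + j))) + (C + \<bar>a\<bar>) * real k)"
        using one less.IH[of M "i+1"] M by (intro add_mono) auto
      also have "\<dots> \<le> a * real N + (C + \<bar>a\<bar>) * (1 + (\<Sum>j<M. of_bool (bad (i + Suc j)))) + (C + \<bar>a\<bar>) * real k"
        using M by (simp add: algebra_simps)
      also have "1 + (\<Sum>j<M. of_bool (bad (i + Suc j))) = (\<Sum>j<N. (of_bool (bad (i + j)) :: real))"
        unfolding M sum.lessThan_Suc_shift using True by simp
      finally show ?thesis .
    next
      case nb: False
      then obtain n where n: "n \<in> {1..k}" "s i n \<le> a * real n" using good by blast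
      define M where "M = N - n"
      have M: "N = n + M" "M < N" using n False by (auto simp: M_def)
      have "s i N \<le> s i n + s (i + n) M" using sub[of i n M] M by simp
      also have "\<dots> \<le> a * real n + (a * real M + (C + \<bar>a\<bar>) * (\<Sum>j<M. of_bool (bad (i + n + j))) + (C + \<bar>a\<bar>) * real k)"
        using n less.IH[of M "i+n"] M by (intro add_mono) auto
      also have "\<dots> = a * real N + (C + \<bar>a\<bar>) * (\<Sum>j<M. of_bool (bad (i + (n + j)))) + (C + \<bar>a\<bar>) * real k"
        using M by (simp add: algebra_simps)
      also have "(\<Sum>j<M. of_bool (bad (i + (n + j)))) = (\<Sum>j\<in>{n..<N}. (of_bool (bad (i + j)) :: real))"
        by (rule sum.reindex_bij_witness[of _ "\<lambda>j. j - n" "\<lambda>j. n + j"]) (auto simp: M)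
      also have "(C + \<bar>a\<bar>) * \<dots> \<le> (C + \<bar>a\<bar>) * (\<Sum>j<N. of_bool (bad (i + j)))"
        using C by (intro mult_left_mono sum_mono2) auto
      finally show ?thesis by simp
    qed
  qed
qed

section \<open>The maximal inequality and almost sure convergence\<close>

locale measure_preserving = prob_space M for M :: "'a measure" +
  fixes T :: "'a \<Rightarrow> 'a"
  assumes T_measurable[measurable]: "T \<in> measurable M M" and T_invariant: "distr M M T = M"
begin

lemma iterate_measurable[measurable]: "(T ^^ n) \<in> measurable M M"
  by (induction n) auto

lemma distr_iterate: "distr M M (T ^^ n) = M"
proof (induction n)
  case 0 then show ?case by (simp add: distr_id2 id_def)
next
  case (Suc n)
  have "distr M M (T ^^ Suc n) = distr (distr M M (T ^^ n)) M T"
    by (simp add: distr_distr)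
  then show ?case using Suc T_invariant by (simp add: comp_def)
qed

lemma iterate_space: "x \<in> space M \<Longrightarrow> (T ^^ n) x \<in> space M"
  by (rule measurable_space[OF iterate_measurable])

lemma integral_iterate:
  fixes f :: "'a \<Rightarrow> real"
  assumes [measurable]: "f \<in> borel_measurable M"
  shows "(\<integral>x. f ((T ^^ n) x) \<partial>M) = (\<integral>x. f x \<partial>M)"
proof -
  have "(\<integral>x. f x \<partial>M) = (\<integral>x. f x \<partial>(distr M M (T ^^ n)))" using distr_iterate by simp
  also have "\<dots> = (\<integral>x. f ((T ^^ n) x) \<partial>M)" by (rule integral_distr) auto
  finally show ?thesis by simp
qed

lemma measure_vimage_iterate:
  assumes [measurable]: "A \<in> sets M"
  shows "prob {x \<in> space M. (T ^^ n) x \<in> A} = prob A"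
proof -
  have "prob A = measure (distr M M (T ^^ n)) A" using distr_iterate by simp
  also have "\<dots> = prob ((T ^^ n) -` A \<inter> space M)" by (rule measure_distr) auto
  also have "(T ^^ n) -` A \<inter> space M = {x \<in> space M. (T ^^ n) x \<in> A}" by auto
  finally show ?thesis by simp
qed

lemma integrable_bounded:
  fixes f :: "'a \<Rightarrow> real"
  assumes "f \<in> borel_measurable M" "\<And>x. x \<in> space M \<Longrightarrow> \<bar>f x\<bar> \<le> B"
  shows "integrable M f"
  using assms by (intro integrable_const_bound[of _ B]) auto

text \<open>A covering argument: with \<open>- S n\<close> as subadditive sequence and rate
  \<open>- l\<close>, the good times are the visits to \<open>E k\<close>, and each of them starts a
  block of length at most \<open>k\<close> on which \<open>B\<close> has frequency above
  \<open>l\<close>. The boundary error \<open>l * k\<close> disappears after integration and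
  division by the orbit length; then \<open>k\<close> tends to infinity.\<close>

lemma maximal_inequality:
  assumes B[measurable]: "B \<in> sets M" and l: "0 < l"
  shows "prob {x \<in> space M. \<exists>n\<ge>1. l * real n < (\<Sum>i<n. indicator B ((T ^^ i) x))} \<le> prob B / l"
proof -
  define S where "S n x = (\<Sum>i<n. indicator B ((T ^^ i) x) :: real)" for n x
  have [measurable]: "S n \<in> borel_measurable M" for n unfolding S_def by measurable
  define E where "E k = {x \<in> space M. \<exists>n\<in>{1..k}. l * real n < S n x}" for k
  have [measurable]: "E k \<in> sets M" for k unfolding E_def by measurable
  have SS: "S (m + n) x = S m x + S n ((T ^^ m) x)" for m n x
  proof (induction n)
    case (Suc n)
    have "S (m + Suc n) x = S (m + n) x + indicator B ((T ^^ (m + n)) x)" by (simp add: S_def)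
    also have "(T ^^ (m + n)) x = (T ^^ n) ((T ^^ m) x)" by (simp add: funpow_add add.commute[of m n])
    finally show ?case using Suc by (simp add: S_def)
  qed (simp add: S_def)
  have ek: "prob (E k) \<le> prob B / l" for k
  proof -
    have pt: "l * (\<Sum>j<N. indicator (E k) ((T ^^ j) x)) \<le> S N x + l * real k" if x: "x \<in> space M" for x N
    proof -
      have "- S N ((T ^^ 0) x) \<le> (- l) * real N
         + (0 + \<bar>-l\<bar>) * (\<Sum>j<N. of_bool ((\<lambda>i. (T ^^ i) x \<notin> E k) (0 + j))) + (0 + \<bar>-l\<bar>) * real k"
      proof (rule subadditive_orbit_bound[where s = "\<lambda>i n. - S n ((T ^^ i) x)" and i = 0])
        fix i m n
        have "(T ^^ m) ((T ^^ i) x) = (T ^^ (i + m)) x"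
          by (simp add: funpow_add add.commute[of i m])
        then show "- S (m + n) ((T ^^ i) x) \<le> - S m ((T ^^ i) x) + - S n ((T ^^ (i + m)) x)"
          using SS[of m n "(T ^^ i) x"] by simp
      next
        fix i assume "\<not> (T ^^ i) x \<notin> E k"
        then obtain n where "n \<in> {1..k}" "l * real n < S n ((T ^^ i) x)" unfolding E_def by auto
        then show "\<exists>n\<in>{1..k}. - S n ((T ^^ i) x) \<le> - l * real n" by (intro bexI[of _ n]) auto
      qed (auto simp: S_def indicator_def)
      then have 1: "- S N x \<le> - l * real N + l * (\<Sum>j<N. of_bool ((T ^^ j) x \<notin> E k)) + l * real k"
        using l by simp
      have "real N = (\<Sum>j<N. of_bool ((T ^^ j) x \<notin> E k)) + (\<Sum>j<N. indicator (E k) ((T ^^ j) x))"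
      proof -
        have "real N = (\<Sum>j<N. 1)" by simp
        also have "\<dots> = (\<Sum>j<N. of_bool ((T ^^ j) x \<notin> E k) + indicator (E k) ((T ^^ j) x))"
          by (intro sum.cong) (auto simp: indicator_def)
        finally show ?thesis by (simp only: sum.distrib)
      qed
      then have "l * real N = l * (\<Sum>j<N. of_bool ((T ^^ j) x \<notin> E k)) + l * (\<Sum>j<N. indicator (E k) ((T ^^ j) x))"
        by (metis distrib_left)
      then show ?thesis using 1 by simp
    qed
    have "l * (real N * prob (E k)) \<le> real N * prob B + l * real k" for N
    proof -
      have int: "integrable M (\<lambda>x. indicator A ((T ^^ j) x) :: real)" if [measurable]: "A \<in> sets M" for A j
        by (intro integrable_bounded[of _ 1]) (auto simp: indicator_def)
      have ii: "(\<integral>x. indicator A ((T ^^ j) x) \<partial>M) = prob A" if [measurable]: "A \<in> sets M" for A j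
      proof -
        have "A \<inter> space M = A" using sets.sets_into_space[OF that] by auto
        then show ?thesis using integral_iterate[of "indicator A" j] by simp
      qed
      have "(\<integral>x. l * (\<Sum>j<N. indicator (E k) ((T ^^ j) x)) \<partial>M) \<le> (\<integral>x. S N x + l * real k \<partial>M)"
        using pt int by (intro integral_mono) (auto simp: S_def intro!: Bochner_Integration.integrable_add
          Bochner_Integration.integrable_sum)
      also have "(\<integral>x. l * (\<Sum>j<N. indicator (E k) ((T ^^ j) x)) \<partial>M) = l * (real N * prob (E k))"
        using int ii by (simp add: Bochner_Integration.integral_sum)
      also have "(\<integral>x. S N x + l * real k \<partial>M) = real N * prob B + l * real k"
        unfolding S_def using int ii
        by (subst Bochner_Integration.integral_add) (auto simp: Bochner_Integration.integral_sum prob_space)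
      finally show ?thesis .
    qed
    then have "(l * prob (E k) - prob B) * real N \<le> l * real k" for N by (simp add: algebra_simps)
    then have "l * prob (E k) - prob B \<le> 0"
      by (metis dual_order.strict_trans1 linorder_not_less mult.commute reals_Archimedean3)
    then show ?thesis using l by (simp add: field_simps)
  qed
  have "(\<lambda>k. prob (E k)) \<longlonglongrightarrow> prob (\<Union>k. E k)"
  proof (rule finite_Lim_measure_incseq)
    show "incseq E" unfolding incseq_def E_def by fastforce
  qed auto
  then have "prob (\<Union>k. E k) \<le> prob B / l"
    using ek by (intro LIMSEQ_le_const2) auto
  also have "(\<Union>k. E k) = {x \<in> space M. \<exists>n\<ge>1. l * real n < (\<Sum>i<n. indicator B ((T ^^ i) x))}"
    unfolding E_def S_def by (auto, force)
  finally show ?thesis .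
qed

text \<open>It suffices that, for each rational \<open>a\<close>, a lower limit below
  \<open>a\<close> almost surely forces an upper limit at most \<open>a\<close>. The blocks of
  growth rate below \<open>a\<close> have no bounded length, but the points that start no such block
  of length at most \<open>k\<close> form a set of small measure, and the maximal inequality makes
  its visits rare.\<close>

theorem kingman_convergent:
  fixes h :: "nat \<Rightarrow> 'a \<Rightarrow> real"
  assumes [measurable]: "\<And>n. h n \<in> borel_measurable M"
    and sub: "\<And>m n x. x \<in> space M \<Longrightarrow> h (m + n) x \<le> h m x + h n ((T ^^ m) x)"
    and bound: "\<And>n x. x \<in> space M \<Longrightarrow> \<bar>h n x\<bar> \<le> C * real n"
  shows "AE x in M. convergent (\<lambda>n. h n x / real n)"
proof -
  have Cpos: "0 \<le> C"
  proof -
    obtain x where "x \<in> space M" using not_empty by auto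
    then show ?thesis using bound[of x 1] by auto
  qed
  have key: "AE x in M. (\<exists>j::nat. \<forall>m. \<exists>n\<ge>m. h n x < (a - 1 / real (Suc j)) * real n) \<longrightarrow>
       (\<forall>j::nat. \<exists>K. \<forall>n. h n x \<le> (a + 1 / real (Suc j)) * real n + K)" for a :: real
  proof -
    define A where "A = {x \<in> space M. \<exists>j::nat. \<forall>m. \<exists>n\<ge>m. h n x < (a - 1 / real (Suc j)) * real n}"
    have [measurable]: "A \<in> sets M" unfolding A_def by measurable
    \<comment> \<open>Passing from \<open>T x\<close> to \<open>x\<close> shifts the time by one and
      costs at most \<open>C\<close>; weakening the margin from \<open>1 / Suc j\<close> to
      \<open>1 / Suc (Suc j)\<close> gains \<open>real n * e\<close>, which outweighs this for large
      \<open>n\<close>. Backward invariance and invariance of the measure then make \<open>A\<close>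
      invariant up to a null set.\<close>
    have AT: "x \<in> A" if x: "x \<in> space M" and Tx: "T x \<in> A" for x
    proof -
      obtain j where j: "\<forall>m. \<exists>n\<ge>m. h n (T x) < (a - 1 / real (Suc j)) * real n"
        using Tx unfolding A_def by auto
      have "\<exists>n\<ge>m. h n x < (a - 1 / real (Suc (Suc j))) * real n" for m
      proof -
        define e where "e = 1 / real (Suc j) - 1 / real (Suc (Suc j))"
        have e: "e > 0" unfolding e_def diff_gt_0_iff_gt by (intro divide_strict_left_mono) auto
        obtain q where q: "real q > (C + \<bar>a - 1 / real (Suc (Suc j))\<bar>) / e" using reals_Archimedean2 by blast
        obtain n where n: "n \<ge> max m q" "h n (T x) < (a - 1 / real (Suc j)) * real n" using j by blast
        have "real n * e > C + \<bar>a - 1 / real (Suc (Suc j))\<bar>"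
        proof -
          have "real n > (C + \<bar>a - 1 / real (Suc (Suc j))\<bar>) / e" using q n by simp
          then show ?thesis using e by (simp add: pos_divide_less_eq)
        qed
        moreover have "h (1 + n) x \<le> h 1 x + h n ((T ^^ 1) x)" using sub[OF x, of 1 n] .
        moreover have "h 1 x \<le> C" using bound[OF x, of 1] by simp
        moreover have "(a - 1 / real (Suc j)) * real n = (a - 1 / real (Suc (Suc j))) * real n - real n * e"
          by (simp add: e_def algebra_simps)
        moreover have "(a - 1 / real (Suc (Suc j))) * real (Suc n) =
             (a - 1 / real (Suc (Suc j))) * real n + (a - 1 / real (Suc (Suc j)))"
          unfolding of_nat_Suc[of n] by (simp only: distrib_left mult_1_right)
        ultimately have "h (Suc n) x < (a - 1 / real (Suc (Suc j))) * real (Suc n)"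
          using n(2) by simp
        then show ?thesis using n(1) by (intro exI[of _ "Suc n"]) auto
      qed
      then show ?thesis using x unfolding A_def by blast
    qed
    have ATn: "x \<in> A" if "x \<in> space M" "(T ^^ n) x \<in> A" for x n
      using that
    proof (induction n arbitrary: x)
      case (Suc n)
      then have "(T ^^ n) (T x) \<in> A" by (simp add: funpow_swap1)
      then have "T x \<in> A" using Suc.IH[of "T x"] Suc.prems(1) iterate_space[of x 1] by simp
      then show ?case using AT Suc.prems(1) by blast
    qed simp
    have inv: "AE x in M. x \<in> A \<longrightarrow> (\<forall>i. (T ^^ i) x \<in> A)"
    proof -
      have "AE x in M. \<forall>i. x \<in> A \<longrightarrow> (T ^^ i) x \<in> A"
      proof (subst AE_all_countable, rule allI)
        fix i
        define A' where "A' = {x \<in> space M. (T ^^ i) x \<in> A}"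
        have [measurable]: "A' \<in> sets M" unfolding A'_def by measurable
        have sub': "A' \<subseteq> A" using ATn unfolding A'_def by auto
        have "prob (A - A') = prob A - prob A'" using sub' by (intro finite_measure_Diff) auto
        then have "prob (A - A') = 0" using measure_vimage_iterate[of A i] by (simp add: A'_def)
        then have "AE x in M. x \<notin> A - A'" by (subst prob_eq_0[symmetric]) auto
        then show "AE x in M. x \<in> A \<longrightarrow> (T ^^ i) x \<in> A" unfolding A'_def by eventually_elim auto
      qed
      then show ?thesis by eventually_elim auto
    qed
    \<comment> \<open>The bad set: the orbit stays in \<open>A\<close>, but no block of length at
      most \<open>k\<close> is good. A lower limit below \<open>a\<close> produces a good block of
      some length, so the intersection over \<open>k\<close> is empty.\<close>
    define B where "B k = {x \<in> space M. (\<forall>i. (T ^^ i) x \<in> A) \<and> (\<forall>n\<in>{1..k}. h n x > a * real n)}" for k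
    have [measurable]: "B k \<in> sets M" for k unfolding B_def by measurable
    have "(\<lambda>k. prob (B k)) \<longlonglongrightarrow> prob (\<Inter>k. B k)"
      by (rule finite_Lim_measure_decseq) (auto simp: decseq_def B_def)
    moreover have "(\<Inter>k. B k) = {}"
    proof -
      have False if x: "\<forall>k. x \<in> B k" for x
      proof -
        have sp: "x \<in> space M" and "(T ^^ 0) x \<in> A" using x unfolding B_def by blast+
        then obtain j where "\<forall>m. \<exists>n\<ge>m. h n x < (a - 1 / real (Suc j)) * real n" unfolding A_def by auto
        then obtain n where n: "n \<ge> 1" "h n x < (a - 1 / real (Suc j)) * real n" by blast
        have "x \<in> B n" using x by blast
        then have "h n x > a * real n" using n(1) unfolding B_def by auto
        moreover have "(a - 1 / real (Suc j)) * real n \<le> a * real n" by (intro mult_right_mono) auto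
        ultimately show False using n(2) by linarith
      qed
      then show ?thesis by blast
    qed
    ultimately have B0: "(\<lambda>k. prob (B k)) \<longlonglongrightarrow> 0" by simp
    have fin: "AE x in M. \<exists>k. \<forall>n\<ge>1. (\<Sum>i<n. indicator (B k) ((T ^^ i) x)) \<le> l * real n" if l: "l > 0" for l :: real
    proof -
      define Z where "Z k = {x \<in> space M. \<exists>n\<ge>1. l * real n < (\<Sum>i<n. indicator (B k) ((T ^^ i) x))}" for k
      have [measurable]: "Z k \<in> sets M" for k unfolding Z_def by measurable
      have "prob (\<Inter>k. Z k) \<le> prob (B k) / l" for k
      proof -
        have "prob (\<Inter>k. Z k) \<le> prob (Z k)" by (rule finite_measure_mono) auto
        also have "\<dots> \<le> prob (B k) / l" unfolding Z_def by (rule maximal_inequality) (use l in auto)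
        finally show ?thesis .
      qed
      moreover have "(\<lambda>k. prob (B k) / l) \<longlonglongrightarrow> 0 / l" by (intro tendsto_divide B0) (use l in auto)
      ultimately have "prob (\<Inter>k. Z k) \<le> 0"
        by (metis (no_types, lifting) LIMSEQ_le_const div_0)
      then have "prob (\<Inter>k. Z k) = 0" using measure_nonneg[of M "\<Inter>k. Z k"] by linarith
      then have "AE x in M. x \<notin> (\<Inter>k. Z k)" by (subst prob_eq_0[symmetric]) auto
      then show ?thesis
        by (rule AE_mp) (rule AE_I2, auto simp: Z_def not_less)
    qed
    \<comment> \<open>This frequency, multiplied by the cost \<open>C + \<bar>a\<bar>\<close> of a
      bad time, stays below \<open>1 / Suc j\<close>; the summand 1 keeps the denominator
      positive.\<close>
    have "AE x in M. \<forall>j::nat. \<exists>k. \<forall>n\<ge>1. (\<Sum>i<n. indicator (B k) ((T ^^ i) x)) \<le> (1 / (real (Suc j) * (C + \<bar>a\<bar> + 1))) * real n"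
      by (subst AE_all_countable, rule allI, rule fin) (use Cpos in auto)
    then show ?thesis using inv AE_space
    proof eventually_elim
      case (elim x)
      show ?case
      proof (intro impI allI)
        fix j :: nat
        assume "\<exists>j::nat. \<forall>m. \<exists>n\<ge>m. h n x < (a - 1 / real (Suc j)) * real n"
        then have "x \<in> A" using elim(3) unfolding A_def by blast
        then have orb: "(T ^^ i) x \<in> A" for i using elim(2) by blast
        obtain k where k: "\<forall>n\<ge>1. (\<Sum>i<n. indicator (B k) ((T ^^ i) x)) \<le> (1 / (real (Suc j) * (C + \<bar>a\<bar> + 1))) * real n"
          using elim(1) by blast
        have "h n x \<le> (a + 1 / real (Suc j)) * real n + (C + \<bar>a\<bar>) * real k" for n
        proof (cases "n = 0")
          case True then show ?thesis using bound[OF elim(3), of 0] Cpos by simp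
        next
          case False
          have "h n ((T ^^ 0) x) \<le> a * real n
             + (C + \<bar>a\<bar>) * (\<Sum>j<n. of_bool ((\<lambda>i. (T ^^ i) x \<in> B k) (0 + j))) + (C + \<bar>a\<bar>) * real k"
          proof (rule subadditive_orbit_bound[where s = "\<lambda>i n. h n ((T ^^ i) x)" and i = 0])
            fix i m n
            have "(T ^^ m) ((T ^^ i) x) = (T ^^ (i + m)) x"
              by (simp add: funpow_add add.commute[of i m])
            then show "h (m + n) ((T ^^ i) x) \<le> h m ((T ^^ i) x) + h n ((T ^^ (i + m)) x)"
              using sub[OF iterate_space[OF elim(3), of i], of m n] by simp
          next
            fix i assume "(T ^^ i) x \<notin> B k"
            moreover have "(T ^^ i') ((T ^^ i) x) \<in> A" for i' using orb[of "i' + i"] by (simp add: funpow_add)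
            ultimately show "\<exists>n\<in>{1..k}. h n ((T ^^ i) x) \<le> a * real n"
              using iterate_space[OF elim(3), of i] unfolding B_def by (auto simp: not_less)
          next
            fix i show "h 0 ((T ^^ i) x) \<le> 0" using bound[OF iterate_space[OF elim(3), of i], of 0] by simp
          next
            fix i show "h 1 ((T ^^ i) x) \<le> C" using bound[OF iterate_space[OF elim(3), of i], of 1] by simp
          qed (use Cpos in auto)
          also have "(\<Sum>j<n. of_bool ((\<lambda>i. (T ^^ i) x \<in> B k) (0 + j))) = (\<Sum>i<n. indicator (B k) ((T ^^ i) x) :: real)"
            by (intro sum.cong) (auto simp: indicator_def)
          also have "(C + \<bar>a\<bar>) * \<dots> \<le> (C + \<bar>a\<bar>) * ((1 / (real (Suc j) * (C + \<bar>a\<bar> + 1))) * real n)"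
            using k False Cpos by (intro mult_left_mono) auto
          also have "\<dots> = ((C + \<bar>a\<bar>) / (C + \<bar>a\<bar> + 1)) * (1 / real (Suc j) * real n)"
            by (simp add: field_simps)
          also have "\<dots> \<le> 1 * (1 / real (Suc j) * real n)"
            using Cpos by (intro mult_right_mono) (auto simp: divide_le_eq)
          finally show ?thesis by (simp add: algebra_simps)
        qed
        then show "\<exists>K. \<forall>n. h n x \<le> (a + 1 / real (Suc j)) * real n + K" by blast
      qed
    qed
  qed
  have "AE x in M. \<forall>a\<in>\<rat>. (\<exists>j::nat. \<forall>m. \<exists>n\<ge>m. h n x < (a - 1 / real (Suc j)) * real n) \<longrightarrow>
       (\<forall>j::nat. \<exists>K. \<forall>n. h n x \<le> (a + 1 / real (Suc j)) * real n + K)"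
    by (subst AE_ball_countable[OF countable_rat]) (use key in blast)
  then show ?thesis using AE_space
  proof eventually_elim
    case (elim x)
    define y where "y n = h n x / real n" for n
    have yb: "\<bar>y n\<bar> \<le> C" for n
    proof (cases "n = 0")
      case False
      then show ?thesis using bound[OF elim(2), of n] by (simp add: y_def abs_divide divide_le_eq)
    qed (use Cpos in \<open>auto simp: y_def\<close>)
    define L where "L = liminf (\<lambda>n. ereal (y n))"
    have "ereal (-C) \<le> L" unfolding L_def using yb by (intro Liminf_bounded) (auto simp: abs_le_iff minus_le_iff)
    moreover have "L \<le> ereal C"
    proof -
      have "L \<le> limsup (\<lambda>n. ereal (y n))" unfolding L_def by (rule Liminf_le_Limsup) simp
      also have "\<dots> \<le> ereal C" using yb by (intro Limsup_bounded) (auto simp: abs_le_iff)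
      finally show ?thesis .
    qed
    ultimately obtain l where l: "L = ereal l" by (cases L) auto
    have "y \<longlonglongrightarrow> l"
    proof (rule order_tendstoI)
      fix c assume "c < l"
      then have "ereal c < liminf (\<lambda>n. ereal (y n))" using l L_def by simp
      then have "eventually (\<lambda>n. ereal c < ereal (y n)) sequentially" by (rule less_LiminfD)
      then show "eventually (\<lambda>n. c < y n) sequentially" by simp
    next
      \<comment> \<open>Between \<open>l\<close> and \<open>c\<close> lie a rational
        \<open>a\<close> and a number \<open>b < a\<close>. If the averages did not drop below
        \<open>a\<close> by a fixed margin infinitely often, they would stay above \<open>b\<close>,
        and so would the lower limit \<open>l\<close>.\<close>
      fix c assume c: "l < c"
      obtain a where a: "a \<in> \<rat>" "l < a" "a < c" using Rats_dense_in_real[OF c] by blast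
      obtain b where b: "l < b" "b < a" using dense a(2) by blast
      obtain j where j: "1 / real (Suc j) < a - b" using b(2)
        by (meson diff_gt_0_iff_gt nat_approx_posE)
      have fr: "\<exists>n\<ge>m. h n x < (a - 1 / real (Suc j)) * real n" for m
      proof (rule ccontr)
        assume as: "\<not> ?thesis"
        have "y n \<ge> b" if "n \<ge> max m 1" for n
        proof -
          have "(a - 1 / real (Suc j)) * real n \<le> h n x" using as that by (meson max.boundedE not_less)
          then have "a - 1 / real (Suc j) \<le> y n" using that by (simp add: y_def le_divide_eq)
          then show ?thesis using j by linarith
        qed
        then have "eventually (\<lambda>n. ereal b \<le> ereal (y n)) sequentially"
          unfolding eventually_sequentially by (intro exI[of _ "max m 1"]) simp
        then have "ereal b \<le> L" unfolding L_def by (rule Liminf_bounded)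
        then show False using l b by simp
      qed
      obtain i where i: "1 / real (Suc i) < c - a" using a(3)
        by (metis diff_gt_0_iff_gt nat_approx_posE)
      obtain K where K: "\<forall>n. h n x \<le> (a + 1 / real (Suc i)) * real n + K"
        using elim(1) a(1) fr by blast
      have "(\<lambda>n. a + 1 / real (Suc i) + K / real n) \<longlonglongrightarrow> a + 1 / real (Suc i) + 0"
        by (intro tendsto_intros lim_const_over_n)
      then have "eventually (\<lambda>n. a + 1 / real (Suc i) + K / real n < c) sequentially"
        proof (rule order_tendstoD(2))
        show "a + 1 / real (Suc i) + 0 < c" using i by (simp only: add_0_right less_diff_eq add.commute)
      qed
      then show "eventually (\<lambda>n. y n < c) sequentially" using eventually_gt_at_top[of 0]
      proof eventually_elim
        case (elim n)
        have "y n \<le> ((a + 1 / real (Suc i)) * real n + K) / real n"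
          unfolding y_def using K elim by (intro divide_right_mono) auto
        also have "\<dots> = a + 1 / real (Suc i) + K / real n" using elim by (simp add: field_simps)
        finally show ?case using elim by linarith
      qed
    qed
    then show ?case unfolding y_def by (rule convergentI)
  qed
qed

end

section \<open>Invariant measures on compact sets\<close>

text \<open>A base-4 code of the members of a countable family of shrinking balls that contain a point.\<close>
lemma real_coding_of_compact:
  fixes K :: "'x::metric_space set"
  assumes K: "compact K" "K \<noteq> {}"
  obtains \<psi> :: "'x \<Rightarrow> real" where "\<And>x. \<psi> x \<in> {0..2}"
    "\<And>e. 0 < e \<Longrightarrow> \<exists>d>0. \<forall>x\<in>K. \<forall>y\<in>K. \<bar>\<psi> x - \<psi> y\<bar> < d \<longrightarrow> dist x y < e"
proof -
  have "\<exists>F. finite F \<and> F \<subseteq> K \<and> K \<subseteq> (\<Union>c\<in>F. ball c (1 / real (Suc k)))" for k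
    using compactE_image[OF K(1), of K "\<lambda>c. ball c (1 / real (Suc k))"]
    by (metis (no_types, lifting) UN_I centre_in_ball divide_pos_pos of_nat_0_less_iff open_ball subsetI zero_less_Suc zero_less_one)
  then obtain F where F: "\<And>k. finite (F k)" "\<And>k. F k \<subseteq> K" "\<And>k. K \<subseteq> (\<Union>c\<in>F k. ball c (1 / real (Suc k)))"
    by metis
  define \<A> where "\<A> = (\<Union>k. (\<lambda>c. ball c (1 / real (Suc k))) ` F k)"
  have cA: "countable \<A>" unfolding \<A>_def by (intro countable_UN countable_image countable_finite[OF F(1)]) simp_all
  have "F 0 \<noteq> {}" using F(3)[of 0] K(2) by (metis SUP_empty subset_empty)
  then have neA: "\<A> \<noteq> {}" unfolding \<A>_def by blast
  define A where "A = from_nat_into \<A>"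
  have rA: "range A = \<A>" unfolding A_def using cA neA by (simp add: range_from_nat_into)
  define b where "b n x = (indicator (A n) x :: real)" for n x
  have b01: "b n x \<in> {0, 1}" for n x by (auto simp: b_def indicator_def)
  define \<psi> where "\<psi> x = (\<Sum>n. b n x * (1/4) ^ n)" for x
  have geo: "summable (\<lambda>n. (1/4::real) ^ n)" by (rule summable_geometric) simp
  have geoS: "(\<Sum>n. (1/4::real) ^ n) = 4/3" by (subst suminf_geometric) auto
  have sm: "summable (\<lambda>n. t n * (1/4) ^ n)" if "\<And>n. \<bar>t n\<bar> \<le> 1" for t :: "nat \<Rightarrow> real"
  proof (rule summable_comparison_test_ev[OF _ geo])
    show "eventually (\<lambda>n. norm (t n * (1/4) ^ n) \<le> (1/4) ^ n) sequentially"
      using that by (intro always_eventually allI) (simp add: abs_mult power_abs mult_left_le_one_le)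
  qed
  have smb: "summable (\<lambda>n. b n x * (1/4) ^ n)" for x
    using b01[of _ x] by (intro sm) (metis abs_0 abs_1 insertE order_refl singletonD zero_le_one)
  \<comment> \<open>At the first digit \<open>n\<close> that differs the codes gain or lose
    \<open>(1/4) ^ n\<close>, and the tail restores at most a third of it. In base 2 the tail could
    cancel the digit; base 4 leaves the gap \<open>(2/3) * (1/4) ^ n\<close>.\<close>
  have agree: "\<forall>n<m. b n x = b n y" if less: "\<bar>\<psi> x - \<psi> y\<bar> < (1/2) * (1/4) ^ m" for x y m
  proof (rule ccontr)
    assume "\<not> ?thesis"
    then have ex: "\<exists>n. n < m \<and> b n x \<noteq> b n y" by auto
    define n where "n = (LEAST n. n < m \<and> b n x \<noteq> b n y)"
    have n: "n < m" "b n x \<noteq> b n y" using LeastI_ex[OF ex] unfolding n_def by auto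
    have below: "b i x = b i y" if "i < n" for i
      using not_less_Least[of i "\<lambda>n. n < m \<and> b n x \<noteq> b n y"] that n(1) unfolding n_def by auto
    define t where "t i = b i x - b i y" for i
    have t1: "\<bar>t i\<bar> \<le> 1" for i using b01[of i x] b01[of i y] by (auto simp: t_def)
    have tn: "\<bar>t n\<bar> = 1" using n(2) b01[of n x] b01[of n y] by (auto simp: t_def)
    have "\<psi> x - \<psi> y = (\<Sum>i. t i * (1/4) ^ i)"
      unfolding \<psi>_def t_def by (subst suminf_diff[OF smb smb]) (simp add: algebra_simps)
    also have "\<dots> = (\<Sum>i. t (i + Suc n) * (1/4) ^ (i + Suc n)) + (\<Sum>i<Suc n. t i * (1/4) ^ i)"
      by (rule suminf_split_initial_segment[OF sm[OF t1]])
    also have "(\<Sum>i<Suc n. t i * (1/4) ^ i) = t n * (1/4) ^ n"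
      using below by (simp add: t_def)
    also have "(\<Sum>i. t (i + Suc n) * (1/4) ^ (i + Suc n)) = (1/4) ^ Suc n * (\<Sum>i. t (i + Suc n) * (1/4) ^ i)"
      by (subst suminf_mult[symmetric]) (auto intro!: sm t1 simp: power_add mult_ac)
    finally have eq: "\<psi> x - \<psi> y = (1/4) ^ Suc n * (\<Sum>i. t (i + Suc n) * (1/4) ^ i) + t n * (1/4) ^ n" .
    have "\<bar>\<Sum>i. t (i + Suc n) * (1/4) ^ i\<bar> \<le> 4/3"
    proof -
      have "(\<Sum>i. t (i + Suc n) * (1/4) ^ i) \<le> (\<Sum>n. (1/4::real) ^ n)"
        using t1 by (intro suminf_le[OF _ sm[OF t1] geo]) (metis abs_le_iff mult_left_le_one_le mult.commute mult_1 mult_right_mono zero_le_divide_1_iff zero_le_numeral zero_le_power)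
      moreover have "(\<Sum>i. (- t (i + Suc n)) * (1/4) ^ i) \<le> (\<Sum>n. (1/4::real) ^ n)"
        using t1 by (intro suminf_le[OF _ sm geo]) (auto, metis abs_le_iff mult_1 mult_right_mono zero_le_divide_1_iff zero_le_numeral zero_le_power mult_minus_left)
      moreover have "(\<Sum>i. (- t (i + Suc n)) * (1/4) ^ i) = - (\<Sum>i. t (i + Suc n) * (1/4) ^ i)"
        by (subst suminf_minus[symmetric, OF sm[OF t1]]) simp
      ultimately show ?thesis using geoS by linarith
    qed
    then have "\<bar>(1/4) ^ Suc n * (\<Sum>i. t (i + Suc n) * (1/4) ^ i)\<bar> \<le> (1/4) ^ Suc n * (4/3)"
      unfolding abs_mult by (intro mult_mono) (auto simp: power_abs)
    moreover have "\<bar>t n * (1/4) ^ n\<bar> = (1/4) ^ n" using tn by (simp add: abs_mult power_abs)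
    ultimately have "\<bar>\<psi> x - \<psi> y\<bar> \<ge> (1/4) ^ n - (1/4) ^ Suc n * (4/3)" unfolding eq by linarith
    moreover have "(1/4) ^ n - (1/4) ^ Suc n * (4/3) = (2/3) * (1/4::real) ^ n" by simp
    moreover have "(1/4::real) ^ m \<le> (1/4) ^ n" using n(1) by (intro power_decreasing) auto
    moreover have "(0::real) < (1/4) ^ n" by simp
    ultimately show False using less by linarith
  qed
  show ?thesis
  proof (rule that)
    fix x
    have "\<psi> x \<ge> 0" unfolding \<psi>_def using b01[of _ x] by (intro suminf_nonneg smb) (auto simp: b_def)
    moreover have "\<psi> x \<le> (\<Sum>n. (1/4::real) ^ n)" unfolding \<psi>_def
      by (intro suminf_le smb geo) (auto simp: b_def indicator_def)
    ultimately show "\<psi> x \<in> {0..2}" using geoS by simp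
  next
    fix e :: real assume "0 < e"
    then obtain k where k: "1 / real (Suc k) < e / 2" by (meson half_gt_zero nat_approx_posE)
    have "\<forall>c\<in>F k. \<exists>n. A n = ball c (1 / real (Suc k))"
    proof
      fix c assume "c \<in> F k"
      then have "ball c (1 / real (Suc k)) \<in> range A" unfolding rA \<A>_def by blast
      then show "\<exists>n. A n = ball c (1 / real (Suc k))" by (metis imageE)
    qed
    then obtain \<nu> where \<nu>: "\<And>c. c \<in> F k \<Longrightarrow> A (\<nu> c) = ball c (1 / real (Suc k))" by metis
    \<comment> \<open>Agreement of the digits below \<open>m\<close> means membership in the same
      balls of radius \<open>1 / Suc k\<close>, and one of these contains \<open>x\<close>.\<close>
    define m where "m = Suc (Max (insert 0 (\<nu> ` F k)))"
    have m: "\<nu> c < m" if "c \<in> F k" for c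
      using that F(1) by (auto simp: m_def less_Suc_eq_le intro!: Max_ge)
    show "\<exists>d>0. \<forall>x\<in>K. \<forall>y\<in>K. \<bar>\<psi> x - \<psi> y\<bar> < d \<longrightarrow> dist x y < e"
    proof (intro exI[of _ "(1/2) * (1/4) ^ m"] conjI ballI impI)
      fix x y assume xy: "x \<in> K" "y \<in> K" "\<bar>\<psi> x - \<psi> y\<bar> < (1/2) * (1/4) ^ m"
      obtain c where c: "c \<in> F k" "x \<in> ball c (1 / real (Suc k))" using F(3)[of k] xy(1) by auto
      have "b (\<nu> c) x = b (\<nu> c) y" using agree[OF xy(3)] m[OF c(1)] by blast
      then have "y \<in> ball c (1 / real (Suc k))" using c \<nu>[OF c(1)] by (auto simp: b_def indicator_def split: if_splits)
      then show "dist x y < e" using c(2) k dist_triangle_half_r[of c x "e" y] by (simp add: dist_commute)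
    qed auto
  qed
qed

text \<open>Closed sets form an intersection-stable generator, and the indicator of a closed set is
  the pointwise limit of the continuous functions \<open>f n\<close>.\<close>

lemma borel_measure_eqI_continuous:
  fixes \<mu> \<nu> :: "'x::metric_space measure"
  assumes \<mu>: "prob_space \<mu>" "sets \<mu> = sets borel" and \<nu>: "prob_space \<nu>" "sets \<nu> = sets borel"
    and eq: "\<And>f :: 'x \<Rightarrow> real. continuous_on UNIV f \<Longrightarrow> (\<And>x. \<bar>f x\<bar> \<le> 1) \<Longrightarrow> (\<integral>x. f x \<partial>\<mu>) = (\<integral>x. f x \<partial>\<nu>)"
  shows "\<mu> = \<nu>"
proof -
  interpret \<mu>: prob_space \<mu> by fact
  interpret \<nu>: prob_space \<nu> by fact
  have sp: "space \<mu> = UNIV" "space \<nu> = UNIV"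
    using \<mu>(2) \<nu>(2) by (metis sets_eq_imp_space_eq space_borel)+
  have closed_eq: "emeasure \<mu> C = emeasure \<nu> C" if C: "closed C" for C
  proof (cases "C = {}")
    case False
    define f where "f n x = max 0 (1 - real n * infdist x C)" for n and x :: 'x
    have cont: "continuous_on UNIV (f n)" for n unfolding f_def by (intro continuous_intros)
    have bd: "\<bar>f n x\<bar> \<le> 1" for n x unfolding f_def using infdist_nonneg[of x C] by (auto simp: max_def)
    have lim: "(\<lambda>n. f n x) \<longlonglongrightarrow> indicator C x" for x
    proof (cases "x \<in> C")
      case True then show ?thesis by (simp add: f_def)
    next
      case F: False
      then have pos: "infdist x C > 0" using C False
        by (metis in_closed_iff_infdist_zero infdist_nonneg less_eq_real_def)
      obtain q where q: "real q > 1 / infdist x C" using reals_Archimedean2 by blast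
      have "f n x = 0" if "n \<ge> q" for n
      proof -
        have "real n > 1 / infdist x C" using q that by (meson less_le_trans of_nat_le_iff)
        then show ?thesis using pos by (simp add: f_def pos_divide_less_eq)
      qed
      then show ?thesis using F by (intro tendsto_eventually) (auto simp: eventually_sequentially)
    qed
    have I: "(\<lambda>n. \<integral>x. f n x \<partial>M) \<longlonglongrightarrow> measure M C" if M: "prob_space M" "sets M = sets borel" for M
    proof -
      interpret prob_space M by fact
      have sM: "space M = UNIV" using M(2) by (metis sets_eq_imp_space_eq space_borel)
      have [measurable]: "C \<in> sets M" using C M(2) by simp
      have [measurable]: "f n \<in> borel_measurable M" for n
        using borel_measurable_continuous_onI[OF cont] M(2) measurable_cong_sets by blast
      have "(\<lambda>n. \<integral>x. f n x \<partial>M) \<longlonglongrightarrow> (\<integral>x. indicator C x \<partial>M)"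
        by (rule integral_dominated_convergence[where w = "\<lambda>_. 1"]) (use lim bd in auto)
      then show ?thesis using sM by simp
    qed
    have "measure \<mu> C = measure \<nu> C"
      by (rule LIMSEQ_unique[OF I[OF \<mu>]]) (use I[OF \<nu>] eq[OF cont bd] in simp)
    then show ?thesis by (simp add: \<mu>.emeasure_eq_measure \<nu>.emeasure_eq_measure)
  qed simp
  show ?thesis
  proof (rule measure_eqI_generator_eq[where E = "Collect closed" and \<Omega> = UNIV and A = "\<lambda>_. UNIV"])
    show "sets \<mu> = sigma_sets UNIV (Collect closed)" "sets \<nu> = sigma_sets UNIV (Collect closed)"
      using \<mu>(2) \<nu>(2) by (simp_all add: borel_eq_closed)
  qed (auto simp: Int_stable_def closed_eq closed_Int)
qed

text \<open>Weak limits are taken on the real line, where tightness yields convergent subsequences: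
  the empirical measures of an orbit are transported by the code \<open>\<psi>\<close>, and their
  limit is transported back. The code is injective on \<open>K\<close> but possibly discontinuous;
  only its inverse has to behave well, and being uniformly continuous it extends to a continuous map
  \<open>\<pi>\<close> on the closure \<open>S\<close> of the image.\<close>

theorem krylov_bogoliubov:
  fixes T :: "'x::metric_space \<Rightarrow> 'x"
  assumes K: "compact K" "K \<noteq> {}" and T: "continuous_on UNIV T" and TK: "T ` K \<subseteq> K"
  obtains \<mu> where "prob_space \<mu>" "sets \<mu> = sets borel" "distr \<mu> borel T = \<mu>" "measure \<mu> K = 1"
proof -
  obtain \<psi> :: "'x \<Rightarrow> real" where \<psi>: "\<And>x. \<psi> x \<in> {0..2}"
    and cod: "\<And>e. 0 < e \<Longrightarrow> \<exists>d>0. \<forall>x\<in>K. \<forall>y\<in>K. \<bar>\<psi> x - \<psi> y\<bar> < d \<longrightarrow> dist x y < e"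
    using real_coding_of_compact[OF K] by metis
  obtain z where z: "z \<in> K" using K(2) by auto
  have orb: "(T ^^ i) z \<in> K" for i using z TK by (induction i) auto
  define S where "S = closure (\<psi> ` K)"
  have clS: "closed S" by (simp add: S_def)
  have lim_ex: "\<exists>x\<in>K. \<forall>e>0. \<exists>d>0. \<forall>y\<in>K. \<bar>\<psi> y - s\<bar> < d \<longrightarrow> dist x y < e" if "s \<in> S" for s
  proof -
    have "\<exists>x\<in>K. \<bar>\<psi> x - s\<bar> < 1 / real (Suc k)" for k
      using that unfolding S_def closure_approachable by (auto simp: dist_real_def)
    then obtain X where X: "\<And>k. X k \<in> K" "\<And>k. \<bar>\<psi> (X k) - s\<bar> < 1 / real (Suc k)" by metis
    obtain x r where x: "x \<in> K" "strict_mono r" "(X \<circ> r) \<longlonglongrightarrow> x"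
      using compact_imp_seq_compact[OF K(1)] X(1) unfolding seq_compact_def by metis
    have "\<exists>d>0. \<forall>y\<in>K. \<bar>\<psi> y - s\<bar> < d \<longrightarrow> dist x y < e" if e: "e > 0" for e
    proof -
      obtain d where d: "d > 0" "\<forall>x\<in>K. \<forall>y\<in>K. \<bar>\<psi> x - \<psi> y\<bar> < d \<longrightarrow> dist x y < e / 2"
        using cod[of "e/2"] e by auto
      obtain q where q: "1 / real (Suc q) < d / 2" using d(1) by (meson half_gt_zero nat_approx_posE)
      have "eventually (\<lambda>k. dist ((X \<circ> r) k) x < e / 2) sequentially" using tendstoD[OF x(3), of "e / 2"] e by simp
      then obtain k where k: "k \<ge> q" "dist (X (r k)) x < e / 2"
        unfolding eventually_sequentially by (metis comp_apply nat_le_linear)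
      have "1 / real (Suc (r k)) \<le> 1 / real (Suc q)"
        using seq_suble[OF x(2), of k] k(1) by (intro divide_left_mono) auto
      then have xk: "\<bar>\<psi> (X (r k)) - s\<bar> < d / 2" using X(2)[of "r k"] q by linarith
      show ?thesis
      proof (intro exI[of _ "d/2"] conjI ballI impI)
        fix y assume y: "y \<in> K" "\<bar>\<psi> y - s\<bar> < d / 2"
        have "\<bar>\<psi> (X (r k)) - \<psi> y\<bar> < d" using xk y(2) by linarith
        then have "dist (X (r k)) y < e / 2" using d(2) X(1) y(1) by blast
        then show "dist x y < e" using k(2) dist_triangle_half_r by blast
      qed (use d in auto)
    qed
    then show ?thesis using x(1) by blast
  qed
  then have "\<exists>\<pi>. \<forall>s\<in>S. \<pi> s \<in> K \<and> (\<forall>e>0. \<exists>d>0. \<forall>y\<in>K. \<bar>\<psi> y - s\<bar> < d \<longrightarrow> dist (\<pi> s) y < e)"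
    by (intro bchoice ballI) (simp only: Bex_def)
  then obtain \<pi> where \<pi>: "\<And>s. s \<in> S \<Longrightarrow> \<pi> s \<in> K"
    "\<And>s e. s \<in> S \<Longrightarrow> e > 0 \<Longrightarrow> \<exists>d>0. \<forall>y\<in>K. \<bar>\<psi> y - s\<bar> < d \<longrightarrow> dist (\<pi> s) y < e"
    by auto
  have \<psi>S: "\<psi> y \<in> S" if "y \<in> K" for y unfolding S_def using subsetD[OF closure_subset imageI[OF that]] .
  have \<pi>\<psi>: "\<pi> (\<psi> y) = y" if "y \<in> K" for y
  proof (rule ccontr)
    assume "\<pi> (\<psi> y) \<noteq> y"
    then have "dist (\<pi> (\<psi> y)) y > 0" by simp
    then show False using \<pi>(2)[OF \<psi>S[OF that], of "dist (\<pi> (\<psi> y)) y"] that by fastforce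
  qed
  have cont\<pi>: "continuous_on S \<pi>"
    unfolding continuous_on_iff
  proof (intro ballI allI impI)
    fix s :: real and e :: real assume s: "s \<in> S" and e: "0 < e"
    obtain d where d: "d > 0" "\<forall>y\<in>K. \<bar>\<psi> y - s\<bar> < d \<longrightarrow> dist (\<pi> s) y < e / 2"
      using \<pi>(2)[OF s, of "e/2"] e by auto
    show "\<exists>d>0. \<forall>x'\<in>S. dist x' s < d \<longrightarrow> dist (\<pi> x') (\<pi> s) < e"
    proof (intro exI[of _ "d/2"] conjI ballI impI)
      fix s' assume s': "s' \<in> S" "dist s' s < d / 2"
      obtain d' where d': "d' > 0" "\<forall>y\<in>K. \<bar>\<psi> y - s'\<bar> < d' \<longrightarrow> dist (\<pi> s') y < e / 2"
        using \<pi>(2)[OF s'(1), of "e/2"] e by auto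
      obtain y where y: "y \<in> K" "\<bar>\<psi> y - s'\<bar> < min d' (d/2)"
        using s'(1) d d' unfolding S_def closure_approachable
        by (metis (no_types, lifting) dist_real_def half_gt_zero imageE min_less_iff_conj)
      have "dist (\<pi> s') y < e / 2" using d'(2) y by auto
      moreover have "\<bar>\<psi> y - s'\<bar> < d / 2" "\<bar>s' - s\<bar> < d / 2" using y(2) s'(2) by (auto simp: dist_real_def)
      then have "\<bar>\<psi> y - s\<bar> < d" by linarith
      then have "dist (\<pi> s) y < e / 2" using d(2) y(1) by blast
      ultimately show "dist (\<pi> s') (\<pi> s) < e" by (metis dist_commute dist_triangle_half_r)
    qed (use d in auto)
  qed
  define \<nu> where "\<nu> n = distr (measure_pmf (pmf_of_set {..n})) borel (\<lambda>i. \<psi> ((T ^^ i) z))" for n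
  have \<nu>rd: "real_distribution (\<nu> n)" for n
    unfolding \<nu>_def real_distribution_def real_distribution_axioms_def
    by (intro conjI measure_pmf.prob_space_distr) auto
  have \<nu>int: "(\<integral>s. f s \<partial>\<nu> n) = (\<Sum>i\<le>n. f (\<psi> ((T ^^ i) z))) / real (Suc n)"
    if [measurable]: "f \<in> borel_measurable borel" for f :: "real \<Rightarrow> real" and n
    unfolding \<nu>_def by (subst integral_distr) (auto simp: integral_pmf_of_set)
  have "measure (\<nu> n) {-1<..3} = 1" for n
  proof -
    have "\<psi> x \<in> {-1<..3}" for x using \<psi>[of x] by auto
    then have "(\<lambda>i. \<psi> ((T ^^ i) z)) -` {-1<..3} = UNIV" by blast
    then show ?thesis unfolding \<nu>_def by (subst measure_distr) auto
  qed
  then have "\<forall>e>0. \<exists>a b. a < b \<and> (\<forall>n. 1 - e < measure (\<nu> n) {a<..b})"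
    by (intro allI impI exI[of _ "-1"] exI[of _ 3]) simp
  then have tight: "tight \<nu>" unfolding tight_def using \<nu>rd by blast
  obtain r \<nu>' where r: "strict_mono r" and \<nu>': "real_distribution \<nu>'" and wc: "weak_conv_m (\<nu> \<circ> id \<circ> r) \<nu>'"
    using tight_imp_convergent_subsubsequence[OF tight strict_mono_id] by auto
  interpret N: real_distribution \<nu>' by fact
  have wlim: "(\<lambda>n. (\<Sum>i\<le>r n. f (\<psi> ((T ^^ i) z))) / real (Suc (r n))) \<longlonglongrightarrow> (\<integral>s. f s \<partial>\<nu>')"
    if f: "continuous_on UNIV f" "\<And>s. \<bar>f s\<bar> \<le> B" for f :: "real \<Rightarrow> real" and B
  proof -
    have "(\<lambda>n. \<integral>s. f s \<partial>((\<nu> \<circ> id \<circ> r) n)) \<longlonglongrightarrow> (\<integral>s. f s \<partial>\<nu>')"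
      by (rule weak_conv_imp_integral_bdd_continuous_conv[OF _ \<nu>' wc, where B = B])
        (use \<nu>rd f in \<open>auto simp: continuous_on_eq_continuous_at\<close>)
    then show ?thesis using \<nu>int[OF borel_measurable_continuous_onI[OF f(1)]] by simp
  qed
  \<comment> \<open>No mass escapes from the closed set \<open>S\<close>: the truncated distance to
    \<open>S\<close> vanishes along the orbit, so its integral vanishes in the limit.\<close>
  have AES: "AE s in \<nu>'. s \<in> S"
  proof -
    define f where "f s = min 1 (infdist s S)" for s
    have neS: "S \<noteq> {}" using \<psi>S[OF z] by auto
    have fc: "continuous_on UNIV f" unfolding f_def by (intro continuous_intros)
    have fb: "\<bar>f s\<bar> \<le> 1" for s using infdist_nonneg[of s S] by (auto simp: f_def)
    have "f (\<psi> ((T ^^ i) z)) = 0" for i using \<psi>S[OF orb[of i]] by (simp add: f_def)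
    then have "(\<lambda>n::nat. 0) \<longlonglongrightarrow> (\<integral>s. f s \<partial>\<nu>')" using wlim[OF fc fb] by simp
    then have 0: "(\<integral>s. f s \<partial>\<nu>') = 0" using LIMSEQ_unique tendsto_const by blast
    have [measurable]: "f \<in> borel_measurable borel" by (rule borel_measurable_continuous_onI[OF fc])
    have int: "integrable \<nu>' f" by (rule N.integrable_const_bound[of _ 1]) (use fb in auto)
    have nn: "AE s in \<nu>'. 0 \<le> f s" by (simp add: f_def infdist_nonneg)
    have "AE s in \<nu>'. f s = 0"
      using 0 integral_nonneg_eq_0_iff_AE[OF int nn] by blast
    then show ?thesis
    proof eventually_elim
      case (elim s)
      then have "infdist s S = 0" by (auto simp: f_def min_def split: if_splits)
      then show ?case using clS neS in_closed_iff_infdist_zero by blast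
    qed
  qed
  \<comment> \<open>Outside \<open>S\<close>, a null set, the constant value \<open>z\<close> keeps
    \<open>q\<close> measurable and inside \<open>K\<close>.\<close>
  define q where "q s = (if s \<in> S then \<pi> s else z)" for s
  have qK: "q s \<in> K" for s using \<pi>(1) z by (simp add: q_def)
  have [measurable]: "q \<in> borel_measurable borel"
    unfolding q_def by (rule borel_measurable_continuous_on_if[OF _ cont\<pi>]) (use clS in auto)
  have q': "q \<in> measurable \<nu>' borel" by simp
  define \<mu> where "\<mu> = distr \<nu>' borel q"
  have \<mu>: "prob_space \<mu>" "sets \<mu> = sets borel" unfolding \<mu>_def by (auto intro: N.prob_space_distr)
  interpret mu: prob_space \<mu> by fact
  have \<mu>K: "measure \<mu> K = 1"
  proof -
    have "q -` K \<inter> space \<nu>' = space \<nu>'" using qK by auto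
    moreover have "measure \<mu> K = measure \<nu>' (q -` K \<inter> space \<nu>')"
      unfolding \<mu>_def using K(1) by (intro measure_distr[OF q']) (auto simp: compact_imp_closed)
    ultimately show ?thesis by (simp only: N.prob_space)
  qed
  have mlim: "(\<lambda>n. (\<Sum>i\<le>r n. f ((T ^^ i) z)) / real (Suc (r n))) \<longlonglongrightarrow> (\<integral>x. f x \<partial>\<mu>)"
    if f: "continuous_on UNIV f" "\<And>x. \<bar>f x\<bar> \<le> 1" for f :: "'x \<Rightarrow> real"
  proof -
    \<comment> \<open>Weak convergence tests functions on the whole line, so
      \<open>f \<circ> \<pi>\<close> is extended by Tietze's theorem; at the codes of orbit points
      the extension returns the values of \<open>f\<close>.\<close>
    have "continuous_on S (\<lambda>s. f (\<pi> s))" by (rule continuous_on_compose2[OF f(1) cont\<pi>]) auto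
    then obtain g where g: "continuous_on UNIV g" "\<And>s. s \<in> S \<Longrightarrow> g s = f (\<pi> s)" "\<And>s. norm (g s) \<le> 1"
      by (rule Tietze[of S "\<lambda>s. f (\<pi> s)" UNIV 1]) (use clS f(2) in auto)
    have [measurable]: "g \<in> borel_measurable borel" "f \<in> borel_measurable borel"
      using g(1) f(1) by (auto intro: borel_measurable_continuous_onI)
    have "(\<integral>x. f x \<partial>\<mu>) = (\<integral>s. f (q s) \<partial>\<nu>')" unfolding \<mu>_def by (rule integral_distr[OF q']) simp
    also have "\<dots> = (\<integral>s. g s \<partial>\<nu>')"
    proof (rule integral_cong_AE)
      show "AE s in \<nu>'. f (q s) = g s" using AES by eventually_elim (simp add: q_def g(2))
    qed auto
    finally have I: "(\<integral>x. f x \<partial>\<mu>) = (\<integral>s. g s \<partial>\<nu>')" .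
    have "g (\<psi> ((T ^^ i) z)) = f ((T ^^ i) z)" for i
      using g(2)[OF \<psi>S[OF orb]] \<pi>\<psi>[OF orb] by simp
    then show ?thesis unfolding I using wlim[OF g(1), of 1] g(3) by simp
  qed
  have Tm: "T \<in> measurable borel borel" using T by (rule borel_measurable_continuous_onI)
  have Tm': "T \<in> measurable \<mu> borel" using Tm \<mu>(2) measurable_cong_sets by blast
  have "distr \<mu> borel T = \<mu>"
  proof (rule borel_measure_eqI_continuous)
    show "prob_space (distr \<mu> borel T)" using Tm' by (rule mu.prob_space_distr)
    fix f :: "'x \<Rightarrow> real" assume f: "continuous_on UNIV f" "\<And>x. \<bar>f x\<bar> \<le> 1"
    have fT: "continuous_on UNIV (\<lambda>x. f (T x))" by (rule continuous_on_compose2[OF f(1) T]) auto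
    have [measurable]: "f \<in> borel_measurable borel" using f(1) by (rule borel_measurable_continuous_onI)
    \<comment> \<open>The sums of \<open>f \<circ> T\<close> and of \<open>f\<close> along the orbit
      telescope, so their averages differ by at most \<open>2 / Suc (r n)\<close>.\<close>
    have diff: "(\<Sum>i\<le>n. f (T ((T ^^ i) z))) - (\<Sum>i\<le>n. f ((T ^^ i) z)) = f ((T ^^ Suc n) z) - f z" for n
      by (induction n) auto
    have "(\<lambda>n. (\<Sum>i\<le>r n. f (T ((T ^^ i) z))) / real (Suc (r n)) - (\<Sum>i\<le>r n. f ((T ^^ i) z)) / real (Suc (r n)))
        \<longlonglongrightarrow> (\<integral>x. f (T x) \<partial>\<mu>) - (\<integral>x. f x \<partial>\<mu>)"
      using mlim[OF fT] mlim[OF f] f(2) by (intro tendsto_diff) auto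
    then have l1: "(\<lambda>n. (f ((T ^^ Suc (r n)) z) - f z) / real (Suc (r n))) \<longlonglongrightarrow> (\<integral>x. f (T x) \<partial>\<mu>) - (\<integral>x. f x \<partial>\<mu>)"
      by (simp only: diff_divide_distrib[symmetric] diff)
    have l2: "(\<lambda>n. (f ((T ^^ Suc (r n)) z) - f z) / real (Suc (r n))) \<longlonglongrightarrow> 0"
    proof (rule Lim_null_comparison)
      show "eventually (\<lambda>n. norm ((f ((T ^^ Suc (r n)) z) - f z) / real (Suc (r n))) \<le> 2 * (1 / real (Suc n))) sequentially"
      proof (intro always_eventually allI)
        fix n
        have "\<bar>f ((T ^^ Suc (r n)) z) - f z\<bar> \<le> 2" using f(2)[of "(T ^^ Suc (r n)) z"] f(2)[of z] by linarith
        then have "\<bar>f ((T ^^ Suc (r n)) z) - f z\<bar> / real (Suc (r n)) \<le> 2 / real (Suc n)"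
          using seq_suble[OF r, of n] by (intro frac_le) auto
        then show "norm ((f ((T ^^ Suc (r n)) z) - f z) / real (Suc (r n))) \<le> 2 * (1 / real (Suc n))"
          by (simp add: abs_divide)
      qed
      show "(\<lambda>n. 2 * (1 / real (Suc n))) \<longlonglongrightarrow> 0"
        using tendsto_mult_right_zero[OF LIMSEQ_inverse_real_of_nat, of 2] by (simp add: inverse_eq_divide)
    qed
    have "(\<integral>x. f (T x) \<partial>\<mu>) = (\<integral>x. f x \<partial>\<mu>)" using LIMSEQ_unique[OF l1 l2] by simp
    then show "(\<integral>x. f x \<partial>(distr \<mu> borel T)) = (\<integral>x. f x \<partial>\<mu>)"
      by (subst integral_distr[OF Tm']) auto
  qed (use \<mu> in auto)
  then show ?thesis using that \<mu> \<mu>K by blast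
qed

section \<open>Vector bundles in local coordinates\<close>

text \<open>Elimination: an unknown \<open>a\<close> with nonzero coefficient in the last equation
  is solved for and removed. The dimension counts in the fibers rest on this lemma.\<close>

lemma homogeneous_system:
  fixes M :: "'a \<Rightarrow> nat \<Rightarrow> real"
  assumes "finite S" "k < card S"
  shows "\<exists>s. (\<exists>l\<in>S. s l \<noteq> 0) \<and> (\<forall>j<k. (\<Sum>l\<in>S. s l * M l j) = 0)"
  using assms
proof (induction k arbitrary: S M)
  case 0
  then obtain l where "l \<in> S" by (metis card.empty equals0I less_irrefl)
  then show ?case by (intro exI[of _ "\<lambda>_. 1"]) auto
next
  case (Suc k)
  show ?case
  proof (cases "\<forall>l\<in>S. M l k = 0")
    case True
    obtain s where s: "\<exists>l\<in>S. s l \<noteq> 0" "\<forall>j<k. (\<Sum>l\<in>S. s l * M l j) = 0"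
      using Suc.IH[of S M] Suc.prems by auto
    have "(\<Sum>l\<in>S. s l * M l j) = 0" if "j < Suc k" for j
      using that s(2) True by (cases "j = k") auto
    then show ?thesis using s(1) by blast
  next
    case False
    then obtain a where a: "a \<in> S" "M a k \<noteq> 0" by auto
    define S' where "S' = S - {a}"
    have S': "finite S'" "k < card S'" "S = insert a S'" "a \<notin> S'"
      using Suc.prems a by (auto simp: S'_def card_Diff_singleton)
    define M' where "M' l j = M l j - M l k / M a k * M a j" for l j
    obtain s where s: "\<exists>l\<in>S'. s l \<noteq> 0" "\<forall>j<k. (\<Sum>l\<in>S'. s l * M' l j) = 0"
      using Suc.IH[of S' M'] S' by auto
    define s' where "s' l = (if l = a then - (\<Sum>l\<in>S'. s l * (M l k / M a k)) else s l)" for l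
    have eq: "(\<Sum>l\<in>S. s' l * M l j) = (\<Sum>l\<in>S'. s l * M' l j)" for j
    proof -
      have "(\<Sum>l\<in>S. s' l * M l j) = s' a * M a j + (\<Sum>l\<in>S'. s' l * M l j)" using S' by simp
      also have "(\<Sum>l\<in>S'. s' l * M l j) = (\<Sum>l\<in>S'. s l * M l j)"
        using S'(4) by (intro sum.cong) (auto simp: s'_def)
      also have "s' a * M a j = - (\<Sum>l\<in>S'. s l * (M l k / M a k) * M a j)"
        by (simp add: s'_def sum_distrib_right)
      finally show ?thesis by (simp add: M'_def sum_subtractf right_diff_distrib mult.assoc)
    qed
    have "(\<Sum>l\<in>S. s' l * M l j) = 0" if "j < Suc k" for j
    proof (cases "j = k")
      case True
      then show ?thesis unfolding eq using a(2) by (simp add: M'_def)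
    qed (use that s(2) eq in auto)
    moreover have "\<exists>l\<in>S. s' l \<noteq> 0" using s(1) S' by (auto simp: s'_def)
    ultimately show ?thesis by blast
  qed
qed

lemma bounded_coordinates_subsequence:
  fixes f :: "nat \<Rightarrow> nat \<Rightarrow> real"
  assumes "\<And>k i. \<bar>f k i\<bar> \<le> B"
  obtains r g where "strict_mono r" "\<And>i. (\<lambda>k. f (r k) i) \<longlonglongrightarrow> g i"
proof -
  define S where "S = PiE UNIV (\<lambda>_::nat. {-B..B})"
  have "compactin (product_topology (\<lambda>_::nat. euclideanreal) UNIV) S"
    unfolding S_def compactin_PiE by auto
  then have "compact S" by (simp add: euclidean_product_topology)
  moreover have "f k \<in> S" for k
    unfolding S_def PiE_UNIV_domain using abs_le_D1[OF assms] abs_le_D2[OF assms] by (auto simp: minus_le_iff)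
  ultimately obtain g r where g: "strict_mono r" "(f \<circ> r) \<longlonglongrightarrow> g"
    using compact_imp_seq_compact unfolding seq_compact_def by metis
  have "(\<lambda>k. (f \<circ> r) k i) \<longlonglongrightarrow> g i" for i
    by (rule continuous_on_tendsto_compose[OF continuous_on_product_coordinates g(2)]) auto
  then have "(\<lambda>k. f (r k) i) \<longlonglongrightarrow> g i" for i by simp
  then show ?thesis by (rule that[OF g(1)])
qed

text \<open>The target is an abstract topology, but the domain is metric, so sequences suffice to
  test continuity.\<close>

lemma continuous_map_from_sequences:
  fixes S :: "'a::metric_space set"
  assumes maps: "\<And>s. s \<in> S \<Longrightarrow> f s \<in> topspace Y"
    and lim: "\<And>\<sigma> s. (\<And>n. \<sigma> n \<in> S) \<Longrightarrow> s \<in> S \<Longrightarrow> \<sigma> \<longlonglongrightarrow> s \<Longrightarrow> limitin Y (\<lambda>n. f (\<sigma> n)) (f s) sequentially"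
  shows "continuous_map (top_of_set S) Y f"
  unfolding continuous_map_def
proof (intro conjI allI impI)
  show "f \<in> topspace (top_of_set S) \<rightarrow> topspace Y" using maps by auto
  fix V assume V: "openin Y V"
  have "openin (top_of_set S) {x \<in> S. f x \<in> V}"
    unfolding openin_euclidean_subtopology_iff
  proof (intro conjI ballI)
    fix s assume s: "s \<in> {x \<in> S. f x \<in> V}"
    show "\<exists>e>0. \<forall>x'\<in>S. dist x' s < e \<longrightarrow> x' \<in> {x \<in> S. f x \<in> V}"
    proof (rule ccontr)
      assume "\<not> ?thesis"
      then have "\<exists>x'\<in>S. dist x' s < 1 / real (Suc n) \<and> f x' \<notin> V" for n
        by (metis (mono_tags, lifting) divide_pos_pos mem_Collect_eq of_nat_0_less_iff zero_less_Suc zero_less_one)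
      then obtain \<sigma> where \<sigma>: "\<And>n. \<sigma> n \<in> S" "\<And>n. dist (\<sigma> n) s < 1 / real (Suc n)" "\<And>n. f (\<sigma> n) \<notin> V" by metis
      have "norm (dist (\<sigma> n) s) \<le> inverse (real (Suc n))" for n
        using less_imp_le[OF \<sigma>(2)[of n]] by (simp add: inverse_eq_divide)
      then have "(\<lambda>n. dist (\<sigma> n) s) \<longlonglongrightarrow> 0"
        by (intro Lim_null_comparison[OF always_eventually LIMSEQ_inverse_real_of_nat]) blast
      then have "\<sigma> \<longlonglongrightarrow> s" by (rule tendsto_dist_iff[THEN iffD2])
      then have "limitin Y (\<lambda>n. f (\<sigma> n)) (f s) sequentially" using lim \<sigma>(1) s by auto
      then have "eventually (\<lambda>n. f (\<sigma> n) \<in> V) sequentially" using V s by (auto simp: limitin_def)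
      then show False using \<sigma>(3) by (simp add: eventually_sequentially)
    qed
  qed auto
  then show "openin (top_of_set S) {x \<in> topspace (top_of_set S). f x \<in> V}" by simp
qed

lemma limitin_sequentially_subseqI:
  assumes "l \<in> topspace Y"
    and "\<And>r::nat \<Rightarrow> nat. strict_mono r \<Longrightarrow> \<exists>r'. strict_mono r' \<and> limitin Y (\<lambda>n. f (r (r' n))) l sequentially"
  shows "limitin Y f l sequentially"
  unfolding limitin_def
proof (intro conjI allI impI assms(1))
  fix V assume V: "openin Y V \<and> l \<in> V"
  show "eventually (\<lambda>n. f n \<in> V) sequentially"
  proof (rule ccontr)
    assume "\<not> ?thesis"
    then have "frequently (\<lambda>n. f n \<notin> V) sequentially" by (simp add: frequently_def)
    then have "infinite {n. f n \<notin> V}" by (simp add: frequently_cofinite[symmetric] cofinite_eq_sequentially)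
    then obtain r :: "nat \<Rightarrow> nat" where r: "strict_mono r" "\<And>n. f (r n) \<notin> V"
      using infinite_enumerate by (metis mem_Collect_eq)
    obtain r' where "limitin Y (\<lambda>n. f (r (r' n))) l sequentially" using assms(2)[OF r(1)] by blast
    then have "eventually (\<lambda>n. f (r (r' n)) \<in> V) sequentially" using V by (auto simp: limitin_def)
    then show False using r(2) by (simp add: eventually_sequentially)
  qed
qed

section \<open>Charts and linear combinations\<close>

locale euclidean_bundle =
  fixes E :: "('x::metric_space, 'e) vbundle" and d :: nat
  assumes base_UNIV: "base_set E = UNIV" and vector_bundle: "vector_bundle E d"
begin

abbreviation fib :: "'x \<Rightarrow> 'e set" where "fib x \<equiv> fiber E x"
abbreviation tot :: "'e set" where "tot \<equiv> topspace (tot_space E)"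
abbreviation conv :: "(nat \<Rightarrow> 'e) \<Rightarrow> 'e \<Rightarrow> bool" where "conv v l \<equiv> limitin (tot_space E) v l sequentially"
abbreviation chart where "chart \<equiv> local_trivialization E d"
abbreviation crd :: "('e \<Rightarrow> 'x \<times> (nat \<Rightarrow> real)) \<Rightarrow> 'e \<Rightarrow> nat \<Rightarrow> real" where "crd h v \<equiv> snd (h v)"

lemma fib_tot: "v \<in> fib x \<Longrightarrow> v \<in> tot" and fib_proj: "v \<in> fib x \<Longrightarrow> bproj E v = x"
  by (auto simp: fiber_def)

lemma tot_fib: "v \<in> tot \<Longrightarrow> v \<in> fib (bproj E v)"
  by (auto simp: fiber_def)

lemma vector_space: "real_vector_space_on (fib x) (vadd E) (vscale E) (vzero E x)"
  using vector_bundle base_UNIV by (auto simp: vector_bundle_def)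

lemma vadd_in: "u \<in> fib x \<Longrightarrow> v \<in> fib x \<Longrightarrow> vadd E u v \<in> fib x"
  using vector_space[of x] unfolding real_vector_space_on_def by blast

lemma vscale_in: "v \<in> fib x \<Longrightarrow> vscale E c v \<in> fib x"
  using vector_space[of x] unfolding real_vector_space_on_def by blast

lemma vzero_in: "vzero E x \<in> fib x"
  using vector_space[of x] unfolding real_vector_space_on_def by blast

lemma vzero_add: "v \<in> fib x \<Longrightarrow> vadd E (vzero E x) v = v"
  using vector_space[of x] unfolding real_vector_space_on_def by blast

lemma chart_exists: obtains U h where "x \<in> U" "chart U h"
  using vector_bundle base_UNIV unfolding vector_bundle_def by (metis UNIV_I)

lemma chart_open: "chart U h \<Longrightarrow> open U"
  using base_UNIV by (simp add: local_trivialization_def)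

lemma chart_homeo: "chart U h \<Longrightarrow> homeomorphic_map (subtopology (tot_space E) {v. bproj E v \<in> U})
                      (prod_topology (top_of_set U) (Euclidean_space d)) h"
  by (simp add: local_trivialization_def)

lemma chart_fst: "chart U h \<Longrightarrow> x \<in> U \<Longrightarrow> v \<in> fib x \<Longrightarrow> fst (h v) = x"
  and crd_add: "chart U h \<Longrightarrow> x \<in> U \<Longrightarrow> u \<in> fib x \<Longrightarrow> v \<in> fib x \<Longrightarrow> crd h (vadd E u v) i = crd h u i + crd h v i"
  and crd_scale: "chart U h \<Longrightarrow> x \<in> U \<Longrightarrow> v \<in> fib x \<Longrightarrow> crd h (vscale E c v) i = c * crd h v i"
  by (auto simp: local_trivialization_def)

lemma bundle_over_eq: "topspace (subtopology (tot_space E) {v. bproj E v \<in> U}) = bundle_over E U"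
  by (auto simp: bundle_over_def)

lemma fib_over: "x \<in> U \<Longrightarrow> v \<in> fib x \<Longrightarrow> v \<in> bundle_over E U"
  by (auto simp: bundle_over_def fiber_def)

lemma chart_bij: "chart U h \<Longrightarrow> bij_betw h (bundle_over E U) (U \<times> {c. \<forall>i\<ge>d. c i = 0})"
  using homeomorphic_imp_injective_map[OF chart_homeo[of U h]] homeomorphic_imp_surjective_map[OF chart_homeo[of U h]]
  unfolding bundle_over_eq bij_betw_def by (simp add: topspace_Euclidean_space)

lemma crd_ge: assumes "chart U h" "x \<in> U" "v \<in> fib x" "i \<ge> d" shows "crd h v i = 0"
proof -
  have "h v \<in> U \<times> {c. \<forall>i\<ge>d. c i = 0}"
    using chart_bij[OF assms(1)] fib_over[OF assms(2,3)] by (auto dest: bij_betwE)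
  then show ?thesis using assms(4) by auto
qed

lemma crd_zero: assumes "chart U h" "x \<in> U" shows "crd h (vzero E x) i = 0"
proof -
  have "crd h (vadd E (vzero E x) (vzero E x)) i = crd h (vzero E x) i"
    by (simp add: vzero_add[OF vzero_in])
  then show ?thesis using crd_add[OF assms vzero_in vzero_in] by simp
qed

lemma crd_eqI:
  assumes "chart U h" "x \<in> U" "u \<in> fib x" "v \<in> fib x" "\<And>i. i < d \<Longrightarrow> crd h u i = crd h v i"
  shows "u = v"
proof -
  have "crd h u i = crd h v i" for i
    using assms(5)[of i] crd_ge[OF assms(1-3), of i] crd_ge[OF assms(1,2,4), of i] by (cases "i < d") auto
  then have "snd (h u) = snd (h v)" by auto
  then have "h u = h v" using chart_fst[OF assms(1,2)] assms(3,4) by (metis prod.collapse)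
  then show ?thesis
    using inj_onD[OF bij_betw_imp_inj_on[OF chart_bij[OF assms(1)]] _ fib_over[OF assms(2,3)] fib_over[OF assms(2,4)]]
    by blast
qed

text \<open>The local section with constant chart coordinates \<open>c\<close>. It is meaningful
  only if \<open>c\<close> vanishes from index \<open>d\<close> on, as points of
  \<open>Euclidean_space d\<close> do.\<close>

definition sec :: "'x set \<Rightarrow> ('e \<Rightarrow> 'x \<times> (nat \<Rightarrow> real)) \<Rightarrow> 'x \<Rightarrow> (nat \<Rightarrow> real) \<Rightarrow> 'e" where
  "sec U h x c = inv_into (bundle_over E U) h (x, c)"

lemma sec:
  assumes "chart U h" "x \<in> U" "\<And>i. i \<ge> d \<Longrightarrow> c i = 0"
  shows sec_in: "sec U h x c \<in> fib x" and crd_sec: "crd h (sec U h x c) = c"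
proof -
  have mem: "(x, c) \<in> h ` bundle_over E U"
    using chart_bij[OF assms(1)] assms(2,3) by (auto simp: bij_betw_def)
  have 1: "sec U h x c \<in> bundle_over E U" "h (sec U h x c) = (x, c)"
    unfolding sec_def by (rule inv_into_into[OF mem], rule f_inv_into_f[OF mem])
  then have "sec U h x c \<in> fib (bproj E (sec U h x c))" "bproj E (sec U h x c) \<in> U"
    by (auto simp: bundle_over_def fiber_def)
  moreover have "bproj E (sec U h x c) = x" using chart_fst[OF assms(1)] calculation 1(2) by (metis fst_conv)
  ultimately show "sec U h x c \<in> fib x" by simp
  show "crd h (sec U h x c) = c" using 1(2) by simp
qed

lemma frame_sec: "frame E U h i x = sec U h x (\<lambda>j. if j = i then 1 else 0)"
  by (simp add: frame_def sec_def)

lemma frame_in: "chart U h \<Longrightarrow> x \<in> U \<Longrightarrow> i < d \<Longrightarrow> frame E U h i x \<in> fib x"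
  and crd_frame: "chart U h \<Longrightarrow> x \<in> U \<Longrightarrow> i < d \<Longrightarrow> crd h (frame E U h i x) j = (if j = i then 1 else 0)"
proof -
  assume a: "chart U h" "x \<in> U" "i < d"
  then have z: "\<And>j. j \<ge> d \<Longrightarrow> (\<lambda>j. if j = i then 1 else (0::real)) j = 0" by auto
  show "frame E U h i x \<in> fib x" unfolding frame_sec by (rule sec_in[OF a(1,2) z])
  show "crd h (frame E U h i x) j = (if j = i then 1 else 0)" unfolding frame_sec by (subst crd_sec[OF a(1,2) z]) auto
qed

text \<open>The operations are record fields and not those of a type class, so linear combinations
  are folded explicitly. Coefficients and vectors are total sequences of which the first
  \<open>k\<close> entries matter.\<close>

primrec comb :: "'x \<Rightarrow> nat \<Rightarrow> (nat \<Rightarrow> real) \<Rightarrow> (nat \<Rightarrow> 'e) \<Rightarrow> 'e" where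
  "comb x 0 c u = vzero E x"
| "comb x (Suc k) c u = vadd E (comb x k c u) (vscale E (c k) (u k))"

lemma comb_in: "(\<And>j. j < k \<Longrightarrow> u j \<in> fib x) \<Longrightarrow> comb x k c u \<in> fib x"
  by (induction k) (auto intro!: vzero_in vadd_in vscale_in)

lemma crd_comb:
  assumes "chart U h" "x \<in> U"
  shows "(\<And>j. j < k \<Longrightarrow> u j \<in> fib x) \<Longrightarrow> crd h (comb x k c u) i = (\<Sum>j<k. c j * crd h (u j) i)"
  by (induction k) (simp_all add: crd_zero[OF assms] crd_add[OF assms] crd_scale[OF assms] comb_in vscale_in)

text \<open>Vector identities are verified through this rule: in a chart they become identities
  between finite sums of reals.\<close>

lemma fib_eqI:
  assumes "u \<in> fib x" "v \<in> fib x"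
    "\<And>U h i. chart U h \<Longrightarrow> x \<in> U \<Longrightarrow> i < d \<Longrightarrow> crd h u i = crd h v i"
  shows "u = v"
  using chart_exists[of x] crd_eqI[OF _ _ assms(1,2)] assms(3) by metis

lemma comb_cong: "(\<And>j. j < k \<Longrightarrow> c j = c' j) \<Longrightarrow> (\<And>j. j < k \<Longrightarrow> u j = u' j) \<Longrightarrow> comb x k c u = comb x k c' u'"
  by (induction k) auto

lemma comb_comb:
  assumes "\<And>j. j < k \<Longrightarrow> a j \<in> fib x"
  shows "comb x m s (\<lambda>l. comb x k (M l) a) = comb x k (\<lambda>j. \<Sum>l<m. s l * M l j) a"
proof (rule fib_eqI)
  fix U h i assume ch: "chart U h" "x \<in> U"
  have "(\<Sum>l<m. s l * (\<Sum>j<k. M l j * crd h (a j) i)) = (\<Sum>j<k. (\<Sum>l<m. s l * M l j) * crd h (a j) i)"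
    by (subst sum_distrib_left, subst sum.swap) (simp add: sum_distrib_right mult.assoc)
  then show "crd h (comb x m s (\<lambda>l. comb x k (M l) a)) i = crd h (comb x k (\<lambda>j. \<Sum>l<m. s l * M l j) a) i"
    using assms by (simp add: crd_comb[OF ch] comb_in)
qed (use assms in \<open>auto intro!: comb_in\<close>)

lemma comb_single:
  assumes "j < k" "\<And>j. j < k \<Longrightarrow> u j \<in> fib x"
  shows "comb x k (\<lambda>i. if i = j then t else 0) u = vscale E t (u j)"
proof (rule fib_eqI)
  fix U h i assume ch: "chart U h" "x \<in> U"
  have "(\<Sum>l<k. (if l = j then t else 0) * crd h (u l) i) = (\<Sum>l<k. if l = j then t * crd h (u j) i else 0)"
    by (intro sum.cong) auto
  then show "crd h (comb x k (\<lambda>i. if i = j then t else 0) u) i = crd h (vscale E t (u j)) i"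
    using assms by (simp add: crd_comb[OF ch] crd_scale[OF ch])
qed (use assms in \<open>auto intro!: comb_in vscale_in\<close>)

lemma comb_add:
  assumes "\<And>j. j < k \<Longrightarrow> u j \<in> fib x"
  shows "vadd E (comb x k c u) (comb x k c' u) = comb x k (\<lambda>j. c j + c' j) u"
proof (rule fib_eqI)
  fix U h i assume ch: "chart U h" "x \<in> U"
  show "crd h (vadd E (comb x k c u) (comb x k c' u)) i = crd h (comb x k (\<lambda>j. c j + c' j) u) i"
    using assms by (simp add: crd_comb[OF ch] crd_add[OF ch] comb_in sum.distrib distrib_right)
qed (use assms in \<open>auto intro!: comb_in vadd_in\<close>)

lemma comb_scale:
  assumes "\<And>j. j < k \<Longrightarrow> u j \<in> fib x"
  shows "vscale E t (comb x k c u) = comb x k (\<lambda>j. t * c j) u"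
proof (rule fib_eqI)
  fix U h i assume ch: "chart U h" "x \<in> U"
  show "crd h (vscale E t (comb x k c u)) i = crd h (comb x k (\<lambda>j. t * c j) u) i"
    using assms by (simp add: crd_comb[OF ch] crd_scale[OF ch] comb_in sum_distrib_left mult.assoc)
qed (use assms in \<open>auto intro!: comb_in vscale_in\<close>)

lemma comb_zero:
  assumes "\<And>j. j < k \<Longrightarrow> u j \<in> fib x" "\<And>j. j < k \<Longrightarrow> c j = 0"
  shows "comb x k c u = vzero E x"
proof (rule fib_eqI)
  fix U h i assume ch: "chart U h" "x \<in> U"
  show "crd h (comb x k c u) i = crd h (vzero E x) i"
    using assms by (simp add: crd_comb[OF ch] crd_zero[OF ch])
qed (use assms in \<open>auto intro!: comb_in vzero_in\<close>)

section \<open>Independence and dimension in a fiber\<close>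

definition indep :: "'x \<Rightarrow> nat \<Rightarrow> (nat \<Rightarrow> 'e) \<Rightarrow> bool" where
  "indep x k u \<longleftrightarrow> (\<forall>j<k. u j \<in> fib x) \<and> (\<forall>c. comb x k c u = vzero E x \<longrightarrow> (\<forall>j<k. c j = 0))"

lemma indep_in: "indep x k u \<Longrightarrow> j < k \<Longrightarrow> u j \<in> fib x"
  by (auto simp: indep_def)

lemma indep_prefix:
  assumes "indep x k u" "m \<le> k" shows "indep x m u"
  unfolding indep_def
proof (intro conjI allI impI)
  show in_m: "u j \<in> fib x" if "j < m" for j using assms that by (auto simp: indep_def)
  fix c j assume c: "comb x m c u = vzero E x" and j: "j < m"
  define c' where "c' j = (if j < m then c j else 0)" for j
  have "comb x k c' u = comb x m c u"
  proof (rule fib_eqI)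
    fix U h i assume ch: "chart U h" "x \<in> U"
    have "(\<Sum>j<k. c' j * crd h (u j) i) = (\<Sum>j<m. c j * crd h (u j) i)"
      using assms(2) by (intro sum.mono_neutral_cong_right) (auto simp: c'_def)
    then show "crd h (comb x k c' u) i = crd h (comb x m c u) i"
      using indep_in[OF assms(1)] in_m by (simp add: crd_comb[OF ch])
  qed (use indep_in[OF assms(1)] in_m in \<open>auto intro!: comb_in\<close>)
  then have "c' j = 0" using assms c j unfolding indep_def by auto
  then show "c j = 0" using j by (simp add: c'_def)
qed

text \<open>More than \<open>k\<close> combinations of \<open>k\<close> vectors satisfy a nontrivial
  relation, because its coefficients solve \<open>k\<close> homogeneous equations in more than
  \<open>k\<close> unknowns.\<close>

lemma indep_le_span:
  assumes u: "indep x m u" and a: "\<And>j. j < k \<Longrightarrow> a j \<in> fib x"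
    and span: "\<And>l. l < m \<Longrightarrow> \<exists>c. u l = comb x k c a"
  shows "m \<le> k"
proof (rule ccontr)
  assume "\<not> m \<le> k"
  then have k: "k < card {..<m}" by simp
  obtain M where M: "\<And>l. l < m \<Longrightarrow> u l = comb x k (M l) a" using span by metis
  obtain s where s: "\<exists>l\<in>{..<m}. s l \<noteq> 0" "\<forall>j<k. (\<Sum>l<m. s l * M l j) = 0"
    using homogeneous_system[OF _ k, of M] by auto
  have "comb x m s u = comb x m s (\<lambda>l. comb x k (M l) a)" using M by (intro comb_cong) auto
  also have "\<dots> = comb x k (\<lambda>j. \<Sum>l<m. s l * M l j) a" using a by (rule comb_comb)
  also have "\<dots> = vzero E x" using a s(2) by (intro comb_zero) auto
  finally show False using u s(1) unfolding indep_def by auto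
qed

lemma frame_comb:
  assumes ch: "chart U h" "x \<in> U" and v: "v \<in> fib x"
  shows "comb x d (crd h v) (\<lambda>i. frame E U h i x) = v"
proof (rule crd_eqI[OF ch])
  show "comb x d (crd h v) (\<lambda>i. frame E U h i x) \<in> fib x" using ch by (intro comb_in frame_in)
  fix i assume i: "i < d"
  have "(\<Sum>j<d. crd h v j * crd h (frame E U h j x) i) = (\<Sum>j<d. if j = i then crd h v i else 0)"
    using crd_frame[OF ch] by (intro sum.cong) auto
  then show "crd h (comb x d (crd h v) (\<lambda>i. frame E U h i x)) i = crd h v i"
    using i frame_in[OF ch] by (simp add: crd_comb[OF ch])
qed fact

lemma frame_indep: assumes ch: "chart U h" "x \<in> U" shows "indep x d (\<lambda>i. frame E U h i x)"
  unfolding indep_def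
proof (intro conjI allI impI)
  fix c j assume c: "comb x d c (\<lambda>i. frame E U h i x) = vzero E x" and j: "j < d"
  have "(\<Sum>i<d. c i * crd h (frame E U h i x) j) = (\<Sum>i<d. if i = j then c j else 0)"
    using crd_frame[OF ch] by (intro sum.cong) auto
  also have "\<dots> = c j" using j by simp
  finally have "c j = crd h (comb x d c (\<lambda>i. frame E U h i x)) j"
    using frame_in[OF ch] by (simp add: crd_comb[OF ch])
  then show "c j = 0" using c crd_zero[OF ch] by simp
qed (use frame_in[OF ch] in auto)

lemma indep_le_dim: "indep x k u \<Longrightarrow> k \<le> d"
proof -
  assume u: "indep x k u"
  obtain U h where ch: "x \<in> U" "chart U h" using chart_exists .
  show "k \<le> d"
    using frame_comb[OF ch(2,1)] frame_in[OF ch(2,1)] indep_in[OF u]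
    by (intro indep_le_span[OF u, of d "\<lambda>i. frame E U h i x"]) (auto, metis)
qed

lemma indep_extend:
  assumes u: "indep x k u" and v: "v \<in> fib x" and ns: "\<And>c. v \<noteq> comb x k c u"
  shows "indep x (Suc k) (u(k := v))"
  unfolding indep_def
proof (intro conjI allI impI)
  show "(u(k := v)) j \<in> fib x" if "j < Suc k" for j using that indep_in[OF u] v by auto
  fix c j assume c: "comb x (Suc k) c (u(k := v)) = vzero E x" and j: "j < Suc k"
  have cc: "comb x k c (u(k := v)) = comb x k c u" by (intro comb_cong) auto
  have ck: "c k = 0"
  proof (rule ccontr)
    assume nz: "c k \<noteq> 0"
    have "v = comb x k (\<lambda>j. - c j / c k) u"
    proof (rule fib_eqI[OF v])
      fix U h i assume ch: "chart U h" "x \<in> U"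
      have "crd h (comb x (Suc k) c (u(k := v))) i = 0" using c crd_zero[OF ch] by simp
      then have "(\<Sum>j<k. c j * crd h (u j) i) + c k * crd h v i = 0"
        using cc v indep_in[OF u] by (simp add: crd_add[OF ch] crd_scale[OF ch] comb_in vscale_in crd_comb[OF ch])
      then have "crd h v i = (- (\<Sum>j<k. c j * crd h (u j) i)) / c k" using nz by (simp add: field_simps)
      then show "crd h v i = crd h (comb x k (\<lambda>j. - c j / c k) u) i"
        using indep_in[OF u] by (simp add: crd_comb[OF ch] sum_divide_distrib sum_negf)
    qed (use indep_in[OF u] in \<open>auto intro!: comb_in\<close>)
    then show False using ns by blast
  qed
  have "comb x k c u = vzero E x"
  proof (rule fib_eqI)
    fix U h i assume ch: "chart U h" "x \<in> U"
    have "crd h (comb x (Suc k) c (u(k := v))) i = 0" using c crd_zero[OF ch] by simp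
    then show "crd h (comb x k c u) i = crd h (vzero E x) i"
      using ck cc v indep_in[OF u] crd_zero[OF ch]
      by (simp add: crd_add[OF ch] crd_scale[OF ch] comb_in vscale_in)
  qed (use indep_in[OF u] in \<open>auto intro!: comb_in vzero_in\<close>)
  then have "\<forall>j<k. c j = 0" using u by (simp add: indep_def)
  then show "c j = 0" using ck j by (cases "j = k") auto
qed

lemma indep_full_spans:
  assumes u: "indep x d u" and v: "v \<in> fib x" shows "\<exists>c. v = comb x d c u"
  using indep_extend[OF assms] indep_le_dim[of x "Suc d"] by fastforce

lemma indep_extend_full:
  assumes "indep x k u" shows "\<exists>u'. indep x d u' \<and> (\<forall>j<k. u' j = u j)"
proof -
  have "\<exists>u'. indep x (k + n) u' \<and> (\<forall>j<k. u' j = u j)" if "k + n \<le> d" for n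
    using that
  proof (induction n)
    case 0 then show ?case using assms by auto
  next
    case (Suc n)
    then obtain u' where u': "indep x (k + n) u'" "\<forall>j<k. u' j = u j" by auto
    obtain U h where ch: "x \<in> U" "chart U h" using chart_exists .
    have "\<exists>v\<in>fib x. \<forall>c. v \<noteq> comb x (k + n) c u'"
    proof (rule ccontr)
      assume "\<not> ?thesis"
      then have "d \<le> k + n"
        using frame_in[OF ch(2,1)] indep_in[OF u'(1)]
        by (intro indep_le_span[OF frame_indep[OF ch(2,1)], of _ u']) auto
      then show False using Suc.prems by simp
    qed
    then obtain v where v: "v \<in> fib x" "\<And>c. v \<noteq> comb x (k + n) c u'" by blast
    have "indep x (Suc (k + n)) (u'(k + n := v))" by (rule indep_extend[OF u'(1) v])
    moreover have "\<forall>j<k. (u'(k + n := v)) j = u j" using u'(2) by auto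
    ultimately show ?case unfolding add_Suc_right by blast
  qed
  from this[of "d - k"] show ?thesis using indep_le_dim[OF assms] by simp
qed

text \<open>The rows of \<open>A\<close> are functionals dual to \<open>u\<close>, written in chart
  coordinates: \<open>u\<close> is extended to a basis \<open>u'\<close>, and \<open>A j i\<close>
  is the coefficient at \<open>u' j\<close> of the \<open>i\<close>-th frame vector.\<close>

lemma indep_dual:
  assumes ch: "chart U h" "x \<in> U" and u: "indep x k u"
  shows "\<exists>A. \<forall>j<k. \<forall>l<k. (\<Sum>i<d. A j i * crd h (u l) i) = (if j = l then 1 else (0::real))"
proof -
  obtain u' where u': "indep x d u'" "\<forall>j<k. u' j = u j" using indep_extend_full[OF u] by blast
  have "\<exists>c. frame E U h i x = comb x d c u'" if "i < d" for i
    using indep_full_spans[OF u'(1) frame_in[OF ch that]] .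
  then obtain t where t: "\<And>i. i < d \<Longrightarrow> frame E U h i x = comb x d (t i) u'" by metis
  show ?thesis
  proof (intro exI[of _ "\<lambda>j i. t i j"] allI impI)
    fix j l assume j: "j < k" and l: "l < k"
    have kd: "k \<le> d" using indep_le_dim[OF u] .
    have "u' l = comb x d (crd h (u' l)) (\<lambda>i. frame E U h i x)"
      using frame_comb[OF ch indep_in[OF u'(1), of l]] l kd by simp
    also have "\<dots> = comb x d (crd h (u' l)) (\<lambda>i. comb x d (t i) u')" using t by (intro comb_cong) auto
    also have "\<dots> = comb x d (\<lambda>j. \<Sum>i<d. crd h (u' l) i * t i j) u'"
      using indep_in[OF u'(1)] by (intro comb_comb) auto
    finally have e1: "u' l = comb x d (\<lambda>j. \<Sum>i<d. crd h (u' l) i * t i j) u'" .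
    have e2: "comb x d (\<lambda>j. if j = l then - 1 else 0) u' = vscale E (- 1) (u' l)"
      using l kd indep_in[OF u'(1)] by (intro comb_single) auto
    have e3: "vadd E (u' l) (vscale E (- 1) (u' l)) = vzero E x"
    proof (rule fib_eqI)
      fix U h i assume ch: "chart U h" "x \<in> U"
      show "crd h (vadd E (u' l) (vscale E (- 1) (u' l))) i = crd h (vzero E x) i"
        using indep_in[OF u'(1), of l] l kd by (simp add: crd_add[OF ch] crd_scale[OF ch] crd_zero[OF ch] vscale_in)
    qed (use indep_in[OF u'(1), of l] l kd in \<open>auto intro!: vadd_in vscale_in vzero_in\<close>)
    have "comb x d (\<lambda>j. (\<Sum>i<d. crd h (u' l) i * t i j) + (if j = l then - 1 else 0)) u' =
        vadd E (comb x d (\<lambda>j. \<Sum>i<d. crd h (u' l) i * t i j) u') (comb x d (\<lambda>j. if j = l then - 1 else 0) u')"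
      using indep_in[OF u'(1)] by (intro comb_add[symmetric]) auto
    then have "comb x d (\<lambda>j. (\<Sum>i<d. crd h (u' l) i * t i j) + (if j = l then - 1 else 0)) u' = vzero E x"
      by (simp only: e1[symmetric] e2 e3)
    then have "\<forall>j<d. (\<lambda>j. (\<Sum>i<d. crd h (u' l) i * t i j) + (if j = l then - 1 else 0)) j = 0"
      using u'(1) unfolding indep_def by blast
    then have "(\<Sum>i<d. crd h (u' l) i * t i j) + (if j = l then - 1 else 0) = 0"
      using j kd by simp
    then show "(\<Sum>i<d. t i j * crd h (u l) i) = (if j = l then 1 else 0)"
      using u'(2) l by (simp add: mult.commute split: if_splits)
  qed
qed

text \<open>An independent family in \<open>V\<close> of greatest length spans \<open>V\<close>; a
  greatest length exists because all lengths are at most \<open>d\<close>.\<close>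

lemma subspace_basis:
  assumes sub: "V \<subseteq> fib x" and closed: "\<And>k u c. (\<And>j. j < k \<Longrightarrow> u j \<in> V) \<Longrightarrow> comb x k c u \<in> V"
  obtains l g where "indep x l g" "\<And>j. j < l \<Longrightarrow> g j \<in> V" "\<And>v. v \<in> V \<Longrightarrow> \<exists>c. v = comb x l c g"
proof -
  define P where "P l \<longleftrightarrow> (\<exists>g. indep x l g \<and> (\<forall>j<l. g j \<in> V))" for l
  have P0: "P 0" by (auto simp: P_def indep_def)
  have Pd: "\<And>l. P l \<Longrightarrow> l \<le> d" by (auto simp: P_def dest: indep_le_dim)
  define l where "l = (GREATEST l. P l)"
  have "P l" unfolding l_def by (rule GreatestI_nat[where P = P and b = d, OF P0 Pd])
  then obtain g where g: "indep x l g" "\<And>j. j < l \<Longrightarrow> g j \<in> V" by (auto simp: P_def)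
  have "\<exists>c. v = comb x l c g" if v: "v \<in> V" for v
  proof (rule ccontr)
    assume ns: "\<not> ?thesis"
    have "indep x (Suc l) (g(l := v))" using ns v sub by (intro indep_extend[OF g(1)]) auto
    then have "P (Suc l)" unfolding P_def using g(2) v by (intro exI[of _ "g(l := v)"]) auto
    then have "Suc l \<le> l" unfolding l_def by (rule Greatest_le_nat[where P = P and b = d, OF _ Pd])
    then show False by simp
  qed
  then show ?thesis using that g by blast
qed

section \<open>Sequential convergence in the total space\<close>

lemma conv_topspace: "conv v l \<Longrightarrow> l \<in> tot"
  by (rule limitin_topspace)

lemma conv_proj: assumes "conv v l" shows "(\<lambda>k. bproj E (v k)) \<longlonglongrightarrow> bproj E l"
proof -
  have "continuous_map (tot_space E) euclidean (bproj E)"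
    using vector_bundle base_UNIV by (simp add: vector_bundle_def)
  from continuous_map_limit[OF this assms] show ?thesis by (simp add: o_def)
qed

lemma conv_fib:
  assumes "conv v l" "\<And>k. v k \<in> fib (x k)" "x \<longlonglongrightarrow> y" shows "l \<in> fib y"
proof -
  have "(\<lambda>k. bproj E (v k)) = x" using fib_proj[OF assms(2)] by auto
  then have "bproj E l = y" using conv_proj[OF assms(1)] assms(3) LIMSEQ_unique by auto
  then show ?thesis using conv_topspace[OF assms(1)] by (simp add: fiber_def)
qed

lemma conv_crd:
  assumes ch: "chart U h" "x \<in> U" and v: "conv v l" and l: "l \<in> fib x"
  shows "(\<lambda>k. crd h (v k) i) \<longlonglongrightarrow> crd h l i"
proof -
  have "(\<lambda>k. bproj E (v k)) \<longlonglongrightarrow> x" using conv_proj[OF v] fib_proj[OF l] by simp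
  then have "eventually (\<lambda>k. bproj E (v k) \<in> U) sequentially"
    using chart_open[OF ch(1)] ch(2) by (rule topological_tendstoD)
  then have "limitin (subtopology (tot_space E) {v. bproj E v \<in> U}) v l sequentially"
    unfolding limitin_subtopology using v ch(2) fib_proj[OF l] by simp
  from continuous_map_limit[OF homeomorphic_imp_continuous_map[OF chart_homeo[OF ch(1)]] this]
  have "limitin (Euclidean_space d) (snd \<circ> (h \<circ> v)) (snd (h l)) sequentially"
    unfolding limitin_pairwise by simp
  then have "limitin (powertop_real UNIV) (snd \<circ> (h \<circ> v)) (snd (h l)) sequentially"
    unfolding Euclidean_space_def limitin_subtopology by simp
  then show ?thesis unfolding limitin_componentwise by (auto simp: o_def)
qed

text \<open>Together with \<open>conv_crd\<close> this reduces convergence in the total space to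
  convergence of base points and of \<open>d\<close> real coordinates.\<close>

lemma convI:
  assumes ch: "chart U h" "x \<in> U" and v: "\<And>k. v k \<in> fib (y k)" and y: "y \<longlonglongrightarrow> x" and l: "l \<in> fib x"
    and c: "\<And>i. i < d \<Longrightarrow> (\<lambda>k. crd h (v k) i) \<longlonglongrightarrow> crd h l i"
  shows "conv v l"
proof -
  let ?S = "subtopology (tot_space E) {v. bproj E v \<in> U}"
  let ?P = "prod_topology (top_of_set U) (Euclidean_space d)"
  obtain g where g: "homeomorphic_maps ?S ?P h g"
    using chart_homeo[OF ch(1)] unfolding homeomorphic_map_maps by blast
  have ev: "eventually (\<lambda>k. y k \<in> U) sequentially"
    using y chart_open[OF ch(1)] ch(2) by (rule topological_tendstoD)
  have ci: "(\<lambda>k. crd h (v k) i) \<longlonglongrightarrow> crd h l i" for i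
  proof (cases "i < d")
    case False
    have "eventually (\<lambda>k. crd h (v k) i = 0) sequentially"
      using ev by eventually_elim (use False crd_ge[OF ch(1) _ v] in auto)
    then show ?thesis using crd_ge[OF ch l, of i] False by (simp add: tendsto_eventually)
  qed (use c in auto)
  have "limitin ?P (h \<circ> v) (h l) sequentially"
    unfolding limitin_pairwise
  proof
    have "eventually (\<lambda>k. y k = (fst \<circ> (h \<circ> v)) k) sequentially"
      using ev by eventually_elim (use chart_fst[OF ch(1) _ v] in auto)
    then have "(fst \<circ> (h \<circ> v)) \<longlonglongrightarrow> x" using y by (rule Lim_transform_eventually[rotated])
    moreover have "eventually (\<lambda>k. (fst \<circ> (h \<circ> v)) k \<in> U) sequentially"
      using ev by eventually_elim (use chart_fst[OF ch(1) _ v] in auto)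
    ultimately show "limitin (top_of_set U) (fst \<circ> (h \<circ> v)) (fst (h l)) sequentially"
      using ch(2) by (simp add: limitin_subtopology chart_fst[OF ch l])
    have "eventually (\<lambda>k. \<forall>i\<ge>d. crd h (v k) i = 0) sequentially"
      using ev by eventually_elim (use crd_ge[OF ch(1) _ v] in auto)
    then show "limitin (Euclidean_space d) (snd \<circ> (h \<circ> v)) (snd (h l)) sequentially"
      unfolding Euclidean_space_def limitin_subtopology limitin_componentwise
      using ci crd_ge[OF ch l] by (auto simp: o_def)
  qed
  note hlim = this
  have "continuous_map ?P ?S g" using g unfolding homeomorphic_maps_def by blast
  from continuous_map_limit[OF this hlim]
  have lim: "limitin ?S (g \<circ> (h \<circ> v)) (g (h l)) sequentially" .
  have gh: "g (h w) = w" if "w \<in> bundle_over E U" for w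
    using g that unfolding homeomorphic_maps_def bundle_over_eq by blast
  have ev': "eventually (\<lambda>k. (g \<circ> (h \<circ> v)) k = v k) sequentially"
    using ev by eventually_elim (use gh[OF fib_over[OF _ v]] in auto)
  have "limitin ?S v (g (h l)) sequentially" by (rule limitin_transform_eventually[OF ev' lim])
  then show ?thesis using gh[OF fib_over[OF ch(2) l]] by (simp add: limitin_subtopology)
qed

lemma conv_const: "l \<in> tot \<Longrightarrow> conv (\<lambda>_. l) l"
  by (simp add: limitin_def)

lemma conv_subseq: "conv v l \<Longrightarrow> strict_mono r \<Longrightarrow> conv (\<lambda>k. v (r k)) l"
  using limitin_subsequence[of r "tot_space E" v l] by (simp add: o_def)

text \<open>The topology of the total space is abstract, so uniqueness of limits is derived from the
  metric base and the charts.\<close>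

lemma conv_unique: assumes "conv v l" "conv v l'" shows "l = l'"
proof -
  have p: "bproj E l = bproj E l'" using conv_proj[OF assms(1)] conv_proj[OF assms(2)] LIMSEQ_unique by blast
  have f: "l \<in> fib (bproj E l)" "l' \<in> fib (bproj E l)"
    using conv_topspace assms p by (auto intro: tot_fib simp: fiber_def)
  show ?thesis
  proof (rule fib_eqI[OF f])
    fix U h i assume ch: "chart U h" "bproj E l \<in> U"
    show "crd h l i = crd h l' i"
      using conv_crd[OF ch assms(1) f(1)] conv_crd[OF ch assms(2) f(2)] LIMSEQ_unique by blast
  qed
qed

lemma conv_sec:
  assumes ch: "chart U h" "x \<in> U" and y: "y \<longlonglongrightarrow> x" "\<And>k. y k \<in> U"
    and c: "\<And>i. (\<lambda>k. c k i) \<longlonglongrightarrow> c' i" "\<And>k i. i \<ge> d \<Longrightarrow> c k i = 0"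
  shows "conv (\<lambda>k. sec U h (y k) (c k)) (sec U h x c')"
proof -
  have c0: "c' i = 0" if "i \<ge> d" for i
    using c(1)[of i] c(2)[OF that] by (simp add: LIMSEQ_const_iff)
  show ?thesis
    by (rule convI[OF ch, of _ y]) (use sec[OF ch(1) y(2) c(2)] sec[OF ch c0] c y in auto)
qed

lemma conv_comb:
  assumes x: "x \<longlonglongrightarrow> y" and u: "\<And>j k. j < m \<Longrightarrow> u k j \<in> fib (x k)"
    and l: "\<And>j. j < m \<Longrightarrow> conv (\<lambda>k. u k j) (l j)" and c: "\<And>j. j < m \<Longrightarrow> (\<lambda>k. c k j) \<longlonglongrightarrow> c' j"
  shows "conv (\<lambda>k. comb (x k) m (c k) (u k)) (comb y m c' l)"
proof -
  have ly: "l j \<in> fib y" if "j < m" for j using conv_fib[OF l[OF that] u[OF that] x] .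
  obtain U h where ch: "y \<in> U" "chart U h" using chart_exists .
  show ?thesis
  proof (rule convI[OF ch(2,1) _ x])
    show "comb (x k) m (c k) (u k) \<in> fib (x k)" for k using u by (intro comb_in)
    show "comb y m c' l \<in> fib y" using ly by (rule comb_in)
    fix i
    have "(\<lambda>k. \<Sum>j<m. c k j * crd h (u k j) i) \<longlonglongrightarrow> (\<Sum>j<m. c' j * crd h (l j) i)"
      using c conv_crd[OF ch(2,1) l ly] by (intro tendsto_intros) auto
    moreover have "eventually (\<lambda>k. x k \<in> U) sequentially"
      using x chart_open[OF ch(2)] ch(1) by (rule topological_tendstoD)
    then have "eventually (\<lambda>k. (\<Sum>j<m. c k j * crd h (u k j) i) = crd h (comb (x k) m (c k) (u k)) i) sequentially"
      by eventually_elim (use u in \<open>simp add: crd_comb[OF ch(2)]\<close>)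
    ultimately have "(\<lambda>k. crd h (comb (x k) m (c k) (u k)) i) \<longlonglongrightarrow> (\<Sum>j<m. c' j * crd h (l j) i)"
      by (rule Lim_transform_eventually)
    then show "(\<lambda>k. crd h (comb (x k) m (c k) (u k)) i) \<longlonglongrightarrow> crd h (comb y m c' l) i"
      using ly by (simp add: crd_comb[OF ch(2,1)])
  qed
qed

end

section \<open>Finsler norms over a compact base\<close>

locale finsler_bundle = euclidean_bundle E d for E :: "('x::metric_space, 'e) vbundle" and d +
  fixes N :: "'e \<Rightarrow> real"
  assumes compact_base: "compact (UNIV :: 'x set)" and finsler: "finsler_norm E N"
begin

lemma norm_nonneg: "v \<in> fib x \<Longrightarrow> 0 \<le> N v"
  and norm_eq_0: "v \<in> fib x \<Longrightarrow> N v = 0 \<longleftrightarrow> v = vzero E x"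
  and norm_scale: "v \<in> fib x \<Longrightarrow> N (vscale E c v) = \<bar>c\<bar> * N v"
  and norm_add: "u \<in> fib x \<Longrightarrow> v \<in> fib x \<Longrightarrow> N (vadd E u v) \<le> N u + N v"
  using finsler base_UNIV by (auto simp: finsler_norm_def)

lemma norm_zero: "N (vzero E x) = 0"
  using norm_eq_0[OF vzero_in] by blast

lemma conv_norm: "conv v l \<Longrightarrow> (\<lambda>k. N (v k)) \<longlonglongrightarrow> N l"
  using continuous_map_limit[of "tot_space E" euclideanreal N v l sequentially] finsler
  by (simp add: finsler_norm_def o_def)

text \<open>Otherwise the vectors, divided by the sum \<open>m\<close> of their absolute
  coordinates, would subconverge to a vector over \<open>x\<close> with absolute coordinate sum 1
  and norm 0.\<close>

lemma bounded_crd: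
  assumes ch: "chart U h" "x \<in> U" and v: "\<And>k. v k \<in> fib (y k)" and y: "y \<longlonglongrightarrow> x"
    and C: "\<And>k. N (v k) \<le> C"
  shows "\<exists>B. eventually (\<lambda>k. \<forall>i<d. \<bar>crd h (v k) i\<bar> \<le> B) sequentially"
proof (rule ccontr)
  assume contr: "\<not> ?thesis"
  have ev: "eventually (\<lambda>k. y k \<in> U) sequentially"
    using y chart_open[OF ch(1)] ch(2) by (rule topological_tendstoD)
  define m where "m k = (\<Sum>i<d. \<bar>crd h (v k) i\<bar>)" for k
  have le_m: "\<bar>crd h (v k) i\<bar> \<le> m k" if "i < d" for i k
    unfolding m_def using that by (intro member_le_sum) auto
  have "\<exists>k\<ge>n. y k \<in> U \<and> m k > real (Suc n)" for n
  proof (rule ccontr)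
    assume "\<not> ?thesis"
    then have "eventually (\<lambda>k. y k \<in> U \<longrightarrow> m k \<le> real (Suc n)) sequentially"
      unfolding eventually_sequentially by (meson not_less)
    with ev have "eventually (\<lambda>k. \<forall>i<d. \<bar>crd h (v k) i\<bar> \<le> real (Suc n)) sequentially"
      by eventually_elim (use le_m order_trans in blast)
    then show False using contr by blast
  qed
  then obtain r where r: "\<And>n. r n \<ge> n" "\<And>n. y (r n) \<in> U" "\<And>n. m (r n) > real (Suc n)" by metis
  have rlim: "filterlim r at_top sequentially"
    using r(1) by (intro filterlim_at_top_mono[OF filterlim_ident]) auto
  define w where "w n = vscale E (1 / m (r n)) (v (r n))" for n
  have mp: "m (r n) > 0" for n using r(3)[of n] by (meson less_trans of_nat_0_less_iff zero_less_Suc)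
  have w: "w n \<in> fib (y (r n))" for n unfolding w_def by (intro vscale_in v)
  have crdw: "crd h (w n) i = crd h (v (r n)) i / m (r n)" for n i
    unfolding w_def using crd_scale[OF ch(1) r(2) v] by simp
  have sumw: "(\<Sum>i<d. \<bar>crd h (w n) i\<bar>) = 1" for n
    using mp[of n] unfolding crdw by (simp add: abs_divide sum_divide_distrib[symmetric] m_def[symmetric])
  have crdw_le: "\<bar>crd h (w n) i\<bar> \<le> 1" for n i
  proof (cases "i < d")
    case True
    then have "\<bar>crd h (w n) i\<bar> \<le> (\<Sum>i<d. \<bar>crd h (w n) i\<bar>)" by (intro member_le_sum) auto
    then show ?thesis using sumw by simp
  qed (use crd_ge[OF ch(1) r(2) w] in simp)
  obtain q g where q: "strict_mono q" and g: "\<And>i. (\<lambda>n. crd h (w (q n)) i) \<longlonglongrightarrow> g i"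
    using bounded_coordinates_subsequence[of "\<lambda>n i. crd h (w n) i" 1] crdw_le by metis
  have g0: "g i = 0" if "i \<ge> d" for i
    using g[of i] crd_ge[OF ch(1) r(2) w that] by (simp add: LIMSEQ_const_iff)
  have sg_in: "sec U h x g \<in> fib x" and sg: "crd h (sec U h x g) = g"
    using sec[OF ch, of g] g0 by auto
  have ylim: "(\<lambda>n. y (r (q n))) \<longlonglongrightarrow> x"
    using filterlim_compose[OF y filterlim_compose[OF rlim filterlim_subseq[OF q]]] .
  have cw: "conv (\<lambda>n. w (q n)) (sec U h x g)"
    by (rule convI[OF ch w ylim sg_in]) (use g sg in simp_all)
  have "(\<lambda>n. N (w (q n))) \<longlonglongrightarrow> 0"
  proof (rule Lim_null_comparison)
    show "eventually (\<lambda>n. norm (N (w (q n))) \<le> \<bar>C\<bar> * inverse (real (Suc n))) sequentially"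
    proof (intro always_eventually allI)
      fix n
      have "N (w (q n)) = N (v (r (q n))) / m (r (q n))"
        unfolding w_def using norm_scale[OF v] abs_of_pos[OF mp[of "q n"]] by simp
      also have "\<dots> \<le> \<bar>C\<bar> / real (Suc n)"
      proof (rule frac_le)
        show "N (v (r (q n))) \<le> \<bar>C\<bar>" using C[of "r (q n)"] by linarith
        have "real (Suc n) \<le> real (Suc (q n))" using seq_suble[OF q, of n] by simp
        then show "real (Suc n) \<le> m (r (q n))" using r(3)[of "q n"] by linarith
      qed auto
      finally show "norm (N (w (q n))) \<le> \<bar>C\<bar> * inverse (real (Suc n))"
        using norm_nonneg[OF w[of "q n"]] by (simp add: divide_inverse)
    qed
    show "(\<lambda>n. \<bar>C\<bar> * inverse (real (Suc n))) \<longlonglongrightarrow> 0"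
      by (rule tendsto_mult_right_zero[OF LIMSEQ_inverse_real_of_nat])
  qed
  then have "N (sec U h x g) = 0" using conv_norm[OF cw] LIMSEQ_unique by blast
  then have "sec U h x g = vzero E x" using norm_eq_0[OF sg_in] by simp
  then have "g i = 0" for i using sg crd_zero[OF ch, of i] by simp
  then have "(\<lambda>n. \<Sum>i<d. \<bar>crd h (w (q n)) i\<bar>) \<longlonglongrightarrow> (\<Sum>i<d. \<bar>0::real\<bar>)"
    using g by (intro tendsto_sum tendsto_rabs) simp
  then show False using sumw by (simp add: LIMSEQ_const_iff)
qed

text \<open>Bolzano-Weierstrass in the total space: a norm bound becomes a coordinate bound in a
  chart around the limit \<open>x\<close>, and a subsequence converges coordinatewise.\<close>

lemma bounded_subsequence:
  assumes v: "\<And>k. v k \<in> fib (y k)" and y: "y \<longlonglongrightarrow> x" and C: "\<And>k. N (v k) \<le> C"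
  obtains r l where "strict_mono r" "conv (\<lambda>k. v (r k)) l" "l \<in> fib x"
proof -
  obtain U h where ch: "x \<in> U" "chart U h" using chart_exists .
  obtain B where "eventually (\<lambda>k. \<forall>i<d. \<bar>crd h (v k) i\<bar> \<le> B) sequentially"
    using bounded_crd[OF ch(2,1) v y C] by blast
  moreover have "eventually (\<lambda>k. y k \<in> U) sequentially"
    using y chart_open[OF ch(2)] ch(1) by (rule topological_tendstoD)
  ultimately have "eventually (\<lambda>k. \<forall>i. \<bar>crd h (v k) i\<bar> \<le> \<bar>B\<bar>) sequentially"
  proof eventually_elim
    case (elim k)
    show ?case
    proof
      fix i show "\<bar>crd h (v k) i\<bar> \<le> \<bar>B\<bar>"
        using elim(1) crd_ge[OF ch(2) elim(2) v, of i] by (cases "i < d") auto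
    qed
  qed
  then obtain K where K: "\<And>k i. k \<ge> K \<Longrightarrow> \<bar>crd h (v k) i\<bar> \<le> \<bar>B\<bar>"
    unfolding eventually_sequentially by blast
  obtain r g where r: "strict_mono r" and g: "\<And>i. (\<lambda>k. crd h (v (r k + K)) i) \<longlonglongrightarrow> g i"
    using bounded_coordinates_subsequence[of "\<lambda>k i. crd h (v (k + K)) i" "\<bar>B\<bar>"] K by (metis le_add2)
  define r' where "r' k = r k + K" for k
  have r': "strict_mono r'" using r by (auto simp: r'_def strict_mono_def)
  have yl: "(\<lambda>k. y (r' k)) \<longlonglongrightarrow> x" using LIMSEQ_subseq_LIMSEQ[OF y r'] by (simp add: o_def)
  have g0: "g i = 0" if "i \<ge> d" for i
  proof -
    have "eventually (\<lambda>k. y (r' k) \<in> U) sequentially"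
      using yl chart_open[OF ch(2)] ch(1) by (rule topological_tendstoD)
    then have "eventually (\<lambda>k. crd h (v (r' k)) i = 0) sequentially"
      by eventually_elim (use crd_ge[OF ch(2) _ v that] in auto)
    then have "(\<lambda>k. crd h (v (r' k)) i) \<longlonglongrightarrow> 0" by (rule tendsto_eventually)
    then show ?thesis using g[of i] LIMSEQ_unique unfolding r'_def by blast
  qed
  have sg_in: "sec U h x g \<in> fib x" and sg: "crd h (sec U h x g) = g"
    using sec[OF ch(2,1), of g] g0 by auto
  have cv: "conv (\<lambda>k. v (r' k)) (sec U h x g)"
    by (rule convI[OF ch(2,1) v yl sg_in]) (use g sg in \<open>simp_all add: r'_def\<close>)
  show ?thesis by (rule that[OF r' cv sg_in])
qed

text \<open>The empty tuple already extracts a convergent subsequence of base points, by compactness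
  of the base; the vectors follow one at a time.\<close>

lemma bounded_tuple_subsequence:
  fixes v :: "nat \<Rightarrow> nat \<Rightarrow> 'e" and p :: nat
  assumes v: "\<And>k j. j < p \<Longrightarrow> v k j \<in> fib (y k)" and C: "\<And>k j. j < p \<Longrightarrow> N (v k j) \<le> C"
  obtains r l x where "strict_mono r" "(\<lambda>k. y (r k)) \<longlonglongrightarrow> x" "\<And>j. j < p \<Longrightarrow> conv (\<lambda>k. v (r k) j) (l j)"
    "\<And>j. j < p \<Longrightarrow> l j \<in> fib x"
proof -
  have "\<exists>r l x. strict_mono r \<and> (\<lambda>k. y (r k)) \<longlonglongrightarrow> x \<and> (\<forall>j<p. conv (\<lambda>k. v (r k) j) (l j) \<and> l j \<in> fib x)"
    using v C
  proof (induction p)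
    case 0
    obtain x r where "strict_mono r" "(y \<circ> r) \<longlonglongrightarrow> x"
      using compact_imp_seq_compact[OF compact_base] unfolding seq_compact_def by (metis UNIV_I)
    then show ?case by (auto simp: o_def)
  next
    case (Suc p)
    have "\<exists>r l x. strict_mono r \<and> (\<lambda>k. y (r k)) \<longlonglongrightarrow> x \<and> (\<forall>j<p. conv (\<lambda>k. v (r k) j) (l j) \<and> l j \<in> fib x)"
      by (rule Suc.IH) (use Suc.prems in auto)
    then obtain r l x where r: "strict_mono r" "(\<lambda>k. y (r k)) \<longlonglongrightarrow> x"
      "\<And>j. j < p \<Longrightarrow> conv (\<lambda>k. v (r k) j) (l j)" "\<And>j. j < p \<Longrightarrow> l j \<in> fib x"
      by auto
    obtain r' l' where r': "strict_mono r'" "conv (\<lambda>k. v (r (r' k)) p) l'" "l' \<in> fib x"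
      by (rule bounded_subsequence[of "\<lambda>k. v (r k) p" "\<lambda>k. y (r k)" x C]) (use Suc.prems r in auto)
    have "conv (\<lambda>k. v (r (r' k)) j) ((l(p := l')) j)" "(l(p := l')) j \<in> fib x" if "j < Suc p" for j
      using that conv_subseq[OF r(3) r'(1)] r' r(4) by (cases "j = p"; auto)+
    moreover have "strict_mono (\<lambda>k. r (r' k))" using r(1) r'(1) by (auto simp: strict_mono_def)
    moreover have "(\<lambda>k. y (r (r' k))) \<longlonglongrightarrow> x" using LIMSEQ_subseq_LIMSEQ[OF r(2) r'(1)] by (simp add: o_def)
    ultimately show ?case by blast
  qed
  then show ?thesis using that by blast
qed

lemma bounded_vector_subsequence:
  fixes v :: "nat \<Rightarrow> 'e"
  assumes v: "\<And>k. v k \<in> fib (y k)" and C: "\<And>k. N (v k) \<le> C"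
  obtains r l x where "strict_mono r" "(\<lambda>k. y (r k)) \<longlonglongrightarrow> x" "conv (\<lambda>k. v (r k)) l" "l \<in> fib x"
proof (rule bounded_tuple_subsequence[of 1 "\<lambda>k _. v k" y C])
  fix r x and l :: "nat \<Rightarrow> 'e"
  assume r: "strict_mono r" "(\<lambda>k. y (r k)) \<longlonglongrightarrow> x"
    and l: "\<And>j. j < 1 \<Longrightarrow> conv (\<lambda>k. v (r k)) (l j)" "\<And>j. j < 1 \<Longrightarrow> l j \<in> fib x"
  show ?thesis by (rule that[OF r l[of 0]]) auto
qed (use v C in auto)

text \<open>Coefficient vectors of absolute sum 1 subconverge to a nonzero limit, so the norms of
  their combinations cannot tend to 0.\<close>

lemma indep_norm_bound:
  assumes u: "indep x m u"
  obtains \<kappa> where "\<kappa> > 0" "\<And>c j. j < m \<Longrightarrow> \<kappa> * \<bar>c j\<bar> \<le> N (comb x m c u)"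
proof -
  have "\<exists>\<kappa>>0. \<forall>c. \<kappa> * (\<Sum>j<m. \<bar>c j\<bar>) \<le> N (comb x m c u)"
  proof (rule ccontr)
    assume "\<not> ?thesis"
    then have "\<exists>c. N (comb x m c u) < inverse (real (Suc n)) * (\<Sum>j<m. \<bar>c j\<bar>)" for n
      by (metis inverse_positive_iff_positive not_le of_nat_0_less_iff zero_less_Suc)
    then obtain c where c: "\<And>n. N (comb x m (c n) u) < inverse (real (Suc n)) * (\<Sum>j<m. \<bar>c n j\<bar>)" by metis
    define s where "s n = (\<Sum>j<m. \<bar>c n j\<bar>)" for n
    have cin: "comb x m c' u \<in> fib x" for c' using indep_in[OF u] by (intro comb_in)
    have sp: "s n > 0" for n
    proof -
      have "0 < inverse (real (Suc n)) * s n" using c[of n] norm_nonneg[OF cin, of "c n"] by (simp add: s_def)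
      then show ?thesis by (simp add: zero_less_mult_iff)
    qed
    define b where "b n j = (if j < m then c n j / s n else 0)" for n j
    have sb: "(\<Sum>j<m. \<bar>b n j\<bar>) = 1" for n
      using sp[of n] by (simp add: b_def abs_divide sum_divide_distrib[symmetric] s_def[symmetric])
    have bb: "\<bar>b n j\<bar> \<le> 1" for n j
    proof (cases "j < m")
      case True
      then have "\<bar>b n j\<bar> \<le> (\<Sum>j<m. \<bar>b n j\<bar>)" by (intro member_le_sum) auto
      then show ?thesis using sb by simp
    qed (simp add: b_def)
    have Nb: "N (comb x m (b n) u) \<le> inverse (real (Suc n))" for n
    proof -
      have "comb x m (b n) u = comb x m (\<lambda>j. (1 / s n) * c n j) u" by (intro comb_cong) (auto simp: b_def)
      also have "\<dots> = vscale E (1 / s n) (comb x m (c n) u)" using indep_in[OF u] by (intro comb_scale[symmetric]) auto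
      finally have "N (comb x m (b n) u) = N (comb x m (c n) u) / s n"
        using norm_scale[OF cin, of "1 / s n" "c n"] sp[of n] by simp
      also have "\<dots> \<le> inverse (real (Suc n))"
        using c[of n] sp[of n] by (simp add: s_def[symmetric] pos_divide_le_eq)
      finally show ?thesis .
    qed
    obtain q g where q: "strict_mono q" and g: "\<And>i. (\<lambda>n. b (q n) i) \<longlonglongrightarrow> g i"
      using bounded_coordinates_subsequence[of b 1] bb by metis
    have "conv (\<lambda>n. comb x m (b (q n)) u) (comb x m g u)"
      by (rule conv_comb[OF tendsto_const]) (use indep_in[OF u] g conv_const fib_tot in auto)
    then have "(\<lambda>n. N (comb x m (b (q n)) u)) \<longlonglongrightarrow> N (comb x m g u)" by (rule conv_norm)
    moreover have "(\<lambda>n. N (comb x m (b (q n)) u)) \<longlonglongrightarrow> 0"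
    proof (rule Lim_null_comparison[OF _ LIMSEQ_subseq_LIMSEQ[OF LIMSEQ_inverse_real_of_nat q]])
      show "eventually (\<lambda>n. norm (N (comb x m (b (q n)) u)) \<le> ((\<lambda>n. inverse (real (Suc n))) \<circ> q) n) sequentially"
        using Nb norm_nonneg[OF cin] by (intro always_eventually) simp
    qed
    ultimately have "N (comb x m g u) = 0" using LIMSEQ_unique by blast
    then have "\<forall>j<m. g j = 0" using norm_eq_0[OF cin] u by (auto simp: indep_def)
    then have "(\<lambda>n. \<Sum>j<m. \<bar>b (q n) j\<bar>) \<longlonglongrightarrow> (\<Sum>j<m. \<bar>0::real\<bar>)"
      using g by (intro tendsto_sum tendsto_rabs) (metis lessThan_iff)
    then show False using sb by (simp add: LIMSEQ_const_iff)
  qed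
  then obtain \<kappa> where k: "\<kappa> > 0" "\<And>c. \<kappa> * (\<Sum>j<m. \<bar>c j\<bar>) \<le> N (comb x m c u)" by blast
  have "\<kappa> * \<bar>c j\<bar> \<le> N (comb x m c u)" if "j < m" for c j
  proof -
    have "\<bar>c j\<bar> \<le> (\<Sum>j<m. \<bar>c j\<bar>)" using that by (intro member_le_sum) auto
    then have "\<kappa> * \<bar>c j\<bar> \<le> \<kappa> * (\<Sum>j<m. \<bar>c j\<bar>)" using k(1) by simp
    then show ?thesis using k(2)[of c] by linarith
  qed
  then show ?thesis using that k(1) by blast
qed

lemma indepI_norm:
  assumes "\<And>j. j < m \<Longrightarrow> u j \<in> fib x" "\<kappa> > 0" "\<And>c j. j < m \<Longrightarrow> \<kappa> * \<bar>c j\<bar> \<le> N (comb x m c u)"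
  shows "indep x m u"
  unfolding indep_def
proof (intro conjI allI impI assms(1))
  fix c j assume "comb x m c u = vzero E x" "j < m"
  then have "\<kappa> * \<bar>c j\<bar> \<le> 0" using assms(3)[of j c] norm_zero by simp
  then show "c j = 0" using assms(2) by (simp add: mult_le_0_iff)
qed

text \<open>The constant is uniform because the base is compact. Besides comparing two given norms,
  the lemma is applied to \<open>N\<close> and its pullback under \<open>\<Phi>\<close>, which
  bounds \<open>\<Phi>\<close> above and below.\<close>

lemma finsler_equivalent:
  assumes "finsler_norm E N'" obtains C where "C > 0" "\<And>v. v \<in> tot \<Longrightarrow> N' v \<le> C * N v"
proof -
  interpret N': finsler_bundle E d N' by unfold_locales (use assms compact_base in auto)
  have "\<exists>C>0. \<forall>v\<in>tot. N' v \<le> C * N v"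
  proof (rule ccontr)
    assume "\<not> ?thesis"
    then have "\<exists>v\<in>tot. N' v > real (Suc n) * N v" for n
      by (metis not_le of_nat_0_less_iff zero_less_Suc)
    then obtain v where v: "\<And>n. v n \<in> tot" "\<And>n. N' (v n) > real (Suc n) * N (v n)" by metis
    define y where "y n = bproj E (v n)" for n
    have vy: "v n \<in> fib (y n)" for n using tot_fib[OF v(1)] by (simp add: y_def)
    have pos: "N' (v n) > 0" for n using v(2)[of n] norm_nonneg[OF vy[of n]]
      by (meson mult_nonneg_nonneg of_nat_0_le_iff order.strict_trans1)
    define w where "w n = vscale E (1 / N' (v n)) (v n)" for n
    have w: "w n \<in> fib (y n)" for n unfolding w_def by (intro vscale_in vy)
    have N'w: "N' (w n) = 1" for n unfolding w_def using N'.norm_scale[OF vy] pos[of n] by simp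
    have Nw: "N (w n) \<le> inverse (real (Suc n))" for n
    proof -
      have "N (w n) = N (v n) / N' (v n)" unfolding w_def using norm_scale[OF vy] pos[of n] by simp
      also have "\<dots> \<le> inverse (real (Suc n))" using v(2)[of n] pos[of n] by (simp add: field_simps)
      finally show ?thesis .
    qed
    have Nw1: "N (w n) \<le> 1" for n
      using order_trans[OF Nw[of n], of 1] by (simp add: inverse_eq_divide)
    obtain r l x where r: "strict_mono r" "conv (\<lambda>k. w (r k)) l" "l \<in> fib x"
      by (rule bounded_vector_subsequence[OF w Nw1])
    have "(\<lambda>k. N (w (r k))) \<longlonglongrightarrow> 0"
    proof (rule Lim_null_comparison[OF _ LIMSEQ_subseq_LIMSEQ[OF LIMSEQ_inverse_real_of_nat r(1)]])
      show "eventually (\<lambda>n. norm (N (w (r n))) \<le> ((\<lambda>n. inverse (real (Suc n))) \<circ> r) n) sequentially"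
        using Nw norm_nonneg[OF w] by (intro always_eventually) simp
    qed
    then have "N l = 0" using conv_norm[OF r(2)] LIMSEQ_unique by auto
    then have "l = vzero E x" using norm_eq_0[OF r(3)] by simp
    then have "N' l = 0" using N'.norm_zero by simp
    moreover have "N' l = 1" using N'.conv_norm[OF r(2)] N'w by (simp add: LIMSEQ_const_iff)
    ultimately show False by simp
  qed
  then show ?thesis using that by blast
qed

end

section \<open>Closed families of subspaces as subbundles\<close>

context finsler_bundle
begin

lemma vadd_uminus: "v \<in> fib x \<Longrightarrow> vadd E v (vscale E (- 1) v) = vzero E x"
  by (rule fib_eqI) (auto intro!: vadd_in vscale_in vzero_in simp: crd_add crd_scale crd_zero vscale_in)

lemma continuous_crd:
  assumes ch: "chart U h"
  shows "continuous_map (subtopology (tot_space E) {v. bproj E v \<in> U}) euclideanreal (\<lambda>v. crd h v i)"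
proof -
  have "continuous_map (subtopology (tot_space E) {v. bproj E v \<in> U}) (Euclidean_space d) (snd \<circ> h)"
    using homeomorphic_imp_continuous_map[OF chart_homeo[OF ch]] continuous_map_snd
    by (rule continuous_map_compose)
  then have "continuous_map (subtopology (tot_space E) {v. bproj E v \<in> U}) (powertop_real UNIV) (snd \<circ> h)"
    unfolding Euclidean_space_def continuous_map_in_subtopology by blast
  then show ?thesis unfolding continuous_map_componentwise_UNIV by (simp add: o_def)
qed

lemma conv_closed_normalized:
  assumes v: "\<And>n. v n \<in> fib (y n)" and y: "y \<longlonglongrightarrow> x"
    and pos: "\<And>n. N (v n) > 0"
  obtains r l where "strict_mono r" "conv (\<lambda>n. vscale E (1 / N (v (r n))) (v (r n))) l" "l \<in> fib x" "N l = 1"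
proof -
  define w where "w n = vscale E (1 / N (v n)) (v n)" for n
  have w: "w n \<in> fib (y n)" for n unfolding w_def by (intro vscale_in v)
  have Nw: "N (w n) = 1" for n unfolding w_def using norm_scale[OF v] pos[of n] by simp
  obtain r l where r: "strict_mono r" "conv (\<lambda>k. w (r k)) l" "l \<in> fib x"
    by (rule bounded_subsequence[OF w y, of 1]) (auto simp: Nw)
  have "N l = 1" using conv_norm[OF r(2)] Nw by (simp add: LIMSEQ_const_iff)
  then show ?thesis using that r unfolding w_def by blast
qed

text \<open>Closedness and constant dimension replace a direct proof that the fibers vary
  continuously. Functionals \<open>lam\<close> dual to a basis of the fiber over \<open>x0\<close>
  serve as chart: closedness makes them injective on nearby fibers with a uniform bound, and
  constant dimension makes them surjective there.\<close>

lemma subbundle_from_closed: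
  assumes S: "S \<subseteq> bundle_over E Y"
    and S0: "\<And>x. x \<in> Y \<Longrightarrow> vzero E x \<in> S"
    and Sadd: "\<And>x u v. x \<in> Y \<Longrightarrow> u \<in> S \<inter> fib x \<Longrightarrow> v \<in> S \<inter> fib x \<Longrightarrow> vadd E u v \<in> S"
    and Sscale: "\<And>x c v. x \<in> Y \<Longrightarrow> v \<in> S \<inter> fib x \<Longrightarrow> vscale E c v \<in> S"
    and basis: "\<And>x. x \<in> Y \<Longrightarrow> \<exists>b. indep x k b \<and> (\<forall>j<k. b j \<in> S) \<and> (\<forall>v\<in>S \<inter> fib x. \<exists>c. v = comb x k c b)"
    and closed: "\<And>v l. (\<And>n. v n \<in> S) \<Longrightarrow> conv v l \<Longrightarrow> bproj E l \<in> Y \<Longrightarrow> l \<in> S"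
  shows "subbundle_over E Y S k"
proof -
  let ?B = "E\<lparr>base_set := Y, tot_space := subtopology (tot_space E) S\<rparr>"
  have Stot: "v \<in> tot" and SY: "bproj E v \<in> Y" if "v \<in> S" for v using S that by (auto simp: bundle_over_def)
  have Sfib: "v \<in> fib (bproj E v)" if "v \<in> S" for v using Stot[OF that] by (rule tot_fib)
  have fibB: "fiber ?B x = S \<inter> fib x" for x by (auto simp: fiber_def)
  have combS: "comb x m c u \<in> S" if "x \<in> Y" "\<And>j. j < m \<Longrightarrow> u j \<in> S \<inter> fib x" for x m c u
    using that(2)
  proof (induction m)
    case (Suc m)
    have u: "u m \<in> S \<inter> fib x" and 1: "comb x m c u \<in> S \<inter> fib x"
      using Suc by (auto intro!: comb_in)
    have 2: "vscale E (c m) (u m) \<in> S \<inter> fib x" using Sscale[OF that(1) u] u by (auto intro!: vscale_in)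
    show ?case using Sadd[OF that(1) 1 2] by simp
  qed (use S0 that(1) in simp)
  have cont: "continuous_map (subtopology (tot_space E) S) (top_of_set Y) (bproj E)"
    using vector_bundle base_UNIV SY
    by (auto simp: vector_bundle_def continuous_map_in_subtopology intro!: continuous_map_from_subtopology)
  have vs: "real_vector_space_on (S \<inter> fib x) (vadd E) (vscale E) (vzero E x)" if x: "x \<in> Y" for x
  proof -
    have "\<exists>w\<in>S \<inter> fib x. vadd E v w = vzero E x" if "v \<in> S \<inter> fib x" for v
      using vadd_uminus[of v x] Sscale[OF x that, of "-1"] vscale_in[of v x "-1"] that by blast
    then show ?thesis
      using vector_space[of x] S0[OF x] Sadd[OF x] Sscale[OF x]
      unfolding real_vector_space_on_def by (auto simp: vadd_in vscale_in vzero_in)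
  qed
  have triv: "\<exists>V \<phi>. x0 \<in> V \<and> local_trivialization ?B k V \<phi>" if x0: "x0 \<in> Y" for x0
  proof -
    obtain U h where ch: "x0 \<in> U" "chart U h" using chart_exists .
    obtain b where b: "indep x0 k b" "\<And>j. j < k \<Longrightarrow> b j \<in> S" "\<And>v. v \<in> S \<inter> fib x0 \<Longrightarrow> \<exists>c. v = comb x0 k c b"
      using basis[OF x0] by blast
    obtain A :: "nat \<Rightarrow> nat \<Rightarrow> real" where A: "\<And>j l. j < k \<Longrightarrow> l < k \<Longrightarrow> (\<Sum>i<d. A j i * crd h (b l) i) = (if j = l then 1 else 0)"
      using indep_dual[OF ch(2,1) b(1)] by blast
    define lam where "lam v j = (if j < k then \<Sum>i<d. A j i * crd h v i else 0)" for v j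
    have lam_comb: "lam (comb x m c u) j = (\<Sum>l<m. c l * lam (u l) j)"
      if "x \<in> U" "\<And>l. l < m \<Longrightarrow> u l \<in> fib x" for x m c u j
    proof (cases "j < k")
      case True
      have "lam (comb x m c u) j = (\<Sum>i<d. A j i * (\<Sum>l<m. c l * crd h (u l) i))"
        unfolding lam_def using True that by (simp add: crd_comb[OF ch(2)])
      also have "\<dots> = (\<Sum>i<d. \<Sum>l<m. c l * (A j i * crd h (u l) i))"
        unfolding sum_distrib_left by (intro sum.cong) (auto simp: mult_ac)
      also have "\<dots> = (\<Sum>l<m. \<Sum>i<d. c l * (A j i * crd h (u l) i))" by (rule sum.swap)
      also have "\<dots> = (\<Sum>l<m. c l * lam (u l) j)" unfolding lam_def using True by (simp add: sum_distrib_left)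
      finally show ?thesis .
    qed (simp add: lam_def)
    have lam_add: "lam (vadd E u v) j = lam u j + lam v j" if "x \<in> U" "u \<in> fib x" "v \<in> fib x" for x u v j
      using that by (simp add: lam_def crd_add[OF ch(2)] distrib_left sum.distrib)
    have lam_scale: "lam (vscale E c v) j = c * lam v j" if "x \<in> U" "v \<in> fib x" for x c v j
      using that by (simp add: lam_def crd_scale[OF ch(2)] sum_distrib_left mult_ac)
    have lam_zero: "lam (vzero E x) j = 0" if "x \<in> U" for x j
      using that by (simp add: lam_def crd_zero[OF ch(2)])
    have lam_conv: "(\<lambda>n. lam (v n) j) \<longlonglongrightarrow> lam l j" if "conv v l" "l \<in> fib x" "x \<in> U" for v l x j
      unfolding lam_def using conv_crd[OF ch(2) that(3,1,2)] by (auto intro!: tendsto_intros)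
    obtain e0 where e0: "e0 > 0" "ball x0 e0 \<subseteq> U" using chart_open[OF ch(2)] ch(1) openE by blast
    \<comment> \<open>Without such a bound, unit vectors of \<open>S\<close> over points tending to
      \<open>x0\<close>, on which \<open>lam\<close> tends to 0, would converge to a unit vector of
      \<open>S\<close> over \<open>x0\<close> with \<open>lam\<close> equal to 0. But over
      \<open>x0\<close> the functionals read off the coefficients in the basis
      \<open>b\<close>.\<close>
    have "\<exists>e>0. e \<le> e0 \<and> (\<forall>x\<in>Y \<inter> ball x0 e. \<forall>v\<in>S \<inter> fib x. e * N v \<le> (\<Sum>j<k. \<bar>lam v j\<bar>))"
    proof (rule ccontr)
      assume contr: "\<not> ?thesis"
      have "\<exists>v\<in>S. bproj E v \<in> ball x0 (min e0 (inverse (real (Suc n)))) \<and>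
          (\<Sum>j<k. \<bar>lam v j\<bar>) < inverse (real (Suc n)) * N v" for n
      proof -
        define e where "e = min e0 (inverse (real (Suc n)))"
        have "e > 0" "e \<le> e0" using e0 by (auto simp: e_def)
        then obtain x v where xv: "x \<in> Y" "x \<in> ball x0 e" "v \<in> S" "v \<in> fib x" "(\<Sum>j<k. \<bar>lam v j\<bar>) < e * N v"
          using contr by (metis IntE not_le)
        have "e * N v \<le> inverse (real (Suc n)) * N v"
          using norm_nonneg[OF xv(4)] by (intro mult_right_mono) (auto simp: e_def)
        then have "(\<Sum>j<k. \<bar>lam v j\<bar>) < inverse (real (Suc n)) * N v" using xv(5) by linarith
        then show ?thesis using xv(2,3) fib_proj[OF xv(4)] unfolding e_def by blast
      qed
      then obtain v where v: "\<And>n. v n \<in> S" "\<And>n. bproj E (v n) \<in> ball x0 (min e0 (inverse (real (Suc n))))"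
        "\<And>n. (\<Sum>j<k. \<bar>lam (v n) j\<bar>) < inverse (real (Suc n)) * N (v n)" by metis
      define y where "y n = bproj E (v n)" for n
      have vy: "v n \<in> fib (y n)" for n unfolding y_def by (rule Sfib[OF v(1)])
      have yU: "y n \<in> U" for n using v(2)[of n] e0(2) by (auto simp: y_def)
      have "norm (dist (y n) x0) \<le> inverse (real (Suc n))" for n
        using v(2)[of n] by (simp add: y_def dist_commute)
      then have "(\<lambda>n. dist (y n) x0) \<longlonglongrightarrow> 0"
        by (intro Lim_null_comparison[OF always_eventually LIMSEQ_inverse_real_of_nat]) blast
      then have yl: "y \<longlonglongrightarrow> x0" by (rule tendsto_dist_iff[THEN iffD2])
      have pos: "N (v n) > 0" for n
      proof -
        have "0 \<le> (\<Sum>j<k. \<bar>lam (v n) j\<bar>)" by (intro sum_nonneg) simp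
        then have "0 < inverse (real (Suc n)) * N (v n)" using v(3)[of n] by linarith
        then show ?thesis by (simp add: zero_less_mult_iff)
      qed
      obtain r l where r: "strict_mono r" and l: "conv (\<lambda>n. vscale E (1 / N (v (r n))) (v (r n))) l" "l \<in> fib x0" "N l = 1"
        by (rule conv_closed_normalized[OF vy yl pos])
      have lS: "l \<in> S"
      proof (rule closed[OF _ l(1)])
        show "vscale E (1 / N (v (r n))) (v (r n)) \<in> S" for n
          using Sscale[OF SY[OF v(1)], of "v (r n)"] v(1) Sfib[OF v(1)] by blast
        show "bproj E l \<in> Y" using fib_proj[OF l(2)] x0 by simp
      qed
      have "lam l j = 0" if "j < k" for j
      proof -
        have "(\<lambda>n. lam (vscale E (1 / N (v (r n))) (v (r n))) j) \<longlonglongrightarrow> 0"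
        proof (rule Lim_null_comparison[OF _ LIMSEQ_subseq_LIMSEQ[OF LIMSEQ_inverse_real_of_nat r]])
          show "eventually (\<lambda>n. norm (lam (vscale E (1 / N (v (r n))) (v (r n))) j) \<le> ((\<lambda>n. inverse (real (Suc n))) \<circ> r) n) sequentially"
          proof (intro always_eventually allI)
            fix n
            have "\<bar>lam (v (r n)) j\<bar> \<le> (\<Sum>j<k. \<bar>lam (v (r n)) j\<bar>)" using that by (intro member_le_sum) auto
            then have "\<bar>lam (v (r n)) j\<bar> / N (v (r n)) \<le> inverse (real (Suc (r n)))"
              using v(3)[of "r n"] pos[of "r n"] by (simp add: pos_divide_le_eq)
            then show "norm (lam (vscale E (1 / N (v (r n))) (v (r n))) j) \<le> ((\<lambda>n. inverse (real (Suc n))) \<circ> r) n"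
              using lam_scale[OF yU vy] pos[of "r n"] by (simp add: abs_mult abs_divide)
          qed
        qed
        then show ?thesis using lam_conv[OF l(1,2) ch(1)] LIMSEQ_unique by blast
      qed
      moreover obtain c where c: "l = comb x0 k c b" using b(3) lS l(2) by blast
      moreover have "lam (comb x0 k c b) j = c j" if "j < k" for j
      proof -
        have "(\<Sum>l<k. c l * lam (b l) j) = (\<Sum>l<k. if l = j then c j else 0)"
          using A that by (intro sum.cong) (auto simp: lam_def)
        then show ?thesis using that indep_in[OF b(1)] by (simp add: lam_comb[OF ch(1)])
      qed
      ultimately have "\<forall>j<k. c j = 0" by simp
      then have "l = vzero E x0" unfolding c using indep_in[OF b(1)] by (intro comb_zero) auto
      then show False using l(3) norm_zero by simp
    qed
    then obtain e where e: "e > 0" "e \<le> e0"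
      and low: "\<And>x v. x \<in> Y \<Longrightarrow> x \<in> ball x0 e \<Longrightarrow> v \<in> S \<Longrightarrow> v \<in> fib x \<Longrightarrow> e * N v \<le> (\<Sum>j<k. \<bar>lam v j\<bar>)"
      by blast
    define V where "V = Y \<inter> ball x0 e"
    have VU: "x \<in> U" if "x \<in> V" for x using that e0(2) e(2) by (auto simp: V_def)
    have inj: "v = vzero E x" if "x \<in> V" "v \<in> S" "v \<in> fib x" "\<And>j. j < k \<Longrightarrow> lam v j = 0" for x v
    proof -
      have "e * N v \<le> 0" using low[of x v] that by (auto simp: V_def)
      then have "N v = 0" using e(1) norm_nonneg[OF that(3)] by (simp add: mult_le_0_iff)
      then show ?thesis using norm_eq_0[OF that(3)] by simp
    qed
    have inj2: "u = v" if "x \<in> V" "u \<in> S" "u \<in> fib x" "v \<in> S" "v \<in> fib x" "\<And>j. j < k \<Longrightarrow> lam u j = lam v j" for x u v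
    proof -
      have x: "x \<in> Y" "x \<in> U" using that(1) VU by (auto simp: V_def)
      define w where "w = vadd E u (vscale E (-1) v)"
      have w: "w \<in> S" "w \<in> fib x" 
      proof -
        have 1: "vscale E (-1) v \<in> S \<inter> fib x" using Sscale[OF x(1)] that vscale_in by blast
        then show "w \<in> S" unfolding w_def using Sadd[OF x(1) _ 1] that by blast
        show "w \<in> fib x" unfolding w_def using 1 that by (intro vadd_in) auto
      qed
      have "w = vzero E x" using that x w by (intro inj) (auto simp: w_def lam_add lam_scale vscale_in)
      then have "crd h u i = crd h v i" for i
        using crd_zero[OF ch(2) x(2), of i] crd_add[OF ch(2) x(2) that(3) vscale_in[OF that(5)], of "-1" i]
          crd_scale[OF ch(2) x(2) that(5), of "-1" i] by (simp add: w_def)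
      then show ?thesis using crd_eqI[OF ch(2) x(2) that(3,5)] by blast
    qed
    \<comment> \<open>The images of \<open>k\<close> basis vectors together with the target
      \<open>c\<close> are \<open>k + 1\<close> vectors with \<open>k\<close> entries, hence
      dependent; by injectivity of \<open>lam\<close> the coefficient of \<open>c\<close> in the
      relation is nonzero.\<close>
    have surj: "\<exists>v\<in>S \<inter> fib x. lam v = c" if x: "x \<in> V" and c: "\<forall>j\<ge>k. c j = 0" for x c
    proof -
      have xY: "x \<in> Y" and xU: "x \<in> U" using x VU by (auto simp: V_def)
      obtain b' where b': "indep x k b'" "\<And>j. j < k \<Longrightarrow> b' j \<in> S" using basis[OF xY] by blast
      define M where "M l j = (if l < k then lam (b' l) j else c j)" for l j
      obtain s where s: "\<exists>l\<in>{..k}. s l \<noteq> 0" "\<forall>j<k. (\<Sum>l\<le>k. s l * M l j) = 0"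
        using homogeneous_system[of "{..k}" k M] by auto
      have split: "(\<Sum>l\<le>k. s l * M l j) = lam (comb x k s b') j + s k * c j" for j
        unfolding lessThan_Suc_atMost[symmetric] sum.lessThan_Suc
        using lam_comb[OF xU, of k b' s j] indep_in[OF b'(1)] by (simp add: M_def)
      have cS: "comb x k t b' \<in> S" "comb x k t b' \<in> fib x" for t
        using combS[OF xY, of k b' t] comb_in[of k b' x t] b'(2) indep_in[OF b'(1)] by auto
      have sk: "s k \<noteq> 0"
      proof
        assume 0: "s k = 0"
        have "comb x k s b' = vzero E x" using split s(2) 0 by (intro inj[OF x cS]) auto
        then have "\<forall>j<k. s j = 0" using b'(1) by (auto simp: indep_def)
        then show False using s(1) 0 by (metis atMost_iff le_neq_implies_less)
      qed
      define v where "v = vscale E (- 1 / s k) (comb x k s b')"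
      have v: "v \<in> S" "v \<in> fib x" unfolding v_def using cS Sscale[OF xY] by (auto intro: vscale_in)
      have "lam v j = c j" for j
      proof (cases "j < k")
        case True
        then have "lam (comb x k s b') j = - s k * c j" using split[of j] s(2) by simp
        then show ?thesis unfolding v_def using lam_scale[OF xU cS(2)] sk by simp
      qed (use c in \<open>auto simp: lam_def\<close>)
      then show ?thesis using v by blast
    qed
    define \<psi> where "\<psi> = (\<lambda>(x, c). SOME v. v \<in> S \<inter> fib x \<and> lam v = c)"
    have \<psi>: "\<psi> (x, c) \<in> S" "\<psi> (x, c) \<in> fib x" "lam (\<psi> (x, c)) = c" if "x \<in> V" "\<forall>j\<ge>k. c j = 0" for x c
    proof -
      have "\<exists>v. v \<in> S \<inter> fib x \<and> lam v = c" using surj[OF that] by blast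
      from someI_ex[OF this] show "\<psi> (x, c) \<in> S" "\<psi> (x, c) \<in> fib x" "lam (\<psi> (x, c)) = c"
        by (auto simp: \<psi>_def)
    qed
    define \<phi> where "\<phi> v = (bproj E v, lam v)" for v
    let ?X = "subtopology (tot_space ?B) {v. bproj ?B v \<in> V}"
    let ?C = "{c::nat \<Rightarrow> real. \<forall>i\<ge>k. c i = 0}"
    have Xeq: "?X = subtopology (tot_space E) (S \<inter> {v. bproj E v \<in> V})" by (simp add: subtopology_subtopology)
    have Xtop: "topspace ?X = {v \<in> S. bproj E v \<in> V}" using Stot by auto
    have Ck: "Euclidean_space k = top_of_set ?C"
      unfolding Euclidean_space_def euclidean_product_topology ..
    have Peq: "prod_topology (top_of_set V) (Euclidean_space k) = top_of_set (V \<times> ?C)"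
      unfolding Ck by (rule prod_topology_subtopology_eu)
    have c1: "continuous_map ?X (prod_topology (top_of_set V) (Euclidean_space k)) \<phi>"
      unfolding continuous_map_pairwise
    proof
      have "continuous_map (subtopology (tot_space E) (S \<inter> {v. bproj E v \<in> V})) euclidean (bproj E)"
        using vector_bundle base_UNIV by (auto simp: vector_bundle_def intro!: continuous_map_from_subtopology)
      then show "continuous_map ?X (top_of_set V) (fst \<circ> \<phi>)"
        unfolding Xeq by (auto simp: \<phi>_def o_def continuous_map_in_subtopology)
      have cc: "continuous_map ?X euclideanreal (\<lambda>v. crd h v i)" for i
        unfolding Xeq by (rule continuous_map_from_subtopology_mono[OF continuous_crd[OF ch(2)]]) (use VU in auto)
      have "continuous_map ?X euclideanreal (\<lambda>v. lam v j)" for j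
        unfolding lam_def by (cases "j < k") (auto intro!: continuous_map_sum continuous_map_real_mult_left cc[simplified])
      then show "continuous_map ?X (Euclidean_space k) (snd \<circ> \<phi>)"
        unfolding Euclidean_space_def continuous_map_in_subtopology continuous_map_componentwise_UNIV
        by (auto simp: \<phi>_def o_def) (simp add: lam_def)
    qed
    \<comment> \<open>Vectors with converging coordinates are bounded by \<open>low\<close>. Every
      subsequential limit belongs to \<open>S\<close> by closedness and has the prescribed
      coordinates, so injectivity identifies it with \<open>\<psi> s\<close>.\<close>
    have c2: "continuous_map (top_of_set (V \<times> ?C)) ?X \<psi>"
    proof (rule continuous_map_from_sequences)
      fix s assume s: "s \<in> V \<times> ?C"
      then show "\<psi> s \<in> topspace ?X"
        unfolding Xtop using \<psi>[of "fst s" "snd s"] by (auto simp: fiber_def)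
    next
      fix \<sigma> s assume \<sigma>: "\<And>n. \<sigma> n \<in> V \<times> ?C" and s: "s \<in> V \<times> ?C" and lim: "\<sigma> \<longlonglongrightarrow> s"
      define y where "y n = fst (\<sigma> n)" for n
      define c where "c n = snd (\<sigma> n)" for n
      define x where "x = fst s"
      define c' where "c' = snd s"
      have mem: "y n \<in> V" "\<forall>j\<ge>k. c n j = 0" for n using \<sigma>[of n] by (auto simp: y_def c_def mem_Times_iff)
      have mem': "x \<in> V" "\<forall>j\<ge>k. c' j = 0" using s by (auto simp: x_def c'_def mem_Times_iff)
      have yl: "y \<longlonglongrightarrow> x" unfolding y_def x_def using tendsto_fst[OF lim] .
      have cl: "(\<lambda>n. c n j) \<longlonglongrightarrow> c' j" for j
        unfolding c_def c'_def
        by (rule continuous_on_tendsto_compose[OF continuous_on_product_coordinates tendsto_snd[OF lim]]) auto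
      define v where "v n = \<psi> (\<sigma> n)" for n
      have sg: "\<sigma> n = (y n, c n)" for n by (simp add: y_def c_def)
      have v: "v n \<in> S" "v n \<in> fib (y n)" "lam (v n) = c n" for n
        unfolding v_def sg using \<psi>[OF mem] by blast+
      have vl: "\<psi> s \<in> S" "\<psi> s \<in> fib x" "lam (\<psi> s) = c'"
        using \<psi>[OF mem'] by (auto simp: x_def c'_def)
      have "(\<lambda>n. \<Sum>j<k. \<bar>c n j\<bar>) \<longlonglongrightarrow> (\<Sum>j<k. \<bar>c' j\<bar>)" using cl by (intro tendsto_intros)
      then have "Bseq (\<lambda>n. \<Sum>j<k. \<bar>c n j\<bar>)" by (intro convergent_imp_Bseq convergentI)
      then obtain K where K: "\<And>n. (\<Sum>j<k. \<bar>c n j\<bar>) \<le> K"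
        unfolding Bseq_def by (metis abs_le_D1 real_norm_def)
      have Nb: "N (v n) \<le> K / e" for n
      proof -
        have "e * N (v n) \<le> (\<Sum>j<k. \<bar>lam (v n) j\<bar>)" using low[OF _ _ v(1,2)] mem(1)[of n] by (auto simp: V_def)
        also have "\<dots> \<le> K" using K v(3) by simp
        finally show ?thesis using e(1) by (simp add: pos_le_divide_eq mult.commute)
      qed
      have "limitin (tot_space E) v (\<psi> s) sequentially"
      proof (rule limitin_sequentially_subseqI)
        fix r :: "nat \<Rightarrow> nat" assume r: "strict_mono r"
        have "(\<lambda>n. y (r n)) \<longlonglongrightarrow> x" using LIMSEQ_subseq_LIMSEQ[OF yl r] by (simp add: o_def)
        then obtain r' l where r': "strict_mono r'" "conv (\<lambda>n. v (r (r' n))) l" "l \<in> fib x"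
          using bounded_subsequence[of "\<lambda>n. v (r n)" "\<lambda>n. y (r n)" x "K / e"] v(2) Nb by blast
        have rr: "strict_mono (\<lambda>n. r (r' n))" using r r'(1) by (auto simp: strict_mono_def)
        have lS: "l \<in> S" by (rule closed[OF _ r'(2)]) (use v(1) fib_proj[OF r'(3)] mem'(1) in \<open>auto simp: V_def\<close>)
        have "lam l j = c' j" for j
        proof -
          have "(\<lambda>n. c (r (r' n)) j) \<longlonglongrightarrow> lam l j"
            using lam_conv[OF r'(2,3) VU[OF mem'(1)], of j] v(3) by simp
          then show ?thesis using LIMSEQ_subseq_LIMSEQ[OF cl[of j] rr] LIMSEQ_unique by (simp add: o_def) blast
        qed
        then have "l = \<psi> s" using inj2[OF mem'(1) lS r'(3) vl(1,2)] vl(3) by simp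
        then show "\<exists>r'. strict_mono r' \<and> limitin (tot_space E) (\<lambda>n. v (r (r' n))) (\<psi> s) sequentially"
          using r' by blast
      qed (use vl(1) Stot in auto)
      moreover have "\<psi> s \<in> S \<inter> {v. bproj E v \<in> V}" using vl mem'(1) fib_proj by auto
      moreover have "v n \<in> S \<inter> {v. bproj E v \<in> V}" for n using v(1) fib_proj[OF v(2)] mem(1) by auto
      ultimately show "limitin ?X (\<lambda>n. \<psi> (\<sigma> n)) (\<psi> s) sequentially"
        unfolding Xeq limitin_subtopology v_def by auto
    qed
    have "homeomorphic_maps ?X (prod_topology (top_of_set V) (Euclidean_space k)) \<phi> \<psi>"
      unfolding homeomorphic_maps_def
    proof (intro conjI c1 ballI)
      show "continuous_map (prod_topology (top_of_set V) (Euclidean_space k)) ?X \<psi>" unfolding Peq by (rule c2)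
      fix v assume "v \<in> topspace ?X"
      then have v: "v \<in> S" "v \<in> fib (bproj E v)" "bproj E v \<in> V" unfolding Xtop using Sfib by auto
      have "\<forall>j\<ge>k. lam v j = 0" by (simp add: lam_def)
      from \<psi>[OF v(3) this] show "\<psi> (\<phi> v) = v" unfolding \<phi>_def
        by (intro inj2[OF v(3) _ _ v(1,2)]) auto
    next
      fix s assume "s \<in> topspace (prod_topology (top_of_set V) (Euclidean_space k))"
      then have "fst s \<in> V" "\<forall>j\<ge>k. snd s j = 0" unfolding Peq by (auto simp: mem_Times_iff)
      from \<psi>[OF this] show "\<phi> (\<psi> s) = s" by (auto simp: \<phi>_def fib_proj)
    qed
    then have hm: "homeomorphic_map ?X (prod_topology (top_of_set V) (Euclidean_space k)) \<phi>"
      unfolding homeomorphic_map_maps by blast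
    have "local_trivialization ?B k V \<phi>"
      unfolding local_trivialization_def fibB
    proof (intro conjI ballI allI)
      show "openin (top_of_set (base_set ?B)) V" unfolding V_def by (auto simp: openin_open)
      show "homeomorphic_map ?X (prod_topology (top_of_set V) (Euclidean_space k)) \<phi>" by (rule hm)
    next
      fix x u v c i assume "x \<in> V" "u \<in> S \<inter> fib x" "v \<in> S \<inter> fib x"
      then show "fst (\<phi> u) = x" "snd (\<phi> (vadd ?B u v)) i = snd (\<phi> u) i + snd (\<phi> v) i"
        "snd (\<phi> (vscale ?B c v)) i = c * snd (\<phi> v) i"
        using VU lam_add[of x u v i] lam_scale[of x v c i] by (auto simp: \<phi>_def fib_proj)
    qed
    moreover have "x0 \<in> V" using x0 e(1) by (simp add: V_def)
    ultimately show ?thesis by blast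
  qed
  show ?thesis
    unfolding subbundle_over_def vector_bundle_def
  proof (intro conjI S ballI)
    show "continuous_map (tot_space ?B) (top_of_set (base_set ?B)) (bproj ?B)" using cont by simp
    fix x assume "x \<in> base_set ?B"
    then have x: "x \<in> Y" by simp
    show "real_vector_space_on (fiber ?B x) (vadd ?B) (vscale ?B) (vzero ?B x)"
      unfolding fibB using vs[OF x] by simp
    show "\<exists>U h. x \<in> U \<and> local_trivialization ?B k U h" by (rule triv[OF x])
  qed
qed

end

section \<open>Exterior powers\<close>

text \<open>The size of the matrices is a variable here, whereas the library determinant fixes it by a type.\<close>

definition leibniz_det :: "nat \<Rightarrow> (nat \<Rightarrow> nat \<Rightarrow> real) \<Rightarrow> real" where
  "leibniz_det p M = (\<Sum>\<pi> | \<pi> permutes {..<p}. of_int (sign \<pi>) * (\<Prod>a<p. M a (\<pi> a)))"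

lemma leibniz_det_cong:
  assumes "\<And>a b. a < p \<Longrightarrow> b < p \<Longrightarrow> M a b = M' a b" shows "leibniz_det p M = leibniz_det p M'"
  unfolding leibniz_det_def
proof (intro sum.cong refl arg_cong2[where f = "(*)"] prod.cong)
  fix \<pi> a assume "\<pi> \<in> {\<pi>. \<pi> permutes {..<p}}" "a \<in> {..<p}"
  then have "a < p" "\<pi> a < p" using permutes_in_image[of \<pi> "{..<p}" a] by auto
  then show "M a (\<pi> a) = M' a (\<pi> a)" using assms by blast
qed

lemma leibniz_prod_row:
  fixes r :: "nat \<Rightarrow> real" and M :: "nat \<Rightarrow> nat \<Rightarrow> real" and i p :: nat
  assumes "i < p"
  shows "(\<Prod>a<p. (M(i := r)) a (\<pi> a)) = r (\<pi> i) * (\<Prod>a\<in>{..<p} - {i}. M a (\<pi> a))"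
proof -
  have "(\<Prod>a<p. (M(i := r)) a (\<pi> a)) = (M(i := r)) i (\<pi> i) * (\<Prod>a\<in>{..<p} - {i}. (M(i := r)) a (\<pi> a))"
    using assms by (intro prod.remove) auto
  also have "(\<Prod>a\<in>{..<p} - {i}. (M(i := r)) a (\<pi> a)) = (\<Prod>a\<in>{..<p} - {i}. M a (\<pi> a))"
    by (intro prod.cong) auto
  finally show ?thesis by simp
qed

lemma leibniz_det_row_add:
  assumes "i < p"
  shows "leibniz_det p (M(i := \<lambda>b. r b + s b)) = leibniz_det p (M(i := r)) + leibniz_det p (M(i := s))"
  unfolding leibniz_det_def leibniz_prod_row[OF assms] sum.distrib[symmetric]
  by (intro sum.cong) (auto simp: algebra_simps)

lemma leibniz_det_row_scale:
  assumes "i < p"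
  shows "leibniz_det p (M(i := \<lambda>b. c * r b)) = c * leibniz_det p (M(i := r))"
  unfolding leibniz_det_def leibniz_prod_row[OF assms] sum_distrib_left
  by (intro sum.cong) (auto simp: algebra_simps)

text \<open>Composing each permutation with the transposition of \<open>i\<close> and
  \<open>j\<close> changes the sign but not the product, as the two rows agree; hence the
  determinant equals its negative.\<close>

lemma leibniz_det_equal_rows:
  assumes ij: "i < p" "j < p" "i \<noteq> j" and eq: "M i = M j"
  shows "leibniz_det p M = 0"
proof -
  let ?P = "{\<pi>. \<pi> permutes {..<p}}"
  let ?\<tau> = "Transposition.transpose i j"
  have \<tau>: "?\<tau> permutes {..<p}" using ij by (intro permutes_swap_id) auto
  have s\<tau>: "sign ?\<tau> = - 1" using ij(3) by (simp add: sign_swap_id)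
  have M\<tau>: "M (?\<tau> a) = M a" for a using eq by (auto simp: Transposition.transpose_def)
  have "leibniz_det p M = (\<Sum>\<pi>\<in>?P. of_int (sign (\<pi> \<circ> ?\<tau>)) * (\<Prod>a<p. M a ((\<pi> \<circ> ?\<tau>) a)))"
    unfolding leibniz_det_def
    by (rule sum.reindex_bij_witness[where i = "\<lambda>\<pi>. \<pi> \<circ> ?\<tau>" and j = "\<lambda>\<pi>. \<pi> \<circ> ?\<tau>"])
      (auto simp: comp_assoc intro: permutes_compose[OF \<tau>])
  also have "\<dots> = (\<Sum>\<pi>\<in>?P. - (of_int (sign \<pi>) * (\<Prod>a<p. M a (\<pi> a))))"
  proof (rule sum.cong[OF refl])
    fix \<pi> assume "\<pi> \<in> ?P"
    then have perm: "permutation \<pi>" using permutation_permutes by blast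
    have pt: "permutation ?\<tau>" by (rule permutation_swap_id)
    have "(\<Prod>a<p. M a ((\<pi> \<circ> ?\<tau>) a)) = (\<Prod>a<p. M (?\<tau> a) (\<pi> (?\<tau> (?\<tau> a))))"
      by (subst prod.permute[OF \<tau>]) (simp add: o_def)
    also have "\<dots> = (\<Prod>a<p. M a (\<pi> a))" by (simp add: M\<tau>)
    finally show "of_int (sign (\<pi> \<circ> ?\<tau>)) * (\<Prod>a<p. M a ((\<pi> \<circ> ?\<tau>) a)) = - (of_int (sign \<pi>) * (\<Prod>a<p. M a (\<pi> a)))"
      using sign_compose[OF perm pt] s\<tau> by simp
  qed
  also have "\<dots> = - leibniz_det p M" unfolding leibniz_det_def by (rule sum_negf)
  finally show ?thesis by simp
qed

lemma leibniz_det_zero_row: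
  assumes "a < p" "\<And>b. b < p \<Longrightarrow> M a b = 0" shows "leibniz_det p M = 0"
  unfolding leibniz_det_def
proof (intro sum.neutral ballI)
  fix \<pi> assume "\<pi> \<in> {\<pi>. \<pi> permutes {..<p}}"
  then have "\<pi> a < p" using permutes_in_image[of \<pi> "{..<p}" a] assms(1) by auto
  then have "(\<Prod>a<p. M a (\<pi> a)) = 0" using assms by (intro prod_zero) auto
  then show "of_int (sign \<pi>) * (\<Prod>a<p. M a (\<pi> a)) = 0" by simp
qed

lemma leibniz_det_identity:
  assumes "\<And>a b. a < p \<Longrightarrow> b < p \<Longrightarrow> M a b = (if a = b then 1 else 0)" shows "leibniz_det p M = 1"
proof -
  have "leibniz_det p M = (\<Sum>\<pi>\<in>{id}. of_int (sign \<pi>) * (\<Prod>a<p. M a (\<pi> a)))"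
    unfolding leibniz_det_def
  proof (rule sum.mono_neutral_right)
    show "finite {\<pi>. \<pi> permutes {..<p}}" by (rule finite_permutations) simp
    show "\<forall>\<pi>\<in>{\<pi>. \<pi> permutes {..<p}} - {id}. of_int (sign \<pi>) * (\<Prod>a<p. M a (\<pi> a)) = 0"
    proof
      fix \<pi> assume \<pi>: "\<pi> \<in> {\<pi>. \<pi> permutes {..<p}} - {id}"
      then obtain a where a: "\<pi> a \<noteq> a" by (metis DiffD2 eq_id_iff singletonI)
      then have "a < p" using \<pi> by (auto simp: permutes_def)
      moreover have "\<pi> a < p" using \<pi> calculation permutes_in_image[of \<pi> "{..<p}" a] by auto
      ultimately have "(\<Prod>a<p. M a (\<pi> a)) = 0" using a assms by (intro prod_zero bexI[of _ a]) auto
      then show "of_int (sign \<pi>) * (\<Prod>a<p. M a (\<pi> a)) = 0" by simp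
    qed
  qed (auto simp: permutes_id)
  also have "\<dots> = 1" using assms by (simp add: sign_id)
  finally show ?thesis .
qed

lemma tendsto_leibniz_det:
  assumes "\<And>a b. a < p \<Longrightarrow> b < p \<Longrightarrow> ((\<lambda>n. M n a b) \<longlongrightarrow> M' a b) F"
  shows "((\<lambda>n. leibniz_det p (M n)) \<longlongrightarrow> leibniz_det p M') F"
  unfolding leibniz_det_def
proof (intro tendsto_intros)
  fix \<pi> a assume "\<pi> \<in> {\<pi>. \<pi> permutes {..<p}}" "a \<in> {..<p}"
  then have "a < p" "\<pi> a < p" using permutes_in_image[of \<pi> "{..<p}" a] by auto
  then show "((\<lambda>n. M n a (\<pi> a)) \<longlongrightarrow> M' a (\<pi> a)) F" by (rule assms)
qed

section \<open>Alternating forms and their expansion in a frame\<close>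

context euclidean_bundle
begin

lemma tuple_update: "us \<in> fiber_tuples E p x \<Longrightarrow> a \<in> fib x \<Longrightarrow> us[i := a] \<in> fiber_tuples E p x"
  using set_update_subset_insert[of us i a] by (auto simp: fiber_tuples_def)

lemma tuple_nth: "us \<in> fiber_tuples E p x \<Longrightarrow> i < p \<Longrightarrow> us ! i \<in> fib x"
  using nth_mem[of i us] by (auto simp: fiber_tuples_def)

lemma tuple_map: "(\<And>j. j < p \<Longrightarrow> u j \<in> fib x) \<Longrightarrow> map u [0..<p] \<in> fiber_tuples E p x"
  by (auto simp: fiber_tuples_def)

text \<open>The wedge product of the functionals \<open>\<Lambda> 0\<close>, ...,
  \<open>\<Lambda> (p - 1)\<close>. Such determinants are the alternating forms that separate
  elements of the exterior power.\<close>

definition det_form :: "'x \<Rightarrow> nat \<Rightarrow> (nat \<Rightarrow> 'e \<Rightarrow> real) \<Rightarrow> 'e list \<Rightarrow> real" where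
  "det_form x p \<Lambda> us = (if us \<in> fiber_tuples E p x then leibniz_det p (\<lambda>a b. \<Lambda> b (us ! a)) else 0)"

lemma det_form_alt:
  assumes add: "\<And>b u v. b < p \<Longrightarrow> u \<in> fib x \<Longrightarrow> v \<in> fib x \<Longrightarrow> \<Lambda> b (vadd E u v) = \<Lambda> b u + \<Lambda> b v"
    and scale: "\<And>b c v. b < p \<Longrightarrow> v \<in> fib x \<Longrightarrow> \<Lambda> b (vscale E c v) = c * \<Lambda> b v"
  shows "det_form x p \<Lambda> \<in> alt_forms E p x"
  unfolding alt_forms_def mem_Collect_eq
proof (intro conjI ballI allI impI)
  fix us i a b assume us: "us \<in> fiber_tuples E p x" and i: "i < p" and ab: "a \<in> fib x" "b \<in> fib x"
  have len: "length us = p" using us by (simp add: fiber_tuples_def)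
  let ?M = "\<lambda>a b. \<Lambda> b (us ! a)"
  have upd: "det_form x p \<Lambda> (us[i := w]) = leibniz_det p (?M(i := \<lambda>b. \<Lambda> b w))" if "w \<in> fib x" for w
    using tuple_update[OF us that] len i unfolding det_form_def
    by (auto intro!: leibniz_det_cong simp: nth_list_update)
  have "leibniz_det p (?M(i := \<lambda>b'. \<Lambda> b' (vadd E a b))) = leibniz_det p (?M(i := \<lambda>b'. \<Lambda> b' a + \<Lambda> b' b))"
    using add ab by (intro leibniz_det_cong) auto
  then show "det_form x p \<Lambda> (us[i := vadd E a b]) = det_form x p \<Lambda> (us[i := a]) + det_form x p \<Lambda> (us[i := b])"
    using ab upd[OF vadd_in[OF ab]] upd leibniz_det_row_add[OF i] by simp
next
  fix us i c a assume us: "us \<in> fiber_tuples E p x" and i: "i < p" and ab: "a \<in> fib x"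
  have len: "length us = p" using us by (simp add: fiber_tuples_def)
  let ?M = "\<lambda>a b. \<Lambda> b (us ! a)"
  have upd: "det_form x p \<Lambda> (us[i := w]) = leibniz_det p (?M(i := \<lambda>b. \<Lambda> b w))" if "w \<in> fib x" for w
    using tuple_update[OF us that] len i unfolding det_form_def
    by (auto intro!: leibniz_det_cong simp: nth_list_update)
  have "leibniz_det p (?M(i := \<lambda>b'. \<Lambda> b' (vscale E c a))) = leibniz_det p (?M(i := \<lambda>b'. c * \<Lambda> b' a))"
    using scale ab by (intro leibniz_det_cong) auto
  then show "det_form x p \<Lambda> (us[i := vscale E c a]) = c * det_form x p \<Lambda> (us[i := a])"
    using ab upd[OF vscale_in[OF ab]] upd leibniz_det_row_scale[OF i] by simp
next
  fix us assume us: "us \<in> fiber_tuples E p x" and "\<not> distinct us"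
  then obtain i j where "i < p" "j < p" "i \<noteq> j" "us ! i = us ! j"
    by (auto simp: distinct_conv_nth fiber_tuples_def)
  then show "det_form x p \<Lambda> us = 0" using us unfolding det_form_def
    by (auto intro!: leibniz_det_equal_rows[of i p j])
qed (simp add: det_form_def)

lemma alt_add: "\<omega> \<in> alt_forms E p x \<Longrightarrow> us \<in> fiber_tuples E p x \<Longrightarrow> i < p \<Longrightarrow> a \<in> fib x \<Longrightarrow> b \<in> fib x \<Longrightarrow>
    \<omega> (us[i := vadd E a b]) = \<omega> (us[i := a]) + \<omega> (us[i := b])"
  and alt_scale: "\<omega> \<in> alt_forms E p x \<Longrightarrow> us \<in> fiber_tuples E p x \<Longrightarrow> i < p \<Longrightarrow> a \<in> fib x \<Longrightarrow>
    \<omega> (us[i := vscale E c a]) = c * \<omega> (us[i := a])"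
  and alt_repeat: "\<omega> \<in> alt_forms E p x \<Longrightarrow> us \<in> fiber_tuples E p x \<Longrightarrow> \<not> distinct us \<Longrightarrow> \<omega> us = 0"
  unfolding alt_forms_def by blast+

lemma vscale_0: "v \<in> fib x \<Longrightarrow> vscale E 0 v = vzero E x"
  by (rule fib_eqI) (auto intro!: vscale_in vzero_in simp: crd_scale crd_zero)

lemma alt_comb:
  assumes \<omega>: "\<omega> \<in> alt_forms E p x" and us: "us \<in> fiber_tuples E p x" and i: "i < p"
    and u: "\<And>j. j < k \<Longrightarrow> u j \<in> fib x"
  shows "\<omega> (us[i := comb x k c u]) = (\<Sum>j<k. c j * \<omega> (us[i := u j]))"
  using u
proof (induction k)
  case 0
  show ?case using alt_scale[OF \<omega> us i vzero_in, of 0] by (simp add: vscale_0[OF vzero_in])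
next
  case (Suc k)
  then show ?case
    using alt_add[OF \<omega> us i, of "comb x k c u" "vscale E (c k) (u k)"] alt_scale[OF \<omega> us i, of "u k" "c k"]
    by (simp add: comb_in vscale_in)
qed

text \<open>A form that vanishes on repeated entries is expanded with \<open>a + b\<close> in both
  places. Adjacent places suffice, since they are all that sorting uses.\<close>

lemma alt_swap:
  assumes \<omega>: "\<omega> \<in> alt_forms E p x" and us: "pre @ a # b # post \<in> fiber_tuples E p x"
  shows "\<omega> (pre @ a # b # post) = - \<omega> (pre @ b # a # post)"
proof -
  let ?i = "length pre"
  have len: "?i < p" "Suc ?i < p" using us by (auto simp: fiber_tuples_def)
  have ab: "a \<in> fib x" "b \<in> fib x" using us by (auto simp: fiber_tuples_def)
  define W where "W u v = pre @ u # v # post" for u v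
  have W: "W u v \<in> fiber_tuples E p x" if "u \<in> fib x" "v \<in> fib x" for u v
    using us that by (auto simp: fiber_tuples_def W_def)
  have u1: "(W u v)[?i := w] = W w v" for u v w by (simp add: W_def)
  have u2: "(W u v)[Suc ?i := w] = W u w" for u v w by (simp add: W_def list_update_append)
  have add1: "\<omega> (W (vadd E u u') v) = \<omega> (W u v) + \<omega> (W u' v)" if "u \<in> fib x" "u' \<in> fib x" "v \<in> fib x" for u u' v
    using alt_add[OF \<omega> W[OF that(1,3)] len(1) that(1,2)] unfolding u1 .
  have add2: "\<omega> (W u (vadd E v v')) = \<omega> (W u v) + \<omega> (W u v')" if "u \<in> fib x" "v \<in> fib x" "v' \<in> fib x" for u v v'
    using alt_add[OF \<omega> W[OF that(1,2)] len(2) that(2,3)] unfolding u2 .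
  have rep: "\<omega> (W u u) = 0" if "u \<in> fib x" for u
    by (rule alt_repeat[OF \<omega> W[OF that that]]) (simp add: W_def)
  have s: "vadd E a b \<in> fib x" using ab by (rule vadd_in)
  have "0 = \<omega> (W (vadd E a b) (vadd E a b))" using rep[OF s] by simp
  also have "\<dots> = \<omega> (W a b) + \<omega> (W b a)"
    using ab by (simp add: add1[OF ab s] add2 rep)
  finally show ?thesis by (simp add: W_def)
qed

definition frame_tuple :: "'x set \<Rightarrow> ('e \<Rightarrow> 'x \<times> (nat \<Rightarrow> real)) \<Rightarrow> 'x \<Rightarrow> nat set \<Rightarrow> 'e list" where
  "frame_tuple U h x I = map (\<lambda>i. frame E U h i x) (sorted_list_of_set I)"

text \<open>The Pluecker coordinate of the tuple at \<open>I\<close>: the determinant formed by the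
  columns \<open>I\<close> of its coordinate matrix.\<close>

definition minor :: "('e \<Rightarrow> 'x \<times> (nat \<Rightarrow> real)) \<Rightarrow> nat \<Rightarrow> nat set \<Rightarrow> 'e list \<Rightarrow> real" where
  "minor h p I us = leibniz_det p (\<lambda>a b. crd h (us ! a) (sorted_list_of_set I ! b))"

definition dual_form :: "('e \<Rightarrow> 'x \<times> (nat \<Rightarrow> real)) \<Rightarrow> 'x \<Rightarrow> nat \<Rightarrow> nat set \<Rightarrow> 'e list \<Rightarrow> real" where
  "dual_form h x p I = det_form x p (\<lambda>b v. crd h v (sorted_list_of_set I ! b))"

lemma dual_form_eq: "us \<in> fiber_tuples E p x \<Longrightarrow> dual_form h x p I us = minor h p I us"
  by (simp add: dual_form_def det_form_def minor_def)

lemma dual_form_alt: "chart U h \<Longrightarrow> x \<in> U \<Longrightarrow> dual_form h x p I \<in> alt_forms E p x"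
  unfolding dual_form_def by (rule det_form_alt) (auto simp: crd_add crd_scale)

lemma index_sets:
  assumes "I \<in> index_sets d p"
  shows index_finite: "finite I" and index_length: "length (sorted_list_of_set I) = p"
    and index_less: "i \<in> set (sorted_list_of_set I) \<Longrightarrow> i < d"
    and index_nth: "b < p \<Longrightarrow> sorted_list_of_set I ! b < d"
proof -
  show f: "finite I" using assms finite_subset[of I "{..<d}"] by (auto simp: index_sets_def)
  show l: "length (sorted_list_of_set I) = p" using assms f by (auto simp: index_sets_def)
  show s: "i \<in> set (sorted_list_of_set I) \<Longrightarrow> i < d" for i using assms f by (auto simp: index_sets_def)
  show "b < p \<Longrightarrow> sorted_list_of_set I ! b < d" using l s nth_mem by metis
qed

lemma finite_index_sets: "finite (index_sets d p)"
  unfolding index_sets_def by (rule finite_subset[of _ "Pow {..<d}"]) auto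

lemma frame_tuple_in: "chart U h \<Longrightarrow> x \<in> U \<Longrightarrow> I \<in> index_sets d p \<Longrightarrow> frame_tuple U h x I \<in> fiber_tuples E p x"
  using index_length index_less frame_in by (auto simp: fiber_tuples_def frame_tuple_def)

lemma minor_frame_tuple:
  assumes ch: "chart U h" "x \<in> U" and I: "I \<in> index_sets d p" and J: "J \<in> index_sets d p"
  shows "minor h p J (frame_tuple U h x I) = (if I = J then 1 else 0)"
proof -
  let ?s = "sorted_list_of_set"
  have eq: "crd h (frame_tuple U h x I ! a) (?s J ! b) = (if ?s J ! b = ?s I ! a then 1 else 0)" if "a < p" "b < p" for a b
    using that index_length[OF I] index_nth[OF I] by (simp add: frame_tuple_def crd_frame[OF ch])
  show ?thesis
  proof (cases "I = J")
    case True
    have "?s J ! b = ?s I ! a \<longleftrightarrow> a = b" if "a < p" "b < p" for a b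
      using that True index_length[OF I] by (auto simp: nth_eq_iff_index_eq)
    then show ?thesis unfolding minor_def using True eq by (auto intro!: leibniz_det_identity)
  next
    case False
    have "\<not> I \<subseteq> J" using False I J card_subset_eq[OF index_finite[OF J], of I] by (auto simp: index_sets_def)
    then obtain i where i: "i \<in> I" "i \<notin> J" by blast
    then obtain a where a: "a < p" "?s I ! a = i"
      using index_finite[OF I] index_length[OF I] by (metis in_set_conv_nth set_sorted_list_of_set)
    have "?s J ! b \<noteq> i" if "b < p" for b
      using that i(2) index_finite[OF J] index_length[OF J] by (metis nth_mem set_sorted_list_of_set)
    then have "minor h p J (frame_tuple U h x I) = 0" unfolding minor_def
      using a eq by (intro leibniz_det_zero_row[OF a(1)]) auto
    then show ?thesis using False by simp
  qed
qed

text \<open>One choice of coefficients has to serve all forms \<open>\<omega>\<close>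
  simultaneously; only then can testing with the dual forms identify the coefficients.\<close>

definition spanned :: "'x set \<Rightarrow> ('e \<Rightarrow> 'x \<times> (nat \<Rightarrow> real)) \<Rightarrow> nat \<Rightarrow> 'x \<Rightarrow> 'e list \<Rightarrow> bool" where
  "spanned U h p x us \<longleftrightarrow> (\<exists>a. \<forall>\<omega>\<in>alt_forms E p x. \<omega> us = (\<Sum>I\<in>index_sets d p. a I * \<omega> (frame_tuple U h x I)))"

text \<open>Multilinearity reduces to tuples of frame vectors, swaps sort their indices, and
  repeated indices give zero. Signs and coefficients are not tracked in this reduction: evaluation
  at the dual forms shows afterwards that the coefficients must be the minors.\<close>

lemma frame_expansion:
  assumes ch: "chart U h" "x \<in> U" and us: "us \<in> fiber_tuples E p x" and \<omega>: "\<omega> \<in> alt_forms E p x"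
  shows "\<omega> us = (\<Sum>I\<in>index_sets d p. minor h p I us * \<omega> (frame_tuple U h x I))"
proof -
  let ?e = "\<lambda>i. frame E U h i x"
  let ?P = "spanned U h p x"
  have e_in: "map ?e fs \<in> fiber_tuples E p x" if "length fs = p" "set fs \<subseteq> {..<d}" for fs
    using that frame_in[OF ch] by (auto simp: fiber_tuples_def)
  have swap_step: "?P (map ?e (pre @ i # j # post))"
    if P: "?P (map ?e (pre @ j # i # post))" and l: "length (pre @ i # j # post) = p" "set (pre @ i # j # post) \<subseteq> {..<d}"
    for pre i j post
  proof -
    obtain a where a: "\<And>\<omega>. \<omega> \<in> alt_forms E p x \<Longrightarrow>
        \<omega> (map ?e (pre @ j # i # post)) = (\<Sum>I\<in>index_sets d p. a I * \<omega> (frame_tuple U h x I))"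
      using P by (auto simp: spanned_def)
    show ?thesis unfolding spanned_def
    proof (intro exI[of _ "\<lambda>I. - a I"] ballI)
      fix \<omega> assume w: "\<omega> \<in> alt_forms E p x"
      have "\<omega> (map ?e (pre @ i # j # post)) = - \<omega> (map ?e (pre @ j # i # post))"
        using alt_swap[OF w, of "map ?e pre" "?e i" "?e j" "map ?e post"] e_in[OF l] by simp
      then show "\<omega> (map ?e (pre @ i # j # post)) = (\<Sum>I\<in>index_sets d p. - a I * \<omega> (frame_tuple U h x I))"
        using a[OF w] by (simp add: sum_negf)
    qed
  qed
  \<comment> \<open>Insertion sort read backwards. The prefix \<open>pre\<close> holds the entries
    that have already been passed, so that each comparison is an adjacent swap inside a list of full
    length \<open>p\<close>.\<close>
  have ins: "?P (map ?e (pre @ i # ys))"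
    if "?P (map ?e (pre @ insort i ys))" "length (pre @ i # ys) = p" "set (pre @ i # ys) \<subseteq> {..<d}" for pre i ys
    using that
  proof (induction ys arbitrary: pre)
    case (Cons y ys)
    show ?case
    proof (cases "i \<le> y")
      case False
      have "?P (map ?e ((pre @ [y]) @ i # ys))"
        using Cons.prems False by (intro Cons.IH) auto
      then show ?thesis using Cons.prems by (intro swap_step[of pre y i ys]) auto
    qed (use Cons.prems in simp)
  qed simp
  have srt: "?P (map ?e (pre @ xs))"
    if "?P (map ?e (pre @ sort xs))" "length (pre @ xs) = p" "set (pre @ xs) \<subseteq> {..<d}" for pre xs
    using that
  proof (induction xs arbitrary: pre)
    case (Cons y xs)
    have "?P (map ?e (pre @ y # sort xs))" using Cons.prems by (intro ins[of pre y "sort xs"]) auto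
    then have "?P (map ?e ((pre @ [y]) @ xs))" using Cons.prems by (intro Cons.IH) auto
    then show ?case by simp
  qed simp
  have base: "?P (map ?e fs)" if l: "length fs = p" "set fs \<subseteq> {..<d}" for fs
  proof (cases "distinct fs")
    case False
    then have "\<not> distinct (map ?e fs)" by (auto simp: distinct_map)
    then show ?thesis unfolding spanned_def using alt_repeat e_in[OF l]
      by (intro exI[of _ "\<lambda>_. 0"]) auto
  next
    case True
    have I: "set fs \<in> index_sets d p" using l True by (auto simp: index_sets_def distinct_card)
    have "map ?e (sort fs) = frame_tuple U h x (set fs)"
      unfolding frame_tuple_def using True by (simp add: sorted_list_of_set_sort_remdups distinct_remdups_id)
    then have "?P (map ?e (sort fs))" unfolding spanned_def
      using I finite_index_sets by (intro exI[of _ "\<lambda>J. if J = set fs then 1 else 0"]) (auto simp: if_distrib[of "\<lambda>c. c * _"] cong: if_cong)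
    then show ?thesis using srt[of "[]" fs] l by simp
  qed
  \<comment> \<open>\<open>k\<close> bounds the number of leading entries that are not yet known to
    be frame vectors; the last of them is expanded in the frame.\<close>
  have Q: "?P us" if "k \<le> p" "us \<in> fiber_tuples E p x" "\<And>i. k \<le> i \<Longrightarrow> i < p \<Longrightarrow> us ! i \<in> ?e ` {..<d}" for k us
    using that
  proof (induction k arbitrary: us)
    case 0
    have len: "length us = p" using 0 by (simp add: fiber_tuples_def)
    have "\<forall>i<p. \<exists>f. f < d \<and> us ! i = ?e f" using 0 by auto
    then obtain f where f: "\<And>i. i < p \<Longrightarrow> f i < d \<and> us ! i = ?e (f i)" by metis
    have "us = map ?e (map f [0..<p])" using len f by (intro nth_equalityI) auto
    moreover have "?P (map ?e (map f [0..<p]))" using f by (intro base) auto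
    ultimately show ?case by (simp only:)
  next
    case (Suc k)
    let ?c = "crd h (us ! k)"
    have k: "k < p" using Suc.prems by simp
    have usk: "us ! k = comb x d ?c ?e" using frame_comb[OF ch tuple_nth[OF Suc.prems(2) k]] by simp
    have len: "length us = p" using Suc.prems by (simp add: fiber_tuples_def)
    have us_eq: "us = us[k := comb x d ?c ?e]" using usk by (metis list_update_id)
    have "?P (us[k := ?e j])" if "j < d" for j
    proof (rule Suc.IH)
      fix i assume i: "k \<le> i" "i < p"
      then show "us[k := ?e j] ! i \<in> ?e ` {..<d}"
        using Suc.prems(3)[of i] that len by (cases "i = k") auto
    qed (use k tuple_update[OF Suc.prems(2) frame_in[OF ch that]] in auto)
    then have "\<forall>j<d. \<exists>a. \<forall>\<omega>\<in>alt_forms E p x. \<omega> (us[k := ?e j]) = (\<Sum>I\<in>index_sets d p. a I * \<omega> (frame_tuple U h x I))"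
      by (simp add: spanned_def)
    then obtain a where a: "\<And>j \<omega>. j < d \<Longrightarrow> \<omega> \<in> alt_forms E p x \<Longrightarrow>
        \<omega> (us[k := ?e j]) = (\<Sum>I\<in>index_sets d p. a j I * \<omega> (frame_tuple U h x I))" by metis
    show ?case unfolding spanned_def
    proof (intro exI[of _ "\<lambda>I. \<Sum>j<d. ?c j * a j I"] ballI)
      fix \<omega> assume w: "\<omega> \<in> alt_forms E p x"
      have "\<omega> us = (\<Sum>j<d. ?c j * \<omega> (us[k := ?e j]))"
        using alt_comb[OF w Suc.prems(2) k, of d ?e ?c] frame_in[OF ch] us_eq by simp
      also have "\<dots> = (\<Sum>j<d. \<Sum>I\<in>index_sets d p. ?c j * a j I * \<omega> (frame_tuple U h x I))"
        using a[OF _ w] by (intro sum.cong refl) (auto simp: sum_distrib_left mult.assoc)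
      also have "\<dots> = (\<Sum>I\<in>index_sets d p. \<Sum>j<d. ?c j * a j I * \<omega> (frame_tuple U h x I))"
        by (rule sum.swap)
      finally show "\<omega> us = (\<Sum>I\<in>index_sets d p. (\<Sum>j<d. ?c j * a j I) * \<omega> (frame_tuple U h x I))"
        by (simp add: sum_distrib_right)
    qed
  qed
  have "?P us" by (rule Q[of p]) (use us in auto)
  then obtain a where a: "\<And>\<omega>. \<omega> \<in> alt_forms E p x \<Longrightarrow> \<omega> us = (\<Sum>I\<in>index_sets d p. a I * \<omega> (frame_tuple U h x I))"
    by (auto simp: spanned_def)
  have "a J = minor h p J us" if J: "J \<in> index_sets d p" for J
  proof -
    have "minor h p J us = (\<Sum>I\<in>index_sets d p. a I * minor h p J (frame_tuple U h x I))"
      using a[OF dual_form_alt[OF ch]] frame_tuple_in[OF ch] by (simp add: dual_form_eq[OF us] dual_form_eq)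
    also have "\<dots> = (\<Sum>I\<in>index_sets d p. if I = J then a J else 0)"
      using minor_frame_tuple[OF ch _ J] by (intro sum.cong) auto
    finally show ?thesis using J finite_index_sets by simp
  qed
  then show ?thesis using a[OF \<omega>] by simp
qed

end

section \<open>Topology and norms of the exterior power\<close>

lemma limitin_topology_generated_by:
  assumes l: "l \<in> \<Union>\<S>" and ev: "\<And>G. G \<in> \<S> \<Longrightarrow> l \<in> G \<Longrightarrow> eventually (\<lambda>n. f n \<in> G) F"
  shows "limitin (topology_generated_by \<S>) f l F"
  unfolding limitin_def
proof (intro conjI allI impI)
  show "l \<in> topspace (topology_generated_by \<S>)" using l by (simp add: topology_generated_by_topspace)
  fix V assume "openin (topology_generated_by \<S>) V \<and> l \<in> V"
  then have "generate_topology_on \<S> V" "l \<in> V" by (auto simp: openin_topology_generated_by_iff)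
  then show "eventually (\<lambda>n. f n \<in> V) F"
  proof (induction V)
    case (Int a b) then show ?case by (auto intro: eventually_conj)
  next
    case (UN K)
    then obtain k where k: "k \<in> K" "l \<in> k" by auto
    then have "eventually (\<lambda>n. f n \<in> k) F" using UN by blast
    then show ?case by eventually_elim (use k in auto)
  qed (use ev in auto)
qed

lemma limitin_offset_rev:
  assumes "limitin X (\<lambda>n. f (n + k)) l sequentially" shows "limitin X f l sequentially"
  unfolding limitin_def
proof (intro conjI allI impI)
  show "l \<in> topspace X" using assms by (rule limitin_topspace)
  fix V assume "openin X V \<and> l \<in> V"
  then have "eventually (\<lambda>n. f (n + k) \<in> V) sequentially" using assms by (auto simp: limitin_def)
  then show "eventually (\<lambda>n. f n \<in> V) sequentially"
    by (rule eventually_sequentially_seg[where P = "\<lambda>n. f n \<in> V", THEN iffD1])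
qed

context finsler_bundle
begin

definition wedge_comb :: "'x set \<Rightarrow> ('e \<Rightarrow> 'x \<times> (nat \<Rightarrow> real)) \<Rightarrow> nat \<Rightarrow> 'x \<Rightarrow> (nat set \<Rightarrow> real) \<Rightarrow> ('e list \<Rightarrow> real) \<Rightarrow> real" where
  "wedge_comb U h p x c = (\<lambda>\<omega>. \<Sum>I\<in>index_sets d p. c I * wedge E p x (frame_tuple U h x I) \<omega>)"

lemma ext_chart_eq: "ext_chart E d p U h (x, c) = (x, wedge_comb U h p x c)"
  by (simp add: ext_chart_def wedge_comb_def frame_tuple_def)

lemma wedge_comb_cong: "(\<And>I. I \<in> index_sets d p \<Longrightarrow> c I = c' I) \<Longrightarrow> wedge_comb U h p x c = wedge_comb U h p x c'"
  by (simp add: wedge_comb_def)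

lemma wedge_expansion:
  assumes ch: "chart U h" "x \<in> U" and us: "us \<in> fiber_tuples E p x"
  shows "wedge E p x us = wedge_comb U h p x (\<lambda>I. minor h p I us)"
proof
  fix \<omega>
  show "wedge E p x us \<omega> = wedge_comb U h p x (\<lambda>I. minor h p I us) \<omega>"
    using frame_expansion[OF ch us, of \<omega>] by (simp add: wedge_def wedge_comb_def)
qed

lemma ext_power_sum:
  assumes "finite S" "\<And>i. i \<in> S \<Longrightarrow> us i \<in> fiber_tuples E p x"
  shows "(\<lambda>\<omega>. \<Sum>i\<in>S. c i * wedge E p x (us i) \<omega>) \<in> ext_power E p x"
proof -
  obtain g where g: "bij_betw g {..<card S} S"
    using ex_bij_betw_nat_finite[OF assms(1)] by (auto simp: atLeast0LessThan)
  have "(\<lambda>\<omega>. \<Sum>i\<in>S. c i * wedge E p x (us i) \<omega>) = (\<lambda>\<omega>. \<Sum>j<card S. (c \<circ> g) j * wedge E p x ((us \<circ> g) j) \<omega>)"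
    by (rule ext, subst sum.reindex_bij_betw[OF g, symmetric]) simp
  moreover have "(us \<circ> g) j \<in> fiber_tuples E p x" if "j < card S" for j
    using assms(2) bij_betwE[OF g] that by auto
  ultimately show ?thesis unfolding ext_power_def by blast
qed

lemma wedge_in_ext_power: "us \<in> fiber_tuples E p x \<Longrightarrow> wedge E p x us \<in> ext_power E p x"
  using ext_power_sum[of "{()}" "\<lambda>_. us" p x "\<lambda>_. 1"] by simp

lemma wedge_comb_in:
  assumes ch: "chart U h" "x \<in> U" shows "wedge_comb U h p x c \<in> ext_power E p x"
  unfolding wedge_comb_def using frame_tuple_in[OF ch] finite_index_sets by (intro ext_power_sum) auto

lemma wedge_comb_dual:
  assumes ch: "chart U h" "x \<in> U" and J: "J \<in> index_sets d p"
  shows "wedge_comb U h p x c (dual_form h x p J) = c J"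
proof -
  have "wedge_comb U h p x c (dual_form h x p J) = (\<Sum>I\<in>index_sets d p. if I = J then c J else 0)"
    unfolding wedge_comb_def wedge_def
    using dual_form_alt[OF ch] minor_frame_tuple[OF ch _ J] frame_tuple_in[OF ch]
    by (intro sum.cong) (auto simp: dual_form_eq)
  then show ?thesis using J finite_index_sets by simp
qed

lemma wedge_dual:
  assumes ch: "chart U h" "x \<in> U" and us: "us \<in> fiber_tuples E p x"
  shows "wedge E p x us (dual_form h x p J) = minor h p J us"
  using dual_form_alt[OF ch] us by (simp add: wedge_def dual_form_eq)

lemma ext_power_expansion:
  assumes ch: "chart U h" "x \<in> U" and \<xi>: "\<xi> \<in> ext_power E p x"
  shows "\<xi> = wedge_comb U h p x (\<lambda>I. \<xi> (dual_form h x p I))"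
proof
  fix \<omega>
  obtain m c u where u: "\<And>j. j < m \<Longrightarrow> u j \<in> fiber_tuples E p x"
    and eq: "\<xi> = (\<lambda>\<omega>. \<Sum>j<(m::nat). c j * wedge E p x (u j) \<omega>)"
    using \<xi> unfolding ext_power_def by blast
  have d: "\<xi> (dual_form h x p I) = (\<Sum>j<m. c j * minor h p I (u j))" for I
    unfolding eq using wedge_dual[OF ch u] by simp
  have "\<xi> \<omega> = (\<Sum>j<m. c j * (\<Sum>I\<in>index_sets d p. minor h p I (u j) * wedge E p x (frame_tuple U h x I) \<omega>))"
    unfolding eq using wedge_expansion[OF ch u] by (simp add: wedge_comb_def)
  also have "\<dots> = (\<Sum>j<m. \<Sum>I\<in>index_sets d p. c j * minor h p I (u j) * wedge E p x (frame_tuple U h x I) \<omega>)"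
    by (simp add: sum_distrib_left mult.assoc)
  also have "\<dots> = (\<Sum>I\<in>index_sets d p. \<Sum>j<m. c j * minor h p I (u j) * wedge E p x (frame_tuple U h x I) \<omega>)"
    by (rule sum.swap)
  also have "\<dots> = wedge_comb U h p x (\<lambda>I. \<xi> (dual_form h x p I)) \<omega>"
    unfolding wedge_comb_def d by (simp add: sum_distrib_right)
  finally show "\<xi> \<omega> = wedge_comb U h p x (\<lambda>I. \<xi> (dual_form h x p I)) \<omega>" .
qed

abbreviation ext :: "nat \<Rightarrow> ('x, 'x \<times> (('e list \<Rightarrow> real) \<Rightarrow> real)) vbundle" where "ext p \<equiv> ext_bundle E d p"

lemma ext_simps [simp]:
  "base_set (ext p) = UNIV" "bproj (ext p) = fst" "vzero (ext p) x = (x, \<lambda>\<omega>. 0)"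
  "vscale (ext p) c (x, \<xi>) = (x, \<lambda>\<omega>. c * \<xi> \<omega>)" "vadd (ext p) (x, \<xi>) (y, \<eta>) = (x, \<lambda>\<omega>. \<xi> \<omega> + \<eta> \<omega>)"
  by (simp_all add: ext_bundle_def base_UNIV)

abbreviation coord_top where "coord_top U p \<equiv> prod_topology (top_of_set U) (powertop_real (index_sets d p))"
abbreviation ext_gens where "ext_gens p \<equiv> {ext_chart E d p U h ` W | U h W.
             local_trivialization E d U h \<and> openin (coord_top U p) W}"

lemma ext_tot: "tot_space (ext p) = subtopology (topology_generated_by (ext_gens p)) {(x, \<xi>). \<xi> \<in> ext_power E p x}"
  by (simp add: ext_bundle_def base_UNIV)

lemma ext_in_gens:
  assumes ch: "chart U h" "x \<in> U" and \<xi>: "\<xi> \<in> ext_power E p x"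
  shows "\<exists>c. (x, c) \<in> topspace (coord_top U p) \<and> (x, \<xi>) = ext_chart E d p U h (x, c)"
proof -
  define c where "c = restrict (\<lambda>I. \<xi> (dual_form h x p I)) (index_sets d p)"
  have "wedge_comb U h p x c = wedge_comb U h p x (\<lambda>I. \<xi> (dual_form h x p I))"
    by (rule wedge_comb_cong) (simp add: c_def)
  then have "(x, \<xi>) = ext_chart E d p U h (x, c)"
    using ext_power_expansion[OF ch \<xi>] by (simp add: ext_chart_eq)
  moreover have "(x, c) \<in> topspace (coord_top U p)" using ch(2) by (auto simp: c_def)
  ultimately show ?thesis by blast
qed

lemma ext_topspace: "topspace (tot_space (ext p)) = {(x, \<xi>). \<xi> \<in> ext_power E p x}"
proof -
  have "(x, \<xi>) \<in> \<Union>(ext_gens p)" if \<xi>: "\<xi> \<in> ext_power E p x" for x \<xi>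
  proof -
    obtain U h where ch: "x \<in> U" "chart U h" using chart_exists .
    obtain c where "(x, c) \<in> topspace (coord_top U p)" "(x, \<xi>) = ext_chart E d p U h (x, c)"
      using ext_in_gens[OF ch(2,1) \<xi>] by blast
    then have "(x, \<xi>) \<in> ext_chart E d p U h ` topspace (coord_top U p)" by blast
    moreover have "ext_chart E d p U h ` topspace (coord_top U p) \<in> ext_gens p"
      using ch(2) openin_topspace by blast
    ultimately show ?thesis by blast
  qed
  then show ?thesis unfolding ext_tot topspace_subtopology topology_generated_by_topspace by auto
qed

lemma ext_fiber: "fiber (ext p) x = {(x, \<xi>) |\<xi>. \<xi> \<in> ext_power E p x}"
  by (auto simp: fiber_def ext_topspace)

lemma conv_minor:
  assumes ch: "chart U h" "x \<in> U" and l: "\<And>j. j < p \<Longrightarrow> conv (\<lambda>n. u n j) (l j)" "\<And>j. j < p \<Longrightarrow> l j \<in> fib x"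
  shows "(\<lambda>n. minor h p I (map (u n) [0..<p])) \<longlonglongrightarrow> minor h p I (map l [0..<p])"
  unfolding minor_def
proof (rule tendsto_leibniz_det)
  fix a b assume "a < p" "b < p"
  then show "(\<lambda>n. crd h (map (u n) [0..<p] ! a) (sorted_list_of_set I ! b))
      \<longlonglongrightarrow> crd h (map l [0..<p] ! a) (sorted_list_of_set I ! b)"
    using conv_crd[OF ch l(1) l(2)] by simp
qed

lemma conv_frame:
  assumes ch: "chart U h" "x \<in> U" and y: "y \<longlonglongrightarrow> x" "\<And>n. y n \<in> U" and i: "i < d"
  shows "conv (\<lambda>n. frame E U h i (y n)) (frame E U h i x)"
  unfolding frame_sec by (rule conv_sec[OF ch y]) (use i in auto)

lemma conv_minor_frame:
  assumes ch: "chart U h" "x \<in> U" and ch': "chart U' h'" "x \<in> U'" and y: "y \<longlonglongrightarrow> x" "\<And>n. y n \<in> U"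
    and I: "I \<in> index_sets d p"
  shows "(\<lambda>n. minor h' p J (frame_tuple U h (y n) I)) \<longlonglongrightarrow> minor h' p J (frame_tuple U h x I)"
proof -
  have eq: "frame_tuple U h z I = map (\<lambda>j. frame E U h (sorted_list_of_set I ! j) z) [0..<p]" for z
    unfolding frame_tuple_def using index_length[OF I] by (intro nth_equalityI) auto
  show ?thesis unfolding eq
    by (rule conv_minor[OF ch']) (use conv_frame[OF ch y] frame_in[OF ch] index_nth[OF I] in auto)
qed

text \<open>The topology is generated by the images of all charts, so convergence of coefficients in
  one chart has to be carried to every other. The transition coefficients are minors of one frame
  read in the other chart, and these depend continuously on the base point.\<close>

lemma ext_conv:
  assumes ch: "chart U h" "x \<in> U" and y: "y \<longlonglongrightarrow> x" "\<And>n. y n \<in> U"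
    and c: "\<And>I. I \<in> index_sets d p \<Longrightarrow> (\<lambda>n. c n I) \<longlonglongrightarrow> c' I"
  shows "limitin (tot_space (ext p)) (\<lambda>n. (y n, wedge_comb U h p (y n) (c n))) (x, wedge_comb U h p x c') sequentially"
  unfolding ext_tot limitin_subtopology
proof (intro conjI)
  show "(x, wedge_comb U h p x c') \<in> {(x, \<xi>). \<xi> \<in> ext_power E p x}" using wedge_comb_in[OF ch] by simp
  show "eventually (\<lambda>n. (y n, wedge_comb U h p (y n) (c n)) \<in> {(x, \<xi>). \<xi> \<in> ext_power E p x}) sequentially"
    using wedge_comb_in[OF ch(1) y(2)] by simp
  show "limitin (topology_generated_by (ext_gens p)) (\<lambda>n. (y n, wedge_comb U h p (y n) (c n))) (x, wedge_comb U h p x c') sequentially"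
  proof (rule limitin_topology_generated_by)
    have "(x, wedge_comb U h p x c') \<in> topspace (tot_space (ext p))" using wedge_comb_in[OF ch] by (simp add: ext_topspace)
    then show "(x, wedge_comb U h p x c') \<in> \<Union>(ext_gens p)"
      unfolding ext_tot topspace_subtopology topology_generated_by_topspace by blast
  next
    fix G assume "G \<in> ext_gens p" and inG: "(x, wedge_comb U h p x c') \<in> G"
    then obtain U' h' W where ch': "chart U' h'" and W: "openin (coord_top U' p) W" and G: "G = ext_chart E d p U' h' ` W"
      by blast
    obtain b where b: "(x, b) \<in> W" "wedge_comb U h p x c' = wedge_comb U' h' p x b"
      using inG unfolding G by (auto simp: ext_chart_eq)
    have xU': "x \<in> U'" and bext: "b \<in> extensional (index_sets d p)"
      using openin_subset[OF W] b(1) by (auto simp: PiE_def)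
    have bJ: "b J = (\<Sum>I\<in>index_sets d p. c' I * minor h' p J (frame_tuple U h x I))" if J: "J \<in> index_sets d p" for J
    proof -
      have "b J = wedge_comb U h p x c' (dual_form h' x p J)"
        unfolding b(2) using wedge_comb_dual[OF ch' xU' J] by simp
      then show ?thesis unfolding wedge_comb_def using wedge_dual[OF ch' xU'] frame_tuple_in[OF ch] by simp
    qed
    \<comment> \<open>The coefficients in the second chart, restricted because the points of the
      product space are extensional functions.\<close>
    define bn where "bn n = restrict (\<lambda>J. \<Sum>I\<in>index_sets d p. c n I * minor h' p J (frame_tuple U h (y n) I)) (index_sets d p)" for n
    have evU: "eventually (\<lambda>n. y n \<in> U') sequentially"
      using y(1) chart_open[OF ch'] xU' by (rule topological_tendstoD)
    have eq: "wedge_comb U h p (y n) (c n) = wedge_comb U' h' p (y n) (bn n)" if yU': "y n \<in> U'" for n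
    proof -
      have "wedge_comb U h p (y n) (c n) = wedge_comb U' h' p (y n) (\<lambda>J. wedge_comb U h p (y n) (c n) (dual_form h' (y n) p J))"
        by (rule ext_power_expansion[OF ch' yU' wedge_comb_in[OF ch(1) y(2)]])
      also have "\<dots> = wedge_comb U' h' p (y n) (bn n)"
      proof (rule wedge_comb_cong)
        fix J assume "J \<in> index_sets d p"
        then show "wedge_comb U h p (y n) (c n) (dual_form h' (y n) p J) = bn n J"
          unfolding bn_def wedge_comb_def using wedge_dual[OF ch' yU'] frame_tuple_in[OF ch(1) y(2)] by simp
      qed
      finally show ?thesis .
    qed
    have "limitin (coord_top U' p) (\<lambda>n. (y n, bn n)) (x, b) sequentially"
      unfolding limitin_pairwise
    proof
      show "limitin (top_of_set U') (fst \<circ> (\<lambda>n. (y n, bn n))) (fst (x, b)) sequentially"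
        using evU y(1) xU' by (simp add: limitin_subtopology o_def)
      have "(\<lambda>n. bn n J) \<longlonglongrightarrow> b J" if J: "J \<in> index_sets d p" for J
        unfolding bn_def bJ[OF J] using J c conv_minor_frame[OF ch ch' xU' y] by (auto intro!: tendsto_sum tendsto_mult)
      then show "limitin (powertop_real (index_sets d p)) (snd \<circ> (\<lambda>n. (y n, bn n))) (snd (x, b)) sequentially"
        unfolding limitin_componentwise using bext by (auto simp: o_def bn_def)
    qed
    then have "eventually (\<lambda>n. (y n, bn n) \<in> W) sequentially" using W b(1) by (auto simp: limitin_def)
    with evU show "eventually (\<lambda>n. (y n, wedge_comb U h p (y n) (c n)) \<in> G) sequentially"
    proof eventually_elim
      case (elim n)
      then have "(y n, wedge_comb U h p (y n) (c n)) = ext_chart E d p U' h' (y n, bn n)"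
        using eq by (simp add: ext_chart_eq)
      then show ?case unfolding G using elim(2) by blast
    qed
  qed
qed

lemma wedge_conv:
  assumes y: "y \<longlonglongrightarrow> x" and u: "\<And>n j. j < p \<Longrightarrow> u n j \<in> fib (y n)"
    and l: "\<And>j. j < p \<Longrightarrow> conv (\<lambda>n. u n j) (l j)"
  shows "limitin (tot_space (ext p)) (\<lambda>n. (y n, wedge E p (y n) (map (u n) [0..<p]))) (x, wedge E p x (map l [0..<p])) sequentially"
proof -
  obtain U h where ch: "x \<in> U" "chart U h" using chart_exists .
  have lx: "l j \<in> fib x" if "j < p" for j using conv_fib[OF l[OF that] u[OF that] y] .
  have "eventually (\<lambda>n. y n \<in> U) sequentially"
    using y chart_open[OF ch(2)] ch(1) by (rule topological_tendstoD)
  then obtain K where K: "\<And>n. n \<ge> K \<Longrightarrow> y n \<in> U" unfolding eventually_sequentially by blast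
  have sK: "strict_mono (\<lambda>n. n + K)" by (simp add: strict_mono_def)
  have yK: "(\<lambda>n. y (n + K)) \<longlonglongrightarrow> x" using LIMSEQ_subseq_LIMSEQ[OF y sK] by (simp add: o_def)
  have "limitin (tot_space (ext p)) (\<lambda>n. (y (n + K), wedge_comb U h p (y (n + K)) (\<lambda>I. minor h p I (map (u (n + K)) [0..<p]))))
     (x, wedge_comb U h p x (\<lambda>I. minor h p I (map l [0..<p]))) sequentially"
    using conv_minor[OF ch(2,1) conv_subseq[OF l sK] lx] K by (intro ext_conv[OF ch(2,1) yK]) auto
  then have "limitin (tot_space (ext p)) (\<lambda>n. (y (n + K), wedge E p (y (n + K)) (map (u (n + K)) [0..<p]))) (x, wedge E p x (map l [0..<p])) sequentially"
    using wedge_expansion[OF ch(2) K tuple_map[OF u]] wedge_expansion[OF ch(2,1) tuple_map[OF lx]] by simp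
  then show ?thesis by (rule limitin_offset_rev)
qed

text \<open>Existence is what gives meaning to the norm that \<open>top_exponent\<close> selects on
  the exterior power by \<open>SOME\<close>. The norm is a sum over finitely many charts of absolute
  coordinate sums, each weighted by a bump function.\<close>

lemma ext_finsler_exists: "\<exists>N'. finsler_norm (ext p) N'"
proof -
  have "\<exists>U h r. chart U h \<and> r > 0 \<and> cball x r \<subseteq> U" for x
    using chart_exists[of x] chart_open open_contains_cball by metis
  then obtain U h r where Uhr: "\<And>x. chart (U x) (h x)" "\<And>x. r x > (0::real)" "\<And>x. cball x (r x) \<subseteq> U x" by metis
  obtain Z where Z: "finite Z" "UNIV \<subseteq> (\<Union>z\<in>Z. ball z (r z))"
    using compactE_image[OF compact_base, of UNIV "\<lambda>z. ball z (r z)"] Uhr(2)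
    by (metis (no_types, lifting) UN_I UNIV_I centre_in_ball open_ball subsetI)
  \<comment> \<open>The weight is supported in the closed ball of radius \<open>r z\<close>, which
    lies in \<open>U z\<close>; thus the coordinates of the chart at \<open>z\<close> count only
    where they are meaningful.\<close>
  define \<rho> where "\<rho> z y = max 0 (r z - dist z y)" for z y
  have \<rho>0: "\<rho> z y \<ge> 0" for z y by (simp add: \<rho>_def)
  have \<rho>U: "y \<in> U z" if "\<rho> z y \<noteq> 0" for z y
    using that Uhr(3)[of z] by (auto simp: \<rho>_def max_def split: if_splits)
  define M where "M \<zeta> = (\<Sum>z\<in>Z. \<rho> z (fst \<zeta>) * (\<Sum>J\<in>index_sets d p. \<bar>snd \<zeta> (dual_form (h z) (fst \<zeta>) p J)\<bar>))" for \<zeta>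
  have Mchart: "M (ext_chart E d p V g (y, c)) =
      (\<Sum>z\<in>Z. \<Sum>J\<in>index_sets d p. \<bar>\<Sum>I\<in>index_sets d p. c I * (\<rho> z y * minor (h z) p J (frame_tuple V g y I))\<bar>)"
    if ch: "chart V g" "y \<in> V" for V g y c
  proof -
    have "\<rho> z y * \<bar>wedge_comb V g p y c (dual_form (h z) y p J)\<bar> =
        \<bar>\<Sum>I\<in>index_sets d p. c I * (\<rho> z y * minor (h z) p J (frame_tuple V g y I))\<bar>" for z J
    proof (cases "\<rho> z y = 0")
      case False
      have "wedge_comb V g p y c (dual_form (h z) y p J) = (\<Sum>I\<in>index_sets d p. c I * minor (h z) p J (frame_tuple V g y I))"
        unfolding wedge_comb_def using wedge_dual[OF Uhr(1) \<rho>U[OF False]] frame_tuple_in[OF ch] by simp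
      then have "\<rho> z y * \<bar>wedge_comb V g p y c (dual_form (h z) y p J)\<bar> =
          \<bar>\<rho> z y * (\<Sum>I\<in>index_sets d p. c I * minor (h z) p J (frame_tuple V g y I))\<bar>"
        using \<rho>0[of z y] by (simp add: abs_mult)
      then show ?thesis by (simp add: sum_distrib_left mult_ac)
    qed simp
    then show ?thesis unfolding M_def ext_chart_eq by (simp add: sum_distrib_left)
  qed
  have kcont: "continuous_on V (\<lambda>y. \<rho> z y * minor (h z) p J (frame_tuple V g y I))"
    if ch: "chart V g" and I: "I \<in> index_sets d p" for V g z J I
    unfolding continuous_on_sequentially
  proof (intro allI ballI impI)
    fix y x assume x: "x \<in> V" and y: "(\<forall>n. y n \<in> V) \<and> y \<longlonglongrightarrow> x"
    have \<rho>l: "(\<lambda>n. \<rho> z (y n)) \<longlonglongrightarrow> \<rho> z x" unfolding \<rho>_def using y by (intro tendsto_intros) auto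
    show "((\<lambda>y. \<rho> z y * minor (h z) p J (frame_tuple V g y I)) \<circ> y) \<longlonglongrightarrow> \<rho> z x * minor (h z) p J (frame_tuple V g x I)"
    proof (cases "x \<in> U z")
      case True
      then show ?thesis
        using tendsto_mult[OF \<rho>l conv_minor_frame[OF ch x Uhr(1) True _ _ I]] y by (simp add: o_def)
    next
      \<comment> \<open>A point outside \<open>U z\<close> has distance greater than
        \<open>r z\<close> from \<open>z\<close>, so the weighted term is zero at all nearby
        points.\<close>
      case False
      then have far: "dist z x > r z" using Uhr(3)[of z] by force
      have "(\<lambda>n. dist z (y n)) \<longlonglongrightarrow> dist z x" using y by (intro tendsto_intros) auto
      then have "eventually (\<lambda>n. dist z (y n) > r z) sequentially" using far by (rule order_tendstoD(1))
      then have "eventually (\<lambda>n. ((\<lambda>y. \<rho> z y * minor (h z) p J (frame_tuple V g y I)) \<circ> y) n = 0) sequentially"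
        by eventually_elim (simp add: \<rho>_def)
      then show ?thesis using far by (intro tendsto_eventually) (simp add: \<rho>_def)
    qed
  qed
  have ccont: "continuous_map (coord_top V p) euclideanreal (\<lambda>q. M (ext_chart E d p V g q))" if ch: "chart V g" for V g
  proof -
    have trm: "continuous_map (coord_top V p) euclideanreal
        (\<lambda>q. snd q I * (\<rho> z (fst q) * minor (h z) p J (frame_tuple V g (fst q) I)))"
      if I: "I \<in> index_sets d p" for z J I
    proof (rule continuous_map_real_mult)
      show "continuous_map (coord_top V p) euclideanreal (\<lambda>q. snd q I)"
        using continuous_map_compose[OF continuous_map_snd continuous_map_product_coordinates[OF I, of "\<lambda>_. euclideanreal"], of "top_of_set V"]
        by (simp add: o_def)
      have "continuous_map (top_of_set V) euclideanreal (\<lambda>y. \<rho> z y * minor (h z) p J (frame_tuple V g y I))"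
        using kcont[OF ch I] by simp
      from continuous_map_compose[OF continuous_map_fst this, of "powertop_real (index_sets d p)"]
      show "continuous_map (coord_top V p) euclideanreal (\<lambda>q. \<rho> z (fst q) * minor (h z) p J (frame_tuple V g (fst q) I))"
        by (simp add: o_def)
    qed
    have "continuous_map (coord_top V p) euclideanreal (\<lambda>q. \<Sum>z\<in>Z. \<Sum>J\<in>index_sets d p. \<bar>\<Sum>I\<in>index_sets d p.
        snd q I * (\<rho> z (fst q) * minor (h z) p J (frame_tuple V g (fst q) I))\<bar>)"
      by (intro continuous_map_sum continuous_map_real_abs Z finite_index_sets trm)
    then show ?thesis
      by (rule continuous_map_eq) (auto simp: Mchart[OF ch])
  qed
  \<comment> \<open>Continuity can be tested chart by chart, because the chart images of open sets
    are among the generators of the topology.\<close>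
  have Mcont: "continuous_map (tot_space (ext p)) euclideanreal M"
    unfolding continuous_map_def
  proof (intro conjI allI impI)
    fix O' :: "real set" assume O': "openin euclideanreal O'"
    show "openin (tot_space (ext p)) {\<zeta> \<in> topspace (tot_space (ext p)). M \<zeta> \<in> O'}"
    proof (subst openin_subopen, rule ballI)
      fix \<zeta> assume \<zeta>: "\<zeta> \<in> {\<zeta> \<in> topspace (tot_space (ext p)). M \<zeta> \<in> O'}"
      obtain x \<xi> where x\<xi>: "\<zeta> = (x, \<xi>)" "\<xi> \<in> ext_power E p x" using \<zeta> by (auto simp: ext_topspace)
      obtain V g where ch: "x \<in> V" "chart V g" using chart_exists .
      obtain c where c: "(x, c) \<in> topspace (coord_top V p)" "(x, \<xi>) = ext_chart E d p V g (x, c)"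
        using ext_in_gens[OF ch(2,1) x\<xi>(2)] by blast
      define W where "W = {q \<in> topspace (coord_top V p). M (ext_chart E d p V g q) \<in> O'}"
      have Wo: "openin (coord_top V p) W"
        unfolding W_def using openin_continuous_map_preimage[OF ccont[OF ch(2)] O'] by simp
      let ?G = "ext_chart E d p V g ` W \<inter> {(x, \<xi>). \<xi> \<in> ext_power E p x}"
      have "ext_chart E d p V g ` W \<in> ext_gens p" using ch(2) Wo by blast
      then have "openin (topology_generated_by (ext_gens p)) (ext_chart E d p V g ` W)"
        by (rule topology_generated_by_Basis)
      then have G1: "openin (tot_space (ext p)) ?G" unfolding ext_tot openin_subtopology by blast
      have "M (ext_chart E d p V g (x, c)) \<in> O'" using \<zeta> x\<xi>(1) unfolding c(2) by simp
      then have "(x, c) \<in> W" using c(1) unfolding W_def by simp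
      then have G2: "\<zeta> \<in> ?G" unfolding x\<xi>(1) using x\<xi>(2) by (auto simp: c(2)[symmetric] intro: image_eqI[where x = "(x, c)"])
      have G3: "?G \<subseteq> {\<zeta> \<in> topspace (tot_space (ext p)). M \<zeta> \<in> O'}"
        unfolding ext_topspace W_def by auto
      show "\<exists>T. openin (tot_space (ext p)) T \<and> \<zeta> \<in> T \<and> T \<subseteq> {\<zeta> \<in> topspace (tot_space (ext p)). M \<zeta> \<in> O'}"
        by (rule exI[of _ ?G], intro conjI G1 G2 G3)
    qed
  qed auto
  have Mpos: "\<xi> = (\<lambda>\<omega>. 0)" if M0: "M (x, \<xi>) = 0" and \<xi>: "\<xi> \<in> ext_power E p x" for x \<xi>
  proof -
    obtain z where "z \<in> Z" "x \<in> ball z (r z)" using Z(2) by blast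
    then have z: "z \<in> Z" "dist z x < r z" by auto
    have t0: "0 \<le> \<rho> z' x * (\<Sum>J\<in>index_sets d p. \<bar>\<xi> (dual_form (h z') x p J)\<bar>)" for z'
      using \<rho>0 by (intro mult_nonneg_nonneg sum_nonneg) auto
    have "\<rho> z x * (\<Sum>J\<in>index_sets d p. \<bar>\<xi> (dual_form (h z) x p J)\<bar>) = 0"
      using M0 z(1) sum_nonneg_eq_0_iff[OF Z(1), of "\<lambda>z'. \<rho> z' x * (\<Sum>J\<in>index_sets d p. \<bar>\<xi> (dual_form (h z') x p J)\<bar>)"] t0
      by (auto simp: M_def)
    moreover have "\<rho> z x > 0" using z(2) by (simp add: \<rho>_def)
    ultimately have "\<xi> (dual_form (h z) x p J) = 0" if "J \<in> index_sets d p" for J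
      using that sum_nonneg_eq_0_iff[OF finite_index_sets, of p "\<lambda>J. \<bar>\<xi> (dual_form (h z) x p J)\<bar>"] by simp
    then have "wedge_comb (U z) (h z) p x (\<lambda>I. \<xi> (dual_form (h z) x p I)) = (\<lambda>\<omega>. 0)"
      by (simp add: wedge_comb_def)
    moreover have "x \<in> U z" using z(2) Uhr(3)[of z] by auto
    ultimately show ?thesis using ext_power_expansion[OF Uhr(1) _ \<xi>, of z] by simp
  qed
  have Mnn: "M \<zeta> \<ge> 0" for \<zeta> unfolding M_def using \<rho>0 by (intro sum_nonneg mult_nonneg_nonneg) auto
  have M0: "M (x, \<lambda>\<omega>. 0) = 0" for x by (simp add: M_def)
  have Msc: "M (x, \<lambda>\<omega>. c * \<xi> \<omega>) = \<bar>c\<bar> * M (x, \<xi>)" for x c \<xi>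
    by (simp add: M_def abs_mult sum_distrib_left mult_ac)
  have Mad: "M (x, \<lambda>\<omega>. \<xi> \<omega> + \<eta> \<omega>) \<le> M (x, \<xi>) + M (x, \<eta>)" for x \<xi> \<eta>
    unfolding M_def sum.distrib[symmetric] fst_conv snd_conv distrib_left[symmetric]
    using \<rho>0 by (intro sum_mono mult_left_mono abs_triangle_ineq) auto
  have "finsler_norm (ext p) M"
    unfolding finsler_norm_def
  proof (intro conjI Mcont ballI allI)
    fix x v assume "v \<in> fiber (ext p) x"
    then obtain \<xi> where v: "v = (x, \<xi>)" "\<xi> \<in> ext_power E p x" by (auto simp: ext_fiber)
    show "0 \<le> M v" by (rule Mnn)
    show "(M v = 0) = (v = vzero (ext p) x)" using Mpos[of x \<xi>] M0[of x] v by auto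
    show "M (vscale (ext p) c v) = \<bar>c\<bar> * M v" for c unfolding v(1) ext_simps by (rule Msc)
    fix w assume "w \<in> fiber (ext p) x"
    then obtain \<eta> where w: "w = (x, \<eta>)" by (auto simp: ext_fiber)
    show "M (vadd (ext p) v w) \<le> M v + M w" unfolding v(1) w ext_simps by (rule Mad)
  qed
  then show ?thesis by blast
qed

end

section \<open>Cocycles and their volume growth\<close>

locale cocycle = finsler_bundle E d N for E :: "('x::metric_space, 'e) vbundle" and d N +
  fixes T :: "'x \<Rightarrow> 'x" and \<Phi> :: "'e \<Rightarrow> 'e"
  assumes automorphism: "bundle_automorphism E T \<Phi>"
begin

lemma phi_bij: "bij_betw \<Phi> (fib x) (fib (T x))"
  and phi_add: "u \<in> fib x \<Longrightarrow> v \<in> fib x \<Longrightarrow> \<Phi> (vadd E u v) = vadd E (\<Phi> u) (\<Phi> v)"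
  and phi_scale: "v \<in> fib x \<Longrightarrow> \<Phi> (vscale E c v) = vscale E c (\<Phi> v)"
  using automorphism base_UNIV unfolding bundle_automorphism_def by blast+

lemma phi_in: "v \<in> fib x \<Longrightarrow> \<Phi> v \<in> fib (T x)"
  using phi_bij by (rule bij_betwE[rule_format])

lemma phi_surj: "w \<in> fib (T x) \<Longrightarrow> \<exists>v\<in>fib x. \<Phi> v = w"
  using phi_bij[of x] by (metis bij_betw_imp_surj_on imageE)

lemma phi_inj: "u \<in> fib x \<Longrightarrow> v \<in> fib x \<Longrightarrow> \<Phi> u = \<Phi> v \<Longrightarrow> u = v"
  using bij_betw_imp_inj_on[OF phi_bij[of x]] by (auto dest: inj_onD)

lemma phi_zero: "\<Phi> (vzero E x) = vzero E (T x)"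
  using phi_scale[OF vzero_in[of x], of 0] by (simp add: vscale_0[OF vzero_in] vscale_0[OF phi_in[OF vzero_in]])

lemma phi_comb: "(\<And>j. j < k \<Longrightarrow> u j \<in> fib x) \<Longrightarrow> \<Phi> (comb x k c u) = comb (T x) k c (\<lambda>j. \<Phi> (u j))"
proof (induction k)
  case (Suc k)
  then show ?case using phi_add[OF comb_in[of k u x c] vscale_in[of "u k" x "c k"]] phi_scale[of "u k" x "c k"] by simp
qed (simp add: phi_zero)

lemma phi_tot: "v \<in> tot \<Longrightarrow> \<Phi> v \<in> tot"
  using phi_in[OF tot_fib] fib_tot by blast

lemma phi_conv: "conv v l \<Longrightarrow> conv (\<lambda>n. \<Phi> (v n)) (\<Phi> l)"
  using continuous_map_limit[of "tot_space E" "tot_space E" \<Phi> v l sequentially] automorphism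
  by (simp add: bundle_automorphism_def o_def)

lemma pullback_finsler: "finsler_norm E (\<lambda>v. N (\<Phi> v))"
  unfolding finsler_norm_def
proof (intro conjI ballI allI)
  have "continuous_map (tot_space E) euclideanreal (N \<circ> \<Phi>)"
    using automorphism finsler by (auto simp: bundle_automorphism_def finsler_norm_def intro: continuous_map_compose)
  then show "continuous_map (tot_space E) euclideanreal (\<lambda>v. N (\<Phi> v))" by (simp add: o_def)
  fix x v assume v: "v \<in> fib x"
  show "0 \<le> N (\<Phi> v)" using norm_nonneg[OF phi_in[OF v]] .
  show "(N (\<Phi> v) = 0) = (v = vzero E x)"
    using norm_eq_0[OF phi_in[OF v]] phi_inj[OF v vzero_in] phi_zero by auto
  show "N (\<Phi> (vscale E c v)) = \<bar>c\<bar> * N (\<Phi> v)" for c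
    using phi_scale[OF v] norm_scale[OF phi_in[OF v]] by simp
  fix u assume "u \<in> fib x"
  then show "N (\<Phi> (vadd E v u)) \<le> N (\<Phi> v) + N (\<Phi> u)"
    using phi_add[OF v] norm_add[OF phi_in[OF v] phi_in] by simp
qed

lemma phi_bounded: obtains B where "B > 0" "\<And>v. v \<in> tot \<Longrightarrow> N (\<Phi> v) \<le> B * N v"
  using finsler_equivalent[OF pullback_finsler] by blast

lemma phi_bounded_below: obtains B where "B > 0" "\<And>v. v \<in> tot \<Longrightarrow> N v \<le> B * N (\<Phi> v)"
proof -
  interpret P: finsler_bundle E d "\<lambda>v. N (\<Phi> v)"
    by unfold_locales (use compact_base pullback_finsler in auto)
  show ?thesis using P.finsler_equivalent[OF finsler] that by blast
qed

text \<open>Interpreting the locale at this instance transfers each fact about \<open>\<Phi>\<close>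
  to its iterates.\<close>

lemma cocycle_iterate: "cocycle E d N (T ^^ n) (\<Phi> ^^ n)"
proof
  show "bundle_automorphism E (T ^^ n) (\<Phi> ^^ n)"
  proof (induction n)
    case 0
    then show ?case by (auto simp: bundle_automorphism_def bij_betw_def)
  next
    case (Suc n)
    then interpret I: cocycle E d N "T ^^ n" "\<Phi> ^^ n" by unfold_locales
    have "continuous_map (tot_space E) (tot_space E) (\<Phi> \<circ> \<Phi> ^^ n)"
      using automorphism I.automorphism by (auto simp: bundle_automorphism_def intro: continuous_map_compose)
    moreover have "bij_betw (\<Phi> \<circ> \<Phi> ^^ n) (fib x) (fib (T ((T ^^ n) x)))" for x
      using I.phi_bij phi_bij by (rule bij_betw_trans)
    moreover have "bproj E (\<Phi> ((\<Phi> ^^ n) v)) = T ((T ^^ n) (bproj E v))" if "v \<in> tot" for v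
      using fib_proj[OF phi_in[OF I.phi_in[OF tot_fib[OF that]]]] .
    ultimately show ?case unfolding bundle_automorphism_def
      using phi_add[OF I.phi_in I.phi_in] I.phi_add phi_scale[OF I.phi_in] I.phi_scale by simp
  qed
qed

lemma iterate_in: "v \<in> fib x \<Longrightarrow> (\<Phi> ^^ n) v \<in> fib ((T ^^ n) x)"
proof -
  interpret I: cocycle E d N "T ^^ n" "\<Phi> ^^ n" by (rule cocycle_iterate)
  show "v \<in> fib x \<Longrightarrow> (\<Phi> ^^ n) v \<in> fib ((T ^^ n) x)" by (rule I.phi_in)
qed

lemma ext_map_sum:
  assumes "finite S" and u: "\<And>j. j \<in> S \<Longrightarrow> u j \<in> fiber_tuples E p x"
  shows "ext_map E p T \<Phi> (x, \<lambda>\<omega>. \<Sum>j\<in>S. c j * wedge E p x (u j) \<omega>) =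
    (T x, \<lambda>\<omega>. \<Sum>j\<in>S. c j * wedge E p (T x) (map \<Phi> (u j)) \<omega>)"
proof -
  have w: "(\<lambda>\<omega>. if \<omega> \<in> alt_forms E p (T x) then wedge E p x (u j) (form_pullback E p \<Phi> x \<omega>) else 0) =
      wedge E p (T x) (map \<Phi> (u j))" if "j \<in> S" for j
    using ext_map_wedge[OF vector_bundle automorphism _ u[OF that]] base_UNIV by (simp add: ext_map_def)
  show ?thesis
    unfolding ext_map_def prod.case
  proof (intro arg_cong2[where f = Pair] refl ext)
    fix \<omega>
    show "(if \<omega> \<in> alt_forms E p (T x) then \<Sum>j\<in>S. c j * wedge E p x (u j) (form_pullback E p \<Phi> x \<omega>) else 0) =
        (\<Sum>j\<in>S. c j * wedge E p (T x) (map \<Phi> (u j)) \<omega>)"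
      using w[THEN fun_cong, of _ \<omega>] by (auto simp: if_distrib cong: if_cong)
  qed
qed

lemma tuple_map_phi: "us \<in> fiber_tuples E p x \<Longrightarrow> map \<Phi> us \<in> fiber_tuples E p (T x)"
  using phi_in by (auto simp: fiber_tuples_def)

lemma ext_map_iterate:
  assumes "finite S" and u: "\<And>j. j \<in> S \<Longrightarrow> u j \<in> fiber_tuples E p x"
  shows "(ext_map E p T \<Phi> ^^ n) (x, \<lambda>\<omega>. \<Sum>j\<in>S. c j * wedge E p x (u j) \<omega>) =
    ((T ^^ n) x, \<lambda>\<omega>. \<Sum>j\<in>S. c j * wedge E p ((T ^^ n) x) (map (\<Phi> ^^ n) (u j)) \<omega>)"
proof (induction n)
  case (Suc n)
  interpret I: cocycle E d N "T ^^ n" "\<Phi> ^^ n" by (rule cocycle_iterate)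
  show ?case
    unfolding funpow.simps comp_def Suc
    using ext_map_sum[OF assms(1) I.tuple_map_phi[OF u]] by (simp add: comp_def)
qed simp

lemma ext_map_iterate_wedge:
  assumes "us \<in> fiber_tuples E p x"
  shows "(ext_map E p T \<Phi> ^^ n) (x, wedge E p x us) = ((T ^^ n) x, wedge E p ((T ^^ n) x) (map (\<Phi> ^^ n) us))"
  using ext_map_iterate[of "{()}" "\<lambda>_. us" p x n "\<lambda>_. 1"] assms by simp

end

section \<open>Operator norms of iterates\<close>

text \<open>The same estimates are needed for the bundle and for its exterior powers. The conditions
  \<open>bdd\<close> and \<open>ne\<close> ensure that the supremum in \<open>fiber_opnorm\<close>
  is over a bounded nonempty set, without which it would have no meaning.\<close>

locale opnorm_cocycle =
  fixes B :: "('x, 'e) vbundle" and A :: "'e \<Rightarrow> 'e" and T :: "'x \<Rightarrow> 'x" and N :: "'e \<Rightarrow> real"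
  assumes A_in: "\<And>x v. v \<in> fiber B x \<Longrightarrow> A v \<in> fiber B (T x)"
    and scale_in: "\<And>x c v. v \<in> fiber B x \<Longrightarrow> vscale B c v \<in> fiber B x"
    and A_scale: "\<And>x c v. v \<in> fiber B x \<Longrightarrow> A (vscale B c v) = vscale B c (A v)"
    and N_scale: "\<And>x c v. v \<in> fiber B x \<Longrightarrow> N (vscale B c v) = \<bar>c\<bar> * N v"
    and N_nonneg: "\<And>x v. v \<in> fiber B x \<Longrightarrow> 0 \<le> N v"
    and N_zero: "\<And>x v. v \<in> fiber B x \<Longrightarrow> N v = 0 \<Longrightarrow> N (A v) = 0"
    and bdd: "\<And>n x. \<exists>K. \<forall>v\<in>fiber B x. N v \<le> 1 \<longrightarrow> N ((A ^^ n) v) \<le> K"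
    and ne: "\<And>x. \<exists>v\<in>fiber B x. N v \<le> 1"
begin

lemma
  shows opnorm_bound: "\<And>n x v. v \<in> fiber B x \<Longrightarrow> N ((A ^^ n) v) \<le> fiber_opnorm B N (A ^^ n) x * N v"
    and opnorm_nonneg: "\<And>n x. 0 \<le> fiber_opnorm B N (A ^^ n) x"
    and opnorm_le: "\<And>n x K. (\<And>v. v \<in> fiber B x \<Longrightarrow> N v \<le> 1 \<Longrightarrow> N ((A ^^ n) v) \<le> K) \<Longrightarrow> fiber_opnorm B N (A ^^ n) x \<le> K"
    and opnorm_mult: "\<And>m n x. fiber_opnorm B N (A ^^ (m + n)) x \<le> fiber_opnorm B N (A ^^ m) x * fiber_opnorm B N (A ^^ n) ((T ^^ m) x)"
proof -
  have An_in: "(A ^^ n) v \<in> fiber B ((T ^^ n) x)" if "v \<in> fiber B x" for n x v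
    using that by (induction n) (auto intro: A_in)
  have An_scale: "(A ^^ n) (vscale B c v) = vscale B c ((A ^^ n) v)" if "v \<in> fiber B x" for n x v c
    using that by (induction n) (auto simp: A_scale[OF An_in])
  have An_zero: "N ((A ^^ n) v) = 0" if "v \<in> fiber B x" "N v = 0" for n x v
    using that by (induction n) (auto intro: N_zero[OF An_in])
  have up: "N ((A ^^ n) v) \<le> fiber_opnorm B N (A ^^ n) x" if "v \<in> fiber B x" "N v \<le> 1" for n x v
  proof -
    obtain K where "\<forall>v\<in>fiber B x. N v \<le> 1 \<longrightarrow> N ((A ^^ n) v) \<le> K" using bdd by blast
    then show ?thesis unfolding fiber_opnorm_def using that by (intro cSUP_upper bdd_aboveI2[where M = K]) auto
  qed
  show bound: "N ((A ^^ n) v) \<le> fiber_opnorm B N (A ^^ n) x * N v" if v: "v \<in> fiber B x" for n x v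
  proof (cases "N v = 0")
    case False
    then have pos: "N v > 0" using N_nonneg[OF v] by simp
    have "N (vscale B (1 / N v) v) = 1" using N_scale[OF v] pos by simp
    then have "N ((A ^^ n) (vscale B (1 / N v) v)) \<le> fiber_opnorm B N (A ^^ n) x"
      by (intro up scale_in v) simp
    then have "N ((A ^^ n) v) / N v \<le> fiber_opnorm B N (A ^^ n) x"
      using An_scale[OF v] N_scale[OF An_in[OF v]] pos by simp
    then show ?thesis using pos by (simp add: pos_divide_le_eq)
  qed (use An_zero[OF v] in simp)
  show nn: "0 \<le> fiber_opnorm B N (A ^^ n) x" for n x
  proof -
    obtain v where v: "v \<in> fiber B x" "N v \<le> 1" using ne by blast
    show ?thesis using order_trans[OF N_nonneg[OF An_in[OF v(1)]] up[OF v]] .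
  qed
  show le: "fiber_opnorm B N (A ^^ n) x \<le> K" if "\<And>v. v \<in> fiber B x \<Longrightarrow> N v \<le> 1 \<Longrightarrow> N ((A ^^ n) v) \<le> K" for n x K
    unfolding fiber_opnorm_def using that ne[of x] by (intro cSUP_least) auto
  show "fiber_opnorm B N (A ^^ (m + n)) x \<le> fiber_opnorm B N (A ^^ m) x * fiber_opnorm B N (A ^^ n) ((T ^^ m) x)" for m n x
  proof (rule le)
    fix v assume v: "v \<in> fiber B x" "N v \<le> 1"
    have "(A ^^ (m + n)) v = (A ^^ n) ((A ^^ m) v)" by (simp add: funpow_add add.commute[of m n])
    then have "N ((A ^^ (m + n)) v) \<le> fiber_opnorm B N (A ^^ n) ((T ^^ m) x) * N ((A ^^ m) v)"
      using bound[OF An_in[OF v(1)]] by simp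
    also have "\<dots> \<le> fiber_opnorm B N (A ^^ n) ((T ^^ m) x) * fiber_opnorm B N (A ^^ m) x"
      using up[OF v] nn by (intro mult_left_mono) auto
    finally show "N ((A ^^ (m + n)) v) \<le> fiber_opnorm B N (A ^^ m) x * fiber_opnorm B N (A ^^ n) ((T ^^ m) x)"
      by (simp add: mult.commute)
  qed
qed

end

section \<open>Comparison of operator norms with volumes of tuples\<close>

context finsler_bundle
begin

lemma alt_scale_all:
  assumes \<omega>: "\<omega> \<in> alt_forms E p x" and us: "us \<in> fiber_tuples E p x"
  shows "\<omega> (map (vscale E t) us) = t ^ p * \<omega> us"
proof -
  have len: "length us = p" using us by (simp add: fiber_tuples_def)
  define W where "W k = map (\<lambda>i. if i < k then vscale E t (us ! i) else us ! i) [0..<p]" for k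
  have "\<omega> (W k) = t ^ k * \<omega> us" if "k \<le> p" for k
    using that
  proof (induction k)
    case 0
    have "W 0 = us" unfolding W_def using len by (intro nth_equalityI) auto
    then show ?case by simp
  next
    case (Suc k)
    have W: "W k \<in> fiber_tuples E p x" unfolding W_def
      using tuple_nth[OF us] by (intro tuple_map) (auto intro: vscale_in)
    have "W (Suc k) = (W k)[k := vscale E t (us ! k)]" "(W k)[k := us ! k] = W k"
      unfolding W_def using Suc.prems by (intro nth_equalityI; auto simp: nth_list_update)+
    then show ?case using alt_scale[OF \<omega> W _ tuple_nth[OF us], of k k t] Suc by simp
  qed
  from this[of p] have "\<omega> (W p) = t ^ p * \<omega> us" by simp
  moreover have "W p = map (vscale E t) us" unfolding W_def using len by (intro nth_equalityI) auto
  ultimately show ?thesis by simp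
qed

text \<open>The operator norm of an exterior power involves all its elements, the volume only
  decomposable ones. A frame with vectors and coefficients bounded uniformly over the base expresses
  every element by boundedly weighted decomposables. Uniformity follows from compactness, since a
  local frame over a neighborhood of a limit point cannot fail along a whole sequence.\<close>

lemma ext_frame_bound:
  assumes N': "finsler_norm (ext p) N'"
  obtains C where "C > 0" "\<And>x. \<exists>e. (\<forall>i<d. e i \<in> fib x \<and> N (e i) \<le> C) \<and>
      (\<forall>\<xi>\<in>ext_power E p x. \<exists>c. (\<forall>I\<in>index_sets d p. \<bar>c I\<bar> \<le> C * N' (x, \<xi>)) \<and>
         \<xi> = (\<lambda>\<omega>. \<Sum>I\<in>index_sets d p. c I * wedge E p x (map e (sorted_list_of_set I)) \<omega>))"
proof -
  have N'0: "0 \<le> N' (x, \<xi>)" "N' (x, \<xi>) = 0 \<longleftrightarrow> \<xi> = (\<lambda>\<omega>. 0)" "N' (x, \<lambda>\<omega>. c * \<xi> \<omega>) = \<bar>c\<bar> * N' (x, \<xi>)"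
    if "\<xi> \<in> ext_power E p x" for x \<xi> c
  proof -
    have f: "(x, \<xi>) \<in> fiber (ext p) x" using that by (simp add: ext_fiber)
    have "(\<forall>v\<in>fiber (ext p) x. 0 \<le> N' v \<and> (N' v = 0 \<longleftrightarrow> v = vzero (ext p) x)) \<and>
        (\<forall>c. \<forall>v\<in>fiber (ext p) x. N' (vscale (ext p) c v) = \<bar>c\<bar> * N' v)"
      using N' unfolding finsler_norm_def by simp
    then have "0 \<le> N' (x, \<xi>) \<and> (N' (x, \<xi>) = 0 \<longleftrightarrow> (x, \<xi>) = vzero (ext p) x)"
      "N' (vscale (ext p) c (x, \<xi>)) = \<bar>c\<bar> * N' (x, \<xi>)" using f by blast+
    then show "0 \<le> N' (x, \<xi>)" "N' (x, \<xi>) = 0 \<longleftrightarrow> \<xi> = (\<lambda>\<omega>. 0)" "N' (x, \<lambda>\<omega>. c * \<xi> \<omega>) = \<bar>c\<bar> * N' (x, \<xi>)"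
      by simp_all
  qed
  define good where "good C x \<longleftrightarrow> (\<exists>e. (\<forall>i<d. e i \<in> fib x \<and> N (e i) \<le> C) \<and>
      (\<forall>\<xi>\<in>ext_power E p x. \<exists>c. (\<forall>I\<in>index_sets d p. \<bar>c I\<bar> \<le> C * N' (x, \<xi>)) \<and>
         \<xi> = (\<lambda>\<omega>. \<Sum>I\<in>index_sets d p. c I * wedge E p x (map e (sorted_list_of_set I)) \<omega>)))" for C x
  have "\<exists>C>0. \<forall>x. good C x"
  proof (rule ccontr)
    assume "\<not> ?thesis"
    then have "\<exists>x. \<not> good (real (Suc n)) x" for n by (metis of_nat_0_less_iff zero_less_Suc)
    then obtain X where X: "\<And>n. \<not> good (real (Suc n)) (X n)" by metis
    obtain x r where r: "strict_mono r" "(X \<circ> r) \<longlonglongrightarrow> x"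
      using compact_imp_seq_compact[OF compact_base] unfolding seq_compact_def by (metis UNIV_I)
    obtain U h where ch: "x \<in> U" "chart U h" using chart_exists .
    have "eventually (\<lambda>n. (X \<circ> r) n \<in> U) sequentially"
      using r(2) chart_open[OF ch(2)] ch(1) by (rule topological_tendstoD)
    then obtain K where K: "\<And>n. n \<ge> K \<Longrightarrow> X (r n) \<in> U" unfolding eventually_sequentially by auto
    have eb: "\<exists>B. \<forall>n. (\<Sum>i<d. N (frame E U h i (X (r (n + K))))) \<le> B"
    proof -
      have "(\<lambda>n. X (r (n + K))) \<longlonglongrightarrow> x" using LIMSEQ_ignore_initial_segment[OF r(2), of K] by (simp add: o_def)
      then have "(\<lambda>n. \<Sum>i<d. N (frame E U h i (X (r (n + K))))) \<longlonglongrightarrow> (\<Sum>i<d. N (frame E U h i x))"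
        using K by (intro tendsto_sum conv_norm conv_frame[OF ch(2,1)]) auto
      then have "Bseq (\<lambda>n. \<Sum>i<d. N (frame E U h i (X (r (n + K)))))" by (intro convergent_imp_Bseq convergentI)
      then show ?thesis unfolding Bseq_def by (metis abs_le_D1 real_norm_def)
    qed
    then obtain B where B: "\<And>n. (\<Sum>i<d. N (frame E U h i (X (r (n + K))))) \<le> B" by blast
    \<comment> \<open>The shift by \<open>L\<close> lets the frame vectors satisfy their bound along
      the sequence, so that only the coefficient bound can fail.\<close>
    obtain L where L: "real L \<ge> B" using real_arch_simple by blast
    define q where "q n = r (n + K + L)" for n
    have q: "strict_mono q" using r(1) by (auto simp: q_def strict_mono_def)
    define y where "y n = X (q n)" for n
    have yU: "y n \<in> U" for n using K[of "n + K + L"] by (simp add: y_def q_def)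
    have yl: "y \<longlonglongrightarrow> x" using LIMSEQ_ignore_initial_segment[OF r(2), of "K + L"] unfolding y_def[abs_def] q_def by (simp add: o_def add.assoc)
    have Nf: "N (frame E U h i (y n)) \<le> real (Suc (q n))" if "i < d" for i n
    proof -
      have "N (frame E U h i (y n)) \<le> (\<Sum>i<d. N (frame E U h i (y n)))"
        using that norm_nonneg[OF frame_in[OF ch(2) yU]] by (intro member_le_sum) auto
      also have "\<dots> \<le> B" using B[of "n + L"] by (simp add: y_def q_def add_ac)
      also have "\<dots> \<le> real (Suc (q n))" using L seq_suble[OF r(1), of "n + K + L"] by (simp add: q_def)
      finally show ?thesis .
    qed
    have "\<exists>\<xi>\<in>ext_power E p (y n). \<exists>I\<in>index_sets d p. \<bar>\<xi> (dual_form h (y n) p I)\<bar> > real (Suc (q n)) * N' (y n, \<xi>)" for n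
    proof (rule ccontr)
      assume neg: "\<not> ?thesis"
      have "good (real (Suc (q n))) (y n)" unfolding good_def
      proof (intro exI[of _ "\<lambda>i. frame E U h i (y n)"] conjI allI impI ballI)
        fix \<xi> assume \<xi>: "\<xi> \<in> ext_power E p (y n)"
        show "\<exists>c. (\<forall>I\<in>index_sets d p. \<bar>c I\<bar> \<le> real (Suc (q n)) * N' (y n, \<xi>)) \<and>
            \<xi> = (\<lambda>\<omega>. \<Sum>I\<in>index_sets d p. c I * wedge E p (y n) (map (\<lambda>i. frame E U h i (y n)) (sorted_list_of_set I)) \<omega>)"
          using ext_power_expansion[OF ch(2) yU \<xi>] neg \<xi>
          by (intro exI[of _ "\<lambda>I. \<xi> (dual_form h (y n) p I)"] conjI ballI)
            (auto simp: wedge_comb_def frame_tuple_def not_less)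
      qed (use Nf frame_in[OF ch(2) yU] in auto)
      then show False using X by (simp add: y_def)
    qed
    then obtain \<xi> where \<xi>: "\<And>n. \<xi> n \<in> ext_power E p (y n)"
      and big: "\<And>n. \<exists>I\<in>index_sets d p. \<bar>\<xi> n (dual_form h (y n) p I)\<bar> > real (Suc (q n)) * N' (y n, \<xi> n)" by metis
    define s where "s n = (\<Sum>I\<in>index_sets d p. \<bar>\<xi> n (dual_form h (y n) p I)\<bar>)" for n
    have s_big: "s n > real (Suc (q n)) * N' (y n, \<xi> n)" for n
    proof -
      obtain I where I: "I \<in> index_sets d p" "\<bar>\<xi> n (dual_form h (y n) p I)\<bar> > real (Suc (q n)) * N' (y n, \<xi> n)"
        using big by blast
      have "\<bar>\<xi> n (dual_form h (y n) p I)\<bar> \<le> s n"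
        unfolding s_def using I(1) finite_index_sets by (intro member_le_sum) auto
      then show ?thesis using I(2) by linarith
    qed
    have sp: "s n > 0" for n
      using s_big[of n] N'0(1)[OF \<xi>] by (meson mult_nonneg_nonneg of_nat_0_le_iff order.strict_trans1)
    define b where "b n I = \<xi> n (dual_form h (y n) p I) / s n" for n I
    have sumb: "(\<Sum>I\<in>index_sets d p. \<bar>b n I\<bar>) = 1" for n
      using sp[of n] by (simp add: b_def abs_divide sum_divide_distrib[symmetric] s_def[symmetric])
    have b1: "\<bar>b n I\<bar> \<le> 1" if "I \<in> index_sets d p" for n I
    proof -
      have "\<bar>b n I\<bar> \<le> (\<Sum>I\<in>index_sets d p. \<bar>b n I\<bar>)" using that finite_index_sets by (intro member_le_sum) auto
      then show ?thesis using sumb by simp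
    qed
    have N'b: "N' (y n, wedge_comb U h p (y n) (b n)) \<le> inverse (real (Suc (q n)))" for n
    proof -
      have "wedge_comb U h p (y n) (b n) = (\<lambda>\<omega>. (1 / s n) * wedge_comb U h p (y n) (\<lambda>I. \<xi> n (dual_form h (y n) p I)) \<omega>)"
        by (simp add: wedge_comb_def b_def sum_distrib_left mult_ac)
      also have "wedge_comb U h p (y n) (\<lambda>I. \<xi> n (dual_form h (y n) p I)) = \<xi> n"
        using ext_power_expansion[OF ch(2) yU \<xi>] by simp
      finally have "N' (y n, wedge_comb U h p (y n) (b n)) = N' (y n, \<xi> n) / s n"
        using N'0(3)[OF \<xi>, of n "1 / s n"] sp[of n] by simp
      also have "\<dots> \<le> inverse (real (Suc (q n)))"
        using s_big[of n] sp[of n] by (simp add: field_simps)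
      finally show ?thesis .
    qed
    \<comment> \<open>Enumerating the index sets turns the coefficients into sequences of reals, to
      which coordinatewise compactness applies.\<close>
    obtain g where g: "bij_betw g {..<card (index_sets d p)} (index_sets d p)"
      using ex_bij_betw_nat_finite[OF finite_index_sets] by (auto simp: atLeast0LessThan)
    define f where "f n i = (if i < card (index_sets d p) then b n (g i) else 0)" for n i
    have "\<bar>f n i\<bar> \<le> 1" for n i using b1 bij_betwE[OF g] by (auto simp: f_def)
    then obtain r' f' where r': "strict_mono r'" and f': "\<And>i. (\<lambda>n. f (r' n) i) \<longlonglongrightarrow> f' i"
      using bounded_coordinates_subsequence[of f 1] by metis
    define b' where "b' I = f' (inv_into {..<card (index_sets d p)} g I)" for I
    have bl: "(\<lambda>n. b (r' n) I) \<longlonglongrightarrow> b' I" if I: "I \<in> index_sets d p" for I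
    proof -
      have "inv_into {..<card (index_sets d p)} g I \<in> {..<card (index_sets d p)}" "g (inv_into {..<card (index_sets d p)} g I) = I"
        using g I by (metis bij_betw_imp_surj_on inv_into_into) (metis g I bij_betw_inv_into_right)
      then show ?thesis using f'[of "inv_into {..<card (index_sets d p)} g I"] by (simp add: f_def b'_def)
    qed
    have yr: "(\<lambda>n. y (r' n)) \<longlonglongrightarrow> x" using LIMSEQ_subseq_LIMSEQ[OF yl r'] by (simp add: o_def)
    have N'cont: "continuous_map (tot_space (ext p)) euclideanreal N'" using N' by (simp add: finsler_norm_def)
    have lim: "(\<lambda>n. N' (y (r' n), wedge_comb U h p (y (r' n)) (b (r' n)))) \<longlonglongrightarrow> N' (x, wedge_comb U h p x b')"
      using continuous_map_limit[OF N'cont ext_conv[OF ch(2,1) yr yU bl]] by (simp add: o_def)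
    have "(\<lambda>n. N' (y (r' n), wedge_comb U h p (y (r' n)) (b (r' n)))) \<longlonglongrightarrow> 0"
    proof (rule Lim_null_comparison[OF _ LIMSEQ_subseq_LIMSEQ[OF LIMSEQ_inverse_real_of_nat strict_mono_o[OF q r']]])
      show "eventually (\<lambda>n. norm (N' (y (r' n), wedge_comb U h p (y (r' n)) (b (r' n)))) \<le> ((\<lambda>n. inverse (real (Suc n))) \<circ> (q \<circ> r')) n) sequentially"
        using N'b N'0(1)[OF wedge_comb_in[OF ch(2) yU]] by (intro always_eventually) simp
    qed
    then have "N' (x, wedge_comb U h p x b') = 0" using lim LIMSEQ_unique by blast
    then have z: "wedge_comb U h p x b' = (\<lambda>\<omega>. 0)" using N'0(2)[OF wedge_comb_in[OF ch(2,1)]] by blast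
    have "b' I = 0" if "I \<in> index_sets d p" for I
      using wedge_comb_dual[OF ch(2,1) that, of b'] z by simp
    then have "(\<lambda>n. \<Sum>I\<in>index_sets d p. \<bar>b (r' n) I\<bar>) \<longlonglongrightarrow> (\<Sum>I\<in>index_sets d p. \<bar>0::real\<bar>)"
      using bl by (intro tendsto_sum tendsto_rabs) auto
    then show False using sumb by (simp add: LIMSEQ_const_iff)
  qed
  then show ?thesis using that unfolding good_def by blast
qed

end

lemma le_of_le_mult_one: "a \<le> B * b \<Longrightarrow> b \<le> 1 \<Longrightarrow> 0 < B \<Longrightarrow> a \<le> (B::real)"
proof -
  assume a: "a \<le> B * b" "b \<le> 1" "0 < B"
  have "B * b \<le> B * 1" using a by (intro mult_left_mono) auto
  then show ?thesis using a(1) by simp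
qed

context cocycle
begin

definition unit_tuple :: "nat \<Rightarrow> 'x \<Rightarrow> (nat \<Rightarrow> 'e) \<Rightarrow> bool" where
  "unit_tuple p x u \<longleftrightarrow> (\<forall>j<p. u j \<in> fib x \<and> N (u j) \<le> 1)"

text \<open>Below \<open>vol x u\<close> is a norm of $u_0 \wedge \dots \wedge u_{p-1}$ and \<open>f n x\<close> the operator norm of
  $\Lambda^p \Phi^n_x$; only the listed properties are used.\<close>

definition is_volume :: "nat \<Rightarrow> ('x \<Rightarrow> (nat \<Rightarrow> 'e) \<Rightarrow> real) \<Rightarrow> bool" where
  "is_volume p vol \<longleftrightarrow>
     (\<forall>x u u'. (\<forall>j<p. u j = u' j) \<longrightarrow> vol x u = vol x u') \<and>
     (\<forall>x u. (\<forall>j<p. u j \<in> fib x) \<longrightarrow> 0 \<le> vol x u) \<and>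
     (\<forall>x u. indep x p u \<longrightarrow> 0 < vol x u) \<and>
     (\<forall>x u i t. i < p \<longrightarrow> (\<forall>j<p. u j \<in> fib x) \<longrightarrow> vol x (u(i := comb x p t u)) = \<bar>t i\<bar> * vol x u) \<and>
     (\<forall>y x u l. y \<longlonglongrightarrow> x \<longrightarrow> (\<forall>n. \<forall>j<p. u n j \<in> fib (y n)) \<longrightarrow> (\<forall>j<p. conv (\<lambda>n. u n j) (l j)) \<longrightarrow>
        (\<lambda>n. vol (y n) (u n)) \<longlonglongrightarrow> vol x l)"

definition is_growth :: "nat \<Rightarrow> ('x \<Rightarrow> (nat \<Rightarrow> 'e) \<Rightarrow> real) \<Rightarrow> (nat \<Rightarrow> 'x \<Rightarrow> real) \<Rightarrow> real \<Rightarrow> bool" where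
  "is_growth p vol f C \<longleftrightarrow> 0 < C \<and>
     (\<forall>n x u. unit_tuple p x u \<longrightarrow> vol ((T ^^ n) x) (\<lambda>j. (\<Phi> ^^ n) (u j)) \<le> C * f n x) \<and>
     (\<forall>n x. \<exists>u. unit_tuple p x u \<and> f n x \<le> C * vol ((T ^^ n) x) (\<lambda>j. (\<Phi> ^^ n) (u j))) \<and>
     (\<forall>m n x. f (m + n) x \<le> f m x * f n ((T ^^ m) x)) \<and>
     (\<forall>x. 1 \<le> f 0 x)"

lemma volume_cong: "is_volume p vol \<Longrightarrow> (\<And>j. j < p \<Longrightarrow> u j = u' j) \<Longrightarrow> vol x u = vol x u'"
  unfolding is_volume_def by blast

lemma volume_pos: "is_volume p vol \<Longrightarrow> indep x p u \<Longrightarrow> 0 < vol x u"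
  and volume_replace: "is_volume p vol \<Longrightarrow> i < p \<Longrightarrow> (\<And>j. j < p \<Longrightarrow> u j \<in> fib x) \<Longrightarrow>
    vol x (u(i := comb x p t u)) = \<bar>t i\<bar> * vol x u"
  by (simp_all add: is_volume_def)

lemma volume_conv:
  assumes "is_volume p vol" "y \<longlonglongrightarrow> x" "\<And>n j. j < p \<Longrightarrow> u n j \<in> fib (y n)" "\<And>j. j < p \<Longrightarrow> conv (\<lambda>n. u n j) (l j)"
  shows "(\<lambda>n. vol (y n) (u n)) \<longlonglongrightarrow> vol x l"
proof -
  have "\<forall>y x u l. y \<longlonglongrightarrow> x \<longrightarrow> (\<forall>n. \<forall>j<p. u n j \<in> fib (y n)) \<longrightarrow> (\<forall>j<p. conv (\<lambda>n. u n j) (l j)) \<longrightarrow>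
        (\<lambda>n. vol (y n) (u n)) \<longlonglongrightarrow> vol x l"
    using assms(1) unfolding is_volume_def by (elim conjE)
  then show ?thesis using assms(2-4) by simp
qed

text \<open>For \<open>p = 1\<close> the exponent is defined on the bundle itself, so the volume is
  just a norm. In the constant, \<open>C1\<close> and \<open>C2\<close> compare the two norms in
  both directions, and 2 comes from a unit vector that reaches half of the supremum.\<close>

lemma vector_volume:
  assumes d: "1 \<le> d" and N1: "finsler_norm E N1"
  defines "vol \<equiv> (\<lambda>(x::'x) u. N1 (u 0))"
  shows "is_volume 1 vol \<and> (\<exists>C. is_growth 1 vol (\<lambda>n x. fiber_opnorm E N1 (\<Phi> ^^ n) x) C)"
proof
  interpret N1: cocycle E d N1 T \<Phi> by unfold_locales (use compact_base N1 automorphism in auto)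
  have comb1: "comb x 1 t u = vscale E (t 0) (u 0)" if "u 0 \<in> fib x" for x t u
  proof -
    have "comb x 1 t u = comb x 1 (\<lambda>i. if i = 0 then t 0 else 0) u" by (intro comb_cong) auto
    then show ?thesis using comb_single[of 0 1 u x "t 0"] that by simp
  qed
  show "is_volume 1 vol" unfolding is_volume_def vol_def
  proof (intro conjI allI impI)
    fix x and u u' :: "nat \<Rightarrow> 'e" assume "\<forall>j<1. u j = u' j" then show "N1 (u 0) = N1 (u' 0)" by simp
  next
    fix x and u :: "nat \<Rightarrow> 'e" assume "\<forall>j<1. u j \<in> fib x" then show "0 \<le> N1 (u 0)" using N1.norm_nonneg by blast
  next
    fix x u assume u: "indep x 1 u"
    have u0: "u 0 \<in> fib x" using indep_in[OF u] by simp
    have "u 0 \<noteq> vzero E x"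
    proof
      assume z: "u 0 = vzero E x"
      have "comb x 1 (\<lambda>_. 1) u = vzero E x" unfolding comb1[of u x, OF u0] z
        by (rule fib_eqI) (auto intro!: vscale_in vzero_in simp: crd_scale crd_zero vzero_in)
      then show False using u unfolding indep_def by fastforce
    qed
    then show "0 < N1 (u 0)" using N1.norm_eq_0[OF u0] N1.norm_nonneg[OF u0] by simp
  next
    fix x and u :: "nat \<Rightarrow> 'e" and i and t :: "nat \<Rightarrow> real" assume "i < (1::nat)" "\<forall>j<1. u j \<in> fib x"
    then show "N1 ((u(i := comb x 1 t u)) 0) = \<bar>t i\<bar> * N1 (u 0)"
      using comb1[of u x t] N1.norm_scale[of "u 0" x "t 0"] by simp
  next
    fix y x and u :: "nat \<Rightarrow> nat \<Rightarrow> 'e" and l :: "nat \<Rightarrow> 'e" assume "\<forall>j<1. conv (\<lambda>n. u n j) (l j)"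
    then show "(\<lambda>n. N1 (u n 0)) \<longlonglongrightarrow> N1 (l 0)" using N1.conv_norm by blast
  qed
  obtain C1 where C1: "C1 > 0" "\<And>v. v \<in> tot \<Longrightarrow> N1 v \<le> C1 * N v" using finsler_equivalent[OF N1] by blast
  obtain C2 where C2: "C2 > 0" "\<And>v. v \<in> tot \<Longrightarrow> N v \<le> C2 * N1 v" using N1.finsler_equivalent[OF finsler] by blast
  have bdd: "\<exists>K. \<forall>v\<in>fib x. N1 v \<le> 1 \<longrightarrow> N1 ((\<Phi> ^^ n) v) \<le> K" for n x
  proof -
    interpret I: cocycle E d N1 "T ^^ n" "\<Phi> ^^ n" by (rule N1.cocycle_iterate)
    obtain B where B: "B > 0" "\<And>v. v \<in> tot \<Longrightarrow> N1 ((\<Phi> ^^ n) v) \<le> B * N1 v" by (rule I.phi_bounded) blast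
    have "N1 ((\<Phi> ^^ n) v) \<le> B" if "v \<in> fib x" "N1 v \<le> 1" for v
      using le_of_le_mult_one[OF B(2)[OF fib_tot[OF that(1)]] that(2) B(1)] .
    then show ?thesis by blast
  qed
  have ne: "\<exists>v\<in>fib x. N1 v \<le> 1" for x using vzero_in[of x] N1.norm_zero[of x] by (intro bexI[of _ "vzero E x"]) auto
  have zero: "N1 (\<Phi> v) = 0" if "v \<in> fib x" "N1 v = 0" for x v
    using that N1.norm_eq_0[of v x] phi_zero N1.norm_zero by simp
  interpret op: opnorm_cocycle E \<Phi> T N1
    by unfold_locales (fact phi_in vscale_in phi_scale N1.norm_scale N1.norm_nonneg zero bdd ne)+
  let ?f = "\<lambda>n x. fiber_opnorm E N1 (\<Phi> ^^ n) x"
  have "is_growth 1 vol ?f (C1 + 2 * C2)"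
    unfolding is_growth_def
  proof (intro conjI allI impI)
    show "0 < C1 + 2 * C2" using C1 C2 by simp
    fix n x u assume "unit_tuple 1 x u"
    then have u: "u 0 \<in> fib x" "N (u 0) \<le> 1" by (auto simp: unit_tuple_def)
    have "N1 (u 0) \<le> C1" using le_of_le_mult_one[OF C1(2)[OF fib_tot[OF u(1)]] u(2) C1(1)] .
    then have "N1 ((\<Phi> ^^ n) (u 0)) \<le> ?f n x * C1"
      using op.opnorm_bound[OF u(1), of n] mult_left_mono[of "N1 (u 0)" C1 "?f n x"] op.opnorm_nonneg[of n x] by linarith
    also have "\<dots> \<le> (C1 + 2 * C2) * ?f n x" using op.opnorm_nonneg[of n x] C2(1) by (simp add: algebra_simps)
    finally show "vol ((T ^^ n) x) (\<lambda>j. (\<Phi> ^^ n) (u j)) \<le> (C1 + 2 * C2) * ?f n x" by (simp add: vol_def)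
  next
    fix n x
    interpret I: cocycle E d N1 "T ^^ n" "\<Phi> ^^ n" by (rule N1.cocycle_iterate)
    have "\<exists>v\<in>fib x. N1 v \<le> 1 \<and> ?f n x \<le> 2 * N1 ((\<Phi> ^^ n) v)"
    proof (rule ccontr)
      assume neg: "\<not> ?thesis"
      then have "N1 ((\<Phi> ^^ n) v) \<le> ?f n x / 2" if "v \<in> fib x" "N1 v \<le> 1" for v using that by fastforce
      then have "?f n x \<le> ?f n x / 2" by (rule op.opnorm_le)
      then have "?f n x \<le> 0" by simp
      then show False using neg ne[of x] N1.norm_nonneg[OF I.phi_in] by (metis mult_nonneg_nonneg order_trans zero_le_numeral)
    qed
    then obtain v where v: "v \<in> fib x" "N1 v \<le> 1" "?f n x \<le> 2 * N1 ((\<Phi> ^^ n) v)" by blast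
    define u where "u j = vscale E (1 / C2) v" for j :: nat
    have "N (u 0) \<le> 1"
    proof -
      have "N v \<le> C2" using le_of_le_mult_one[OF C2(2)[OF fib_tot[OF v(1)]] v(2) C2(1)] .
      then show ?thesis unfolding u_def using norm_scale[OF v(1), of "1 / C2"] C2(1) by simp
    qed
    then have ut: "unit_tuple 1 x u" unfolding unit_tuple_def using vscale_in[OF v(1)] by (simp add: u_def)
    have e: "C2 * N1 ((\<Phi> ^^ n) (u 0)) = N1 ((\<Phi> ^^ n) v)"
      unfolding u_def using I.phi_scale[OF v(1)] N1.norm_scale[OF I.phi_in[OF v(1)]] C2(1) by simp
    have "0 \<le> N1 ((\<Phi> ^^ n) (u 0))" unfolding u_def by (rule N1.norm_nonneg[OF I.phi_in[OF vscale_in[OF v(1)]]])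
    then have "?f n x \<le> (C1 + 2 * C2) * N1 ((\<Phi> ^^ n) (u 0))"
      using v(3) e C1(1) by (simp add: distrib_right add_increasing mult.assoc)
    then show "\<exists>u. unit_tuple 1 x u \<and> ?f n x \<le> (C1 + 2 * C2) * vol ((T ^^ n) x) (\<lambda>j. (\<Phi> ^^ n) (u j))"
      using ut by (auto simp: vol_def)
  next
    fix m n x
    show "?f (m + n) x \<le> ?f m x * ?f n ((T ^^ m) x)" by (rule op.opnorm_mult)
  next
    fix x
    obtain U h where ch: "x \<in> U" "chart U h" using chart_exists .
    have "indep x 1 (\<lambda>i. frame E U h i x)" using indep_prefix[OF frame_indep[OF ch(2,1)]] d by simp
    then have "0 < N1 (frame E U h 0 x)" using \<open>is_volume 1 vol\<close> unfolding is_volume_def vol_def by blast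
    then show "1 \<le> ?f 0 x"
      using op.opnorm_bound[of "frame E U h 0 x" x 0] frame_in[OF ch(2,1), of 0] d by simp
  qed
  then show "\<exists>C. is_growth 1 vol ?f C" by blast
qed

lemma ext_volume:
  assumes p: "1 \<le> p" "p \<le> d" and N': "finsler_norm (ext p) N'"
  defines "vol \<equiv> (\<lambda>x u. N' (x, wedge E p x (map u [0..<p])))"
  shows "is_volume p vol \<and> (\<exists>C. is_growth p vol (\<lambda>n x. fiber_opnorm (ext p) N' (ext_map E p T \<Phi> ^^ n) x) C)"
proof
  let ?L = "ext_map E p T \<Phi>"
  let ?f = "\<lambda>n x. fiber_opnorm (ext p) N' (?L ^^ n) x"
  have fibI: "(x, \<xi>) \<in> fiber (ext p) x" if "\<xi> \<in> ext_power E p x" for x \<xi> using that by (simp add: ext_fiber)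
  have N'all: "\<forall>x. (\<forall>v\<in>fiber (ext p) x. 0 \<le> N' v \<and> (N' v = 0 \<longleftrightarrow> v = vzero (ext p) x)) \<and>
        (\<forall>c. \<forall>v\<in>fiber (ext p) x. N' (vscale (ext p) c v) = \<bar>c\<bar> * N' v) \<and>
        (\<forall>u\<in>fiber (ext p) x. \<forall>v\<in>fiber (ext p) x. N' (vadd (ext p) u v) \<le> N' u + N' v)"
    using N' unfolding finsler_norm_def by simp
  have N'nn: "0 \<le> N' v" and N'0: "N' v = 0 \<longleftrightarrow> v = (x, \<lambda>\<omega>. 0)"
    and N'sc: "N' (vscale (ext p) c v) = \<bar>c\<bar> * N' v" if "v \<in> fiber (ext p) x" for v x c
    using N'all that unfolding ext_simps by blast+
  have N'ad: "N' (x, \<lambda>\<omega>. \<xi> \<omega> + \<eta> \<omega>) \<le> N' (x, \<xi>) + N' (x, \<eta>)" if "\<xi> \<in> ext_power E p x" "\<eta> \<in> ext_power E p x" for x \<xi> \<eta>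
    using N'all fibI[OF that(1)] fibI[OF that(2)] unfolding ext_simps(5)[of p x \<xi> x \<eta>, symmetric] by blast
  have N'zero: "N' (x, \<lambda>\<omega>. 0) = 0" for x
  proof -
    have "(\<lambda>\<omega>. 0) \<in> ext_power E p x" using ext_power_sum[of "{}" "\<lambda>_. []" p x] by simp
    from N'0[OF fibI[OF this]] show ?thesis by simp
  qed
  have scw: "N' (x, \<lambda>\<omega>. c * \<xi> \<omega>) = \<bar>c\<bar> * N' (x, \<xi>)" if "\<xi> \<in> ext_power E p x" for x c \<xi>
    using N'sc[OF fibI[OF that], of c] by simp
  have scale_ext: "(\<lambda>\<omega>. c * \<xi> \<omega>) \<in> ext_power E p x" if \<xi>: "\<xi> \<in> ext_power E p x" for x c \<xi>
  proof -
    obtain m b u where u: "\<And>j. j < (m::nat) \<Longrightarrow> u j \<in> fiber_tuples E p x" "\<xi> = (\<lambda>\<omega>. \<Sum>j<m. b j * wedge E p x (u j) \<omega>)"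
      using \<xi> unfolding ext_power_def by blast
    have "(\<lambda>\<omega>. c * \<xi> \<omega>) = (\<lambda>\<omega>. \<Sum>j<m. (c * b j) * wedge E p x (u j) \<omega>)"
      unfolding u(2) by (simp add: sum_distrib_left mult.assoc)
    then show ?thesis using u(1) by (auto intro!: ext_power_sum)
  qed
  have N'sum: "N' (x, \<lambda>\<omega>. \<Sum>I\<in>S. c I * wedge E p x (us I) \<omega>) \<le> (\<Sum>I\<in>S. \<bar>c I\<bar> * N' (x, wedge E p x (us I)))"
    if "finite S" "\<And>I. I \<in> S \<Longrightarrow> us I \<in> fiber_tuples E p x" for S c us x
    using that
  proof (induction S)
    case (insert I S)
    have "N' (x, \<lambda>\<omega>. \<Sum>I\<in>insert I S. c I * wedge E p x (us I) \<omega>) =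
        N' (x, \<lambda>\<omega>. c I * wedge E p x (us I) \<omega> + (\<Sum>I\<in>S. c I * wedge E p x (us I) \<omega>))"
      using insert by simp
    also have "\<dots> \<le> N' (x, \<lambda>\<omega>. c I * wedge E p x (us I) \<omega>) + N' (x, \<lambda>\<omega>. \<Sum>I\<in>S. c I * wedge E p x (us I) \<omega>)"
      using insert by (intro N'ad scale_ext wedge_in_ext_power ext_power_sum) auto
    also have "\<dots> \<le> \<bar>c I\<bar> * N' (x, wedge E p x (us I)) + (\<Sum>I\<in>S. \<bar>c I\<bar> * N' (x, wedge E p x (us I)))"
      using insert scw[OF wedge_in_ext_power[of "us I"]] by (intro add_mono) auto
    finally show ?case using insert by simp
  qed (simp add: N'zero)
  have vol_scale: "vol x (\<lambda>j. vscale E t (u j)) = \<bar>t\<bar> ^ p * vol x u" if "\<And>j. j < p \<Longrightarrow> u j \<in> fib x" for x t u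
  proof -
    have us: "map u [0..<p] \<in> fiber_tuples E p x" using that by (rule tuple_map)
    have "wedge E p x (map (\<lambda>j. vscale E t (u j)) [0..<p]) = (\<lambda>\<omega>. t ^ p * wedge E p x (map u [0..<p]) \<omega>)"
    proof
      fix \<omega>
      show "wedge E p x (map (\<lambda>j. vscale E t (u j)) [0..<p]) \<omega> = t ^ p * wedge E p x (map u [0..<p]) \<omega>"
        using alt_scale_all[OF _ us, of \<omega> t] by (simp add: wedge_def comp_def)
    qed
    then show ?thesis unfolding vol_def using scw[OF wedge_in_ext_power[OF us]] by (simp add: power_abs)
  qed
  show vol: "is_volume p vol" unfolding is_volume_def
  proof (intro conjI allI impI)
    fix x and u u' :: "nat \<Rightarrow> 'e" assume "\<forall>j<p. u j = u' j"
    then have "map u [0..<p] = map u' [0..<p]" by simp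
    then show "vol x u = vol x u'" unfolding vol_def by (simp only:)
  next
    fix x u assume "\<forall>j<p. u j \<in> fib x"
    then show "0 \<le> vol x u" unfolding vol_def by (intro N'nn[OF fibI] wedge_in_ext_power tuple_map) auto
  next
    fix x u assume u: "indep x p u"
    have us: "map u [0..<p] \<in> fiber_tuples E p x" using indep_in[OF u] by (rule tuple_map)
    obtain U h where ch: "x \<in> U" "chart U h" using chart_exists .
    \<comment> \<open>The determinant of the functionals dual to \<open>u\<close> is an alternating
      form with value 1 on \<open>u\<close>; hence the wedge product of \<open>u\<close> is
      nonzero.\<close>
    obtain A :: "nat \<Rightarrow> nat \<Rightarrow> real" where A: "\<forall>j<p. \<forall>l<p. (\<Sum>i<d. A j i * crd h (u l) i) = (if j = l then 1 else 0)"
      using indep_dual[OF ch(2,1) u] by blast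
    define \<omega> where "\<omega> = det_form x p (\<lambda>b v. \<Sum>i<d. A b i * crd h v i)"
    have alt: "\<omega> \<in> alt_forms E p x" unfolding \<omega>_def
      using ch by (intro det_form_alt) (auto simp: crd_add crd_scale distrib_left sum.distrib sum_distrib_left mult_ac)
    have "\<omega> (map u [0..<p]) = 1" unfolding \<omega>_def det_form_def using us A by (auto intro!: leibniz_det_identity)
    then have "wedge E p x (map u [0..<p]) \<omega> = 1" using alt by (simp add: wedge_def)
    then have "wedge E p x (map u [0..<p]) \<noteq> (\<lambda>\<omega>. 0)" by (metis zero_neq_one)
    then have "N' (x, wedge E p x (map u [0..<p])) \<noteq> 0" using N'0[OF fibI[OF wedge_in_ext_power[OF us]]] by simp
    then show "0 < vol x u" unfolding vol_def using N'nn[OF fibI[OF wedge_in_ext_power[OF us]]] by simp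
  next
    fix x u i and t :: "nat \<Rightarrow> real" assume i: "i < p" and u: "\<forall>j<p. u j \<in> fib x"
    have us: "map u [0..<p] \<in> fiber_tuples E p x" using u by (intro tuple_map) auto
    have upd: "map (u(i := w)) [0..<p] = (map u [0..<p])[i := w]" for w
      using i by (intro nth_equalityI) (auto simp: nth_list_update)
    have "wedge E p x (map (u(i := comb x p t u)) [0..<p]) = (\<lambda>\<omega>. t i * wedge E p x (map u [0..<p]) \<omega>)"
    proof
      fix \<omega>
      show "wedge E p x (map (u(i := comb x p t u)) [0..<p]) \<omega> = t i * wedge E p x (map u [0..<p]) \<omega>"
      proof (cases "\<omega> \<in> alt_forms E p x")
        case True
        have "\<omega> ((map u [0..<p])[i := u j]) = (if j = i then \<omega> (map u [0..<p]) else 0)" if j: "j < p" for j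
        proof (cases "j = i")
          case True
          have "(map u [0..<p])[i := u i] = map u [0..<p]" using upd[of "u i"] by simp
          then show ?thesis using True by simp
        next
          case False
          have "\<not> distinct ((map u [0..<p])[i := u j])"
          proof
            assume "distinct ((map u [0..<p])[i := u j])"
            moreover have "(map u [0..<p])[i := u j] ! i = (map u [0..<p])[i := u j] ! j" using i j False by simp
            ultimately show False
              using i j False nth_eq_iff_index_eq[of "(map u [0..<p])[i := u j]" i j] by simp
          qed
          then show ?thesis using alt_repeat[OF True tuple_update[OF us]] u j False by simp
        qed
        then have "\<omega> (map (u(i := comb x p t u)) [0..<p]) = (\<Sum>j<p. if j = i then t i * \<omega> (map u [0..<p]) else 0)"
          unfolding upd using alt_comb[OF True us i, of p u t] u by (simp add: if_distrib[of "\<lambda>z. _ * z"] cong: if_cong)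
        then show ?thesis using True i by (simp add: wedge_def)
      qed (simp add: wedge_def)
    qed
    then show "vol x (u(i := comb x p t u)) = \<bar>t i\<bar> * vol x u"
      unfolding vol_def using scw[OF wedge_in_ext_power[OF us]] by simp
  next
    fix y x and u :: "nat \<Rightarrow> nat \<Rightarrow> 'e" and l
    assume y: "y \<longlonglongrightarrow> x" and u: "\<forall>n. \<forall>j<p. u n j \<in> fib (y n)" and l: "\<forall>j<p. conv (\<lambda>n. u n j) (l j)"
    have N'cont: "continuous_map (tot_space (ext p)) euclideanreal N'" using N' by (simp add: finsler_norm_def)
    have "limitin (tot_space (ext p)) (\<lambda>n. (y n, wedge E p (y n) (map (u n) [0..<p]))) (x, wedge E p x (map l [0..<p])) sequentially"
      by (rule wedge_conv[OF y]) (use u l in auto)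
    from continuous_map_limit[OF N'cont this]
    show "(\<lambda>n. vol (y n) (u n)) \<longlonglongrightarrow> vol x l" unfolding vol_def by (simp add: o_def)
  qed
  have vol_nn: "0 \<le> vol x u" if "\<And>j. j < p \<Longrightarrow> u j \<in> fib x" for x u
    using vol that unfolding is_volume_def by blast
  obtain C0 where C0: "C0 > 0" "\<And>x u. unit_tuple p x u \<Longrightarrow> vol x u \<le> C0"
  proof -
    have "\<exists>C0>0. \<forall>x u. unit_tuple p x u \<longrightarrow> vol x u \<le> C0"
    proof (rule ccontr)
      assume "\<not> ?thesis"
      then have "\<exists>x u. unit_tuple p x u \<and> vol x u > real (Suc n)" for n
        by (metis not_le of_nat_0_less_iff zero_less_Suc)
      then obtain y u where yu: "\<And>n. unit_tuple p (y n) (u n)" "\<And>n. vol (y n) (u n) > real (Suc n)" by metis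
      obtain r l x where r: "strict_mono r" "(\<lambda>k. y (r k)) \<longlonglongrightarrow> x" "\<And>j. j < p \<Longrightarrow> conv (\<lambda>k. u (r k) j) (l j)"
        by (rule bounded_tuple_subsequence[of p u y 1]) (use yu(1) in \<open>auto simp: unit_tuple_def\<close>)
      have "(\<lambda>n. vol (y (r n)) (u (r n))) \<longlonglongrightarrow> vol x l"
        by (rule volume_conv[OF vol r(2)]) (use r(3) yu(1) in \<open>auto simp: unit_tuple_def\<close>)
      then have "Bseq (\<lambda>n. vol (y (r n)) (u (r n)))" by (intro convergent_imp_Bseq convergentI)
      then obtain K where K: "\<And>n. vol (y (r n)) (u (r n)) \<le> K" unfolding Bseq_def by (metis abs_le_D1 real_norm_def)
      obtain n where n: "real n > K" using reals_Archimedean2 by blast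
      show False using K[of n] yu(2)[of "r n"] n seq_suble[OF r(1), of n] by simp
    qed
    then show ?thesis using that by blast
  qed
  obtain C1 where C1: "C1 > 0" "\<And>x. \<exists>e. (\<forall>i<d. e i \<in> fib x \<and> N (e i) \<le> C1) \<and>
      (\<forall>\<xi>\<in>ext_power E p x. \<exists>c. (\<forall>I\<in>index_sets d p. \<bar>c I\<bar> \<le> C1 * N' (x, \<xi>)) \<and>
         \<xi> = (\<lambda>\<omega>. \<Sum>I\<in>index_sets d p. c I * wedge E p x (map e (sorted_list_of_set I)) \<omega>))"
    by (rule ext_frame_bound[OF N']) blast
  let ?sl = sorted_list_of_set
  have step: "\<exists>e. (\<forall>i<d. e i \<in> fib x \<and> N (e i) \<le> C1) \<and>
     (\<forall>\<zeta>\<in>fiber (ext p) x. N' \<zeta> \<le> 1 \<longrightarrow> N' ((?L ^^ n) \<zeta>) \<le>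
        (\<Sum>I\<in>index_sets d p. C1 * N' ((T ^^ n) x, wedge E p ((T ^^ n) x) (map (\<Phi> ^^ n) (map e (?sl I))))))" for n x
  proof -
    interpret I: cocycle E d N "T ^^ n" "\<Phi> ^^ n" by (rule cocycle_iterate)
    obtain e where e: "\<And>i. i < d \<Longrightarrow> e i \<in> fib x \<and> N (e i) \<le> C1"
      and ex: "\<And>\<xi>. \<xi> \<in> ext_power E p x \<Longrightarrow> \<exists>c. (\<forall>I\<in>index_sets d p. \<bar>c I\<bar> \<le> C1 * N' (x, \<xi>)) \<and>
         \<xi> = (\<lambda>\<omega>. \<Sum>I\<in>index_sets d p. c I * wedge E p x (map e (?sl I)) \<omega>)"
      using C1(2)[of x] by blast
    have tup: "map e (?sl I) \<in> fiber_tuples E p x" if "I \<in> index_sets d p" for I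
      using index_length[OF that] index_less[OF that] e by (auto simp: fiber_tuples_def)
    have "N' ((?L ^^ n) \<zeta>) \<le> (\<Sum>I\<in>index_sets d p. C1 * N' ((T ^^ n) x, wedge E p ((T ^^ n) x) (map (\<Phi> ^^ n) (map e (?sl I)))))"
      if z: "\<zeta> \<in> fiber (ext p) x" "N' \<zeta> \<le> 1" for \<zeta>
    proof -
      obtain \<xi> where \<xi>: "\<zeta> = (x, \<xi>)" "\<xi> \<in> ext_power E p x" using z(1) by (auto simp: ext_fiber)
      obtain c where c: "\<And>I. I \<in> index_sets d p \<Longrightarrow> \<bar>c I\<bar> \<le> C1 * N' (x, \<xi>)"
        and eq: "\<xi> = (\<lambda>\<omega>. \<Sum>I\<in>index_sets d p. c I * wedge E p x (map e (?sl I)) \<omega>)"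
        using ex[OF \<xi>(2)] by blast
      have c1: "\<bar>c I\<bar> \<le> C1" if "I \<in> index_sets d p" for I
        using le_of_le_mult_one[OF c[OF that] _ C1(1)] z(2) \<xi>(1) by simp
      have "N' ((?L ^^ n) \<zeta>) = N' ((T ^^ n) x, \<lambda>\<omega>. \<Sum>I\<in>index_sets d p. c I * wedge E p ((T ^^ n) x) (map (\<Phi> ^^ n) (map e (?sl I))) \<omega>)"
        unfolding \<xi>(1) by (subst eq, subst ext_map_iterate[OF finite_index_sets tup]) auto
      also have "\<dots> \<le> (\<Sum>I\<in>index_sets d p. \<bar>c I\<bar> * N' ((T ^^ n) x, wedge E p ((T ^^ n) x) (map (\<Phi> ^^ n) (map e (?sl I)))))"
        by (rule N'sum[OF finite_index_sets I.tuple_map_phi[OF tup]])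
      also have "\<dots> \<le> (\<Sum>I\<in>index_sets d p. C1 * N' ((T ^^ n) x, wedge E p ((T ^^ n) x) (map (\<Phi> ^^ n) (map e (?sl I)))))"
        using c1 by (intro sum_mono mult_right_mono N'nn[OF fibI[OF wedge_in_ext_power[OF I.tuple_map_phi[OF tup]]]]) auto
      finally show ?thesis .
    qed
    then show ?thesis using e by blast
  qed
  have A_in: "?L \<zeta> \<in> fiber (ext p) (T x)" if z: "\<zeta> \<in> fiber (ext p) x" for \<zeta> x
  proof -
    obtain \<xi> where \<xi>: "\<zeta> = (x, \<xi>)" "\<xi> \<in> ext_power E p x" using z by (auto simp: ext_fiber)
    obtain m c u where u: "\<And>j. j < (m::nat) \<Longrightarrow> u j \<in> fiber_tuples E p x" "\<xi> = (\<lambda>\<omega>. \<Sum>j<m. c j * wedge E p x (u j) \<omega>)"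
      using \<xi>(2) unfolding ext_power_def by blast
    show ?thesis unfolding \<xi>(1) u(2) using ext_map_sum[of "{..<m}" u p x c] u(1) tuple_map_phi
      by (auto intro!: fibI ext_power_sum)
  qed
  have scale_in: "vscale (ext p) c \<zeta> \<in> fiber (ext p) x" if "\<zeta> \<in> fiber (ext p) x" for c \<zeta> x
    using that scale_ext by (auto simp: ext_fiber)
  have A_scale: "?L (vscale (ext p) c \<zeta>) = vscale (ext p) c (?L \<zeta>)" if "\<zeta> \<in> fiber (ext p) x" for c \<zeta> x
    using that by (auto simp: ext_fiber ext_map_def fun_eq_iff)
  have A_zero: "N' (?L \<zeta>) = 0" if "\<zeta> \<in> fiber (ext p) x" "N' \<zeta> = 0" for \<zeta> x
    using N'0[OF that(1)] that(2) N'zero by (auto simp: ext_map_def)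
  have bdd: "\<exists>K. \<forall>\<zeta>\<in>fiber (ext p) x. N' \<zeta> \<le> 1 \<longrightarrow> N' ((?L ^^ n) \<zeta>) \<le> K" for n x
    using step[of x n] by blast
  have ne: "\<exists>\<zeta>\<in>fiber (ext p) x. N' \<zeta> \<le> 1" for x
  proof -
    have "(\<lambda>\<omega>. 0) \<in> ext_power E p x" using ext_power_sum[of "{}" "\<lambda>_. []" p x] by simp
    then show ?thesis using fibI N'zero[of x] by (intro bexI[of _ "(x, \<lambda>\<omega>. 0)"]) auto
  qed
  interpret op: opnorm_cocycle "ext p" ?L T N'
    by unfold_locales (fact A_in scale_in A_scale N'sc N'nn A_zero bdd ne)+
  \<comment> \<open>\<open>C0\<close> bounds the volume of unit tuples and serves the upper bound.
    For the lower bound every index set contributes a coefficient at most \<open>C1\<close>, and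
    scaling \<open>p\<close> frame vectors into the unit ball costs \<open>C1 ^ p\<close>.\<close>
  define C where "C = C0 + C1 * real (card (index_sets d p)) * C1 ^ p"
  have idx0: "{..<p} \<in> index_sets d p" using p by (auto simp: index_sets_def)
  have C2pos: "C1 * real (card (index_sets d p)) * C1 ^ p > 0"
  proof -
    have "card (index_sets d p) > 0" using idx0 finite_index_sets[of p] by (auto simp: card_gt_0_iff)
    then show ?thesis using C1(1) by simp
  qed
  have "is_growth p vol ?f C" unfolding is_growth_def
  proof (intro conjI allI impI)
    show "0 < C" using C0 C2pos by (simp add: C_def)
    fix n x u assume ut: "unit_tuple p x u"
    have us: "map u [0..<p] \<in> fiber_tuples E p x" using ut by (intro tuple_map) (auto simp: unit_tuple_def)
    have "N' ((?L ^^ n) (x, wedge E p x (map u [0..<p]))) \<le> ?f n x * N' (x, wedge E p x (map u [0..<p]))"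
      by (rule op.opnorm_bound[OF fibI[OF wedge_in_ext_power[OF us]]])
    also have "\<dots> \<le> ?f n x * C0" using C0(2)[OF ut] op.opnorm_nonneg[of n x] by (intro mult_left_mono) (auto simp: vol_def)
    also have "\<dots> \<le> C * ?f n x" using op.opnorm_nonneg[of n x] C2pos by (simp add: C_def distrib_right mult.commute)
    finally show "vol ((T ^^ n) x) (\<lambda>j. (\<Phi> ^^ n) (u j)) \<le> C * ?f n x"
      unfolding ext_map_iterate_wedge[OF us] by (simp add: vol_def comp_def)
  next
    fix n x
    interpret I: cocycle E d N "T ^^ n" "\<Phi> ^^ n" by (rule cocycle_iterate)
    obtain e where e: "\<And>i. i < d \<Longrightarrow> e i \<in> fib x \<and> N (e i) \<le> C1"
      and le: "\<And>\<zeta>. \<zeta> \<in> fiber (ext p) x \<Longrightarrow> N' \<zeta> \<le> 1 \<Longrightarrow> N' ((?L ^^ n) \<zeta>) \<le>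
        (\<Sum>I\<in>index_sets d p. C1 * N' ((T ^^ n) x, wedge E p ((T ^^ n) x) (map (\<Phi> ^^ n) (map e (?sl I)))))"
      using step[of x n] by blast
    define a where "a I = N' ((T ^^ n) x, wedge E p ((T ^^ n) x) (map (\<Phi> ^^ n) (map e (?sl I))))" for I
    \<comment> \<open>The frame tuple with the largest image controls the whole sum and, after
      scaling, is the required unit tuple.\<close>
    have "\<exists>I0\<in>index_sets d p. \<forall>I\<in>index_sets d p. a I \<le> a I0"
    proof -
      have "Max (a ` index_sets d p) \<in> a ` index_sets d p" using idx0 finite_index_sets by (intro Max_in) auto
      then obtain I0 where "I0 \<in> index_sets d p" "Max (a ` index_sets d p) = a I0" by auto
      then show ?thesis using finite_index_sets by (metis Max_ge finite_imageI imageI)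
    qed
    then obtain I0 where I0: "I0 \<in> index_sets d p" "\<And>I. I \<in> index_sets d p \<Longrightarrow> a I \<le> a I0" by blast
    define u where "u j = vscale E (1 / C1) (e (?sl I0 ! j))" for j
    have ei: "e (?sl I0 ! j) \<in> fib x" "N (e (?sl I0 ! j)) \<le> C1" if "j < p" for j
      using e[OF index_nth[OF I0(1) that]] by auto
    have ut: "unit_tuple p x u" unfolding unit_tuple_def u_def
      using ei norm_scale[OF ei(1), of _ "1 / C1"] C1(1) by (auto intro: vscale_in)
    have "vol ((T ^^ n) x) (\<lambda>j. (\<Phi> ^^ n) (u j)) = vol ((T ^^ n) x) (\<lambda>j. vscale E (1 / C1) ((\<Phi> ^^ n) (e (?sl I0 ! j))))"
    proof -
      have eq: "map (\<lambda>j. (\<Phi> ^^ n) (u j)) [0..<p] = map (\<lambda>j. vscale E (1 / C1) ((\<Phi> ^^ n) (e (?sl I0 ! j)))) [0..<p]"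
        unfolding u_def using I.phi_scale[OF ei(1)] by simp
      show ?thesis unfolding vol_def by (simp only: eq)
    qed
    also have "\<dots> = \<bar>1 / C1\<bar> ^ p * vol ((T ^^ n) x) (\<lambda>j. (\<Phi> ^^ n) (e (?sl I0 ! j)))"
      by (rule vol_scale) (use I.phi_in[OF ei(1)] in auto)
    also have "vol ((T ^^ n) x) (\<lambda>j. (\<Phi> ^^ n) (e (?sl I0 ! j))) = a I0"
    proof -
      have eq: "map (\<lambda>j. (\<Phi> ^^ n) (e (?sl I0 ! j))) [0..<p] = map (\<Phi> ^^ n) (map e (?sl I0))"
        using index_length[OF I0(1)] by (intro nth_equalityI) auto
      show ?thesis unfolding vol_def a_def by (simp only: eq)
    qed
    finally have ve: "C1 ^ p * vol ((T ^^ n) x) (\<lambda>j. (\<Phi> ^^ n) (u j)) = a I0"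
      using C1(1) by (simp add: power_divide)
    have vnn: "0 \<le> vol ((T ^^ n) x) (\<lambda>j. (\<Phi> ^^ n) (u j))"
      by (rule vol_nn, rule I.phi_in) (use ut in \<open>auto simp: unit_tuple_def\<close>)
    have "?f n x \<le> (\<Sum>I\<in>index_sets d p. C1 * a I)" using le by (intro op.opnorm_le) (auto simp: a_def)
    also have "\<dots> \<le> (\<Sum>I\<in>index_sets d p. C1 * a I0)" using I0(2) C1(1) by (intro sum_mono mult_left_mono) auto
    also have "\<dots> = (C1 * real (card (index_sets d p)) * C1 ^ p) * vol ((T ^^ n) x) (\<lambda>j. (\<Phi> ^^ n) (u j))"
      unfolding ve[symmetric] by simp
    also have "\<dots> \<le> C * vol ((T ^^ n) x) (\<lambda>j. (\<Phi> ^^ n) (u j))"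
      using vnn C0(1) by (intro mult_right_mono) (auto simp: C_def)
    finally show "\<exists>u. unit_tuple p x u \<and> ?f n x \<le> C * vol ((T ^^ n) x) (\<lambda>j. (\<Phi> ^^ n) (u j))"
      using ut by blast
  next
    fix m n x
    show "?f (m + n) x \<le> ?f m x * ?f n ((T ^^ m) x)" by (rule op.opnorm_mult)
  next
    fix x
    obtain U h where ch: "x \<in> U" "chart U h" using chart_exists .
    let ?u = "\<lambda>i. frame E U h i x"
    have ind: "indep x p ?u" using indep_prefix[OF frame_indep[OF ch(2,1)] p(2)] .
    then have pos: "0 < vol x ?u" using vol unfolding is_volume_def by blast
    have "vol x ?u \<le> ?f 0 x * vol x ?u"
      using op.opnorm_bound[OF fibI[OF wedge_in_ext_power[OF tuple_map[OF indep_in[OF ind]]]], where n = 0] by (simp add: vol_def)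
    then show "1 \<le> ?f 0 x" using pos by simp
  qed
  then show "\<exists>C. is_growth p vol ?f C" by blast
qed

text \<open>The interface to everything that follows: \<open>vol\<close>, \<open>f\<close> and
  \<open>C\<close> are fixed before the measure \<open>\<mu>\<close>, and the later estimates use
  only their abstract properties.\<close>

theorem exponent_volume:
  assumes p: "p \<in> {1..d}"
  obtains vol f C where "is_volume p vol" "is_growth p vol f C"
    "\<And>\<mu>. exponent_sum E d T \<Phi> \<mu> p = (LINT x|\<mu>. lim (\<lambda>n. (1 / real n) * ln (f n x)))"
proof (cases "p = 1")
  case True
  have "\<exists>N. finsler_norm E N" using finsler by blast
  then have N1: "finsler_norm E (SOME N. finsler_norm E N)" by (rule someI_ex)
  show ?thesis
    using vector_volume[OF _ N1] p True that
    by (auto simp: exponent_sum_def top_exponent_def Let_def)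
next
  case False
  have N1: "finsler_norm (ext p) (SOME N. finsler_norm (ext p) N)" by (rule someI_ex[OF ext_finsler_exists])
  show ?thesis
    using ext_volume[OF _ _ N1] p False that
    by (auto simp: exponent_sum_def top_exponent_def Let_def)
qed

end

section \<open>Recurrence and limits of averages\<close>

text \<open>Poincare recurrence: \<open>A m\<close> is the preimage of \<open>A 0\<close> under
  \<open>T ^^ m\<close>, so these nested sets have equal measure and differ by null sets.\<close>

lemma (in measure_preserving) recurrence:
  assumes [measurable]: "B \<in> sets M"
  shows "AE x in M. x \<in> B \<longrightarrow> (\<forall>m. \<exists>n\<ge>m. (T ^^ n) x \<in> B)"
proof -
  define A where "A m = {x \<in> space M. \<exists>n\<ge>m. (T ^^ n) x \<in> B}" for m
  have [measurable]: "A m \<in> sets M" for m unfolding A_def by measurable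
  have shift: "{x \<in> space M. (T ^^ m) x \<in> A 0} = A m" for m
  proof -
    have "(\<exists>n. (T ^^ n) ((T ^^ m) x) \<in> B) \<longleftrightarrow> (\<exists>n\<ge>m. (T ^^ n) x \<in> B)" for x
    proof -
      have e: "(T ^^ n) ((T ^^ m) x) = (T ^^ (n + m)) x" for n by (simp add: funpow_add)
      show ?thesis unfolding e by (metis le_add2 le_add_diff_inverse2)
    qed
    then show ?thesis using iterate_space by (auto simp: A_def)
  qed
  have "AE x in M. \<forall>m. x \<in> A 0 \<longrightarrow> x \<in> A m"
  proof (subst AE_all_countable, rule allI)
    fix m
    have sub: "A m \<subseteq> A 0" by (auto simp: A_def)
    have "prob (A 0 - A m) = prob (A 0) - prob (A m)" using sub by (intro finite_measure_Diff) auto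
    then have "prob (A 0 - A m) = 0" using measure_vimage_iterate[of "A 0" m] shift[of m] by simp
    then have "AE x in M. x \<notin> A 0 - A m" by (subst prob_eq_0[symmetric]) auto
    then show "AE x in M. x \<in> A 0 \<longrightarrow> x \<in> A m" by eventually_elim auto
  qed
  then show ?thesis using AE_space
  proof eventually_elim
    case (elim x)
    show ?case
    proof
      assume "x \<in> B"
      then have "x \<in> A 0" using elim(2) unfolding A_def by (auto intro!: exI[of _ 0])
      then show "\<forall>m. \<exists>n\<ge>m. (T ^^ n) x \<in> B" using elim(1) unfolding A_def by auto
    qed
  qed
qed

lemma measure_preserving_borel:
  assumes "continuous_on UNIV T" and \<mu>: "prob_space \<mu>" "sets \<mu> = sets borel" "distr \<mu> borel T = \<mu>"
  shows "measure_preserving \<mu> T"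
  unfolding measure_preserving_def measure_preserving_axioms_def
proof (intro conjI \<mu>(1))
  have Tm: "T \<in> measurable borel borel" using assms(1) by (rule borel_measurable_continuous_onI)
  show "T \<in> measurable \<mu> \<mu>" using Tm measurable_cong_sets[OF \<mu>(2) \<mu>(2)] by simp
  have "distr \<mu> \<mu> T = distr \<mu> borel T" by (rule distr_cong) (use \<mu>(2) in auto)
  then show "distr \<mu> \<mu> T = \<mu>" using \<mu>(3) by simp
qed

text \<open>The two sequences have the same set of limits, and \<open>lim\<close> is a description
  that depends on this set alone. Therefore the equality holds also where neither sequence
  converges, which matters for the integrands defining the exponents.\<close>

lemma lim_eq_of_diff:
  fixes a b :: "nat \<Rightarrow> real"
  assumes "(\<lambda>n. a n - b n) \<longlonglongrightarrow> 0" shows "lim a = lim b"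
proof -
  have "a \<longlonglongrightarrow> L \<longleftrightarrow> b \<longlonglongrightarrow> L" for L
  proof
    assume "a \<longlonglongrightarrow> L" from tendsto_diff[OF this assms] show "b \<longlonglongrightarrow> L" by simp
  next
    assume "b \<longlonglongrightarrow> L" from tendsto_add[OF assms this] show "a \<longlonglongrightarrow> L" by simp
  qed
  then show ?thesis by (simp add: lim_def)
qed

lemma lim_scaled_eq:
  fixes a b :: "nat \<Rightarrow> real"
  assumes "\<And>n. n \<ge> 1 \<Longrightarrow> \<bar>a n - b n\<bar> \<le> K"
  shows "(\<lambda>n. (1 / real n) * a n - (1 / real n) * b n) \<longlonglongrightarrow> 0"
proof (rule Lim_null_comparison)
  show "eventually (\<lambda>n. norm ((1 / real n) * a n - (1 / real n) * b n) \<le> K / real n) sequentially"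
    using eventually_ge_at_top[of 1]
  proof eventually_elim
    case (elim n)
    have "(1 / real n) * a n - (1 / real n) * b n = (a n - b n) / real n" by (simp add: diff_divide_distrib)
    then show ?case using assms[OF elim] elim by (simp add: abs_divide divide_right_mono)
  qed
  show "(\<lambda>n. K / real n) \<longlonglongrightarrow> 0" by (rule lim_const_over_n)
qed

section \<open>Expanding tuples\<close>

locale extremal_cocycle = cocycle E d N T \<Phi> for E :: "('x::metric_space, 'e) vbundle" and d N T \<Phi> +
  fixes L :: real and S :: "'x \<Rightarrow> 'x"
  assumes L_pos: "0 < L" and contr: "\<And>v. v \<in> tot \<Longrightarrow> N (\<Phi> v) \<le> L * N v"
    and T_cont: "continuous_on UNIV T" and ST: "\<And>x. S (T x) = x" "\<And>x. T (S x) = x"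
begin

lemma iterate_contr: "v \<in> fib x \<Longrightarrow> N ((\<Phi> ^^ n) v) \<le> L ^ n * N v"
proof (induction n)
  case (Suc n)
  have "N (\<Phi> ((\<Phi> ^^ n) v)) \<le> L * N ((\<Phi> ^^ n) v)" by (rule contr[OF fib_tot[OF iterate_in[OF Suc.prems]]])
  also have "\<dots> \<le> L * (L ^ n * N v)" using Suc L_pos by (intro mult_left_mono) auto
  finally show ?case by (simp add: mult.assoc)
qed simp

lemma iterate_tot: "v \<in> tot \<Longrightarrow> (\<Phi> ^^ n) v \<in> tot"
  using iterate_in[OF tot_fib] fib_tot by blast

lemma iterate_zero: "(\<Phi> ^^ n) (vzero E x) = vzero E ((T ^^ n) x)"
proof -
  interpret I: cocycle E d N "T ^^ n" "\<Phi> ^^ n" by (rule cocycle_iterate)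
  show ?thesis by (rule I.phi_zero)
qed

lemma iterate_scale: "v \<in> fib x \<Longrightarrow> (\<Phi> ^^ n) (vscale E c v) = vscale E c ((\<Phi> ^^ n) v)"
proof -
  interpret I: cocycle E d N "T ^^ n" "\<Phi> ^^ n" by (rule cocycle_iterate)
  show "v \<in> fib x \<Longrightarrow> ?thesis" by (rule I.phi_scale)
qed

lemma iterate_add: "u \<in> fib x \<Longrightarrow> v \<in> fib x \<Longrightarrow> (\<Phi> ^^ n) (vadd E u v) = vadd E ((\<Phi> ^^ n) u) ((\<Phi> ^^ n) v)"
proof -
  interpret I: cocycle E d N "T ^^ n" "\<Phi> ^^ n" by (rule cocycle_iterate)
  show "u \<in> fib x \<Longrightarrow> v \<in> fib x \<Longrightarrow> ?thesis" by (rule I.phi_add)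
qed

lemma iterate_comb: "(\<And>j. j < k \<Longrightarrow> u j \<in> fib x) \<Longrightarrow>
    (\<Phi> ^^ n) (comb x k c u) = comb ((T ^^ n) x) k c (\<lambda>j. (\<Phi> ^^ n) (u j))"
proof -
  interpret I: cocycle E d N "T ^^ n" "\<Phi> ^^ n" by (rule cocycle_iterate)
  show "(\<And>j. j < k \<Longrightarrow> u j \<in> fib x) \<Longrightarrow> ?thesis" by (rule I.phi_comb)
qed

lemma iterate_surj: "w \<in> fib ((T ^^ n) x) \<Longrightarrow> \<exists>v\<in>fib x. (\<Phi> ^^ n) v = w"
proof -
  interpret I: cocycle E d N "T ^^ n" "\<Phi> ^^ n" by (rule cocycle_iterate)
  show "w \<in> fib ((T ^^ n) x) \<Longrightarrow> ?thesis" by (rule I.phi_surj)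
qed

lemma iterate_conv: "conv v l \<Longrightarrow> conv (\<lambda>k. (\<Phi> ^^ n) (v k)) ((\<Phi> ^^ n) l)"
proof -
  interpret I: cocycle E d N "T ^^ n" "\<Phi> ^^ n" by (rule cocycle_iterate)
  show "conv v l \<Longrightarrow> ?thesis" by (rule I.phi_conv)
qed

lemma Tn_cont: "continuous_on UNIV (T ^^ n)"
proof (induction n)
  case (Suc n)
  show ?case using continuous_on_compose[OF Suc continuous_on_subset[OF T_cont]] by (simp add: comp_def)
qed (simp add: id_def)

lemma Tn_tendsto: "y \<longlonglongrightarrow> x \<Longrightarrow> (\<lambda>k. (T ^^ n) (y k)) \<longlonglongrightarrow> (T ^^ n) x"
  by (rule continuous_on_tendsto_compose[OF Tn_cont]) auto

lemma Tn_inj: "(T ^^ n) x = (T ^^ n) y \<Longrightarrow> x = y"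
proof (induction n)
  case (Suc n)
  then have "S (T ((T ^^ n) x)) = S (T ((T ^^ n) y))" by simp
  then show ?case using Suc.IH ST by simp
qed simp

definition \<rho> :: "nat \<Rightarrow> 'e \<Rightarrow> real" where "\<rho> n v = N ((\<Phi> ^^ n) v) / L ^ n"

lemma rho_nonneg: "v \<in> fib x \<Longrightarrow> 0 \<le> \<rho> n v"
  unfolding \<rho>_def using norm_nonneg[OF iterate_in] L_pos by simp

lemma rho_0 [simp]: "\<rho> 0 v = N v"
  by (simp add: \<rho>_def)

lemma rho_iterate: "\<rho> n ((\<Phi> ^^ m) v) = L ^ m * \<rho> (m + n) v"
proof -
  have "(\<Phi> ^^ n) ((\<Phi> ^^ m) v) = (\<Phi> ^^ (m + n)) v" by (simp add: funpow_add add.commute[of m n])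
  then show ?thesis unfolding \<rho>_def using L_pos by (simp add: power_add)
qed

lemma rho_le: "v \<in> fib x \<Longrightarrow> \<rho> n v \<le> N v"
  unfolding \<rho>_def using iterate_contr[of v x n] L_pos by (simp add: pos_divide_le_eq mult.commute)

lemma rho_antimono: "v \<in> fib x \<Longrightarrow> m \<le> n \<Longrightarrow> \<rho> n v \<le> \<rho> m v"
proof -
  assume v: "v \<in> fib x" and mn: "m \<le> n"
  have "L ^ m * \<rho> n v \<le> N ((\<Phi> ^^ m) v)"
    using rho_le[OF iterate_in[OF v], of "n - m" m] mn by (simp add: rho_iterate)
  then show ?thesis unfolding \<rho>_def[of m] using L_pos by (simp add: pos_le_divide_eq mult.commute)
qed

lemma rho_scale: "v \<in> fib x \<Longrightarrow> \<rho> n (vscale E c v) = \<bar>c\<bar> * \<rho> n v"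
  unfolding \<rho>_def using norm_scale[OF iterate_in] by (simp add: iterate_scale)

lemma rho_add: "u \<in> fib x \<Longrightarrow> v \<in> fib x \<Longrightarrow> \<rho> n (vadd E u v) \<le> \<rho> n u + \<rho> n v"
  unfolding \<rho>_def using norm_add[OF iterate_in iterate_in] L_pos
  by (simp add: iterate_add add_divide_distrib[symmetric] divide_right_mono)

lemma rho_conv: "conv v l \<Longrightarrow> (\<lambda>k. \<rho> n (v k)) \<longlonglongrightarrow> \<rho> n l"
  unfolding \<rho>_def using L_pos by (intro tendsto_divide conv_norm iterate_conv) auto

lemma rho_convergent: "v \<in> fib x \<Longrightarrow> \<exists>\<nu>. (\<lambda>n. \<rho> n v) \<longlonglongrightarrow> \<nu>"
  using decseq_convergent[of "\<lambda>n. \<rho> n v" 0] rho_antimono rho_nonneg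
  by (metis decseq_def)

definition expanding :: "nat \<Rightarrow> 'x \<Rightarrow> (nat \<Rightarrow> 'e) \<Rightarrow> real \<Rightarrow> bool" where
  "expanding k x u \<kappa> \<longleftrightarrow> 0 < \<kappa> \<and> (\<forall>j<k. u j \<in> fib x) \<and> (\<forall>n t. \<forall>j<k. \<kappa> * \<bar>t j\<bar> \<le> \<rho> n (comb x k t u))"

lemma expanding_indep: "expanding k x u \<kappa> \<Longrightarrow> indep x k u"
  unfolding expanding_def by (rule indepI_norm[of k u x \<kappa>]) (auto dest: spec[of _ "0::nat"])

lemma expanding_prefix:
  assumes "expanding k x u \<kappa>" "m \<le> k" shows "expanding m x u \<kappa>"
  unfolding expanding_def
proof (intro conjI allI impI)
  show "0 < \<kappa>" and u: "\<And>j. j < m \<Longrightarrow> u j \<in> fib x" using assms by (auto simp: expanding_def)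
  have uk: "\<And>j. j < k \<Longrightarrow> u j \<in> fib x" using assms by (auto simp: expanding_def)
  fix n j and t :: "nat \<Rightarrow> real" assume j: "j < m"
  define t' where "t' j = (if j < m then t j else 0)" for j
  have "comb x k t' u = comb x m t u"
  proof (rule fib_eqI)
    fix U h i assume ch: "chart U h" "x \<in> U"
    have "(\<Sum>j<k. t' j * crd h (u j) i) = (\<Sum>j<m. t j * crd h (u j) i)"
      using assms(2) by (intro sum.mono_neutral_cong_right) (auto simp: t'_def)
    then show "crd h (comb x k t' u) i = crd h (comb x m t u) i"
      using uk u by (simp add: crd_comb[OF ch])
  qed (use uk u in \<open>auto intro!: comb_in\<close>)
  moreover have "\<kappa> * \<bar>t' j\<bar> \<le> \<rho> n (comb x k t' u)" using assms j unfolding expanding_def by simp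
  ultimately show "\<kappa> * \<bar>t j\<bar> \<le> \<rho> n (comb x m t u)" using j by (simp add: t'_def)
qed

text \<open>The \<open>n\<close>-th tuple only has to expand up to time \<open>n\<close>: for each
  fixed time \<open>i\<close> the bound holds for all but finitely many \<open>n\<close>, and it
  passes to the limit.\<close>

lemma expanding_limit:
  assumes y: "y \<longlonglongrightarrow> x" and u: "\<And>n j. j < k \<Longrightarrow> u n j \<in> fib (y n)"
    and l: "\<And>j. j < k \<Longrightarrow> conv (\<lambda>n. u n j) (l j)" and \<kappa>: "0 < \<kappa>"
    and b: "\<And>n i t j. i \<le> n \<Longrightarrow> j < k \<Longrightarrow> \<kappa> * \<bar>t j\<bar> \<le> \<rho> i (comb (y n) k t (u n))"
  shows "expanding k x l \<kappa>"
  unfolding expanding_def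
proof (intro conjI allI impI \<kappa>)
  show "l j \<in> fib x" if "j < k" for j using conv_fib[OF l[OF that] u[OF that] y] .
  fix i t j assume j: "j < k"
  have "(\<lambda>n. \<rho> i (comb (y n) k t (u n))) \<longlonglongrightarrow> \<rho> i (comb x k t l)"
    by (intro rho_conv conv_comb[OF y u l]) auto
  then show "\<kappa> * \<bar>t j\<bar> \<le> \<rho> i (comb x k t l)"
    by (rule LIMSEQ_le_const) (use b j in blast)
qed

lemma volume_scale_all:
  assumes vol: "is_volume p vol" and u: "\<And>j. j < p \<Longrightarrow> u j \<in> fib x"
  shows "vol x (\<lambda>j. vscale E c (u j)) = \<bar>c\<bar> ^ p * vol x u"
proof -
  define W where "W k = (\<lambda>j. if j < k then vscale E c (u j) else u j)" for k
  have "vol x (W k) = \<bar>c\<bar> ^ k * vol x u" if "k \<le> p" for k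
    using that
  proof (induction k)
    case 0 then show ?case by (simp add: W_def)
  next
    case (Suc k)
    then have k: "k < p" by simp
    have Win: "W k j \<in> fib x" if "j < p" for j using u[OF that] by (auto simp: W_def intro: vscale_in)
    have cs: "comb x p (\<lambda>i. if i = k then c else 0) (W k) = vscale E c (W k k)"
      by (rule comb_single[OF k]) (rule Win)
    have e1: "W (Suc k) = (W k)(k := comb x p (\<lambda>i. if i = k then c else 0) (W k))"
      unfolding cs by (auto simp: W_def fun_eq_iff)
    have e2: "vol x ((W k)(k := comb x p (\<lambda>i. if i = k then c else 0) (W k))) = \<bar>if k = k then c else 0\<bar> * vol x (W k)"
      by (rule volume_replace[OF vol k]) (rule Win)
    have "vol x (W (Suc k)) = \<bar>if k = k then c else 0\<bar> * vol x (W k)" by (subst e1) (rule e2)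
    then show ?case using Suc by simp
  qed
  from this[of p] have "vol x (W p) = \<bar>c\<bar> ^ p * vol x u" by simp
  moreover have "vol x (W p) = vol x (\<lambda>j. vscale E c (u j))" by (rule volume_cong[OF vol]) (simp add: W_def)
  ultimately show ?thesis by simp
qed

lemma volume_bounded:
  assumes vol: "is_volume p vol"
  obtains C where "C > 0" "\<And>x u. unit_tuple p x u \<Longrightarrow> vol x u \<le> C"
proof -
  have "\<exists>C0>0. \<forall>x u. unit_tuple p x u \<longrightarrow> vol x u \<le> C0"
  proof (rule ccontr)
    assume "\<not> ?thesis"
    then have "\<exists>x u. unit_tuple p x u \<and> vol x u > real (Suc n)" for n
      by (metis not_le of_nat_0_less_iff zero_less_Suc)
    then obtain y u where yu: "\<And>n. unit_tuple p (y n) (u n)" "\<And>n. vol (y n) (u n) > real (Suc n)" by metis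
    obtain r l x where r: "strict_mono r" "(\<lambda>k. y (r k)) \<longlonglongrightarrow> x" "\<And>j. j < p \<Longrightarrow> conv (\<lambda>k. u (r k) j) (l j)"
      by (rule bounded_tuple_subsequence[of p u y 1]) (use yu(1) in \<open>auto simp: unit_tuple_def\<close>)
    have "(\<lambda>n. vol (y (r n)) (u (r n))) \<longlonglongrightarrow> vol x l"
      by (rule volume_conv[OF vol r(2)]) (use r(3) yu(1) in \<open>auto simp: unit_tuple_def\<close>)
    then have "Bseq (\<lambda>n. vol (y (r n)) (u (r n)))" by (intro convergent_imp_Bseq convergentI)
    then obtain K where K: "\<And>n. vol (y (r n)) (u (r n)) \<le> K" unfolding Bseq_def by (metis abs_le_D1 real_norm_def)
    obtain n where n: "real n > K" using reals_Archimedean2 by blast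
    show False using K[of n] yu(2)[of "r n"] n seq_suble[OF r(1), of n] by simp
  qed
  then show ?thesis using that by blast
qed

lemma unit_tuple_iterate:
  assumes "unit_tuple p x u" shows "unit_tuple p ((T ^^ n) x) (\<lambda>j. vscale E (1 / L ^ n) ((\<Phi> ^^ n) (u j)))"
  unfolding unit_tuple_def
proof (intro allI impI conjI)
  fix j assume "j < p"
  then have u: "u j \<in> fib x" "N (u j) \<le> 1" using assms by (auto simp: unit_tuple_def)
  show "vscale E (1 / L ^ n) ((\<Phi> ^^ n) (u j)) \<in> fib ((T ^^ n) x)" by (intro vscale_in iterate_in u)
  have "N (vscale E (1 / L ^ n) ((\<Phi> ^^ n) (u j))) = \<rho> n (u j)"
    using norm_scale[OF iterate_in[OF u(1)]] L_pos by (simp add: \<rho>_def)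
  then show "N (vscale E (1 / L ^ n) ((\<Phi> ^^ n) (u j))) \<le> 1" using rho_le[OF u(1), of n] u(2) by simp
qed

lemma volume_iterate:
  assumes vol: "is_volume p vol" and u: "\<And>j. j < p \<Longrightarrow> u j \<in> fib x"
  shows "vol ((T ^^ n) x) (\<lambda>j. (\<Phi> ^^ n) (u j)) = L ^ (n * p) * vol ((T ^^ n) x) (\<lambda>j. vscale E (1 / L ^ n) ((\<Phi> ^^ n) (u j)))"
  using volume_scale_all[OF vol, of "\<lambda>j. (\<Phi> ^^ n) (u j)" "(T ^^ n) x" "1 / L ^ n"] iterate_in[OF u] L_pos
  by (simp add: power_mult power_divide)

lemma conv_vscale:
  assumes y: "y \<longlonglongrightarrow> x" and v: "\<And>k. v k \<in> fib (y k)" and l: "conv v l" and c: "c \<longlonglongrightarrow> c'"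
  shows "conv (\<lambda>k. vscale E (c k) (v k)) (vscale E c' l)"
proof -
  have "comb z 1 (\<lambda>_. a) (\<lambda>_. w) = vscale E a w" if "w \<in> fib z" for z a w
    using vzero_add[OF vscale_in[OF that]] by simp
  moreover have "conv (\<lambda>k. comb (y k) 1 (\<lambda>_. c k) (\<lambda>_. v k)) (comb x 1 (\<lambda>_. c') (\<lambda>_. l))"
    by (rule conv_comb[OF y v l c])
  ultimately show ?thesis using v conv_fib[OF l v y] by simp
qed

lemma iterate_bounded_below: obtains B where "B > 0" "\<And>v n. v \<in> tot \<Longrightarrow> N v \<le> B ^ n * N ((\<Phi> ^^ n) v)"
proof -
  obtain B where B: "B > 0" "\<And>v. v \<in> tot \<Longrightarrow> N v \<le> B * N (\<Phi> v)" by (rule phi_bounded_below) blast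
  have "N v \<le> B ^ n * N ((\<Phi> ^^ n) v)" if "v \<in> tot" for n v
  proof (induction n)
    case (Suc n)
    have "B ^ n * N ((\<Phi> ^^ n) v) \<le> B ^ n * (B * N (\<Phi> ((\<Phi> ^^ n) v)))"
      using B iterate_tot[OF that] by (intro mult_left_mono) auto
    then show ?case using Suc by (simp add: mult_ac)
  qed simp
  then show ?thesis using that B(1) by blast
qed

lemma comb_iterate_scaled:
  assumes u: "\<And>j. j < k \<Longrightarrow> u j \<in> fib x"
  shows "comb ((T ^^ n) x) k t (\<lambda>j. vscale E c ((\<Phi> ^^ n) (u j))) = vscale E c ((\<Phi> ^^ n) (comb x k t u))"
proof -
  have i: "(\<Phi> ^^ n) (u j) \<in> fib ((T ^^ n) x)" if "j < k" for j using u[OF that] by (rule iterate_in)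
  have "comb ((T ^^ n) x) k t (\<lambda>j. vscale E c ((\<Phi> ^^ n) (u j))) = comb ((T ^^ n) x) k (\<lambda>j. c * t j) (\<lambda>j. (\<Phi> ^^ n) (u j))"
  proof (rule fib_eqI)
    fix U h i assume ch: "chart U h" "(T ^^ n) x \<in> U"
    show "crd h (comb ((T ^^ n) x) k t (\<lambda>j. vscale E c ((\<Phi> ^^ n) (u j)))) i =
        crd h (comb ((T ^^ n) x) k (\<lambda>j. c * t j) (\<lambda>j. (\<Phi> ^^ n) (u j))) i"
      using i by (simp add: crd_comb[OF ch] crd_scale[OF ch] vscale_in mult_ac)
  qed (use i in \<open>auto intro!: comb_in vscale_in\<close>)
  also have "\<dots> = vscale E c (comb ((T ^^ n) x) k t (\<lambda>j. (\<Phi> ^^ n) (u j)))"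
    by (rule comb_scale[symmetric]) (rule i)
  also have "comb ((T ^^ n) x) k t (\<lambda>j. (\<Phi> ^^ n) (u j)) = (\<Phi> ^^ n) (comb x k t u)"
    by (rule iterate_comb[symmetric]) (rule u)
  finally show ?thesis .
qed

lemma rho_comb_iterate_scaled:
  assumes u: "\<And>j. j < k \<Longrightarrow> u j \<in> fib x"
  shows "\<rho> m (comb ((T ^^ n) x) k t (\<lambda>j. vscale E (1 / L ^ n) ((\<Phi> ^^ n) (u j)))) = \<rho> (n + m) (comb x k t u)"
proof -
  have v: "comb x k t u \<in> fib x" by (rule comb_in) (rule u)
  have "comb ((T ^^ n) x) k t (\<lambda>j. vscale E (1 / L ^ n) ((\<Phi> ^^ n) (u j))) = vscale E (1 / L ^ n) ((\<Phi> ^^ n) (comb x k t u))"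
    by (rule comb_iterate_scaled) (rule u)
  then show ?thesis using rho_scale[OF iterate_in[OF v], of m "1 / L ^ n" n] L_pos by (simp add: rho_iterate)
qed

section \<open>The largest volume of a normalized image\<close>

text \<open>Up to a constant this is the operator norm of the exterior power divided by
  \<open>L ^ (n * p)\<close>. As an attained maximum of a continuous function over compact fibers of
  tuples it is semicontinuous, and so supplies a measurable substitute for \<open>f\<close>.\<close>

definition maxvol :: "nat \<Rightarrow> ('x \<Rightarrow> (nat \<Rightarrow> 'e) \<Rightarrow> real) \<Rightarrow> nat \<Rightarrow> 'x \<Rightarrow> real" where
  "maxvol p vol n x = (SUP u\<in>Collect (unit_tuple p x). vol ((T ^^ n) x) (\<lambda>j. vscale E (1 / L ^ n) ((\<Phi> ^^ n) (u j))))"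

lemma unit_tuple_ex: "\<exists>u. unit_tuple p x u"
  unfolding unit_tuple_def using vzero_in[of x] norm_zero[of x] by (intro exI[of _ "\<lambda>_. vzero E x"]) auto

text \<open>Unit tuples over one point subconverge and the volume is continuous, so the supremum is
  attained; exact maximizers are what \<open>bounded_below_imp_expanding\<close> takes limits
  of.\<close>

lemma
  assumes vol: "is_volume p vol"
  shows maxvol_upper: "unit_tuple p x u \<Longrightarrow> vol ((T ^^ n) x) (\<lambda>j. vscale E (1 / L ^ n) ((\<Phi> ^^ n) (u j))) \<le> maxvol p vol n x"
    and maxvol_least: "(\<And>u. unit_tuple p x u \<Longrightarrow> vol ((T ^^ n) x) (\<lambda>j. vscale E (1 / L ^ n) ((\<Phi> ^^ n) (u j))) \<le> K) \<Longrightarrow> maxvol p vol n x \<le> K"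
    and maxvol_attained: "\<exists>u. unit_tuple p x u \<and> vol ((T ^^ n) x) (\<lambda>j. vscale E (1 / L ^ n) ((\<Phi> ^^ n) (u j))) = maxvol p vol n x"
proof -
  let ?g = "\<lambda>x u. vol ((T ^^ n) x) (\<lambda>j. vscale E (1 / L ^ n) ((\<Phi> ^^ n) (u j)))"
  obtain C where C: "C > 0" "\<And>x u. unit_tuple p x u \<Longrightarrow> vol x u \<le> C" by (rule volume_bounded[OF vol]) blast
  have bdd: "bdd_above (?g x ` Collect (unit_tuple p x))"
    using C(2)[OF unit_tuple_iterate] by (intro bdd_aboveI2[where M = C]) auto
  show upper: "unit_tuple p x u \<Longrightarrow> ?g x u \<le> maxvol p vol n x" for u
    unfolding maxvol_def using bdd by (intro cSUP_upper) auto
  show "(\<And>u. unit_tuple p x u \<Longrightarrow> ?g x u \<le> K) \<Longrightarrow> maxvol p vol n x \<le> K" for K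
    unfolding maxvol_def using unit_tuple_ex by (intro cSUP_least) auto
  have "\<exists>u. unit_tuple p x u \<and> maxvol p vol n x - inverse (real (Suc i)) < ?g x u" for i
  proof -
    have "maxvol p vol n x - inverse (real (Suc i)) < maxvol p vol n x" by simp
    then show ?thesis unfolding maxvol_def[of p vol n x]
      using less_cSUP_iff[OF _ bdd] unit_tuple_ex[of p x] by auto
  qed
  then obtain u where u: "\<And>i. unit_tuple p x (u i)" "\<And>i. maxvol p vol n x - inverse (real (Suc i)) < ?g x (u i)" by metis
  obtain r l z where r: "strict_mono r" "(\<lambda>k. x) \<longlonglongrightarrow> z" "\<And>j. j < p \<Longrightarrow> conv (\<lambda>k. u (r k) j) (l j)" "\<And>j. j < p \<Longrightarrow> l j \<in> fib z"
  proof (rule bounded_tuple_subsequence[of p u "\<lambda>_. x" 1])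
    show "u n j \<in> fib x" "N (u n j) \<le> 1" if "j < p" for n j using u(1)[of n] that by (auto simp: unit_tuple_def)
  qed (rule that)
  have zx: "z = x" by (rule LIMSEQ_unique[OF r(2) tendsto_const])
  have "N (l j) \<le> 1" if "j < p" for j
    using conv_norm[OF r(3)[OF that]] by (rule LIMSEQ_le_const2) (use u(1) that in \<open>auto simp: unit_tuple_def\<close>)
  then have ut: "unit_tuple p x l" using r(4) zx by (auto simp: unit_tuple_def)
  have "(\<lambda>k. ?g x (u (r k))) \<longlonglongrightarrow> ?g x l"
  proof (rule volume_conv[OF vol tendsto_const])
    fix k j assume j: "j < p"
    show "vscale E (1 / L ^ n) ((\<Phi> ^^ n) (u (r k) j)) \<in> fib ((T ^^ n) x)"
      using unit_tuple_iterate[OF u(1)] j by (auto simp: unit_tuple_def)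
  next
    fix j assume j: "j < p"
    show "conv (\<lambda>k. vscale E (1 / L ^ n) ((\<Phi> ^^ n) (u (r k) j))) (vscale E (1 / L ^ n) ((\<Phi> ^^ n) (l j)))"
    proof (rule conv_vscale[OF tendsto_const _ iterate_conv[OF r(3)[OF j]] tendsto_const])
      show "(\<Phi> ^^ n) (u (r k) j) \<in> fib ((T ^^ n) x)" for k
        using u(1) j by (intro iterate_in) (auto simp: unit_tuple_def)
    qed
  qed
  moreover have "(\<lambda>k. maxvol p vol n x - inverse (real (Suc (r k)))) \<longlonglongrightarrow> maxvol p vol n x - 0"
    using LIMSEQ_subseq_LIMSEQ[OF LIMSEQ_inverse_real_of_nat r(1)] by (intro tendsto_intros) (simp add: o_def)
  ultimately have "maxvol p vol n x \<le> ?g x l"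
    by (intro LIMSEQ_le[of "\<lambda>k. maxvol p vol n x - inverse (real (Suc (r k)))" _ "\<lambda>k. ?g x (u (r k))"])
      (use u(2) in \<open>auto intro!: exI[of _ 0] less_imp_le\<close>)
  then show "\<exists>u. unit_tuple p x u \<and> ?g x u = maxvol p vol n x" using ut upper[OF ut] by (intro exI[of _ l]) auto
qed

text \<open>Upper semicontinuity, the source of measurability: maximizers over converging base
  points subconverge to a unit tuple over the limit point.\<close>

lemma maxvol_closed:
  assumes vol: "is_volume p vol" shows "closed {x. a \<le> maxvol p vol n x}"
  unfolding closed_sequential_limits
proof (intro allI impI)
  fix y x assume as: "(\<forall>k. y k \<in> {x. a \<le> maxvol p vol n x}) \<and> y \<longlonglongrightarrow> x"
  let ?g = "\<lambda>x u. vol ((T ^^ n) x) (\<lambda>j. vscale E (1 / L ^ n) ((\<Phi> ^^ n) (u j)))"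
  have "\<exists>u. unit_tuple p (y k) u \<and> ?g (y k) u = maxvol p vol n (y k)" for k by (rule maxvol_attained[OF vol])
  then obtain u where u: "\<And>k. unit_tuple p (y k) (u k)" "\<And>k. ?g (y k) (u k) = maxvol p vol n (y k)" by metis
  obtain r l z where r: "strict_mono r" "(\<lambda>k. y (r k)) \<longlonglongrightarrow> z" "\<And>j. j < p \<Longrightarrow> conv (\<lambda>k. u (r k) j) (l j)" "\<And>j. j < p \<Longrightarrow> l j \<in> fib z"
    by (rule bounded_tuple_subsequence[of p u y 1]) (use u(1) in \<open>auto simp: unit_tuple_def\<close>)
  have zx: "z = x" by (rule LIMSEQ_unique[OF r(2)]) (use LIMSEQ_subseq_LIMSEQ[OF conjunct2[OF as] r(1)] in \<open>simp add: o_def\<close>)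
  have "N (l j) \<le> 1" if "j < p" for j
    using conv_norm[OF r(3)[OF that]] by (rule LIMSEQ_le_const2) (use u(1) that in \<open>auto simp: unit_tuple_def\<close>)
  then have ut: "unit_tuple p x l" using r(4) zx by (auto simp: unit_tuple_def)
  have yr: "(\<lambda>k. (T ^^ n) (y (r k))) \<longlonglongrightarrow> (T ^^ n) x" using Tn_tendsto[OF r(2)] zx by simp
  have "(\<lambda>k. ?g (y (r k)) (u (r k))) \<longlonglongrightarrow> ?g x l"
  proof (rule volume_conv[OF vol yr])
    fix k j assume j: "j < p"
    show "vscale E (1 / L ^ n) ((\<Phi> ^^ n) (u (r k) j)) \<in> fib ((T ^^ n) (y (r k)))"
      using unit_tuple_iterate[OF u(1)] j by (auto simp: unit_tuple_def)
  next
    fix j assume j: "j < p"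
    show "conv (\<lambda>k. vscale E (1 / L ^ n) ((\<Phi> ^^ n) (u (r k) j))) (vscale E (1 / L ^ n) ((\<Phi> ^^ n) (l j)))"
    proof (rule conv_vscale[OF yr _ iterate_conv[OF r(3)[OF j]] tendsto_const])
      show "(\<Phi> ^^ n) (u (r k) j) \<in> fib ((T ^^ n) (y (r k)))" for k
        using u(1) j by (intro iterate_in) (auto simp: unit_tuple_def)
    qed
  qed
  then have "a \<le> ?g x l" by (rule LIMSEQ_le_const) (use as u(2) in auto)
  then show "x \<in> {x. a \<le> maxvol p vol n x}" using maxvol_upper[OF vol ut, of n] by simp
qed

lemma maxvol_measurable: "is_volume p vol \<Longrightarrow> maxvol p vol n \<in> borel_measurable borel"
  unfolding borel_measurable_iff_ge using maxvol_closed by (auto intro: borel_closed)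

lemma vscale_vscale: "v \<in> fib x \<Longrightarrow> vscale E a (vscale E b v) = vscale E (a * b) v"
  by (rule fib_eqI) (auto intro!: vscale_in simp: crd_scale vscale_in)

text \<open>Pulling a tuple back by \<open>n\<close> steps increases norms at most by
  \<open>B ^ n\<close>, so the normalized volume decays at most exponentially. This keeps the
  logarithms finite and of linear growth.\<close>

lemma maxvol_lower:
  assumes vol: "is_volume p vol" and gr: "is_growth p vol f C"
  obtains c b where "0 < c" "0 < b" "\<And>n x. c * b ^ n \<le> maxvol p vol n x"
proof -
  obtain B where B: "B > 0" and Bn: "\<And>v n. v \<in> tot \<Longrightarrow> N v \<le> B ^ n * N ((\<Phi> ^^ n) v)"
    by (rule iterate_bounded_below) blast
  have Cp: "C > 0" using gr by (simp add: is_growth_def)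
  have "1 / C * ((1 / (L * B)) ^ p) ^ n \<le> maxvol p vol n x" for n x
  proof -
    let ?y = "(T ^^ n) x"
    \<comment> \<open>Growth at time 0 provides a unit tuple over the endpoint \<open>?y\<close> of
      volume at least \<open>1 / C\<close>; its preimage, shrunk by \<open>B ^ n\<close>, is a unit
      tuple over \<open>x\<close>.\<close>
    have "\<exists>v. unit_tuple p ?y v \<and> f 0 ?y \<le> C * vol ((T ^^ 0) ?y) (\<lambda>j. (\<Phi> ^^ 0) (v j))" "1 \<le> f 0 ?y"
      using gr unfolding is_growth_def by blast+
    then obtain v where v: "unit_tuple p ?y v" "f 0 ?y \<le> C * vol ?y v" "1 \<le> f 0 ?y" by auto
    have vy: "1 / C \<le> vol ?y v" using v(2,3) Cp by (simp add: field_simps)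
    have "\<exists>w\<in>fib x. (\<Phi> ^^ n) w = v j" if "j < p" for j
      using v(1) that by (intro iterate_surj) (auto simp: unit_tuple_def)
    then obtain w where w: "\<And>j. j < p \<Longrightarrow> w j \<in> fib x" "\<And>j. j < p \<Longrightarrow> (\<Phi> ^^ n) (w j) = v j" by metis
    define u where "u j = vscale E (1 / B ^ n) (w j)" for j
    have ut: "unit_tuple p x u" unfolding unit_tuple_def
    proof (intro allI impI conjI)
      fix j assume j: "j < p"
      show "u j \<in> fib x" unfolding u_def using w(1)[OF j] by (rule vscale_in)
      have "N (w j) \<le> B ^ n * N (v j)" using Bn[OF fib_tot[OF w(1)[OF j]], of n] w(2)[OF j] by simp
      also have "\<dots> \<le> B ^ n * 1" using v(1) j B by (intro mult_left_mono) (auto simp: unit_tuple_def)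
      finally show "N (u j) \<le> 1" unfolding u_def using norm_scale[OF w(1)[OF j]] B by simp
    qed
    have vf: "v j \<in> fib ?y" if "j < p" for j using v(1) that by (auto simp: unit_tuple_def)
    have "vscale E (1 / L ^ n) ((\<Phi> ^^ n) (u j)) = vscale E ((1 / (L * B)) ^ n) (v j)" if j: "j < p" for j
      unfolding u_def iterate_scale[OF w(1)[OF j]] w(2)[OF j] vscale_vscale[OF vf[OF j]]
      by (simp add: power_divide power_mult_distrib)
    then have "vol ?y (\<lambda>j. vscale E (1 / L ^ n) ((\<Phi> ^^ n) (u j))) = vol ?y (\<lambda>j. vscale E ((1 / (L * B)) ^ n) (v j))"
      by (rule volume_cong[OF vol])
    also have "\<dots> = \<bar>(1 / (L * B)) ^ n\<bar> ^ p * vol ?y v" using vf by (rule volume_scale_all[OF vol])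
    also have "\<bar>(1 / (L * B)) ^ n\<bar> ^ p = ((1 / (L * B)) ^ p) ^ n"
      using L_pos B by (simp add: power_mult[symmetric] mult.commute)
    finally have "vol ?y (\<lambda>j. vscale E (1 / L ^ n) ((\<Phi> ^^ n) (u j))) = ((1 / (L * B)) ^ p) ^ n * vol ?y v" .
    moreover have "1 / C * ((1 / (L * B)) ^ p) ^ n \<le> ((1 / (L * B)) ^ p) ^ n * vol ?y v"
      using vy L_pos B by (subst mult.commute) (intro mult_left_mono, auto)
    ultimately show ?thesis using maxvol_upper[OF vol ut, of n] by linarith
  qed
  then show ?thesis using that[of "1 / C" "(1 / (L * B)) ^ p"] Cp L_pos B by simp
qed

lemma growth_maxvol:
  assumes vol: "is_volume p vol" and gr: "is_growth p vol f C"
  shows "L ^ (n * p) * maxvol p vol n x \<le> C * f n x" and "f n x \<le> C * (L ^ (n * p) * maxvol p vol n x)"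
proof -
  have Cp: "C > 0" using gr by (simp add: is_growth_def)
  have "maxvol p vol n x \<le> C * f n x / L ^ (n * p)"
  proof (rule maxvol_least[OF vol])
    fix u assume u: "unit_tuple p x u"
    then have "vol ((T ^^ n) x) (\<lambda>j. (\<Phi> ^^ n) (u j)) \<le> C * f n x" using gr by (auto simp: is_growth_def)
    then show "vol ((T ^^ n) x) (\<lambda>j. vscale E (1 / L ^ n) ((\<Phi> ^^ n) (u j))) \<le> C * f n x / L ^ (n * p)"
      using volume_iterate[OF vol, of u x n] u L_pos by (simp add: unit_tuple_def pos_le_divide_eq mult.commute)
  qed
  then show "L ^ (n * p) * maxvol p vol n x \<le> C * f n x" using L_pos by (simp add: pos_le_divide_eq mult.commute)
  obtain u where u: "unit_tuple p x u" "f n x \<le> C * vol ((T ^^ n) x) (\<lambda>j. (\<Phi> ^^ n) (u j))"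
    using gr unfolding is_growth_def by blast
  have "vol ((T ^^ n) x) (\<lambda>j. (\<Phi> ^^ n) (u j)) \<le> L ^ (n * p) * maxvol p vol n x"
    using volume_iterate[OF vol, of u x n] maxvol_upper[OF vol u(1), of n] u(1) L_pos by (simp add: unit_tuple_def)
  then have "C * vol ((T ^^ n) x) (\<lambda>j. (\<Phi> ^^ n) (u j)) \<le> C * (L ^ (n * p) * maxvol p vol n x)"
    using Cp by (intro mult_left_mono) auto
  then show "f n x \<le> C * (L ^ (n * p) * maxvol p vol n x)" using u(2) by linarith
qed

text \<open>The factor $C^3$ absorbs the comparison constants and makes the sequence subadditive; at \<open>n = 0\<close> that
  would fail, so the value there is set to zero.\<close>

definition log_growth :: "nat \<Rightarrow> ('x \<Rightarrow> (nat \<Rightarrow> 'e) \<Rightarrow> real) \<Rightarrow> real \<Rightarrow> nat \<Rightarrow> 'x \<Rightarrow> real" where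
  "log_growth p vol C n x = (if n = 0 then 0 else ln (C ^ 3 * maxvol p vol n x))"

lemma maxvol_pos:
  assumes vol: "is_volume p vol" and gr: "is_growth p vol f C" shows "0 < maxvol p vol n x"
proof -
  obtain c b where cb: "0 < c" "0 < b" "\<And>n x. c * b ^ n \<le> maxvol p vol n x" by (rule maxvol_lower[OF vol gr]) blast
  have "0 < c * b ^ n" using cb by simp
  then show ?thesis using cb(3)[of n x] by linarith
qed

lemma log_growth_subadditive:
  assumes vol: "is_volume p vol" and gr: "is_growth p vol f C"
  shows "log_growth p vol C (m + n) x \<le> log_growth p vol C m x + log_growth p vol C n ((T ^^ m) x)"
proof (cases "m = 0 \<or> n = 0")
  case True then show ?thesis by (auto simp: log_growth_def)
next
  case False
  have Cp: "C > 0" using gr by (simp add: is_growth_def)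
  let ?M = "maxvol p vol"
  note pos = maxvol_pos[OF vol gr]
  have fpos: "0 \<le> f n x" for n x
  proof -
    have "0 \<le> L ^ (n * p) * ?M n x" using pos[of n x] L_pos by simp
    then have "0 \<le> C * f n x" using growth_maxvol(1)[OF vol gr, of n x] by linarith
    then show ?thesis using Cp by (simp add: zero_le_mult_iff)
  qed
  have "L ^ ((m + n) * p) * ?M (m + n) x \<le> C * f (m + n) x" by (rule growth_maxvol[OF vol gr])
  also have "\<dots> \<le> C * (f m x * f n ((T ^^ m) x))" using gr Cp by (intro mult_left_mono) (auto simp: is_growth_def)
  also have "\<dots> \<le> C * ((C * (L ^ (m * p) * ?M m x)) * (C * (L ^ (n * p) * ?M n ((T ^^ m) x))))"
    using Cp fpos growth_maxvol(2)[OF vol gr] pos L_pos by (intro mult_left_mono mult_mono) (auto intro: less_imp_le)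
  also have "\<dots> = L ^ ((m + n) * p) * (C ^ 3 * ?M m x * ?M n ((T ^^ m) x))"
    by (simp add: power3_eq_cube power_add distrib_right)
  finally have "?M (m + n) x \<le> C ^ 3 * ?M m x * ?M n ((T ^^ m) x)" using L_pos by simp
  then have "C ^ 3 * ?M (m + n) x \<le> C ^ 3 * (C ^ 3 * ?M m x * ?M n ((T ^^ m) x))" using Cp by simp
  then have "ln (C ^ 3 * ?M (m + n) x) \<le> ln ((C ^ 3 * ?M m x) * (C ^ 3 * ?M n ((T ^^ m) x)))"
    using Cp pos by (subst ln_le_cancel_iff) (auto simp: mult_ac)
  also have "\<dots> = ln (C ^ 3 * ?M m x) + ln (C ^ 3 * ?M n ((T ^^ m) x))"
    using Cp pos by (intro ln_mult_pos) auto
  finally show ?thesis using False by (simp add: log_growth_def)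
qed

text \<open>The linear bound is a hypothesis of Kingman's theorem. The constant upper bound
  expresses the contraction of the normalized iterates and is what later turns a zero growth rate
  into boundedness.\<close>

lemma log_growth_bounds:
  assumes vol: "is_volume p vol" and gr: "is_growth p vol f C"
  obtains D where "0 < D" "\<And>n x. log_growth p vol C n x \<le> D" "\<And>n x. \<bar>log_growth p vol C n x\<bar> \<le> D * real n"
proof -
  have Cp: "C ^ 3 > 0" using gr by (simp add: is_growth_def)
  obtain C0 where C0: "C0 > 0" "\<And>x u. unit_tuple p x u \<Longrightarrow> vol x u \<le> C0" by (rule volume_bounded[OF vol]) blast
  obtain c b where cb: "0 < c" "0 < b" "\<And>n x. c * b ^ n \<le> maxvol p vol n x" by (rule maxvol_lower[OF vol gr]) blast
  note pos = maxvol_pos[OF vol gr]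
  have up: "maxvol p vol n x \<le> C0" for n x using C0(2)[OF unit_tuple_iterate] by (intro maxvol_least[OF vol])
  define D where "D = \<bar>ln (C ^ 3 * C0)\<bar> + \<bar>ln (C ^ 3 * c)\<bar> + \<bar>ln b\<bar> + 1"
  have D: "0 < D" by (simp add: D_def add_pos_pos add_nonneg_pos)
  have u1: "log_growth p vol C n x \<le> \<bar>ln (C ^ 3 * C0)\<bar>" for n x
  proof (cases "n = 0")
    case False
    have "ln (C ^ 3 * maxvol p vol n x) \<le> ln (C ^ 3 * C0)"
      using up[of n x] pos[of n x] Cp C0(1) by (subst ln_le_cancel_iff) auto
    then show ?thesis using False by (simp add: log_growth_def)
  qed (simp add: log_growth_def)
  have l1: "log_growth p vol C n x \<ge> - \<bar>ln (C ^ 3 * c)\<bar> - \<bar>ln b\<bar> * real n" if "n \<noteq> 0" for n x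
  proof -
    have "ln (C ^ 3 * c * b ^ n) \<le> ln (C ^ 3 * maxvol p vol n x)"
      using cb Cp pos[of n x] by (subst ln_le_cancel_iff) (auto simp: mult.assoc)
    moreover have "ln (C ^ 3 * c * b ^ n) = ln (C ^ 3 * c) + real n * ln b"
      using cb Cp by (subst ln_mult_pos) (auto simp: ln_realpow)
    moreover have "real n * ln b \<ge> - (\<bar>ln b\<bar> * real n)"
      by (metis abs_ge_minus_self abs_mult abs_of_nat minus_le_iff mult.commute)
    ultimately show ?thesis using that by (simp add: log_growth_def)
  qed
  show ?thesis
  proof (rule that[OF D])
    fix n x
    show "log_growth p vol C n x \<le> D" using u1[of n x] by (simp add: D_def)
    show "\<bar>log_growth p vol C n x\<bar> \<le> D * real n"
    proof (cases "n = 0")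
      case False
      then have n1: "1 \<le> real n" by simp
      have e: "a \<le> a * real n" if "0 \<le> a" for a :: real using mult_left_mono[OF n1 that] by simp
      have "log_growth p vol C n x \<le> D * real n"
        using u1[of n x] e[of "\<bar>ln (C ^ 3 * C0)\<bar>"] D_def
        by (smt (verit, best) abs_ge_zero mult_right_mono n1 D e)
      moreover have "- (D * real n) \<le> log_growth p vol C n x"
      proof -
        have "\<bar>ln (C ^ 3 * c)\<bar> \<le> \<bar>ln (C ^ 3 * c)\<bar> * real n" by (rule e) simp
        then have "\<bar>ln (C ^ 3 * c)\<bar> + \<bar>ln b\<bar> * real n \<le> (\<bar>ln (C ^ 3 * c)\<bar> + \<bar>ln b\<bar>) * real n"
          by (simp add: distrib_right)
        also have "\<dots> \<le> D * real n" by (intro mult_right_mono) (auto simp: D_def)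
        finally show ?thesis using l1[OF False, of x] by linarith
      qed
      ultimately show ?thesis by (simp add: abs_le_iff)
    qed (simp add: log_growth_def)
  qed
qed

lemma log_growth_lim:
  assumes vol: "is_volume p vol" and gr: "is_growth p vol f C"
  shows "(\<lambda>n. (1 / real n) * ln (f n x) - (real p * ln L + log_growth p vol C n x / real n)) \<longlonglongrightarrow> 0"
proof -
  have Cp: "C > 0" using gr by (simp add: is_growth_def)
  note pos = maxvol_pos[OF vol gr]
  have bd: "\<bar>ln (f n x) - (real n * (real p * ln L) + log_growth p vol C n x)\<bar> \<le> \<bar>ln C\<bar> + \<bar>ln (C ^ 3)\<bar>" if n: "n \<ge> 1" for n
  proof -
    let ?m = "L ^ (n * p) * maxvol p vol n x"
    have m: "?m > 0" using pos L_pos by simp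
    have fp: "f n x > 0"
    proof -
      have "0 < C * f n x" using growth_maxvol(1)[OF vol gr, of n x] m by linarith
      then show ?thesis using Cp by (simp add: zero_less_mult_iff)
    qed
    have "ln (f n x) \<le> ln (C * ?m)" using growth_maxvol(2)[OF vol gr, of n x] fp Cp m by (subst ln_le_cancel_iff) auto
    also have "\<dots> = ln C + ln ?m" using Cp m by (intro ln_mult_pos) auto
    finally have 1: "ln (f n x) \<le> ln C + ln ?m" .
    have "ln ?m \<le> ln (C * f n x)" using growth_maxvol(1)[OF vol gr, of n x] fp Cp m by (subst ln_le_cancel_iff) auto
    also have "\<dots> = ln C + ln (f n x)" using Cp fp by (intro ln_mult_pos) auto
    finally have 2: "ln ?m \<le> ln C + ln (f n x)" .
    have 3: "ln ?m = real n * (real p * ln L) + ln (maxvol p vol n x)"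
      using pos[of n x] L_pos by (subst ln_mult_pos) (auto simp: ln_realpow)
    have 4: "log_growth p vol C n x = ln (C ^ 3) + ln (maxvol p vol n x)"
      unfolding log_growth_def using n pos[of n x] Cp by (subst ln_mult_pos) auto
    show ?thesis using 1 2 3 4 by linarith
  qed
  have "(\<lambda>n. (1 / real n) * ln (f n x) - (1 / real n) * (real n * (real p * ln L) + log_growth p vol C n x)) \<longlonglongrightarrow> 0"
    by (rule lim_scaled_eq[OF bd])
  moreover have "eventually (\<lambda>n. (1 / real n) * ln (f n x) - (1 / real n) * (real n * (real p * ln L) + log_growth p vol C n x) =
      (1 / real n) * ln (f n x) - (real p * ln L + log_growth p vol C n x / real n)) sequentially"
    using eventually_ge_at_top[of 1] by eventually_elim (simp add: distrib_left)
  ultimately show ?thesis by (rule Lim_transform_eventually)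
qed

lemma log_growth_measurable: "is_volume p vol \<Longrightarrow> log_growth p vol C n \<in> borel_measurable borel"
  unfolding log_growth_def[abs_def] using maxvol_measurable[of p vol n] by measurable

section \<open>From exponents to expanding tuples and back\<close>

text \<open>The growth rate has mean zero, so by subadditivity no mean of \<open>log_growth\<close>
  at a positive time is negative. As these functions are bounded above by \<open>D\<close>, very
  negative values have small probability uniformly in time, and a very negative value at one time
  persists at all later times up to \<open>D\<close>. Hence a low value at any time of the orbit is
  as improbable as one at a single time.\<close>

lemma exponent_full_imp_bounded_below:
  assumes vol: "is_volume p vol" and gr: "is_growth p vol f C"
    and \<mu>: "prob_space \<mu>" "sets \<mu> = sets borel" "distr \<mu> borel T = \<mu>"
    and full: "(LINT x|\<mu>. lim (\<lambda>n. (1 / real n) * ln (f n x))) = real p * ln L"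
  shows "AE x in \<mu>. \<exists>c>0. \<forall>n. c \<le> maxvol p vol n x"
proof -
  let ?h = "log_growth p vol C"
  have meas_eq: "measurable \<mu> A = measurable borel A" for A :: "'c measure" using \<mu>(2) by (rule measurable_cong_sets) simp
  interpret measure_preserving \<mu> T by (rule measure_preserving_borel[OF T_cont \<mu>])
  have sp: "space \<mu> = UNIV" using \<mu>(2) by (metis sets_eq_imp_space_eq space_borel)
  have hm[measurable]: "?h n \<in> borel_measurable \<mu>" for n
    using log_growth_measurable[OF vol] by (simp add: meas_eq)
  obtain D where D: "0 < D" "\<And>n x. ?h n x \<le> D" "\<And>n x. \<bar>?h n x\<bar> \<le> D * real n"
    by (rule log_growth_bounds[OF vol gr]) blast
  have sub: "?h (m + n) x \<le> ?h m x + ?h n ((T ^^ m) x)" for m n x by (rule log_growth_subadditive[OF vol gr])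
  have conv: "AE x in \<mu>. convergent (\<lambda>n. ?h n x / real n)"
    by (rule kingman_convergent[where C = D]) (use sub D(3) in auto)
  define g where "g x = lim (\<lambda>n. ?h n x / real n)" for x
  have [measurable]: "g \<in> borel_measurable \<mu>" unfolding g_def[abs_def] by (intro borel_measurable_lim_metric) measurable
  define w where "w x = lim (\<lambda>n. (1 / real n) * ln (f n x))" for x
  \<comment> \<open>Measurability of \<open>w\<close> is inherited from \<open>maxvol\<close>, to
    which the growth \<open>f\<close> is only comparable; the equality is pointwise and includes
    points without a limit.\<close>
  have w_eq: "w x = lim (\<lambda>n. real p * ln L + ?h n x / real n)" for x
    unfolding w_def by (rule lim_eq_of_diff[OF log_growth_lim[OF vol gr]])
  have [measurable]: "w \<in> borel_measurable \<mu>"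
    unfolding w_eq[abs_def] by (intro borel_measurable_lim_metric) measurable
  have glim: "AE x in \<mu>. (\<lambda>n. ?h n x / real n) \<longlonglongrightarrow> g x"
    using conv by eventually_elim (simp add: g_def convergent_LIMSEQ_iff)
  have wg: "AE x in \<mu>. w x = real p * ln L + g x"
    using glim
  proof eventually_elim
    case (elim x)
    show ?case unfolding w_eq by (rule limI) (intro tendsto_add tendsto_const elim)
  qed
  have hb: "\<bar>?h n x / real n\<bar> \<le> D" for n x
    using D(3)[of n x] D(1) by (cases "n = 0") (auto simp: abs_divide pos_divide_le_eq)
  have gb: "AE x in \<mu>. norm (g x) \<le> D"
    using glim
  proof eventually_elim
    case (elim x)
    have "(\<lambda>n. \<bar>?h n x / real n\<bar>) \<longlonglongrightarrow> \<bar>g x\<bar>" using elim by (rule tendsto_rabs)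
    then show ?case using hb by (simp only: real_norm_def) (rule LIMSEQ_le_const2, auto)
  qed
  have gint: "integrable \<mu> g" by (rule integrable_const_bound[OF gb]) measurable
  have "(LINT x|\<mu>. w x) = (LINT x|\<mu>. real p * ln L + g x)" by (rule integral_cong_AE) (use wg in auto)
  also have "\<dots> = real p * ln L + (LINT x|\<mu>. g x)" using gint by (simp add: prob_space)
  finally have g0: "(LINT x|\<mu>. g x) = 0" using full by (simp add: w_def)
  have hint: "integrable \<mu> (?h n)" for n by (rule integrable_bounded[of _ "D * real n"]) (use D(3) in auto)
  have hTint: "integrable \<mu> (\<lambda>x. ?h n ((T ^^ m) x))" for n m
    by (rule integrable_bounded[of _ "D * real n"]) (use D(3) in auto)
  \<comment> \<open>The mean at time \<open>k * n\<close> is at most \<open>k\<close> times the mean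
    at time \<open>n\<close>, while divided by \<open>k * n\<close> it tends to the mean of
    \<open>g\<close>, which is 0.\<close>
  have hpos: "0 \<le> (LINT x|\<mu>. ?h n x)" if n: "n \<ge> 1" for n
  proof -
    have kn: "(LINT x|\<mu>. ?h (k * n) x) \<le> real k * (LINT x|\<mu>. ?h n x)" for k
    proof (induction k)
      case (Suc k)
      have "(LINT x|\<mu>. ?h (Suc k * n) x) \<le> (LINT x|\<mu>. ?h (k * n) x + ?h n ((T ^^ (k * n)) x))"
        using sub[of "k * n" n] by (intro integral_mono hint Bochner_Integration.integrable_add hTint) (simp add: add.commute)
      also have "\<dots> = (LINT x|\<mu>. ?h (k * n) x) + (LINT x|\<mu>. ?h n ((T ^^ (k * n)) x))"
        by (intro Bochner_Integration.integral_add hint hTint)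
      also have "(LINT x|\<mu>. ?h n ((T ^^ (k * n)) x)) = (LINT x|\<mu>. ?h n x)" by (rule integral_iterate) measurable
      finally show ?case using Suc by (simp add: algebra_simps)
    qed (simp add: log_growth_def)
    have lim: "(\<lambda>m. LINT x|\<mu>. ?h m x / real m) \<longlonglongrightarrow> (LINT x|\<mu>. g x)"
      by (rule integral_dominated_convergence[where w = "\<lambda>_. D"]) (use glim hb in auto)
    \<comment> \<open>The multiples of \<open>n\<close> are taken from \<open>Suc k\<close> on, so
      that all divisors are positive.\<close>
    have sm: "strict_mono (\<lambda>k. Suc k * n)" using n by (auto simp: strict_mono_def)
    have "(\<lambda>k. LINT x|\<mu>. ?h (Suc k * n) x / real (Suc k * n)) \<longlonglongrightarrow> 0"
      using LIMSEQ_subseq_LIMSEQ[OF lim sm] g0 by (simp add: o_def)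
    moreover have "(LINT x|\<mu>. ?h (Suc k * n) x / real (Suc k * n)) \<le> (LINT x|\<mu>. ?h n x) / real n" for k
    proof -
      have "(LINT x|\<mu>. ?h (Suc k * n) x / real (Suc k * n)) = (LINT x|\<mu>. ?h (Suc k * n) x) / real (Suc k * n)" by simp
      also have "\<dots> \<le> (real (Suc k) * (LINT x|\<mu>. ?h n x)) / real (Suc k * n)" by (intro divide_right_mono kn) simp
      also have "\<dots> = (LINT x|\<mu>. ?h n x) / real n" unfolding of_nat_mult by (rule mult_divide_mult_cancel_left) simp
      finally show ?thesis .
    qed
    ultimately have "0 \<le> (LINT x|\<mu>. ?h n x) / real n" by (intro LIMSEQ_le_const2) blast+
    then show ?thesis using n by (simp add: zero_le_divide_iff)
  qed
  \<comment> \<open>Markov's inequality for a function bounded above by \<open>D\<close>: a set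
    where it is below \<open>- R\<close> lowers the mean by at least \<open>R\<close> times its
    probability.\<close>
  have markov: "prob {x \<in> space \<mu>. ?h n x < - R} \<le> D / R" if R: "R > 0" and n: "n \<ge> 1" for n R
  proof -
    let ?A = "{x \<in> space \<mu>. ?h n x < - R}"
    have [measurable]: "?A \<in> sets \<mu>" by measurable
    have "0 \<le> (LINT x|\<mu>. ?h n x)" by (rule hpos[OF n])
    also have "\<dots> \<le> (LINT x|\<mu>. D - R * indicator ?A x)"
    proof (intro integral_mono hint)
      show "integrable \<mu> (\<lambda>x. D - R * indicator ?A x)"
        by (rule integrable_bounded[of _ "D + R"]) (use D(1) R in \<open>auto simp: indicator_def\<close>)
      fix x show "?h n x \<le> D - R * indicator ?A x"
        using D(1) D(2)[of n x] by (auto simp: indicator_def)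
    qed
    also have "\<dots> = D - R * prob ?A" 
    proof -
      have "integrable \<mu> (\<lambda>x. R * indicator ?A x)"
        by (rule integrable_bounded[of _ R]) (use R in \<open>auto simp: indicator_def\<close>)
      from Bochner_Integration.integral_diff[OF integrable_const[of D] this] show ?thesis by (simp add: prob_space)
    qed
    finally show ?thesis using R by (simp add: field_simps)
  qed
  \<comment> \<open>If the value at time \<open>j\<close> is below \<open>- R - D\<close>,
    subadditivity and the bound \<open>D\<close> for the remaining time keep the value at
    \<open>Suc n\<close> below \<open>- R\<close> for every \<open>n \<ge> j\<close>. So finitely
    many events are contained in one, with probability at most \<open>D / R\<close>.\<close>
  define Bad where "Bad R = {x \<in> space \<mu>. \<exists>j. ?h j x < - R - D}" for R
  have [measurable]: "Bad R \<in> sets \<mu>" for R unfolding Bad_def by measurable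
  have bad: "prob (Bad R) \<le> D / R" if R: "R > 0" for R
  proof -
    define A where "A n = {x \<in> space \<mu>. \<exists>j\<le>n. ?h j x < - R - D}" for n
    have [measurable]: "A n \<in> sets \<mu>" for n unfolding A_def by measurable
    have "prob (A n) \<le> D / R" for n
    proof -
      have "A n \<subseteq> {x \<in> space \<mu>. ?h (Suc n) x < - R}"
      proof
        fix x assume "x \<in> A n"
        then obtain j where j: "j \<le> n" "?h j x < - R - D" "x \<in> space \<mu>" by (auto simp: A_def)
        have "?h (j + (Suc n - j)) x \<le> ?h j x + ?h (Suc n - j) ((T ^^ j) x)" by (rule sub)
        then have "?h (Suc n) x \<le> ?h j x + D" using j(1) D(2)[of "Suc n - j" "(T ^^ j) x"] by simp
        then show "x \<in> {x \<in> space \<mu>. ?h (Suc n) x < - R}" using j by simp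
      qed
      then have "prob (A n) \<le> prob {x \<in> space \<mu>. ?h (Suc n) x < - R}" by (intro finite_measure_mono) auto
      also have "\<dots> \<le> D / R" by (rule markov[OF R]) simp
      finally show ?thesis .
    qed
    moreover have "(\<lambda>n. prob (A n)) \<longlonglongrightarrow> prob (\<Union>n. A n)"
    proof (rule finite_Lim_measure_incseq)
      show "incseq A" unfolding incseq_def A_def by (intro allI impI Collect_mono) (meson order_trans)
    qed auto
    ultimately have "prob (\<Union>n. A n) \<le> D / R" by (intro LIMSEQ_le_const2) auto
    moreover have "(\<Union>n. A n) = Bad R" unfolding A_def Bad_def by blast
    ultimately show ?thesis by simp
  qed
  have "prob (\<Inter>k. Bad (real (Suc k))) \<le> D / real (Suc k)" for k
    using order_trans[OF finite_measure_mono bad[of "real (Suc k)"], of "\<Inter>k. Bad (real (Suc k))"] by auto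
  moreover have "(\<lambda>k. D / real (Suc k)) \<longlonglongrightarrow> 0"
    using LIMSEQ_Suc[OF lim_const_over_n[of D]] by simp
  ultimately have "prob (\<Inter>k. Bad (real (Suc k))) \<le> 0" by (intro LIMSEQ_le_const) blast+
  then have "prob (\<Inter>k. Bad (real (Suc k))) = 0" using measure_nonneg[of \<mu> "\<Inter>k. Bad (real (Suc k))"] by linarith
  then have "AE x in \<mu>. x \<notin> (\<Inter>k. Bad (real (Suc k)))" by (subst prob_eq_0[symmetric]) auto
  then show ?thesis
  proof (rule AE_mp, intro AE_I2 impI)
    fix x assume "x \<in> space \<mu>" "x \<notin> (\<Inter>k. Bad (real (Suc k)))"
    then obtain k where k: "\<And>j. ?h j x \<ge> - real (Suc k) - D" unfolding Bad_def by (auto simp: not_less)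
    have Cp: "C ^ 3 > 0" using gr by (simp add: is_growth_def)
    note pos = maxvol_pos[OF vol gr]
    \<comment> \<open>Time 0 is treated separately because \<open>log_growth\<close> was set to zero
      there.\<close>
    have "min (maxvol p vol 0 x) (exp (- real (Suc k) - D) / C ^ 3) \<le> maxvol p vol n x" for n
    proof (cases "n = 0")
      case False
      have "exp (- real (Suc k) - D) \<le> exp (ln (C ^ 3 * maxvol p vol n x))"
        using k[of n] False by (simp add: log_growth_def)
      also have "\<dots> = C ^ 3 * maxvol p vol n x" using Cp pos by (intro exp_ln) auto
      finally show ?thesis using Cp by (simp add: pos_divide_le_eq mult.commute min.coboundedI2)
    qed simp
    then show "\<exists>c>0. \<forall>n. c \<le> maxvol p vol n x"
      using Cp pos[of 0 x] by (intro exI[of _ "min (maxvol p vol 0 x) (exp (- real (Suc k) - D) / C ^ 3)"]) auto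
  qed
qed

text \<open>A positive lower bound on the volumes bounds \<open>log_growth\<close> from below, and
  it is always bounded above; divided by \<open>n\<close> it tends to 0, so that the rate is exactly
  \<open>p * ln L\<close>.\<close>

lemma bounded_below_imp_exponent_full:
  assumes vol: "is_volume p vol" and gr: "is_growth p vol f C"
    and \<mu>: "prob_space \<mu>" "sets \<mu> = sets borel"
    and low: "AE x in \<mu>. \<exists>c>0. \<forall>n. c \<le> maxvol p vol n x"
  shows "(LINT x|\<mu>. lim (\<lambda>n. (1 / real n) * ln (f n x))) = real p * ln L"
proof -
  let ?h = "log_growth p vol C"
  interpret prob_space \<mu> by fact
  have hm[measurable]: "?h n \<in> borel_measurable \<mu>" for n
    using log_growth_measurable[OF vol] measurable_cong_sets[OF \<mu>(2) refl] by blast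
  obtain D where D: "0 < D" "\<And>n x. ?h n x \<le> D" by (rule log_growth_bounds[OF vol gr]) blast
  define w where "w x = lim (\<lambda>n. (1 / real n) * ln (f n x))" for x
  have w_eq: "w x = lim (\<lambda>n. real p * ln L + ?h n x / real n)" for x
    unfolding w_def by (rule lim_eq_of_diff[OF log_growth_lim[OF vol gr]])
  have [measurable]: "w \<in> borel_measurable \<mu>"
    unfolding w_eq[abs_def] by (intro borel_measurable_lim_metric) measurable
  have Cp: "C ^ 3 > 0" using gr by (simp add: is_growth_def)
  have "AE x in \<mu>. w x = real p * ln L"
    using low
  proof eventually_elim
    case (elim x)
    then obtain c where c: "c > 0" "\<And>n. c \<le> maxvol p vol n x" by blast
    have hl: "?h n x \<ge> - \<bar>ln (C ^ 3 * c)\<bar>" for n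
    proof (cases "n = 0")
      case False
      have "ln (C ^ 3 * c) \<le> ln (C ^ 3 * maxvol p vol n x)"
        using c Cp maxvol_pos[OF vol gr, of n x] by (subst ln_le_cancel_iff) auto
      then show ?thesis using False by (simp add: log_growth_def)
    qed (simp add: log_growth_def)
    have "(\<lambda>n. ?h n x / real n) \<longlonglongrightarrow> 0"
    proof (rule Lim_null_comparison)
      show "eventually (\<lambda>n. norm (?h n x / real n) \<le> (D + \<bar>ln (C ^ 3 * c)\<bar>) / real n) sequentially"
      proof (intro always_eventually allI)
        fix n
        have "\<bar>?h n x\<bar> \<le> D + \<bar>ln (C ^ 3 * c)\<bar>" using hl[of n] D(1) D(2)[of n x] by linarith
        then show "norm (?h n x / real n) \<le> (D + \<bar>ln (C ^ 3 * c)\<bar>) / real n"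
          by (simp add: abs_divide divide_right_mono)
      qed
    qed (rule lim_const_over_n)
    then have "(\<lambda>n. real p * ln L + ?h n x / real n) \<longlonglongrightarrow> real p * ln L + 0" by (intro tendsto_intros)
    then show ?case unfolding w_eq by (simp add: limI)
  qed
  then have "(LINT x|\<mu>. w x) = (LINT x|\<mu>. real p * ln L)" by (intro integral_cong_AE) auto
  then show ?thesis by (simp add: w_def prob_space)
qed

text \<open>Cramer's rule as an estimate: replacing the \<open>i\<close>-th vector by the
  combination multiplies the volume by \<open>\<bar>t i\<bar>\<close>, while the normalized
  combination is again admissible in a unit tuple. A volume bounded below thus bounds norms of
  combinations below.\<close>

lemma volume_one_replaced:
  assumes vol: "is_volume p vol" and C: "0 < C" "\<And>x u. unit_tuple p x u \<Longrightarrow> vol x u \<le> C"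
    and v: "unit_tuple p x v" and i: "i < p"
  shows "\<bar>t i\<bar> * vol x v \<le> C * N (comb x p t v)"
proof -
  have vf: "v j \<in> fib x" if "j < p" for j using v that by (auto simp: unit_tuple_def)
  have vr: "vol x (v(i := comb x p s v)) = \<bar>s i\<bar> * vol x v" for s by (rule volume_replace[OF vol i]) (rule vf)
  let ?w = "comb x p t v"
  have w: "?w \<in> fib x" using vf by (rule comb_in)
  show ?thesis
  proof (cases "N ?w = 0")
    case True
    then have wz: "?w = vzero E x" using norm_eq_0[OF w] by simp
    have z: "comb x p (\<lambda>_. 0) v = vzero E x" using vf by (intro comb_zero) auto
    have "\<bar>t i\<bar> * vol x v = vol x (v(i := ?w))" using vr[of t] by simp
    also have "\<dots> = 0" using vr[of "\<lambda>_. 0"] unfolding wz z by simp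
    finally have "\<bar>t i\<bar> * vol x v = 0" .
    moreover have "C * N ?w = 0" unfolding True by simp
    ultimately show ?thesis by linarith
  next
    case False
    then have pos: "N ?w > 0" using norm_nonneg[OF w] by simp
    have e: "comb x p (\<lambda>j. 1 / N ?w * t j) v = vscale E (1 / N ?w) ?w" using vf by (intro comb_scale[symmetric]) auto
    have "unit_tuple p x (v(i := vscale E (1 / N ?w) ?w))"
      using v w pos norm_scale[OF w, of "1 / N ?w"] by (auto simp: unit_tuple_def intro: vscale_in)
    then have "vol x (v(i := comb x p (\<lambda>j. 1 / N ?w * t j) v)) \<le> C" unfolding e by (rule C(2))
    then have "\<bar>1 / N ?w * t i\<bar> * vol x v \<le> C" using vr[of "\<lambda>j. 1 / N ?w * t j"] by simp
    then show ?thesis using pos by (simp add: abs_mult field_simps)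
  qed
qed

text \<open>A tuple maximizing the volume at time \<open>n\<close> satisfies the lower bound with
  constant \<open>c / C\<close> at time \<open>n\<close>, and at earlier times because
  \<open>\<rho>\<close> decreases. A limit of these tuples expands at all times.\<close>

lemma bounded_below_imp_expanding:
  assumes vol: "is_volume p vol" and c: "0 < c" "\<And>n. c \<le> maxvol p vol n x"
  shows "\<exists>u \<kappa>. expanding p x u \<kappa>"
proof -
  obtain C where C: "0 < C" "\<And>x u. unit_tuple p x u \<Longrightarrow> vol x u \<le> C" by (rule volume_bounded[OF vol]) blast
  obtain u where u: "\<And>n. unit_tuple p x (u n)"
    "\<And>n. vol ((T ^^ n) x) (\<lambda>j. vscale E (1 / L ^ n) ((\<Phi> ^^ n) (u n j))) = maxvol p vol n x"
    using maxvol_attained[OF vol] by metis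
  have uf: "u n j \<in> fib x" if "j < p" for n j using u(1) that by (auto simp: unit_tuple_def)
  have b: "c / C * \<bar>t j\<bar> \<le> \<rho> i (comb x p t (u n))" if i: "i \<le> n" and j: "j < p" for n i t j
  proof -
    let ?v = "\<lambda>j. vscale E (1 / L ^ n) ((\<Phi> ^^ n) (u n j))"
    have ut: "unit_tuple p ((T ^^ n) x) ?v" by (rule unit_tuple_iterate[OF u(1)])
    have "\<bar>t j\<bar> * c \<le> \<bar>t j\<bar> * vol ((T ^^ n) x) ?v" using u(2) c(2) by (intro mult_left_mono) auto
    also have "\<dots> \<le> C * N (comb ((T ^^ n) x) p t ?v)" by (rule volume_one_replaced[OF vol C ut j])
    also have "comb ((T ^^ n) x) p t ?v = vscale E (1 / L ^ n) ((\<Phi> ^^ n) (comb x p t (u n)))"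
      by (rule comb_iterate_scaled) (rule uf)
    also have "N (vscale E (1 / L ^ n) ((\<Phi> ^^ n) (comb x p t (u n)))) = \<rho> n (comb x p t (u n))"
      using uf norm_scale[OF iterate_in[OF comb_in[of p "u n" x t]], of "1 / L ^ n" n] L_pos
      by (simp add: \<rho>_def)
    also have "C * \<rho> n (comb x p t (u n)) \<le> C * \<rho> i (comb x p t (u n))"
      using rho_antimono[OF comb_in[OF uf] i] C(1) by (intro mult_left_mono) auto
    finally show ?thesis using C(1) by (simp add: field_simps)
  qed
  obtain r l z where r: "strict_mono r" "(\<lambda>k. x) \<longlonglongrightarrow> z" "\<And>j. j < p \<Longrightarrow> conv (\<lambda>k. u (r k) j) (l j)"
  proof (rule bounded_tuple_subsequence[of p u "\<lambda>_. x" 1])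
    show "u n j \<in> fib x" "N (u n j) \<le> 1" if "j < p" for n j using u(1)[of n] that by (auto simp: unit_tuple_def)
  qed (rule that)
  have "expanding p x l (c / C)"
  proof (rule expanding_limit[where y = "\<lambda>_. x" and u = "\<lambda>k. u (r k)"])
    fix n i j :: nat and t assume "i \<le> n" "j < p"
    then show "c / C * \<bar>t j\<bar> \<le> \<rho> i (comb x p t (u (r n)))"
      using seq_suble[OF r(1), of n] by (intro b) auto
  qed (use uf r(3) C(1) c(1) in auto)
  then show ?thesis by blast
qed

text \<open>The normalized images stay in the unit ball and uniformly independent. If their volumes
  approached 0, a limit tuple would be independent with volume 0.\<close>

lemma expanding_imp_bounded_below:
  assumes vol: "is_volume p vol" and ex: "expanding p x u \<kappa>"
  shows "\<exists>c>0. \<forall>n. c \<le> maxvol p vol n x"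
proof -
  have \<kappa>: "\<kappa> > 0" and uf: "\<And>j. j < p \<Longrightarrow> u j \<in> fib x"
    and lowb: "\<And>n t j. j < p \<Longrightarrow> \<kappa> * \<bar>t j\<bar> \<le> \<rho> n (comb x p t u)"
    using ex by (auto simp: expanding_def)
  define B where "B = 1 + (\<Sum>j<p. N (u j))"
  have Bp: "B > 0" unfolding B_def using norm_nonneg[OF uf] by (intro add_pos_nonneg sum_nonneg) auto
  define v where "v j = vscale E (1 / B) (u j)" for j
  have vf: "v j \<in> fib x" if "j < p" for j unfolding v_def using uf[OF that] by (rule vscale_in)
  have vN: "N (v j) \<le> 1" if j: "j < p" for j
  proof -
    have "N (u j) \<le> (\<Sum>j<p. N (u j))" using j norm_nonneg[OF uf] by (intro member_le_sum) auto
    then have "N (u j) \<le> B" by (simp add: B_def)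
    then show ?thesis unfolding v_def using norm_scale[OF uf[OF j], of "1 / B"] Bp by simp
  qed
  have ut: "unit_tuple p x v" using vf vN by (simp add: unit_tuple_def)
  have comb_v: "comb x p t v = comb x p (\<lambda>j. t j / B) u" for t
  proof (rule fib_eqI)
    fix U h i assume ch: "chart U h" "x \<in> U"
    show "crd h (comb x p t v) i = crd h (comb x p (\<lambda>j. t j / B) u) i"
      using uf vf by (simp add: crd_comb[OF ch]) (simp add: v_def crd_scale[OF ch])
  qed (use uf vf in \<open>auto intro!: comb_in\<close>)
  define V where "V n j = vscale E (1 / L ^ n) ((\<Phi> ^^ n) (v j))" for n j
  have "\<exists>c>0. \<forall>n. c \<le> vol ((T ^^ n) x) (V n)"
  proof (rule ccontr)
    assume "\<not> ?thesis"
    then have "\<exists>n. vol ((T ^^ n) x) (V n) < inverse (real (Suc k))" for k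
      by (metis inverse_positive_iff_positive not_le of_nat_0_less_iff zero_less_Suc)
    then obtain m where m: "\<And>k. vol ((T ^^ m k) x) (V (m k)) < inverse (real (Suc k))" by metis
    have VU: "unit_tuple p ((T ^^ m k) x) (V (m k))" for k unfolding V_def by (rule unit_tuple_iterate[OF ut])
    obtain r l y where r: "strict_mono r" "(\<lambda>k. (T ^^ m (r k)) x) \<longlonglongrightarrow> y" "\<And>j. j < p \<Longrightarrow> conv (\<lambda>k. V (m (r k)) j) (l j)"
      "\<And>j. j < p \<Longrightarrow> l j \<in> fib y"
      by (rule bounded_tuple_subsequence[of p "\<lambda>k. V (m k)" "\<lambda>k. (T ^^ m k) x" 1]) (use VU in \<open>auto simp: unit_tuple_def\<close>)
    have Vf: "V n j \<in> fib ((T ^^ n) x)" if "j < p" for n j unfolding V_def using vf[OF that] by (intro vscale_in iterate_in)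
    have low: "\<kappa> / B * \<bar>t j\<bar> \<le> N (comb ((T ^^ n) x) p t (V n))" if j: "j < p" for n t j
    proof -
      have "N (comb ((T ^^ n) x) p t (V n)) = \<rho> n (comb x p t v)"
        using rho_comb_iterate_scaled[of p v x 0 n t] vf by (simp add: V_def[abs_def])
      also have "\<dots> = \<rho> n (comb x p (\<lambda>j. t j / B) u)" by (simp add: comb_v)
      finally have "N (comb ((T ^^ n) x) p t (V n)) = \<rho> n (comb x p (\<lambda>j. t j / B) u)" .
      then show ?thesis using lowb[OF j, of "\<lambda>j. t j / B" n] Bp by (simp add: abs_divide)
    qed
    have "indep y p l"
    proof (rule indepI_norm[of p l y "\<kappa> / B"])
      fix t j assume j: "j < p"
      have "(\<lambda>k. N (comb ((T ^^ m (r k)) x) p t (V (m (r k))))) \<longlonglongrightarrow> N (comb y p t l)"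
        by (intro conv_norm conv_comb[OF r(2) Vf r(3)]) auto
      then show "\<kappa> / B * \<bar>t j\<bar> \<le> N (comb y p t l)" by (rule LIMSEQ_le_const) (use low[OF j] in blast)
    qed (use r(4) \<kappa> Bp in auto)
    then have "0 < vol y l" by (rule volume_pos[OF vol])
    moreover have "(\<lambda>k. vol ((T ^^ m (r k)) x) (V (m (r k)))) \<longlonglongrightarrow> vol y l"
      by (rule volume_conv[OF vol r(2) Vf r(3)])
    moreover have "(\<lambda>k. inverse (real (Suc (r k)))) \<longlonglongrightarrow> 0"
      using LIMSEQ_subseq_LIMSEQ[OF LIMSEQ_inverse_real_of_nat r(1)] by (simp add: o_def)
    ultimately have "vol y l \<le> 0"
      by (intro LIMSEQ_le[of "\<lambda>k. vol ((T ^^ m (r k)) x) (V (m (r k)))" _ "\<lambda>k. inverse (real (Suc (r k)))"])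
        (use m in \<open>auto intro!: exI[of _ 0] less_imp_le\<close>)
    then show False using \<open>0 < vol y l\<close> by simp
  qed
  then obtain c where c: "c > 0" "\<And>n. c \<le> vol ((T ^^ n) x) (V n)" by blast
  have "c \<le> maxvol p vol n x" for n using c(2)[of n] maxvol_upper[OF vol ut, of n] by (simp add: V_def[abs_def])
  then show ?thesis using c(1) by blast
qed

section \<open>Auerbach bases and calibrated vectors\<close>

text \<open>Independence bounds the coefficients of a convergent sequence in the span, so they
  subconverge, and the limit is unique.\<close>

lemma span_closed:
  assumes u: "indep x p u" and v: "\<And>n. v n = comb x p (c n) u" and l: "conv v l"
  shows "\<exists>c. l = comb x p c u"
proof -
  obtain \<kappa> where \<kappa>: "\<kappa> > 0" "\<And>c j. j < p \<Longrightarrow> \<kappa> * \<bar>c j\<bar> \<le> N (comb x p c u)" by (rule indep_norm_bound[OF u]) blast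
  have uf: "u j \<in> fib x" if "j < p" for j using indep_in[OF u that] .
  have "Bseq (\<lambda>n. N (v n))" using conv_norm[OF l] by (intro convergent_imp_Bseq convergentI)
  then obtain K where K: "\<And>n. N (v n) \<le> K" unfolding Bseq_def by (metis abs_le_D1 real_norm_def)
  define c' where "c' n j = (if j < p then c n j else 0)" for n j
  have K0: "0 \<le> K" using K[of 0] norm_nonneg[OF comb_in[of p u x "c 0"]] uf unfolding v[of 0] by fastforce
  have "\<bar>c' n j\<bar> \<le> K / \<kappa>" for n j
  proof (cases "j < p")
    case True
    have "\<kappa> * \<bar>c n j\<bar> \<le> K" using \<kappa>(2)[OF True, of "c n"] K[of n] v[of n] by simp
    then show ?thesis using True \<kappa>(1) by (simp add: c'_def pos_le_divide_eq mult.commute)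
  qed (use K0 \<kappa>(1) in \<open>simp add: c'_def\<close>)
  then obtain r g where r: "strict_mono r" "\<And>i. (\<lambda>n. c' (r n) i) \<longlonglongrightarrow> g i"
    using bounded_coordinates_subsequence[of c' "K / \<kappa>"] by metis
  have "conv (\<lambda>n. comb x p (c' (r n)) u) (comb x p g u)"
    by (rule conv_comb[OF tendsto_const]) (use uf r(2) conv_const fib_tot in auto)
  moreover have "(\<lambda>n. comb x p (c' (r n)) u) = (\<lambda>n. v (r n))"
    unfolding v by (intro ext comb_cong) (auto simp: c'_def)
  ultimately have "l = comb x p g u" using conv_unique conv_subseq[OF l r(1)] by metis
  then show ?thesis by blast
qed

text \<open>A tuple of maximal volume in the unit ball of the span: replacing one of its vectors by a unit vector does not
  increase the volume.\<close>

lemma auerbach_basis: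
  assumes vol: "is_volume p vol" and u: "indep x p u"
  obtains w a where "\<And>j. j < p \<Longrightarrow> w j = comb x p (a j) u" "unit_tuple p x w"
    "\<And>t j. j < p \<Longrightarrow> \<bar>t j\<bar> \<le> N (comb x p t w)"
proof -
  have uf: "u j \<in> fib x" if "j < p" for j using indep_in[OF u that] .
  define A where "A = {w. unit_tuple p x w \<and> (\<forall>j<p. \<exists>c. w j = comb x p c u)}"
  obtain C where C: "0 < C" "\<And>x u. unit_tuple p x u \<Longrightarrow> vol x u \<le> C" by (rule volume_bounded[OF vol]) blast
  define B where "B = 1 + (\<Sum>j<p. N (u j))"
  have Bp: "B > 0" unfolding B_def using norm_nonneg[OF uf] by (intro add_pos_nonneg sum_nonneg) auto
  define v where "v j = vscale E (1 / B) (u j)" for j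
  have vA: "v \<in> A"
  proof -
    have "\<exists>c. v j = comb x p c u" if j: "j < p" for j
      using comb_single[of j p u x "1 / B", OF j uf] unfolding v_def by metis
    moreover have "unit_tuple p x v" unfolding unit_tuple_def
    proof (intro allI impI conjI)
      fix j assume j: "j < p"
      show "v j \<in> fib x" unfolding v_def using uf[OF j] by (rule vscale_in)
      have "N (u j) \<le> (\<Sum>j<p. N (u j))" using j norm_nonneg[OF uf] by (intro member_le_sum) auto
      then have "N (u j) \<le> B" by (simp add: B_def)
      then show "N (v j) \<le> 1" unfolding v_def using norm_scale[OF uf[OF j], of "1 / B"] Bp by simp
    qed
    ultimately show ?thesis by (simp add: A_def)
  qed
  have vpos: "0 < vol x v"
    using volume_scale_all[OF vol uf, where c = "1 / B"] volume_pos[OF vol u] Bp by (simp add: v_def[abs_def])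
  define s where "s = (SUP w\<in>A. vol x w)"
  have bdd: "bdd_above (vol x ` A)" using C(2) by (intro bdd_aboveI2[where M = C]) (auto simp: A_def)
  have s_up: "vol x w \<le> s" if "w \<in> A" for w unfolding s_def using bdd that by (intro cSUP_upper)
  have "\<exists>w\<in>A. s - inverse (real (Suc n)) < vol x w" for n
  proof -
    have "s - inverse (real (Suc n)) < s" by simp
    then show ?thesis using less_cSUP_iff[OF _ bdd, of "s - inverse (real (Suc n))"] vA unfolding s_def[symmetric] by blast
  qed
  then obtain W where W: "\<And>n. W n \<in> A" "\<And>n. s - inverse (real (Suc n)) < vol x (W n)" by metis
  have Wu: "unit_tuple p x (W n)" for n using W(1) by (simp add: A_def)
  obtain r w z where r: "strict_mono r" "(\<lambda>k. x) \<longlonglongrightarrow> z" "\<And>j. j < p \<Longrightarrow> conv (\<lambda>k. W (r k) j) (w j)" "\<And>j. j < p \<Longrightarrow> w j \<in> fib z"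
  proof (rule bounded_tuple_subsequence[of p W "\<lambda>_. x" 1])
    show "W n j \<in> fib x" "N (W n j) \<le> 1" if "j < p" for n j using Wu[of n] that by (auto simp: unit_tuple_def)
  qed (rule that)
  have zx: "z = x" by (rule LIMSEQ_unique[OF r(2) tendsto_const])
  have Nw: "N (w j) \<le> 1" if "j < p" for j
    using conv_norm[OF r(3)[OF that]] by (rule LIMSEQ_le_const2) (use Wu that in \<open>auto simp: unit_tuple_def\<close>)
  have wu: "unit_tuple p x w" using r(4) zx Nw by (auto simp: unit_tuple_def)
  have wspan: "\<exists>c. w j = comb x p c u" if j: "j < p" for j
  proof -
    have "\<exists>c. W (r k) j = comb x p c u" for k using W(1) j by (auto simp: A_def)
    then obtain c where "\<And>k. W (r k) j = comb x p (c k) u" by metis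
    then show ?thesis using r(3)[OF j] by (rule span_closed[OF u])
  qed
  have wA: "w \<in> A" using wu wspan by (simp add: A_def)
  have "(\<lambda>k. vol x (W (r k))) \<longlonglongrightarrow> vol x w"
    by (rule volume_conv[OF vol tendsto_const]) (use r(3) Wu in \<open>auto simp: unit_tuple_def\<close>)
  moreover have "(\<lambda>k. s - inverse (real (Suc (r k)))) \<longlonglongrightarrow> s - 0"
    using LIMSEQ_subseq_LIMSEQ[OF LIMSEQ_inverse_real_of_nat r(1)] by (intro tendsto_intros) (simp add: o_def)
  ultimately have "s \<le> vol x w"
    by (intro LIMSEQ_le[of "\<lambda>k. s - inverse (real (Suc (r k)))" _ "\<lambda>k. vol x (W (r k))"])
      (use W(2) in \<open>auto intro!: exI[of _ 0] less_imp_le\<close>)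
  then have vw: "vol x w = s" using s_up[OF wA] by simp
  have sp: "s > 0" using vpos s_up[OF vA] by simp
  have wf: "w j \<in> fib x" if "j < p" for j using wu that by (auto simp: unit_tuple_def)
  obtain a where a: "\<And>j. j < p \<Longrightarrow> w j = comb x p (a j) u" using wspan by metis
  have "\<bar>t j\<bar> \<le> N (comb x p t w)" if j: "j < p" for t j
  proof -
    let ?y = "comb x p t w"
    have y: "?y \<in> fib x" using wf by (rule comb_in)
    show ?thesis
    proof (cases "N ?y = 0")
      case True
      have "\<bar>t j\<bar> * vol x w \<le> C * N ?y" by (rule volume_one_replaced[OF vol C wu j])
      then show ?thesis using True sp vw by (simp add: mult_le_0_iff)
    next
      case False
      then have pos: "N ?y > 0" using norm_nonneg[OF y] by simp
      have e: "comb x p (\<lambda>j. 1 / N ?y * t j) w = vscale E (1 / N ?y) ?y" using wf by (intro comb_scale[symmetric]) auto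
      have "?y = comb x p t (\<lambda>j. comb x p (a j) u)" using a by (intro comb_cong) auto
      also have "\<dots> = comb x p (\<lambda>j. \<Sum>l<p. t l * a l j) u" using uf by (rule comb_comb)
      finally have "\<exists>c. vscale E (1 / N ?y) ?y = comb x p c u" using comb_scale[of p u x "1 / N ?y"] uf by metis
      moreover have "N (vscale E (1 / N ?y) ?y) = 1" using norm_scale[OF y] pos by simp
      ultimately have "w(j := vscale E (1 / N ?y) ?y) \<in> A"
        using wA vscale_in[OF y] unfolding A_def unit_tuple_def by auto
      then have "vol x (w(j := comb x p (\<lambda>j. 1 / N ?y * t j) w)) \<le> s" unfolding e by (rule s_up)
      moreover have "vol x (w(j := comb x p (\<lambda>j. 1 / N ?y * t j) w)) = \<bar>1 / N ?y * t j\<bar> * vol x w"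
        by (rule volume_replace[OF vol j]) (rule wf)
      ultimately have "\<bar>1 / N ?y * t j\<bar> * s \<le> 1 * s" using vw by simp
      then have "\<bar>1 / N ?y * t j\<bar> \<le> 1" using sp by (rule mult_right_le_imp_le)
      then show ?thesis using pos by (simp add: abs_mult pos_divide_le_eq)
    qed
  qed
  then show ?thesis using that a wu by blast
qed

text \<open>Expansion keeps the rescaled coefficients \<open>s i\<close> bounded, so they
  subconverge to some \<open>g\<close>. The value of \<open>\<rho> k\<close> at the
  \<open>i\<close>-th iterate is the value at time \<open>n i + k\<close> of the combination with
  coefficients \<open>s i\<close>, and for every \<open>k\<close> it tends to the same number: the
  limit of \<open>\<rho>\<close> along the fixed combination with coefficients \<open>g\<close>. So
  \<open>\<rho> k w\<close> does not depend on \<open>k\<close>.\<close>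

lemma expanding_iterates_limit_calibrated:
  assumes ex: "expanding p x u \<kappa>" and n: "filterlim n at_top sequentially"
    and w: "conv (\<lambda>i. (\<Phi> ^^ n i) (comb x p (t i) u)) w"
  shows "N ((\<Phi> ^^ m) w) = L ^ m * N w"
proof -
  have \<kappa>: "\<kappa> > 0" and uf: "\<And>j. j < p \<Longrightarrow> u j \<in> fib x"
    and lowb: "\<And>n t j. j < p \<Longrightarrow> \<kappa> * \<bar>t j\<bar> \<le> \<rho> n (comb x p t u)"
    using ex by (auto simp: expanding_def)
  let ?w = "\<lambda>i. (\<Phi> ^^ n i) (comb x p (t i) u)"
  have "Bseq (\<lambda>i. N (?w i))" using conv_norm[OF w] by (intro convergent_imp_Bseq convergentI)
  then obtain K where K: "K > 0" "\<And>i. \<bar>N (?w i)\<bar> \<le> K" unfolding Bseq_def by auto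
  define s where "s i j = (if j < p then L ^ n i * t i j else 0)" for i j
  have cs: "comb x p (s i) u = vscale E (L ^ n i) (comb x p (t i) u)" for i
  proof -
    have "comb x p (s i) u = comb x p (\<lambda>j. L ^ n i * t i j) u" by (intro comb_cong) (auto simp: s_def)
    then show ?thesis using comb_scale[of p u x "L ^ n i" "t i"] uf by simp
  qed
  have rho_s: "\<rho> (n i + k) (comb x p (s i) u) = \<rho> k (?w i)" for i k
    unfolding cs using rho_scale[OF comb_in[of p u x "t i"], of "n i + k" "L ^ n i"] uf L_pos by (simp add: rho_iterate)
  have "\<bar>s i j\<bar> \<le> K / \<kappa>" for i j
  proof (cases "j < p")
    case True
    have "\<kappa> * \<bar>s i j\<bar> \<le> \<rho> (n i) (comb x p (s i) u)" using lowb[OF True] .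
    also have "\<dots> = N (?w i)" using rho_s[of i 0] by simp
    also have "\<dots> \<le> K" using K(2)[of i] by linarith
    finally show ?thesis using \<kappa> by (simp add: pos_le_divide_eq mult.commute)
  qed (use K(1) \<kappa> in \<open>simp add: s_def\<close>)
  then obtain r g where r: "strict_mono r" "\<And>j. (\<lambda>i. s (r i) j) \<longlonglongrightarrow> g j"
    using bounded_coordinates_subsequence[of s "K / \<kappa>"] by metis
  let ?v = "comb x p g u"
  have v: "?v \<in> fib x" using uf by (rule comb_in)
  obtain \<nu> where \<nu>: "(\<lambda>n. \<rho> n ?v) \<longlonglongrightarrow> \<nu>" using rho_convergent[OF v] by blast
  have nr: "filterlim (\<lambda>i. n (r i) + k) at_top sequentially" for k
    using filterlim_compose[OF n filterlim_subseq[OF r(1)]] by (rule filterlim_at_top_mono) simp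
  have lim: "(\<lambda>i. \<rho> k (?w (r i))) \<longlonglongrightarrow> \<nu>" for k
  proof -
    have diff: "(\<lambda>i. N (comb x p (\<lambda>j. s (r i) j - g j) u)) \<longlonglongrightarrow> N (comb x p (\<lambda>j. 0) u)"
      using r(2) uf conv_const fib_tot by (intro conv_norm conv_comb[OF tendsto_const]) (auto intro!: tendsto_eq_intros)
    then have diff0: "(\<lambda>i. N (comb x p (\<lambda>j. s (r i) j - g j) u)) \<longlonglongrightarrow> 0"
      using comb_zero[of p u x "\<lambda>_. 0"] uf norm_zero by simp
    \<comment> \<open>At each time \<open>\<rho>\<close> is a seminorm below \<open>N\<close>;
      replacing coefficients by their limits therefore costs an error independent of the growing
      times.\<close>
    have "\<bar>\<rho> k (?w (r i)) - \<rho> (n (r i) + k) ?v\<bar> \<le> N (comb x p (\<lambda>j. s (r i) j - g j) u)" for i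
    proof -
      let ?d = "comb x p (\<lambda>j. s (r i) j - g j) u" and ?s = "comb x p (s (r i)) u"
      let ?d' = "comb x p (\<lambda>j. g j - s (r i) j) u"
      have d: "?d \<in> fib x" "?d' \<in> fib x" "?s \<in> fib x" using uf by (auto intro!: comb_in)
      have "vadd E ?v ?d = ?s" using comb_add[of p u x g "\<lambda>j. s (r i) j - g j"] uf by simp
      then have 1: "\<rho> (n (r i) + k) ?s \<le> \<rho> (n (r i) + k) ?v + \<rho> (n (r i) + k) ?d"
        using rho_add[OF v d(1), of "n (r i) + k"] by simp
      have "vadd E ?s ?d' = ?v" using comb_add[of p u x "s (r i)" "\<lambda>j. g j - s (r i) j"] uf by simp
      then have 2: "\<rho> (n (r i) + k) ?v \<le> \<rho> (n (r i) + k) ?s + \<rho> (n (r i) + k) ?d'"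
        using rho_add[OF d(3,2), of "n (r i) + k"] by simp
      have "?d' = vscale E (- 1) ?d" using comb_scale[of p u x "-1" "\<lambda>j. s (r i) j - g j"] uf by simp
      then have 3: "\<rho> (n (r i) + k) ?d' = \<rho> (n (r i) + k) ?d" using rho_scale[OF d(1), of "n (r i) + k" "-1"] by simp
      show ?thesis using 1 2 3 rho_le[OF d(1), of "n (r i) + k"] rho_s[of "r i" k] by linarith
    qed
    then have "(\<lambda>i. \<rho> k (?w (r i)) - \<rho> (n (r i) + k) ?v) \<longlonglongrightarrow> 0"
      by (intro Lim_null_comparison[OF always_eventually diff0]) simp
    moreover have "(\<lambda>i. \<rho> (n (r i) + k) ?v) \<longlonglongrightarrow> \<nu>" by (rule filterlim_compose[OF \<nu> nr])
    ultimately have "(\<lambda>i. (\<rho> k (?w (r i)) - \<rho> (n (r i) + k) ?v) + \<rho> (n (r i) + k) ?v) \<longlonglongrightarrow> 0 + \<nu>"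
      by (rule tendsto_add)
    then show ?thesis by simp
  qed
  have "\<rho> k w = \<nu>" for k
    using rho_conv[OF conv_subseq[OF w r(1)], of k] lim[of k] LIMSEQ_unique by blast
  from this[of m] this[of 0] show ?thesis using L_pos by (simp add: \<rho>_def field_simps)
qed

definition calibrated :: "'e \<Rightarrow> bool" where
  "calibrated v \<longleftrightarrow> (\<forall>m. N ((\<Phi> ^^ m) v) = L ^ m * N v)"

text \<open>Equality at negative times is expressed by calibrated preimages of every order; order 0
  makes the vector itself calibrated.\<close>

definition bicalibrated :: "'e set" where
  "bicalibrated = {u \<in> tot. \<forall>n. \<exists>w\<in>tot. (\<Phi> ^^ n) w = u \<and> calibrated w}"

lemma calibrated_limit:
  assumes "\<And>k. calibrated (v k)" "conv v l" shows "calibrated l"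
  unfolding calibrated_def
proof
  fix m
  have "(\<lambda>k. N ((\<Phi> ^^ m) (v k))) \<longlonglongrightarrow> N ((\<Phi> ^^ m) l)" by (intro conv_norm iterate_conv assms)
  moreover have "(\<lambda>k. N ((\<Phi> ^^ m) (v k))) = (\<lambda>k. L ^ m * N (v k))" using assms(1) by (auto simp: calibrated_def)
  moreover have "(\<lambda>k. L ^ m * N (v k)) \<longlonglongrightarrow> L ^ m * N l" by (intro tendsto_mult tendsto_const conv_norm assms)
  ultimately show "N ((\<Phi> ^^ m) l) = L ^ m * N l" using LIMSEQ_unique by metis
qed

lemma bicalibrated_calibrated: "u \<in> bicalibrated \<Longrightarrow> calibrated u"
  unfolding bicalibrated_def by (auto dest: spec[of _ "0::nat"])

lemma bicalibrated_rho: "u \<in> bicalibrated \<Longrightarrow> \<rho> n u = N u"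
  using bicalibrated_calibrated[of u] L_pos by (simp add: calibrated_def \<rho>_def)

lemma bicalibrated_phi: assumes "u \<in> bicalibrated" shows "\<Phi> u \<in> bicalibrated"
  unfolding bicalibrated_def
proof (intro CollectI conjI allI)
  have u: "u \<in> tot" using assms by (simp add: bicalibrated_def)
  then show "\<Phi> u \<in> tot" by (rule phi_tot)
  fix n show "\<exists>w\<in>tot. (\<Phi> ^^ n) w = \<Phi> u \<and> calibrated w"
  proof (cases n)
    case 0
    have c: "N ((\<Phi> ^^ m) u) = L ^ m * N u" for m using bicalibrated_calibrated[OF assms] by (simp add: calibrated_def)
    have "N ((\<Phi> ^^ m) (\<Phi> u)) = L ^ m * N (\<Phi> u)" for m
      using c[of "Suc m"] c[of 1] by (simp add: funpow_swap1)
    then show ?thesis using 0 phi_tot[OF u] by (auto simp: calibrated_def)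
  next
    case (Suc k)
    obtain w where "w \<in> tot" "(\<Phi> ^^ k) w = u" "calibrated w" using assms by (auto simp: bicalibrated_def)
    then show ?thesis using Suc by auto
  qed
qed

lemma fib_same: assumes "v \<in> tot" "\<Phi> v \<in> fib (T x)" shows "v \<in> fib x"
proof -
  have "T (bproj E v) = T x" using fib_proj[OF assms(2)] fib_proj[OF phi_in[OF tot_fib[OF assms(1)]]] by simp
  then have "S (T (bproj E v)) = S (T x)" by simp
  then show ?thesis using tot_fib[OF assms(1)] ST by simp
qed

lemma bicalibrated_phi_surj:
  assumes u: "u \<in> bicalibrated" "u \<in> fib (T x)" shows "\<exists>w\<in>bicalibrated \<inter> fib x. \<Phi> w = u"
proof -
  obtain w where w: "w \<in> tot" "(\<Phi> ^^ 1) w = u" using u(1) unfolding bicalibrated_def by blast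
  then have wu: "\<Phi> w = u" by simp
  have wx: "w \<in> fib x" using fib_same[OF w(1)] u(2) wu by simp
  have "w \<in> bicalibrated" unfolding bicalibrated_def
  proof (intro CollectI conjI allI w(1))
    fix n
    obtain w' where w': "w' \<in> tot" "(\<Phi> ^^ Suc n) w' = u" "calibrated w'" using u(1) unfolding bicalibrated_def by blast
    have "\<Phi> ((\<Phi> ^^ n) w') = \<Phi> w" using w'(2) wu by simp
    moreover have "(\<Phi> ^^ n) w' \<in> fib x" using fib_same[OF iterate_tot[OF w'(1)]] u(2) w'(2) by simp
    ultimately have "(\<Phi> ^^ n) w' = w" using phi_inj[OF _ wx] by blast
    then show "\<exists>w'\<in>tot. (\<Phi> ^^ n) w' = w \<and> calibrated w'" using w' by blast
  qed
  then show ?thesis using wx wu by blast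
qed

text \<open>Preimages of a convergent sequence under \<open>\<Phi> ^^ n\<close> are bounded by
  \<open>iterate_bounded_below\<close>, so they subconverge, and calibration passes to the
  limit.\<close>

lemma bicalibrated_closed:
  assumes v: "\<And>k. v k \<in> bicalibrated" and l: "conv v l" shows "l \<in> bicalibrated"
  unfolding bicalibrated_def
proof (intro CollectI conjI allI)
  show "l \<in> tot" using l by (rule conv_topspace)
  fix n
  have "\<exists>w\<in>tot. (\<Phi> ^^ n) w = v k \<and> calibrated w" for k using v[of k] by (auto simp: bicalibrated_def)
  then obtain w where w: "\<And>k. w k \<in> tot" "\<And>k. (\<Phi> ^^ n) (w k) = v k" "\<And>k. calibrated (w k)" by metis
  obtain B where B: "B > 0" "\<And>v n. v \<in> tot \<Longrightarrow> N v \<le> B ^ n * N ((\<Phi> ^^ n) v)" by (rule iterate_bounded_below) blast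
  have "Bseq (\<lambda>i. N (v i))" using conv_norm[OF l] by (intro convergent_imp_Bseq convergentI)
  then obtain K where K: "\<And>i. N (v i) \<le> K" unfolding Bseq_def by (metis abs_le_D1 real_norm_def)
  have "N (w k) \<le> B ^ n * K" for k
  proof -
    have "N (w k) \<le> B ^ n * N (v k)" using B(2)[OF w(1), of k n] w(2) by simp
    also have "\<dots> \<le> B ^ n * K" using K B(1) by (intro mult_left_mono) auto
    finally show ?thesis .
  qed
  then obtain r a x where r: "strict_mono r" "(\<lambda>k. bproj E (w (r k))) \<longlonglongrightarrow> x" "conv (\<lambda>k. w (r k)) a" "a \<in> fib x"
    using bounded_vector_subsequence[of w "\<lambda>k. bproj E (w k)" "B ^ n * K"] tot_fib[OF w(1)] by metis
  have "conv (\<lambda>k. (\<Phi> ^^ n) (w (r k))) ((\<Phi> ^^ n) a)" by (rule iterate_conv[OF r(3)])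
  then have "(\<Phi> ^^ n) a = l" unfolding w(2) using conv_unique conv_subseq[OF l r(1)] by blast
  moreover have "calibrated a" by (rule calibrated_limit[OF _ r(3)]) (rule w(3))
  ultimately show "\<exists>w\<in>tot. (\<Phi> ^^ n) w = l \<and> calibrated w" using fib_tot[OF r(4)] by blast
qed

text \<open>A preimage of order \<open>m\<close> of the limit is found among limits of the same
  orbit segments stopped \<open>m\<close> steps earlier, which are calibrated for the same
  reason.\<close>

lemma expanding_iterates_limit_bicalibrated:
  assumes ex: "expanding p x u \<kappa>" and n: "\<And>i. i \<le> n i"
    and w: "conv (\<lambda>i. (\<Phi> ^^ n i) (comb x p (t i) u)) w"
  shows "w \<in> bicalibrated"
  unfolding bicalibrated_def
proof (intro CollectI conjI allI)
  show "w \<in> tot" using w by (rule conv_topspace)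
  have uf: "u j \<in> fib x" if "j < p" for j using ex that by (auto simp: expanding_def)
  fix m
  \<comment> \<open>The index shift by \<open>m\<close> guarantees \<open>m \<le> n (i + m)\<close>,
    so that the subtraction is exact.\<close>
  define W where "W i = (\<Phi> ^^ (n (i + m) - m)) (comb x p (t (i + m)) u)" for i
  have Wf: "W i \<in> fib ((T ^^ (n (i + m) - m)) x)" for i
    unfolding W_def by (intro iterate_in comb_in) (rule uf)
  have WP: "(\<Phi> ^^ m) (W i) = (\<Phi> ^^ n (i + m)) (comb x p (t (i + m)) u)" for i
  proof -
    have "m \<le> n (i + m)" using n[of "i + m"] by simp
    then have "n (i + m) = m + (n (i + m) - m)" by simp
    then have "\<Phi> ^^ n (i + m) = (\<Phi> ^^ m) \<circ> (\<Phi> ^^ (n (i + m) - m))" by (metis funpow_add)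
    then show ?thesis by (simp add: W_def)
  qed
  have sm: "strict_mono (\<lambda>i. i + m)" by (simp add: strict_mono_def)
  have cW: "conv (\<lambda>i. (\<Phi> ^^ m) (W i)) w" unfolding WP using conv_subseq[OF w sm] .
  obtain B where B: "B > 0" "\<And>v n. v \<in> tot \<Longrightarrow> N v \<le> B ^ n * N ((\<Phi> ^^ n) v)" by (rule iterate_bounded_below) blast
  have "Bseq (\<lambda>i. N ((\<Phi> ^^ m) (W i)))" using conv_norm[OF cW] by (intro convergent_imp_Bseq convergentI)
  then obtain K where K: "\<And>i. N ((\<Phi> ^^ m) (W i)) \<le> K" unfolding Bseq_def by (metis abs_le_D1 real_norm_def)
  have "N (W i) \<le> B ^ m * K" for i
  proof -
    have "N (W i) \<le> B ^ m * N ((\<Phi> ^^ m) (W i))" by (rule B(2)[OF fib_tot[OF Wf]])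
    also have "\<dots> \<le> B ^ m * K" using K B(1) by (intro mult_left_mono) auto
    finally show ?thesis .
  qed
  then obtain r a z where r: "strict_mono r" "(\<lambda>k. (T ^^ (n (r k + m) - m)) x) \<longlonglongrightarrow> z" "conv (\<lambda>k. W (r k)) a" "a \<in> fib z"
    using bounded_vector_subsequence[of W "\<lambda>i. (T ^^ (n (i + m) - m)) x" "B ^ m * K"] Wf by metis
  have "filterlim (\<lambda>i. n (r i + m) - m) at_top sequentially"
  proof (rule filterlim_at_top_mono[OF filterlim_ident], intro always_eventually allI)
    fix i show "i \<le> n (r i + m) - m" using n[of "r i + m"] seq_suble[OF r(1), of i] by simp
  qed
  then have "N ((\<Phi> ^^ k) a) = L ^ k * N a" for k
    by (rule expanding_iterates_limit_calibrated[OF ex, where t = "\<lambda>i. t (r i + m)"])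
      (use r(3) in \<open>simp add: W_def\<close>)
  moreover have "(\<Phi> ^^ m) a = w"
    using conv_unique[OF iterate_conv[OF r(3)] conv_subseq[OF cW r(1)]] .
  ultimately show "\<exists>v\<in>tot. (\<Phi> ^^ m) v = w \<and> calibrated v" using fib_tot[OF r(4)] by (auto simp: calibrated_def)
qed

section \<open>Calibrated frames over supports of measures\<close>

text \<open>The constants 1 in the norm bounds depend neither on the point nor on the tuple, so that
  limits of frames over varying points remain frames. All combinations, and not only the frame
  vectors, are required to be bicalibrated.\<close>

definition calibrated_frame :: "nat \<Rightarrow> 'x \<Rightarrow> (nat \<Rightarrow> 'e) \<Rightarrow> bool" where
  "calibrated_frame p x u \<longleftrightarrow> unit_tuple p x u \<and> (\<forall>c. \<forall>j<p. \<bar>c j\<bar> \<le> N (comb x p c u)) \<and>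
     (\<forall>c. comb x p c u \<in> bicalibrated)"

lemma calibrated_frame_limit:
  assumes y: "y \<longlonglongrightarrow> x" and u: "\<And>k. unit_tuple p (y k) (u k)"
    and b: "\<And>k c j. j < p \<Longrightarrow> \<bar>c j\<bar> \<le> N (comb (y k) p c (u k))"
    and l: "\<And>j. j < p \<Longrightarrow> conv (\<lambda>k. u k j) (l j)"
    and bic: "\<And>c. comb x p c l \<in> bicalibrated"
  shows "calibrated_frame p x l"
  unfolding calibrated_frame_def unit_tuple_def
proof (intro conjI allI impI bic)
  have uf: "u k j \<in> fib (y k)" if "j < p" for k j using u[of k] that by (auto simp: unit_tuple_def)
  fix j assume j: "j < p"
  show "l j \<in> fib x" using conv_fib[OF l[OF j] uf[OF j] y] .
  show "N (l j) \<le> 1"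
    by (rule LIMSEQ_le_const2[OF conv_norm[OF l[OF j]]]) (use u j in \<open>auto simp: unit_tuple_def\<close>)
  fix c
  have "conv (\<lambda>k. comb (y k) p c (u k)) (comb x p c l)"
    by (rule conv_comb[OF y]) (use uf l in auto)
  from conv_norm[OF this] show "\<bar>c j\<bar> \<le> N (comb x p c l)"
    by (rule LIMSEQ_le_const) (use b[OF j] in blast)
qed

text \<open>Expanding tuples exist only almost everywhere, and \<open>x0\<close> itself may carry
  none. A ball around it has positive measure and hence contains a point that carries one and
  returns to the ball infinitely often; at the return times the images accumulate over a point of
  the closed ball.\<close>

lemma calibrated_frame_near:
  assumes \<mu>: "\<mu> \<in> invariant_measures T" and supp: "x0 \<in> measure_support \<mu>"
    and p: "p \<in> {1..d}" and full: "exponent_sum E d T \<Phi> \<mu> p = real p * ln L" and \<epsilon>: "0 < \<epsilon>"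
  shows "\<exists>y u. dist y x0 \<le> \<epsilon> \<and> calibrated_frame p y u"
proof -
  have \<mu>': "prob_space \<mu>" "sets \<mu> = sets borel" "distr \<mu> borel T = \<mu>" using \<mu> by (auto simp: invariant_measures_def)
  obtain vol f C where vol: "is_volume p vol" and gr: "is_growth p vol f C"
    and ex: "\<And>\<mu>. exponent_sum E d T \<Phi> \<mu> p = (LINT x|\<mu>. lim (\<lambda>n. (1 / real n) * ln (f n x)))"
    by (rule exponent_volume[OF p]) blast
  have "AE x in \<mu>. \<exists>c>0. \<forall>n. c \<le> maxvol p vol n x"
    by (rule exponent_full_imp_bounded_below[OF vol gr \<mu>']) (use full ex[of \<mu>] in simp)
  then have good: "AE x in \<mu>. \<exists>u \<kappa>. expanding p x u \<kappa>"
    by eventually_elim (use bounded_below_imp_expanding[OF vol] in blast)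
  interpret measure_preserving \<mu> T by (rule measure_preserving_borel[OF T_cont \<mu>'])
  let ?B = "ball x0 \<epsilon>"
  have Bs: "?B \<in> sets \<mu>" using \<mu>'(2) by simp
  \<comment> \<open>If no point of the ball had both almost sure properties, the ball would be a
    null set, against \<open>x0\<close> being in the support.\<close>
  have "\<exists>x\<in>?B. (\<exists>u \<kappa>. expanding p x u \<kappa>) \<and> (\<forall>m. \<exists>n\<ge>m. (T ^^ n) x \<in> ?B)"
  proof (rule ccontr)
    assume none: "\<not> ?thesis"
    have "AE x in \<mu>. x \<notin> ?B"
      using good recurrence[OF Bs] by eventually_elim (use none in blast)
    moreover have "{x \<in> space \<mu>. \<not> x \<notin> ?B} = ?B" using sets.sets_into_space[OF Bs] by blast
    ultimately have "emeasure \<mu> ?B = 0" using AE_iff_measurable[OF Bs, of "\<lambda>x. x \<notin> ?B"] by blast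
    moreover have "0 < emeasure \<mu> ?B" using supp \<epsilon> unfolding measure_support_def by simp
    ultimately show False by simp
  qed
  then obtain x u \<kappa> where xu: "expanding p x u \<kappa>" and rec: "\<forall>m. \<exists>n\<ge>m. (T ^^ n) x \<in> ?B" by blast
  from rec obtain n where n: "\<And>i. i \<le> n i" "\<And>i. (T ^^ n i) x \<in> ?B" by metis
  have uf: "u j \<in> fib x" if "j < p" for j using xu that by (auto simp: expanding_def)
  have \<kappa>: "\<kappa> > 0" using xu by (simp add: expanding_def)
  let ?u = "\<lambda>i j. (\<Phi> ^^ n i) (u j)"
  have ind: "indep ((T ^^ n i) x) p (?u i)" for i
  proof (rule indepI_norm)
    show "?u i j \<in> fib ((T ^^ n i) x)" if "j < p" for j using uf[OF that] by (rule iterate_in)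
    show "0 < L ^ n i * \<kappa>" using L_pos \<kappa> by simp
    fix c j assume j: "j < p"
    have "\<kappa> * \<bar>c j\<bar> \<le> \<rho> (n i) (comb x p c u)" using xu j by (simp add: expanding_def)
    then have "L ^ n i * (\<kappa> * \<bar>c j\<bar>) \<le> N ((\<Phi> ^^ n i) (comb x p c u))"
      using L_pos by (simp add: \<rho>_def pos_le_divide_eq mult.commute)
    also have "(\<Phi> ^^ n i) (comb x p c u) = comb ((T ^^ n i) x) p c (?u i)" by (rule iterate_comb) (rule uf)
    finally show "L ^ n i * \<kappa> * \<bar>c j\<bar> \<le> N (comb ((T ^^ n i) x) p c (?u i))" by (simp add: mult.assoc)
  qed
  \<comment> \<open>The normalized images of \<open>u\<close> would have a lower bound depending on
    \<open>x\<close> through \<open>\<kappa>\<close>, and it could degenerate as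
    \<open>\<epsilon>\<close> tends to 0. Auerbach bases of the same spans have constant 1.\<close>
  have "\<exists>w a. (\<forall>j<p. w j = comb ((T ^^ n i) x) p (a j) (?u i)) \<and> unit_tuple p ((T ^^ n i) x) w \<and>
      (\<forall>t. \<forall>j<p. \<bar>t j\<bar> \<le> N (comb ((T ^^ n i) x) p t w))" for i
    by (rule auerbach_basis[OF vol ind[of i]]) blast
  then obtain w a where w: "\<And>i j. j < p \<Longrightarrow> w i j = comb ((T ^^ n i) x) p (a i j) (?u i)"
    and wu: "\<And>i. unit_tuple p ((T ^^ n i) x) (w i)"
    and wb: "\<And>i t j. j < p \<Longrightarrow> \<bar>t j\<bar> \<le> N (comb ((T ^^ n i) x) p t (w i))" by metis
  obtain r l y where r: "strict_mono r" "(\<lambda>k. (T ^^ n (r k)) x) \<longlonglongrightarrow> y" "\<And>j. j < p \<Longrightarrow> conv (\<lambda>k. w (r k) j) (l j)"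
  proof (rule bounded_tuple_subsequence[of p w "\<lambda>i. (T ^^ n i) x" 1])
    show "w i j \<in> fib ((T ^^ n i) x)" "N (w i j) \<le> 1" if "j < p" for i j using wu[of i] that by (auto simp: unit_tuple_def)
  qed (rule that)
  have wf: "w i j \<in> fib ((T ^^ n i) x)" if "j < p" for i j using wu[of i] that by (auto simp: unit_tuple_def)
  have nr: "k \<le> n (r k)" for k using n(1)[of "r k"] seq_suble[OF r(1), of k] by simp
  have "calibrated_frame p y l"
  proof (rule calibrated_frame_limit[OF r(2), where u = "\<lambda>k. w (r k)"])
    fix c
    have cc: "conv (\<lambda>k. comb ((T ^^ n (r k)) x) p c (w (r k))) (comb y p c l)"
      by (rule conv_comb[OF r(2)]) (use wf r(3) in auto)
    have eq: "comb ((T ^^ n i) x) p c (w i) = (\<Phi> ^^ n i) (comb x p (\<lambda>m. \<Sum>j<p. c j * a i j m) u)" for i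
    proof -
      have "comb ((T ^^ n i) x) p c (w i) = comb ((T ^^ n i) x) p c (\<lambda>j. comb ((T ^^ n i) x) p (a i j) (?u i))"
        using w by (intro comb_cong) auto
      also have "\<dots> = comb ((T ^^ n i) x) p (\<lambda>m. \<Sum>j<p. c j * a i j m) (?u i)"
        by (rule comb_comb) (rule indep_in[OF ind])
      also have "\<dots> = (\<Phi> ^^ n i) (comb x p (\<lambda>m. \<Sum>j<p. c j * a i j m) u)"
        by (rule iterate_comb[symmetric]) (rule uf)
      finally show ?thesis .
    qed
    show "comb y p c l \<in> bicalibrated"
      by (rule expanding_iterates_limit_bicalibrated[OF xu nr]) (use cc in \<open>simp add: eq\<close>)
  qed (use wu wb r(3) in auto)
  moreover have "dist y x0 \<le> \<epsilon>"
  proof -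
    have "(\<lambda>k. dist ((T ^^ n (r k)) x) x0) \<longlonglongrightarrow> dist y x0" by (intro tendsto_dist r(2) tendsto_const)
    then show ?thesis by (rule LIMSEQ_le_const2) (use n(2) in \<open>auto simp: dist_commute less_imp_le\<close>)
  qed
  ultimately show ?thesis by blast
qed

text \<open>Frames over points converging to \<open>x\<close> subconverge, and both the norm bounds
  and bicalibration are closed conditions.\<close>

lemma calibrated_frame_exists:
  assumes \<mu>: "\<mu> \<in> invariant_measures T" and supp: "x \<in> measure_support \<mu>"
    and p: "p \<in> {1..d}" and full: "exponent_sum E d T \<Phi> \<mu> p = real p * ln L"
  shows "\<exists>u. calibrated_frame p x u"
proof -
  have "\<exists>y u. dist y x \<le> inverse (real (Suc k)) \<and> calibrated_frame p y u" for k
    by (rule calibrated_frame_near[OF assms]) simp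
  then obtain y u where yu: "\<And>k. dist (y k) x \<le> inverse (real (Suc k))" "\<And>k. calibrated_frame p (y k) (u k)" by metis
  have y: "y \<longlonglongrightarrow> x"
  proof (rule tendsto_dist_iff[THEN iffD2], rule tendsto_sandwich[OF _ _ tendsto_const LIMSEQ_inverse_real_of_nat])
    show "\<forall>\<^sub>F k in sequentially. 0 \<le> dist (y k) x" by simp
    show "\<forall>\<^sub>F k in sequentially. dist (y k) x \<le> inverse (real (Suc k))"
      by (rule always_eventually) (rule allI, rule yu(1))
  qed
  have ut: "unit_tuple p (y k) (u k)" for k using yu(2) by (simp add: calibrated_frame_def)
  obtain r l z where r: "strict_mono r" "(\<lambda>k. y (r k)) \<longlonglongrightarrow> z" "\<And>j. j < p \<Longrightarrow> conv (\<lambda>k. u (r k) j) (l j)"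
  proof (rule bounded_tuple_subsequence[of p u y 1])
    show "u i j \<in> fib (y i)" "N (u i j) \<le> 1" if "j < p" for i j using ut[of i] that by (auto simp: unit_tuple_def)
  qed (rule that)
  have yr: "(\<lambda>k. y (r k)) \<longlonglongrightarrow> x" using LIMSEQ_subseq_LIMSEQ[OF y r(1)] by (simp add: o_def)
  have uf: "u k j \<in> fib (y k)" if "j < p" for k j using ut[of k] that by (auto simp: unit_tuple_def)
  have "calibrated_frame p x l"
  proof (rule calibrated_frame_limit[OF yr, where u = "\<lambda>k. u (r k)"])
    fix c
    have "conv (\<lambda>k. comb (y (r k)) p c (u (r k))) (comb x p c l)"
      by (rule conv_comb[OF yr]) (use uf r(3) in auto)
    then show "comb x p c l \<in> bicalibrated"
      by (rule bicalibrated_closed[rotated]) (use yu(2) in \<open>simp add: calibrated_frame_def\<close>)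
  qed (use ut yu(2) r(3) in \<open>auto simp: calibrated_frame_def\<close>)
  then show ?thesis by blast
qed

end

section \<open>Vanishing combinations and invariant measures from expanding tuples\<close>

lemma (in euclidean_bundle) comb_append:
  assumes u: "\<And>j. j < p \<Longrightarrow> u j \<in> fib x" and g: "\<And>j. j < l \<Longrightarrow> g j \<in> fib x"
  shows "comb x (p + l) c (\<lambda>j. if j < p then u j else g (j - p)) = vadd E (comb x p c u) (comb x l (\<lambda>j. c (p + j)) g)"
proof (rule fib_eqI)
  let ?h = "\<lambda>j. if j < p then u j else g (j - p)"
  have h: "?h j \<in> fib x" if "j < p + l" for j using u[of j] g[of "j - p"] that by auto
  have uc: "comb x p c u \<in> fib x" by (rule comb_in) (rule u)
  have gc: "comb x l (\<lambda>j. c (p + j)) g \<in> fib x" by (rule comb_in) (rule g)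
  show "comb x (p + l) c ?h \<in> fib x" by (rule comb_in) (rule h)
  show "vadd E (comb x p c u) (comb x l (\<lambda>j. c (p + j)) g) \<in> fib x" by (rule vadd_in[OF uc gc])
  fix U k i assume ch: "chart U k" "x \<in> U"
  have split: "(\<Sum>j<p + l. f j) = (\<Sum>j<p. f j) + (\<Sum>j<l. f (p + j))" for f :: "nat \<Rightarrow> real"
    by (induction l) auto
  have "crd k (comb x (p + l) c ?h) i = (\<Sum>j<p + l. c j * crd k (?h j) i)" by (rule crd_comb[OF ch]) (rule h)
  also have "\<dots> = (\<Sum>j<p. c j * crd k (u j) i) + (\<Sum>j<l. c (p + j) * crd k (g j) i)" unfolding split by simp
  also have "(\<Sum>j<p. c j * crd k (u j) i) = crd k (comb x p c u) i" by (rule crd_comb[OF ch, symmetric]) (rule u)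
  also have "(\<Sum>j<l. c (p + j) * crd k (g j) i) = crd k (comb x l (\<lambda>j. c (p + j)) g) i"
    by (rule crd_comb[OF ch, symmetric]) (rule g)
  also have "crd k (comb x p c u) i + crd k (comb x l (\<lambda>j. c (p + j)) g) i =
      crd k (vadd E (comb x p c u) (comb x l (\<lambda>j. c (p + j)) g)) i" by (rule crd_add[OF ch uc gc, symmetric])
  finally show "crd k (comb x (p + l) c ?h) i = crd k (vadd E (comb x p c u) (comb x l (\<lambda>j. c (p + j)) g)) i" .
qed

context extremal_cocycle
begin

text \<open>If expansion fails for every constant, there are normalized coefficients whose
  combinations are arbitrarily small at some times. Their limit \<open>s\<close> works because
  \<open>\<rho>\<close> decreases: the limit along \<open>s\<close> is below every single value, in
  particular below those at the exceptional times.\<close>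

lemma null_combination:
  assumes U: "\<And>j. j < k \<Longrightarrow> U j \<in> fib x" and ne: "\<And>\<kappa>. \<not> expanding k x U \<kappa>"
  shows "\<exists>t. (\<exists>j<k. t j \<noteq> 0) \<and> (\<lambda>n. \<rho> n (comb x k t U)) \<longlonglongrightarrow> 0"
proof -
  have Cf: "comb x k t U \<in> fib x" for t by (rule comb_in) (rule U)
  have "\<exists>n t. (\<Sum>j<k. \<bar>t j\<bar>) = 1 \<and> (\<forall>j\<ge>k. t j = 0) \<and> \<rho> n (comb x k t U) \<le> inverse (real (Suc i))" for i
  proof -
    have "\<exists>n t j. j < k \<and> \<rho> n (comb x k t U) < inverse (real (Suc i)) * \<bar>t j\<bar>"
      using ne[of "inverse (real (Suc i))"] U unfolding expanding_def by (auto simp: not_le)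
    then obtain n t j where j: "j < k" and small: "\<rho> n (comb x k t U) < inverse (real (Suc i)) * \<bar>t j\<bar>" by blast
    define \<sigma> where "\<sigma> = (\<Sum>j<k. \<bar>t j\<bar>)"
    have tj: "\<bar>t j\<bar> \<le> \<sigma>" unfolding \<sigma>_def using j by (intro member_le_sum) auto
    have "0 < \<bar>t j\<bar>"
    proof (rule ccontr)
      assume "\<not> 0 < \<bar>t j\<bar>"
      then show False using small rho_nonneg[OF Cf, of n t] by simp
    qed
    then have \<sigma>: "0 < \<sigma>" using tj by linarith
    define t' where "t' m = (if m < k then 1 / \<sigma> * t m else 0)" for m
    have "comb x k t' U = comb x k (\<lambda>m. 1 / \<sigma> * t m) U" by (intro comb_cong) (auto simp: t'_def)
    also have "\<dots> = vscale E (1 / \<sigma>) (comb x k t U)" by (rule comb_scale[symmetric]) (rule U)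
    finally have "\<rho> n (comb x k t' U) = 1 / \<sigma> * \<rho> n (comb x k t U)"
      using rho_scale[OF Cf[of t], of n "1 / \<sigma>"] \<sigma> by simp
    also have "\<dots> \<le> 1 / \<sigma> * (inverse (real (Suc i)) * \<sigma>)"
    proof (rule mult_left_mono)
      have "inverse (real (Suc i)) * \<bar>t j\<bar> \<le> inverse (real (Suc i)) * \<sigma>" using tj by (intro mult_left_mono) auto
      then show "\<rho> n (comb x k t U) \<le> inverse (real (Suc i)) * \<sigma>" using small by linarith
    qed (use \<sigma> in simp)
    also have "\<dots> = inverse (real (Suc i))" using \<sigma> by simp
    finally have "\<rho> n (comb x k t' U) \<le> inverse (real (Suc i))" .
    moreover have "(\<Sum>m<k. \<bar>t' m\<bar>) = 1"
    proof -
      have "(\<Sum>m<k. \<bar>t' m\<bar>) = (\<Sum>m<k. \<bar>t m\<bar> / \<sigma>)" using \<sigma> by (intro sum.cong) (auto simp: t'_def abs_mult)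
      also have "\<dots> = \<sigma> / \<sigma>" unfolding \<sigma>_def by (rule sum_divide_distrib[symmetric])
      finally show ?thesis using \<sigma> by simp
    qed
    ultimately show ?thesis by (intro exI[of _ n] exI[of _ t']) (auto simp: t'_def)
  qed
  then obtain n t where t1: "\<And>i. (\<Sum>j<k. \<bar>t i j\<bar>) = 1" and t0: "\<And>i j. j \<ge> k \<Longrightarrow> t i j = 0"
    and small: "\<And>i. \<rho> (n i) (comb x k (t i) U) \<le> inverse (real (Suc i))" by metis
  have tb: "\<bar>t i j\<bar> \<le> 1" for i j
  proof (cases "j < k")
    case True
    have "\<bar>t i j\<bar> \<le> (\<Sum>j<k. \<bar>t i j\<bar>)" using True by (intro member_le_sum) auto
    then show ?thesis using t1 by simp
  qed (use t0 in simp)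
  obtain r s where r: "strict_mono r" "\<And>j. (\<lambda>i. t (r i) j) \<longlonglongrightarrow> s j"
    by (rule bounded_coordinates_subsequence[of t 1]) (rule tb, rule that)
  have "(\<lambda>i. \<Sum>j<k. \<bar>t (r i) j\<bar>) \<longlonglongrightarrow> (\<Sum>j<k. \<bar>s j\<bar>)" by (intro tendsto_sum tendsto_rabs r(2))
  then have s1: "(\<Sum>j<k. \<bar>s j\<bar>) = 1" unfolding t1 using LIMSEQ_unique[OF _ tendsto_const] by blast
  have ex: "\<exists>j<k. s j \<noteq> 0"
  proof (rule ccontr)
    assume "\<not> ?thesis"
    then have "(\<Sum>j<k. \<bar>s j\<bar>) = 0" by simp
    then show False using s1 by simp
  qed
  obtain \<nu> where \<nu>: "(\<lambda>n. \<rho> n (comb x k s U)) \<longlonglongrightarrow> \<nu>" using rho_convergent[OF Cf] by blast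
  have \<nu>le: "\<nu> \<le> \<rho> m (comb x k s U)" for m
    by (rule LIMSEQ_le_const2[OF \<nu>]) (use rho_antimono[OF Cf] in blast)
  \<comment> \<open>At time \<open>n (r i)\<close> the combination with coefficients
    \<open>t (r i)\<close> is small, and the remainder is controlled by its norm at time 0.\<close>
  have bound: "\<nu> \<le> inverse (real (Suc (r i))) + N (comb x k (\<lambda>j. s j - t (r i) j) U)" for i
  proof -
    have e: "vadd E (comb x k (t (r i)) U) (comb x k (\<lambda>j. s j - t (r i) j) U) = comb x k s U"
    proof -
      have "vadd E (comb x k (t (r i)) U) (comb x k (\<lambda>j. s j - t (r i) j) U) = comb x k (\<lambda>j. t (r i) j + (s j - t (r i) j)) U"
        by (rule comb_add) (rule U)
      then show ?thesis by simp
    qed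
    have "\<nu> \<le> \<rho> (n (r i)) (comb x k s U)" by (rule \<nu>le)
    also have "\<dots> \<le> \<rho> (n (r i)) (comb x k (t (r i)) U) + \<rho> (n (r i)) (comb x k (\<lambda>j. s j - t (r i) j) U)"
      using rho_add[OF Cf[of "t (r i)"] Cf[of "\<lambda>j. s j - t (r i) j"], of "n (r i)"] unfolding e .
    also have "\<dots> \<le> inverse (real (Suc (r i))) + N (comb x k (\<lambda>j. s j - t (r i) j) U)"
      by (intro add_mono small rho_le[OF Cf])
    finally show ?thesis .
  qed
  have "conv (\<lambda>i. comb x k (\<lambda>j. s j - t (r i) j) U) (comb x k (\<lambda>j. 0) U)"
  proof (rule conv_comb[OF tendsto_const])
    fix j
    show "(\<lambda>i. s j - t (r i) j) \<longlonglongrightarrow> 0" using tendsto_diff[OF tendsto_const r(2), of "s j" j] by simp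
  qed (use U conv_const fib_tot in auto)
  moreover have "comb x k (\<lambda>j. 0) U = vzero E x" by (rule comb_zero) (use U in auto)
  ultimately have "(\<lambda>i. N (comb x k (\<lambda>j. s j - t (r i) j) U)) \<longlonglongrightarrow> 0" using conv_norm norm_zero by metis
  moreover have "(\<lambda>i. inverse (real (Suc (r i)))) \<longlonglongrightarrow> 0"
    using LIMSEQ_subseq_LIMSEQ[OF LIMSEQ_inverse_real_of_nat r(1)] by (simp add: o_def)
  ultimately have "(\<lambda>i. inverse (real (Suc (r i))) + N (comb x k (\<lambda>j. s j - t (r i) j) U)) \<longlonglongrightarrow> 0 + 0"
    by (intro tendsto_add)
  then have "\<nu> \<le> 0 + 0" by (rule LIMSEQ_le_const) (use bound in blast)
  moreover have "0 \<le> \<nu>" by (rule LIMSEQ_le_const[OF \<nu>]) (use rho_nonneg[OF Cf] in blast)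
  ultimately have "\<nu> = 0" by simp
  then show ?thesis using ex \<nu> by blast
qed

text \<open>Combinations of calibrated vectors need not be calibrated, so independence over
  \<open>x\<close> does not give expansion over \<open>x\<close> itself. Preimages under
  \<open>\<Phi> ^^ n\<close>, rescaled by \<open>L ^ n\<close>, keep their norms, and their
  combinations arrive at time \<open>n\<close> as the independent combinations over
  \<open>x\<close>. Limits as \<open>n\<close> grows expand forever, over a point \<open>y\<close>
  of \<open>Y\<close> reached backwards from \<open>x\<close>.\<close>

lemma bicalibrated_indep_expanding:
  assumes Y: "closed Y" "T ` Y = Y" "x \<in> Y" and u: "indep x k u" "\<And>j. j < k \<Longrightarrow> u j \<in> bicalibrated"
  shows "\<exists>y\<in>Y. \<exists>l \<kappa>. expanding k y l \<kappa>"
proof -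
  have uf: "u j \<in> fib x" if "j < k" for j using indep_in[OF u(1) that] .
  obtain \<kappa> where \<kappa>: "\<kappa> > 0" "\<And>c j. j < k \<Longrightarrow> \<kappa> * \<bar>c j\<bar> \<le> N (comb x k c u)" by (rule indep_norm_bound[OF u(1)]) blast
  have preim: "\<exists>z\<in>Y. (T ^^ n) z = y" if "y \<in> Y" for n y
    using that
  proof (induction n arbitrary: y)
    case (Suc n)
    have "y \<in> T ` Y" unfolding Y(2) by (rule Suc.prems)
    then obtain y' where y': "y = T y'" "y' \<in> Y" by (rule imageE)
    obtain z where "z \<in> Y" "(T ^^ n) z = y'" using Suc.IH[OF y'(2)] by (rule bexE)
    then show ?case using y'(1) by (intro bexI[of _ z]) simp
  qed (simp add: bexI)
  have "\<forall>n. \<exists>z w. z \<in> Y \<and> (T ^^ n) z = x \<and> (\<forall>j<k. w j \<in> fib z \<and> (\<Phi> ^^ n) (w j) = u j \<and> calibrated (w j))"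
  proof
    fix n
    obtain z where z: "z \<in> Y" "(T ^^ n) z = x" using preim[OF Y(3)] by blast
    have "\<exists>w. w \<in> fib z \<and> (\<Phi> ^^ n) w = u j \<and> calibrated w" if j: "j < k" for j
    proof -
      obtain w where w: "w \<in> tot" "(\<Phi> ^^ n) w = u j" "calibrated w" using u(2)[OF j] by (auto simp: bicalibrated_def)
      have "(T ^^ n) (bproj E w) = (T ^^ n) z"
        using fib_proj[OF iterate_in[OF tot_fib[OF w(1)], of n]] fib_proj[OF uf[OF j]] w(2) z(2) by simp
      then have "bproj E w = z" by (rule Tn_inj)
      then show ?thesis using w tot_fib[OF w(1)] by auto
    qed
    then have "\<exists>w. \<forall>j<k. w j \<in> fib z \<and> (\<Phi> ^^ n) (w j) = u j \<and> calibrated (w j)" by metis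
    then show "\<exists>z w. z \<in> Y \<and> (T ^^ n) z = x \<and> (\<forall>j<k. w j \<in> fib z \<and> (\<Phi> ^^ n) (w j) = u j \<and> calibrated (w j))"
      using z by blast
  qed
  then obtain z w where z: "\<And>n. z n \<in> Y" "\<And>n. (T ^^ n) (z n) = x"
    and w: "\<And>n j. j < k \<Longrightarrow> w n j \<in> fib (z n)" "\<And>n j. j < k \<Longrightarrow> (\<Phi> ^^ n) (w n j) = u j"
      "\<And>n j. j < k \<Longrightarrow> calibrated (w n j)"
    unfolding choice_iff by auto
  define v where "v n j = vscale E (L ^ n) (w n j)" for n j
  have vf: "v n j \<in> fib (z n)" if "j < k" for n j unfolding v_def using w(1)[OF that] by (rule vscale_in)
  have vN: "N (v n j) \<le> (\<Sum>j<k. N (u j))" if j: "j < k" for n j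
  proof -
    have "N (v n j) = L ^ n * N (w n j)" unfolding v_def using norm_scale[OF w(1)[OF j]] L_pos by simp
    also have "\<dots> = N ((\<Phi> ^^ n) (w n j))" using w(3)[OF j, of n] by (simp add: calibrated_def)
    also have "\<dots> = N (u j)" unfolding w(2)[OF j] ..
    also have "\<dots> \<le> (\<Sum>j<k. N (u j))" using j norm_nonneg[OF uf] by (intro member_le_sum) auto
    finally show ?thesis .
  qed
  \<comment> \<open>At time \<open>n\<close> the bound is the independence bound over
    \<open>x\<close>; monotonicity of \<open>\<rho>\<close> extends it to all earlier times.\<close>
  have vb: "\<kappa> * \<bar>t j\<bar> \<le> \<rho> i (comb (z n) k t (v n))" if i: "i \<le> n" and j: "j < k" for i n j t
  proof -
    have vc: "comb (z n) k t (v n) \<in> fib (z n)" by (rule comb_in) (rule vf)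
    have wc: "comb (z n) k t (w n) \<in> fib (z n)" by (rule comb_in) (rule w(1))
    have "comb (z n) k t (v n) = vscale E (L ^ n) (comb (z n) k t (w n))"
      using comb_iterate_scaled[of k "w n" "z n" 0 t "L ^ n"] w(1) by (simp add: v_def[abs_def])
    then have "\<rho> n (comb (z n) k t (v n)) = N ((\<Phi> ^^ n) (comb (z n) k t (w n)))"
      using rho_scale[OF wc, of n "L ^ n"] L_pos by (simp add: \<rho>_def)
    also have "(\<Phi> ^^ n) (comb (z n) k t (w n)) = comb ((T ^^ n) (z n)) k t (\<lambda>j. (\<Phi> ^^ n) (w n j))"
      by (rule iterate_comb) (rule w(1))
    also have "\<dots> = comb x k t u" unfolding z(2) by (rule comb_cong) (use w(2) in auto)
    finally have "\<kappa> * \<bar>t j\<bar> \<le> \<rho> n (comb (z n) k t (v n))" using \<kappa>(2)[OF j, of t] by simp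
    also have "\<dots> \<le> \<rho> i (comb (z n) k t (v n))" by (rule rho_antimono[OF vc i])
    finally show ?thesis .
  qed
  obtain r l y where r: "strict_mono r" "(\<lambda>n. z (r n)) \<longlonglongrightarrow> y" "\<And>j. j < k \<Longrightarrow> conv (\<lambda>n. v (r n) j) (l j)"
  proof (rule bounded_tuple_subsequence[of k v z "\<Sum>j<k. N (u j)"])
    show "v n j \<in> fib (z n)" "N (v n j) \<le> (\<Sum>j<k. N (u j))" if "j < k" for n j by (rule vf[OF that], rule vN[OF that])
  qed (rule that)
  have "y \<in> Y" using closed_sequentially[OF Y(1) _ r(2)] z(1) by simp
  moreover have "expanding k y l \<kappa>"
  proof (rule expanding_limit[OF r(2), where u = "\<lambda>n. v (r n)"])
    fix n i j :: nat and t assume "i \<le> n" "j < k"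
    then show "\<kappa> * \<bar>t j\<bar> \<le> \<rho> i (comb (z (r n)) k t (v (r n)))"
      using seq_suble[OF r(1), of n] by (intro vb) auto
  qed (use vf r(3) \<kappa>(1) in auto)
  ultimately show ?thesis by blast
qed

text \<open>Expansion with fixed constant and bounded length holds on a compact forward invariant
  set \<open>K\<close>. An invariant measure carried by \<open>K\<close> has full exponent sums for
  every \<open>i \<le> k\<close>, because an initial part of an expanding tuple expands with the
  same constant.\<close>

lemma expanding_imp_mather:
  assumes Y: "compact Y" "T ` Y = Y" "x \<in> Y" and ex: "expanding k x u \<kappa>"
  shows "\<exists>\<mu>\<in>invariant_measures T. measure_support \<mu> \<inter> Y \<noteq> {} \<and>
    (\<forall>i\<in>{1..k}. exponent_sum E d T \<Phi> \<mu> i = real i * ln L)"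
proof -
  have uf: "u j \<in> fib x" if "j < k" for j using ex that by (auto simp: expanding_def)
  have \<kappa>: "\<kappa> > 0" using ex by (simp add: expanding_def)
  \<comment> \<open>The length bound makes tuples over converging points subconverge, so that
    \<open>K\<close> is closed. It is preserved by normalized iteration, since
    \<open>\<rho> 1\<close> is at most the norm.\<close>
  define B where "B = (\<Sum>j<k. N (u j))"
  define K where "K = {z \<in> Y. \<exists>w. (\<forall>j<k. N (w j) \<le> B) \<and> expanding k z w \<kappa>}"
  have "closed K" unfolding closed_sequential_limits
  proof (intro allI impI)
    fix y z assume as: "(\<forall>n. y n \<in> K) \<and> y \<longlonglongrightarrow> z"
    then have "\<forall>n. \<exists>w. (\<forall>j<k. N (w j) \<le> B) \<and> expanding k (y n) w \<kappa>" by (auto simp: K_def)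
    then obtain w where w: "\<And>n j. j < k \<Longrightarrow> N (w n j) \<le> B" "\<And>n. expanding k (y n) (w n) \<kappa>" unfolding choice_iff by blast
    have wf: "w n j \<in> fib (y n)" if "j < k" for n j using w(2) that by (auto simp: expanding_def)
    obtain r l z' where r: "strict_mono r" "(\<lambda>n. y (r n)) \<longlonglongrightarrow> z'" "\<And>j. j < k \<Longrightarrow> conv (\<lambda>n. w (r n) j) (l j)"
    proof (rule bounded_tuple_subsequence[of k w y B])
      show "w n j \<in> fib (y n)" "N (w n j) \<le> B" if "j < k" for n j by (rule wf[OF that], rule w(1)[OF that])
    qed (rule that)
    have yr: "(\<lambda>n. y (r n)) \<longlonglongrightarrow> z" using LIMSEQ_subseq_LIMSEQ[OF conjunct2[OF as] r(1)] by (simp add: o_def)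
    have "N (l j) \<le> B" if "j < k" for j
      by (rule LIMSEQ_le_const2[OF conv_norm[OF r(3)[OF that]]]) (use w(1)[OF that] in blast)
    moreover have "expanding k z l \<kappa>"
    proof (rule expanding_limit[OF yr, where u = "\<lambda>n. w (r n)"])
      fix n i j :: nat and t assume "i \<le> n" "j < k"
      then show "\<kappa> * \<bar>t j\<bar> \<le> \<rho> i (comb (y (r n)) k t (w (r n)))" using w(2)[of "r n"] by (auto simp: expanding_def)
    qed (use wf r(3) \<kappa> in auto)
    moreover have "z \<in> Y" by (rule closed_sequentially[OF compact_imp_closed[OF Y(1)] _ conjunct2[OF as]]) (use as in \<open>auto simp: K_def\<close>)
    ultimately show "z \<in> K" by (auto simp: K_def)
  qed
  then have Kc: "compact K" using compact_Int_closed[OF Y(1)] by (metis (no_types, lifting) K_def Int_absorb1 mem_Collect_eq subsetI)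
  have "N (u j) \<le> B" if "j < k" for j unfolding B_def using that norm_nonneg[OF uf] by (intro member_le_sum) auto
  then have xK: "x \<in> K" using Y(3) ex by (auto simp: K_def)
  have TK: "T ` K \<subseteq> K"
  proof
    fix y assume "y \<in> T ` K"
    then obtain z w where z: "y = T z" "z \<in> Y" "\<And>j. j < k \<Longrightarrow> N (w j) \<le> B" "expanding k z w \<kappa>" by (auto simp: K_def)
    have wf: "w j \<in> fib z" if "j < k" for j using z(4) that by (auto simp: expanding_def)
    let ?w = "\<lambda>j. vscale E (1 / L ^ 1) ((\<Phi> ^^ 1) (w j))"
    have wi: "?w j \<in> fib ((T ^^ 1) z)" if "j < k" for j by (intro vscale_in iterate_in wf[OF that])
    have "N (?w j) \<le> B" if j: "j < k" for j
    proof -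
      have "N (?w j) = \<rho> 1 (w j)"
        using norm_scale[OF iterate_in[OF wf[OF j]], of "1 / L ^ 1" 1] L_pos by (simp add: \<rho>_def)
      then show ?thesis using rho_le[OF wf[OF j], of 1] z(3)[OF j] by linarith
    qed
    moreover have "expanding k ((T ^^ 1) z) ?w \<kappa>"
      unfolding expanding_def
    proof (intro conjI allI impI \<kappa> wi)
      fix n t j assume j: "j < k"
      have "\<rho> n (comb ((T ^^ 1) z) k t ?w) = \<rho> (1 + n) (comb z k t w)" by (rule rho_comb_iterate_scaled) (rule wf)
      then show "\<kappa> * \<bar>t j\<bar> \<le> \<rho> n (comb ((T ^^ 1) z) k t ?w)" using z(4) j by (simp add: expanding_def del: funpow.simps)
    qed
    moreover have "y \<in> Y" using z Y(2) by blast
    ultimately show "y \<in> K" unfolding K_def z(1) mem_Collect_eq by (intro conjI exI[of _ ?w]) simp_all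
  qed
  obtain \<mu> where \<mu>: "prob_space \<mu>" "sets \<mu> = sets borel" "distr \<mu> borel T = \<mu>" "measure \<mu> K = 1"
  proof (rule krylov_bogoliubov[OF Kc _ T_cont TK])
    show "K \<noteq> {}" using xK by blast
  qed (rule that)
  interpret prob_space \<mu> by fact
  have Ks: "K \<in> sets \<mu>" using Kc \<mu>(2) by (simp add: borel_compact)
  have inK: "AE z in \<mu>. z \<in> K" by (rule AE_prob_1[OF \<mu>(4)])
  have "exponent_sum E d T \<Phi> \<mu> i = real i * ln L" if i: "i \<in> {1..k}" for i
  proof -
    have id: "i \<in> {1..d}" using i indep_le_dim[OF expanding_indep[OF ex]] by auto
    obtain vol f C where vol: "is_volume i vol" and gr: "is_growth i vol f C"
      and es: "\<And>\<mu>. exponent_sum E d T \<Phi> \<mu> i = (LINT x|\<mu>. lim (\<lambda>n. (1 / real n) * ln (f n x)))"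
      by (rule exponent_volume[OF id]) blast
    have "AE z in \<mu>. \<exists>c>0. \<forall>n. c \<le> maxvol i vol n z"
      using inK
    proof eventually_elim
      case (elim z)
      then obtain w where "expanding k z w \<kappa>" by (auto simp: K_def)
      then have "expanding i z w \<kappa>" by (rule expanding_prefix) (use i in simp)
      then show ?case by (rule expanding_imp_bounded_below[OF vol])
    qed
    then show ?thesis unfolding es by (rule bounded_below_imp_exponent_full[OF vol gr \<mu>(1,2)])
  qed
  moreover have "measure_support \<mu> \<inter> Y \<noteq> {}"
  proof
    assume none: "measure_support \<mu> \<inter> Y = {}"
    \<comment> \<open>Otherwise \<open>K\<close> would be covered by finitely many open null sets,
      although it has measure 1.\<close>
    have "\<exists>U. open U \<and> z \<in> U \<and> emeasure \<mu> U = 0" if "z \<in> K" for z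
    proof -
      have "z \<notin> measure_support \<mu>" using none that by (auto simp: K_def)
      then obtain U where "open U" "z \<in> U" "\<not> 0 < emeasure \<mu> U" unfolding measure_support_def by blast
      then show ?thesis by (intro exI[of _ U]) simp
    qed
    then have "\<forall>z\<in>K. \<exists>U. open U \<and> z \<in> U \<and> emeasure \<mu> U = 0" by (intro ballI)
    from bchoice[OF this] obtain U where U: "\<forall>z\<in>K. open (U z) \<and> z \<in> U z \<and> emeasure \<mu> (U z) = 0" by (rule exE)
    obtain D where D: "D \<subseteq> K" "finite D" "K \<subseteq> (\<Union>z\<in>D. U z)"
    proof (rule compactE_image[OF Kc, of K U])
      show "open (U z)" if "z \<in> K" for z using U that by blast
      show "K \<subseteq> (\<Union>z\<in>K. U z)" using U by blast
    qed (rule that)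
    have Us: "U z \<in> null_sets \<mu>" if "z \<in> D" for z 
    proof (rule null_setsI)
      have "open (U z)" using U D(1) that by blast
      then show "U z \<in> sets \<mu>" using \<mu>(2) by simp
      show "emeasure \<mu> (U z) = 0" using U D(1) that by blast
    qed
    have "(\<Union>z\<in>D. U z) \<in> null_sets \<mu>" by (rule null_sets_UN'[OF countable_finite[OF D(2)]]) (rule Us)
    then have "K \<in> null_sets \<mu>" using Ks D(3) by (rule null_sets_subset)
    then have "measure \<mu> K = 0" by (simp add: measure_def null_setsD1)
    then show False using \<mu>(4) by simp
  qed
  moreover have "\<mu> \<in> invariant_measures T" using \<mu>(1-3) by (simp add: invariant_measures_def)
  ultimately show ?thesis by (intro bexI[of _ \<mu>] conjI ballI)
qed

end

section \<open>The dominated splitting\<close>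

text \<open>The conditions on Mather sets are restated with exponent sums, the quantities controlled
  by volumes. The guard \<open>p + 1 \<le> d\<close> reflects that the Mather set of index
  \<open>d + 1\<close> is empty.\<close>

locale extremal_splitting = extremal_cocycle E d N T \<Phi> L S
  for E :: "('x::metric_space, 'e) vbundle" and d N T \<Phi> L S +
  fixes p :: nat and Y :: "'x set"
  assumes p: "p \<in> {1..d}" and Y_compact: "compact Y" and TY: "T ` Y = Y"
    and on_mather: "\<And>x. x \<in> Y \<Longrightarrow> \<exists>\<mu>\<in>invariant_measures T. x \<in> measure_support \<mu> \<and>
      exponent_sum E d T \<Phi> \<mu> p = real p * ln L"
    and off_mather: "\<And>x \<mu>. x \<in> Y \<Longrightarrow> \<mu> \<in> invariant_measures T \<Longrightarrow> x \<in> measure_support \<mu> \<Longrightarrow> p + 1 \<le> d \<Longrightarrow>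
      \<exists>i\<in>{1..p + 1}. exponent_sum E d T \<Phi> \<mu> i \<noteq> real i * ln L"
begin

lemma T_Y: "x \<in> Y \<Longrightarrow> T x \<in> Y"
  using TY by blast

lemma frame_ex: "x \<in> Y \<Longrightarrow> \<exists>u. calibrated_frame p x u"
  using on_mather[of x] calibrated_frame_exists[OF _ _ p] by blast

lemma not_expanding: assumes x: "x \<in> Y" shows "\<not> expanding (Suc p) x u \<kappa>"
proof
  assume ex: "expanding (Suc p) x u \<kappa>"
  obtain \<mu> where \<mu>: "\<mu> \<in> invariant_measures T" "measure_support \<mu> \<inter> Y \<noteq> {}"
    "\<forall>i\<in>{1..Suc p}. exponent_sum E d T \<Phi> \<mu> i = real i * ln L"
    using expanding_imp_mather[OF Y_compact TY x ex] by (elim bexE conjE)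
  obtain z where z: "z \<in> Y" "z \<in> measure_support \<mu>" using \<mu>(2) by blast
  have "p + 1 \<le> d" using indep_le_dim[OF expanding_indep[OF ex]] by simp
  then show False using off_mather[OF z(1) \<mu>(1) z(2)] \<mu>(3) by auto
qed

section \<open>The two bundles, their fibers and the contraction estimate\<close>

definition FF :: "'e set" where "FF = {v \<in> bicalibrated. bproj E v \<in> Y}"
definition GG :: "'e set" where "GG = {v \<in> tot. bproj E v \<in> Y \<and> (\<lambda>n. \<rho> n v) \<longlonglongrightarrow> 0}"

lemma FF_iff: "v \<in> fib x \<Longrightarrow> x \<in> Y \<Longrightarrow> v \<in> FF \<longleftrightarrow> v \<in> bicalibrated"
  and GG_iff: "v \<in> fib x \<Longrightarrow> x \<in> Y \<Longrightarrow> v \<in> GG \<longleftrightarrow> (\<lambda>n. \<rho> n v) \<longlonglongrightarrow> 0"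
  by (auto simp: FF_def GG_def fiber_def)

lemma frame_facts:
  assumes "calibrated_frame p x u"
  shows frame_fib: "j < p \<Longrightarrow> u j \<in> fib x"
    and frame_norm: "j < p \<Longrightarrow> N (u j) \<le> 1"
    and frame_lower: "j < p \<Longrightarrow> \<bar>c j\<bar> \<le> N (comb x p c u)"
    and frame_span: "comb x p c u \<in> bicalibrated"
    and frame_in_fib: "comb x p c u \<in> fib x"
    and frame_independent: "indep x p u"
proof -
  show fb: "j < p \<Longrightarrow> u j \<in> fib x" and "j < p \<Longrightarrow> N (u j) \<le> 1" for j
    using assms by (auto simp: calibrated_frame_def unit_tuple_def)
  show lo: "j < p \<Longrightarrow> \<bar>c j\<bar> \<le> N (comb x p c u)" and "comb x p c u \<in> bicalibrated" for j c
    using assms by (auto simp: calibrated_frame_def)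
  show "comb x p c u \<in> fib x" for c by (rule comb_in) (rule fb)
  show "indep x p u" by (rule indepI_norm[of p u x 1]) (use fb lo in auto)
qed

text \<open>A bicalibrated vector outside the span would complete the frame to \<open>p + 1\<close>
  independent bicalibrated vectors, hence yield an expanding tuple of that length, possibly over a
  different point of \<open>Y\<close>. In particular the span does not depend on the chosen
  frame.\<close>

lemma FF_span:
  assumes x: "x \<in> Y" and u: "calibrated_frame p x u" and v: "v \<in> bicalibrated" "v \<in> fib x"
  shows "\<exists>c. v = comb x p c u"
proof (rule ccontr)
  assume "\<not> ?thesis"
  then have ns: "v \<noteq> comb x p c u" for c by blast
  have ind: "indep x (Suc p) (u(p := v))" by (rule indep_extend[OF frame_independent[OF u] v(2) ns])
  have "(u(p := v)) j \<in> bicalibrated" if "j < Suc p" for j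
  proof (cases "j = p")
    case False
    then have j: "j < p" using that by simp
    have "comb x p (\<lambda>i. if i = j then 1 else 0) u = vscale E 1 (u j)"
      by (rule comb_single[OF j]) (rule frame_fib[OF u])
    also have "\<dots> = u j"
      by (rule fib_eqI) (use frame_fib[OF u j] in \<open>auto intro!: vscale_in simp: crd_scale\<close>)
    finally show ?thesis using frame_span[OF u] False by (metis fun_upd_apply)
  qed (use v in simp)
  from bicalibrated_indep_expanding[OF compact_imp_closed[OF Y_compact] TY x ind this]
  show False using not_expanding by blast
qed

lemma null_calibrated_zero:
  assumes v: "v \<in> bicalibrated" "v \<in> fib x" and "(\<lambda>n. \<rho> n v) \<longlonglongrightarrow> 0" shows "v = vzero E x"
proof -
  have "(\<lambda>n. \<rho> n v) = (\<lambda>n. N v)" using bicalibrated_rho[OF v(1)] by simp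
  then have "N v = 0" using assms(3) LIMSEQ_unique[OF tendsto_const] by metis
  then show ?thesis using norm_eq_0[OF v(2)] by simp
qed

lemma null_add:
  assumes "u \<in> fib x" "v \<in> fib x" "(\<lambda>n. \<rho> n u) \<longlonglongrightarrow> 0" "(\<lambda>n. \<rho> n v) \<longlonglongrightarrow> 0"
  shows "(\<lambda>n. \<rho> n (vadd E u v)) \<longlonglongrightarrow> 0"
proof (rule tendsto_sandwich[OF _ _ tendsto_const])
  show "(\<lambda>n. \<rho> n u + \<rho> n v) \<longlonglongrightarrow> 0" using tendsto_add[OF assms(3,4)] by simp
  show "\<forall>\<^sub>F n in sequentially. 0 \<le> \<rho> n (vadd E u v)" using rho_nonneg[OF vadd_in[OF assms(1,2)]] by simp
  show "\<forall>\<^sub>F n in sequentially. \<rho> n (vadd E u v) \<le> \<rho> n u + \<rho> n v" using rho_add[OF assms(1,2)] by simp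
qed

lemma null_scale:
  assumes "v \<in> fib x" "(\<lambda>n. \<rho> n v) \<longlonglongrightarrow> 0" shows "(\<lambda>n. \<rho> n (vscale E c v)) \<longlonglongrightarrow> 0"
  using tendsto_mult[OF tendsto_const[of "\<bar>c\<bar>"] assms(2)] by (simp add: rho_scale[OF assms(1)])

lemma null_zero: "(\<lambda>n. \<rho> n (vzero E x)) \<longlonglongrightarrow> 0"
  by (simp add: \<rho>_def iterate_zero norm_zero)

lemma null_comb:
  assumes "\<And>j. j < k \<Longrightarrow> u j \<in> fib x" "\<And>j. j < k \<Longrightarrow> (\<lambda>n. \<rho> n (u j)) \<longlonglongrightarrow> 0"
  shows "(\<lambda>n. \<rho> n (comb x k c u)) \<longlonglongrightarrow> 0"
  using assms
proof (induction k)
  case 0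
  then show ?case using null_zero by simp
next
  case (Suc k)
  have "comb x k c u \<in> fib x" by (rule comb_in) (rule Suc.prems(1), simp)
  then show ?case unfolding comb.simps
    by (rule null_add) (use Suc in \<open>auto intro!: vscale_in null_scale\<close>)
qed

text \<open>The frame together with \<open>v\<close> cannot expand, so some nontrivial combination
  is null. Its coefficient at \<open>v\<close> is nonzero, since a combination of the frame alone is
  bicalibrated and would have to vanish; solving for \<open>v\<close> gives the two
  components.\<close>

lemma splitting_exists:
  assumes x: "x \<in> Y" and u: "calibrated_frame p x u" and v: "v \<in> fib x"
  shows "\<exists>c g. g \<in> fib x \<and> (\<lambda>n. \<rho> n g) \<longlonglongrightarrow> 0 \<and> v = vadd E (comb x p c u) g"
proof -
  let ?U = "u(p := v)"
  have Uf: "?U j \<in> fib x" if "j < Suc p" for j using frame_fib[OF u, of j] v that by (cases "j = p") auto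
  obtain t where t: "\<exists>j<Suc p. t j \<noteq> 0" and lim: "(\<lambda>n. \<rho> n (comb x (Suc p) t ?U)) \<longlonglongrightarrow> 0"
    using null_combination[of "Suc p" ?U x, OF Uf not_expanding[OF x]] by blast
  let ?w = "comb x (Suc p) t ?U"
  have w: "?w = vadd E (comb x p t u) (vscale E (t p) v)"
  proof -
    have "comb x p t ?U = comb x p t u" by (rule comb_cong) auto
    then show ?thesis by simp
  qed
  note uc = frame_in_fib[OF u]
  have wf: "?w \<in> fib x" unfolding w by (intro vadd_in uc vscale_in v)
  have tp: "t p \<noteq> 0"
  proof
    assume 0: "t p = 0"
    have "?w = comb x p t u" unfolding w
      by (rule fib_eqI) (use uc v 0 in \<open>auto intro!: vadd_in vscale_in simp: crd_add crd_scale vscale_in\<close>)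
    then have "comb x p t u = vzero E x" using null_calibrated_zero[OF frame_span[OF u] uc] lim by simp
    then have "\<bar>t j\<bar> \<le> 0" if "j < p" for j using frame_lower[OF u that, of t] norm_zero by simp
    then show False using t 0 by (auto simp: less_Suc_eq)
  qed
  let ?f = "comb x p (\<lambda>j. - (1 / t p) * t j) u" and ?g = "vscale E (1 / t p) ?w"
  have f: "?f = vscale E (- (1 / t p)) (comb x p t u)" by (rule comb_scale[symmetric]) (rule frame_fib[OF u])
  have "v = vadd E ?f ?g"
  proof (rule fib_eqI[OF v])
    show "vadd E ?f ?g \<in> fib x" by (intro vadd_in uc vscale_in wf)
    fix U h i assume ch: "chart U h" "x \<in> U"
    have "crd h (vadd E ?f ?g) i = - (1 / t p) * crd h (comb x p t u) i + 1 / t p * crd h ?w i"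
      by (simp only: f crd_add[OF ch vscale_in[OF uc] vscale_in[OF wf]] crd_scale[OF ch uc] crd_scale[OF ch wf])
    also have "crd h ?w i = crd h (comb x p t u) i + t p * crd h v i"
      unfolding w by (simp only: crd_add[OF ch uc vscale_in[OF v]] crd_scale[OF ch v])
    also have "- (1 / t p) * crd h (comb x p t u) i + 1 / t p * (crd h (comb x p t u) i + t p * crd h v i) = crd h v i"
      using tp by (simp add: distrib_left)
    finally show "crd h v i = crd h (vadd E ?f ?g) i" by (rule sym)
  qed
  then show ?thesis using null_scale[OF wf lim] vscale_in[OF wf] by blast
qed

text \<open>The difference of the two frame components is again a combination of the frame, hence
  bicalibrated, and it equals a difference of null vectors. Being both, it is zero.\<close>

lemma splitting_unique:
  assumes x: "x \<in> Y" and u: "calibrated_frame p x u" and g: "g \<in> fib x" "(\<lambda>n. \<rho> n g) \<longlonglongrightarrow> 0"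
    and g': "g' \<in> fib x" "(\<lambda>n. \<rho> n g') \<longlonglongrightarrow> 0"
    and eq: "vadd E (comb x p c u) g = vadd E (comb x p c' u) g'"
  shows "comb x p c u = comb x p c' u" "g = g'"
proof -
  note uc = frame_in_fib[OF u]
  let ?h = "comb x p (\<lambda>j. c j - c' j) u" and ?k = "vadd E g' (vscale E (- 1) g)"
  have h: "vadd E ?h (comb x p c' u) = comb x p c u"
  proof -
    have "vadd E ?h (comb x p c' u) = comb x p (\<lambda>j. c j - c' j + c' j) u" by (rule comb_add) (rule frame_fib[OF u])
    then show ?thesis by simp
  qed
  have kf: "?k \<in> fib x" by (intro vadd_in vscale_in g g')
  have hk: "?h = ?k"
  proof (rule fib_eqI[OF uc kf])
    fix U k i assume ch: "chart U k" "x \<in> U"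
    have 1: "crd k (comb x p c u) i + crd k g i = crd k (comb x p c' u) i + crd k g' i"
      using arg_cong[OF eq, of "\<lambda>v. crd k v i"] by (simp only: crd_add[OF ch uc g(1)] crd_add[OF ch uc g'(1)])
    have 2: "crd k ?h i + crd k (comb x p c' u) i = crd k (comb x p c u) i"
      using arg_cong[OF h, of "\<lambda>v. crd k v i"] by (simp only: crd_add[OF ch uc uc])
    have 3: "crd k ?k i = crd k g' i + - 1 * crd k g i"
      by (simp only: crd_add[OF ch g'(1) vscale_in[OF g(1)]] crd_scale[OF ch g(1)])
    show "crd k ?h i = crd k ?k i" using 1 2 3 by linarith
  qed
  have "(\<lambda>n. \<rho> n ?k) \<longlonglongrightarrow> 0" by (intro null_add[OF g'(1) vscale_in[OF g(1)]] g' null_scale[OF g(1)] g)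
  then have h0: "?h = vzero E x" using null_calibrated_zero[OF frame_span[OF u] uc] unfolding hk by (simp add: hk[symmetric])
  then show e: "comb x p c u = comb x p c' u" using h vzero_add[OF uc] by simp
  show "g = g'"
  proof (rule fib_eqI[OF g(1) g'(1)])
    fix U k i assume ch: "chart U k" "x \<in> U"
    have "crd k (comb x p c u) i + crd k g i = crd k (comb x p c' u) i + crd k g' i"
      using arg_cong[OF eq, of "\<lambda>v. crd k v i"] by (simp only: crd_add[OF ch uc g(1)] crd_add[OF ch uc g'(1)])
    then show "crd k g i = crd k g' i" using e by simp
  qed
qed

lemma null_phi_iff: "v \<in> fib x \<Longrightarrow> (\<lambda>n. \<rho> n (\<Phi> v)) \<longlonglongrightarrow> 0 \<longleftrightarrow> (\<lambda>n. \<rho> n v) \<longlonglongrightarrow> 0"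
proof -
  have e: "(\<lambda>n. \<rho> n (\<Phi> v)) = (\<lambda>n. L * \<rho> (Suc n) v)" using rho_iterate[of _ 1 v] by simp
  have "(\<lambda>n. L * \<rho> (Suc n) v) \<longlonglongrightarrow> L * 0 \<longleftrightarrow> (\<lambda>n. \<rho> (Suc n) v) \<longlonglongrightarrow> 0"
    using L_pos by (intro tendsto_mult_left_iff) simp
  then show ?thesis unfolding e using filterlim_sequentially_Suc[of "\<lambda>n. \<rho> n v" "nhds 0"] by simp
qed

text \<open>Otherwise vectors of the dominated bundle that contract ever more slowly, together with calibrated frames,
  would converge to an expanding tuple of length $p + 1$.\<close>

lemma uniform_contraction:
  obtains m where "0 < m" "\<And>x v. x \<in> Y \<Longrightarrow> v \<in> fib x \<Longrightarrow> (\<lambda>n. \<rho> n v) \<longlonglongrightarrow> 0 \<Longrightarrow> \<rho> m v \<le> 1 / 2 * N v"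
proof -
  have "\<exists>m. \<forall>x v. x \<in> Y \<longrightarrow> v \<in> fib x \<longrightarrow> (\<lambda>n. \<rho> n v) \<longlonglongrightarrow> 0 \<longrightarrow> \<rho> (Suc m) v \<le> 1 / 2 * N v"
  proof (rule ccontr)
    assume "\<not> ?thesis"
    then have "\<forall>m. \<exists>x v. x \<in> Y \<and> v \<in> fib x \<and> (\<lambda>n. \<rho> n v) \<longlonglongrightarrow> 0 \<and> 1 / 2 * N v < \<rho> (Suc m) v" by (simp add: not_le)
    then obtain y v' where y: "\<And>m. y m \<in> Y" and v': "\<And>m. v' m \<in> fib (y m)" "\<And>m. (\<lambda>n. \<rho> n (v' m)) \<longlonglongrightarrow> 0"
      "\<And>m. 1 / 2 * N (v' m) < \<rho> (Suc m) (v' m)" unfolding choice_iff by blast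
    define v where "v m = vscale E (1 / N (v' m)) (v' m)" for m
    have pos: "N (v' m) > 0" for m
    proof (rule ccontr)
      assume "\<not> 0 < N (v' m)"
      then have "N (v' m) = 0" using norm_nonneg[OF v'(1)[of m]] by simp
      then show False using v'(3)[of m] rho_le[OF v'(1)[of m], of "Suc m"] by simp
    qed
    have vf: "v m \<in> fib (y m)" for m unfolding v_def by (intro vscale_in v')
    have v0: "(\<lambda>n. \<rho> n (v m)) \<longlonglongrightarrow> 0" for m unfolding v_def by (rule null_scale[OF v'(1,2)])
    have vN: "N (v m) = 1" for m unfolding v_def using norm_scale[OF v'(1)] pos[of m] by simp
    have vh: "1 / 2 < \<rho> (Suc m) (v m)" for m
    proof -
      have "1 / 2 = 1 / N (v' m) * (1 / 2 * N (v' m))" using pos[of m] by simp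
      also have "\<dots> < 1 / N (v' m) * \<rho> (Suc m) (v' m)" using v'(3)[of m] pos[of m] by (intro mult_strict_left_mono) auto
      also have "\<dots> = \<rho> (Suc m) (v m)" unfolding v_def using rho_scale[OF v'(1)[of m], of "Suc m" "1 / N (v' m)"] pos[of m] by simp
      finally show ?thesis .
    qed
    have "\<forall>m. \<exists>u. calibrated_frame p (y m) u" using frame_ex y by blast
    then obtain u where u: "\<And>m. calibrated_frame p (y m) (u m)" unfolding choice_iff by blast
    define U where "U m = (u m)(p := v m)" for m
    have Uf: "U m j \<in> fib (y m)" if "j < Suc p" for m j
      using frame_fib[OF u, of j m] vf[of m] that by (cases "j = p") (auto simp: U_def)
    have UN: "N (U m j) \<le> 1" if "j < Suc p" for m j
      using frame_norm[OF u, of j m] vN[of m] that by (cases "j = p") (auto simp: U_def)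
    \<comment> \<open>Letting time tend to infinity kills the component along \<open>v m\<close>, so
      \<open>N ?f\<close> is at most every \<open>\<rho> i ?c\<close>. For \<open>i \<le> m\<close>
      the vector \<open>v m\<close> retains size 1/2, which gives \<open>\<bar>t p\<bar> / 2 \<le>
      \<rho> i ?c + N ?f \<le> 2 * \<rho> i ?c\<close> and thereby the constant 1/4.\<close>
    have low: "1 / 4 * \<bar>t j\<bar> \<le> \<rho> i (comb (y m) (Suc p) t (U m))" if i: "i \<le> m" and j: "j < Suc p" for i m j t
    proof -
      let ?f = "comb (y m) p t (u m)" and ?c = "comb (y m) (Suc p) t (U m)" and ?s = "vscale E (t p) (v m)"
      have f: "?f \<in> fib (y m)" by (rule frame_in_fib[OF u])
      have s: "?s \<in> fib (y m)" by (rule vscale_in[OF vf])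
      have c: "?c = vadd E ?f ?s"
      proof -
        have "comb (y m) p t (U m) = ?f" by (rule comb_cong) (auto simp: U_def)
        then show ?thesis by (simp add: U_def)
      qed
      have cf: "?c \<in> fib (y m)" unfolding c by (rule vadd_in[OF f s])
      have m1: "vscale E (- 1) ?s \<in> fib (y m)" "vscale E (- 1) ?f \<in> fib (y m)" by (intro vscale_in s f)+
      have f_eq: "?f = vadd E ?c (vscale E (- 1) ?s)"
      proof (rule fib_eqI[OF f vadd_in[OF cf m1(1)]])
        fix V h k assume ch: "chart V h" "y m \<in> V"
        show "crd h ?f k = crd h (vadd E ?c (vscale E (- 1) ?s)) k"
          unfolding crd_add[OF ch cf m1(1)] crd_scale[OF ch s] unfolding c crd_add[OF ch f s] by simp
      qed
      have s_eq: "?s = vadd E ?c (vscale E (- 1) ?f)"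
      proof (rule fib_eqI[OF s vadd_in[OF cf m1(2)]])
        fix V h k assume ch: "chart V h" "y m \<in> V"
        show "crd h ?s k = crd h (vadd E ?c (vscale E (- 1) ?f)) k"
          unfolding crd_add[OF ch cf m1(2)] crd_scale[OF ch f] unfolding c crd_add[OF ch f s] by simp
      qed
      have rf: "\<rho> n ?f = N ?f" for n by (rule bicalibrated_rho[OF frame_span[OF u]])
      have s0: "(\<lambda>n. \<rho> n ?s) \<longlonglongrightarrow> 0" by (rule null_scale[OF vf v0])
      have "\<rho> n ?f \<le> \<rho> n ?c + \<rho> n ?s" for n
        using rho_add[OF cf m1(1), of n] rho_scale[OF s, of n "- 1"] unfolding f_eq[symmetric] by simp
      then have "N ?f \<le> \<rho> i ?c + \<rho> n ?s" if "i \<le> n" for n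
        using rho_antimono[OF cf that] unfolding rf by (meson add_mono order_refl order_trans)
      then have "N ?f \<le> \<rho> i ?c + 0"
        by (intro LIMSEQ_le_const[OF tendsto_add[OF tendsto_const s0]]) blast
      then have 1: "N ?f \<le> \<rho> i ?c" by simp
      have "\<rho> i ?s \<le> \<rho> i ?c + \<rho> i ?f"
        using rho_add[OF cf m1(2), of i] rho_scale[OF f, of i "- 1"] unfolding s_eq[symmetric] by simp
      then have 2: "\<bar>t p\<bar> * \<rho> i (v m) \<le> \<rho> i ?c + N ?f" unfolding rf rho_scale[OF vf] .
      have "1 / 2 \<le> \<rho> i (v m)" using vh[of m] rho_antimono[OF vf[of m], of i "Suc m"] i by simp
      then have "\<bar>t p\<bar> * (1 / 2) \<le> \<bar>t p\<bar> * \<rho> i (v m)" by (intro mult_left_mono) auto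
      then have 3: "1 / 4 * \<bar>t p\<bar> \<le> \<rho> i ?c" using 1 2 by linarith
      show ?thesis
      proof (cases "j = p")
        case False
        then have "\<bar>t j\<bar> \<le> N ?f" using frame_lower[OF u, of j t m] j by simp
        then show ?thesis using 1 by linarith
      qed (use 3 in simp)
    qed
    obtain r l x where r: "strict_mono r" "(\<lambda>n. y (r n)) \<longlonglongrightarrow> x" "\<And>j. j < Suc p \<Longrightarrow> conv (\<lambda>n. U (r n) j) (l j)"
    proof (rule bounded_tuple_subsequence[of "Suc p" U y 1])
      show "U n j \<in> fib (y n)" "N (U n j) \<le> 1" if "j < Suc p" for n j by (rule Uf[OF that], rule UN[OF that])
    qed (rule that)
    have x: "x \<in> Y" by (rule closed_sequentially[OF compact_imp_closed[OF Y_compact] _ r(2)]) (simp add: y)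
    have "expanding (Suc p) x l (1 / 4)"
    proof (rule expanding_limit[OF r(2), where u = "\<lambda>n. U (r n)"])
      fix n i j :: nat and t assume i: "i \<le> n" and j: "j < Suc p"
      have "i \<le> r n" using seq_suble[OF r(1), of n] i by simp
      then show "1 / 4 * \<bar>t j\<bar> \<le> \<rho> i (comb (y (r n)) (Suc p) t (U (r n)))" by (rule low[OF _ j])
    qed (use Uf r(3) in auto)
    then show False using not_expanding[OF x] by blast
  qed
  then obtain m where "\<forall>x v. x \<in> Y \<longrightarrow> v \<in> fib x \<longrightarrow> (\<lambda>n. \<rho> n v) \<longlonglongrightarrow> 0 \<longrightarrow> \<rho> (Suc m) v \<le> 1 / 2 * N v" by blast
  then show ?thesis by (intro that[of "Suc m"]) auto
qed

lemma contraction_iterate: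
  assumes m: "\<And>x v. x \<in> Y \<Longrightarrow> v \<in> fib x \<Longrightarrow> (\<lambda>n. \<rho> n v) \<longlonglongrightarrow> 0 \<Longrightarrow> \<rho> m v \<le> 1 / 2 * N v"
    and x: "x \<in> Y" and v: "v \<in> fib x" "(\<lambda>n. \<rho> n v) \<longlonglongrightarrow> 0"
  shows "\<rho> (a * m) v \<le> (1 / 2) ^ a * N v"
proof (induction a)
  case (Suc a)
  have "(T ^^ n) x \<in> Y \<and> (\<lambda>k. \<rho> k ((\<Phi> ^^ n) v)) \<longlonglongrightarrow> 0" for n
  proof (induction n)
    case (Suc n)
    then show ?case using T_Y null_phi_iff[OF iterate_in[OF v(1), of n]] by simp
  qed (use x v in simp)
  then have "\<rho> m ((\<Phi> ^^ (a * m)) v) \<le> 1 / 2 * N ((\<Phi> ^^ (a * m)) v)" using m[OF _ iterate_in[OF v(1)]] by blast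
  also have "N ((\<Phi> ^^ (a * m)) v) = L ^ (a * m) * \<rho> (a * m) v" using L_pos by (simp add: \<rho>_def)
  finally have "L ^ (a * m) * \<rho> (Suc a * m) v \<le> L ^ (a * m) * (1 / 2 * \<rho> (a * m) v)"
    by (simp add: rho_iterate add.commute)
  then have "\<rho> (Suc a * m) v \<le> 1 / 2 * \<rho> (a * m) v" by (rule mult_left_le_imp_le) (use L_pos in simp)
  then show ?case using Suc by simp
qed simp

text \<open>Convergence to zero is not a closed condition by itself; the uniform rate
  \<open>(1 / 2) ^ a\<close> at time \<open>a * m\<close>, shared by all vectors of
  \<open>GG\<close>, is.\<close>

lemma GG_closed:
  assumes v: "\<And>n. v n \<in> GG" and l: "conv v l" and lY: "bproj E l \<in> Y" shows "l \<in> GG"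
proof -
  obtain m where m: "0 < m" "\<And>x v. x \<in> Y \<Longrightarrow> v \<in> fib x \<Longrightarrow> (\<lambda>n. \<rho> n v) \<longlonglongrightarrow> 0 \<Longrightarrow> \<rho> m v \<le> 1 / 2 * N v"
    by (rule uniform_contraction) blast
  have lf: "l \<in> fib (bproj E l)" by (rule tot_fib[OF conv_topspace[OF l]])
  have b: "\<rho> (a * m) l \<le> (1 / 2) ^ a * N l" for a
  proof (rule LIMSEQ_le)
    show "(\<lambda>k. \<rho> (a * m) (v k)) \<longlonglongrightarrow> \<rho> (a * m) l" by (rule rho_conv[OF l])
    show "(\<lambda>k. (1 / 2) ^ a * N (v k)) \<longlonglongrightarrow> (1 / 2) ^ a * N l" by (intro tendsto_mult tendsto_const conv_norm l)
    have "\<rho> (a * m) (v k) \<le> (1 / 2) ^ a * N (v k)" for k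
      by (rule contraction_iterate[OF m(2), where x = "bproj E (v k)"]) (use v[of k] in \<open>auto simp: GG_def intro: tot_fib\<close>)
    then show "\<exists>K. \<forall>k\<ge>K. \<rho> (a * m) (v k) \<le> (1 / 2) ^ a * N (v k)" by blast
  qed
  obtain \<nu> where \<nu>: "(\<lambda>n. \<rho> n l) \<longlonglongrightarrow> \<nu>" using rho_convergent[OF lf] by blast
  have "\<nu> \<le> (1 / 2) ^ a * N l" for a
  proof -
    have "\<nu> \<le> \<rho> (a * m) l" by (rule LIMSEQ_le_const2[OF \<nu>]) (use rho_antimono[OF lf] in blast)
    then show ?thesis using b[of a] by linarith
  qed
  moreover have "(\<lambda>a. (1 / 2) ^ a * N l) \<longlonglongrightarrow> 0 * N l"
    by (intro tendsto_mult tendsto_const LIMSEQ_realpow_zero) auto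
  ultimately have "\<nu> \<le> 0 * N l" by (intro LIMSEQ_le_const[of _ "0 * N l" \<nu>]) blast+
  moreover have "0 \<le> \<nu>" by (rule LIMSEQ_le_const[OF \<nu>]) (use rho_nonneg[OF lf] in blast)
  ultimately have "\<nu> = 0" by simp
  then show ?thesis using \<nu> lY conv_topspace[OF l] by (simp add: GG_def)
qed

text \<open>A basis of the null vectors of length \<open>l\<close>, put after a calibrated frame, is
  independent by uniqueness of the splitting and spans by its existence; so \<open>p + l = d\<close>
  at every point, although the null vectors are defined pointwise.\<close>

lemma GG_basis:
  assumes x: "x \<in> Y"
  shows "\<exists>b. indep x (d - p) b \<and> (\<forall>j<d - p. b j \<in> GG) \<and> (\<forall>v\<in>GG \<inter> fib x. \<exists>c. v = comb x (d - p) c b)"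
proof -
  obtain u where u: "calibrated_frame p x u" using frame_ex[OF x] by blast
  let ?V = "{v \<in> fib x. (\<lambda>n. \<rho> n v) \<longlonglongrightarrow> 0}"
  have V: "GG \<inter> fib x = ?V" using GG_iff[OF _ x] by blast
  obtain l g where g: "indep x l g" "\<And>j. j < l \<Longrightarrow> g j \<in> ?V" "\<And>v. v \<in> ?V \<Longrightarrow> \<exists>c. v = comb x l c g"
  proof (rule subspace_basis[of ?V x])
    show "?V \<subseteq> fib x" by blast
    fix k c and w :: "nat \<Rightarrow> 'e" assume w: "\<And>j. j < k \<Longrightarrow> w j \<in> ?V"
    have "comb x k c w \<in> fib x" by (rule comb_in) (use w in blast)
    moreover have "(\<lambda>n. \<rho> n (comb x k c w)) \<longlonglongrightarrow> 0" by (rule null_comb) (use w in blast)+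
    ultimately show "comb x k c w \<in> ?V" by simp
  qed (rule that)
  have gf: "g j \<in> fib x" if "j < l" for j using g(2)[OF that] by simp
  have gn: "(\<lambda>n. \<rho> n (comb x l c g)) \<longlonglongrightarrow> 0" for c by (rule null_comb) (use g(2) in blast)+
  have gc: "comb x l c g \<in> fib x" for c by (rule comb_in) (rule gf)
  note uc = frame_in_fib[OF u]
  let ?h = "\<lambda>j. if j < p then u j else g (j - p)"
  have hf: "?h j \<in> fib x" if "j < p + l" for j using frame_fib[OF u, of j] gf[of "j - p"] that by auto
  have app: "comb x (p + l) c ?h = vadd E (comb x p c u) (comb x l (\<lambda>j. c (p + j)) g)" for c
    by (rule comb_append) (rule frame_fib[OF u], simp, rule gf, simp)
  have "indep x (p + l) ?h" unfolding indep_def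
  proof (intro conjI allI impI hf)
    fix c j assume c0: "comb x (p + l) c ?h = vzero E x" and j: "j < p + l"
    have z: "comb x p (\<lambda>_. 0) u = vzero E x" by (rule comb_zero) (use frame_fib[OF u] in auto)
    have e: "vadd E (comb x p c u) (comb x l (\<lambda>j. c (p + j)) g) = vadd E (comb x p (\<lambda>_. 0) u) (vzero E x)"
      using c0 app[of c] z vzero_add[OF vzero_in] by simp
    note un = splitting_unique[OF x u gc gn vzero_in null_zero e]
    show "c j = 0"
    proof (cases "j < p")
      case True
      have "comb x p c u = vzero E x" using un(1) z by simp
      then show ?thesis using frame_independent[OF u] True by (simp add: indep_def)
    next
      case False
      then have "j - p < l" "c j = c (p + (j - p))" using j by auto
      moreover from g(1) have "\<forall>c. comb x l c g = vzero E x \<longrightarrow> (\<forall>j<l. c j = 0)" by (simp add: indep_def)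
      ultimately show ?thesis using un(2) by (metis (no_types))
    qed
  qed
  then have le: "p + l \<le> d" by (rule indep_le_dim)
  obtain U h where ch: "x \<in> U" "chart U h" using chart_exists .
  have "d \<le> p + l"
  proof (rule indep_le_span[OF frame_indep[OF ch(2,1)] hf])
    fix j assume "j < d"
    then have "frame E U h j x \<in> fib x" by (rule frame_in[OF ch(2,1)])
    from splitting_exists[OF x u this] obtain c g' where g': "g' \<in> fib x" "(\<lambda>n. \<rho> n g') \<longlonglongrightarrow> 0"
      "frame E U h j x = vadd E (comb x p c u) g'" by (elim exE conjE)
    obtain c' where c': "g' = comb x l c' g" using g(3)[of g'] g' by auto
    let ?c = "\<lambda>j. if j < p then c j else c' (j - p)"
    have "comb x p ?c u = comb x p c u" by (rule comb_cong) auto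
    then have "comb x (p + l) ?c ?h = frame E U h j x" using app[of ?c] g'(3) c' by simp
    then show "\<exists>c. frame E U h j x = comb x (p + l) c ?h" by metis
  qed
  then have "l = d - p" using le by simp
  then show ?thesis using g V by blast
qed

text \<open>Closure under addition is not evident from the definition of \<open>FF\<close>; it holds
  because each fiber is exactly the span of a calibrated frame.\<close>

lemma FF_subbundle: "subbundle_over E Y FF p"
proof (rule subbundle_from_closed)
  show "FF \<subseteq> bundle_over E Y" by (auto simp: FF_def bundle_over_def bicalibrated_def)
  have lin: "\<exists>u. calibrated_frame p x u \<and> (\<forall>c. comb x p c u \<in> FF) \<and> (\<forall>v\<in>FF \<inter> fib x. \<exists>c. v = comb x p c u)" if x: "x \<in> Y" for x
  proof -
    obtain u where u: "calibrated_frame p x u" using frame_ex[OF x] by blast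
    have "comb x p c u \<in> FF" for c using frame_span[OF u] FF_iff[OF frame_in_fib[OF u] x] by blast
    moreover have "\<exists>c. v = comb x p c u" if "v \<in> FF \<inter> fib x" for v
      using that FF_span[OF x u, of v] by (auto simp: FF_def)
    ultimately show ?thesis using u by blast
  qed
  fix x assume x: "x \<in> Y"
  then obtain u where u: "calibrated_frame p x u" and in_FF: "\<And>c. comb x p c u \<in> FF"
    and span: "\<And>v. v \<in> FF \<inter> fib x \<Longrightarrow> \<exists>c. v = comb x p c u" using lin by metis
  have "comb x p (\<lambda>_. 0) u = vzero E x" by (rule comb_zero) (use frame_fib[OF u] in auto)
  then show "vzero E x \<in> FF" using in_FF by metis
  show "vscale E c v \<in> FF" if v: "v \<in> FF \<inter> fib x" for c v
  proof -
    obtain a where a: "v = comb x p a u" using span[OF v] by blast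
    have "vscale E c v = comb x p (\<lambda>j. c * a j) u" unfolding a by (rule comb_scale) (rule frame_fib[OF u])
    then show ?thesis using in_FF by simp
  qed
  show "vadd E v w \<in> FF" if v: "v \<in> FF \<inter> fib x" and w: "w \<in> FF \<inter> fib x" for v w
  proof -
    obtain a b where ab: "v = comb x p a u" "w = comb x p b u" using span[OF v] span[OF w] by blast
    have "vadd E v w = comb x p (\<lambda>j. a j + b j) u" unfolding ab by (rule comb_add) (rule frame_fib[OF u])
    then show ?thesis using in_FF by simp
  qed
  show "\<exists>b. indep x p b \<and> (\<forall>j<p. b j \<in> FF) \<and> (\<forall>v\<in>FF \<inter> fib x. \<exists>c. v = comb x p c b)"
  proof (intro exI[of _ u] conjI allI impI ballI frame_independent[OF u] span)
    fix j assume j: "j < p"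
    have "comb x p (\<lambda>i. if i = j then 1 else 0) u = vscale E 1 (u j)"
      by (rule comb_single[OF j]) (rule frame_fib[OF u])
    also have "\<dots> = u j"
      by (rule fib_eqI) (use frame_fib[OF u j] in \<open>auto intro!: vscale_in simp: crd_scale\<close>)
    finally show "u j \<in> FF" using in_FF by metis
  qed
next
  show "l \<in> FF" if "\<And>n. v n \<in> FF" "conv v l" "bproj E l \<in> Y" for v l
    using bicalibrated_closed[of v l] that by (auto simp: FF_def)
qed

lemma GG_subbundle: "subbundle_over E Y GG (d - p)"
proof (rule subbundle_from_closed[OF _ _ _ _ GG_basis GG_closed])
  show "GG \<subseteq> bundle_over E Y" by (auto simp: GG_def bundle_over_def)
  fix x assume x: "x \<in> Y"
  show "vzero E x \<in> GG" using null_zero GG_iff[OF vzero_in x] by blast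
  show "vadd E u v \<in> GG" if "u \<in> GG \<inter> fib x" "v \<in> GG \<inter> fib x" for u v
    using that GG_iff[OF vadd_in x, of u v] null_add[of u x v] by (auto simp: GG_def)
  show "vscale E c v \<in> GG" if "v \<in> GG \<inter> fib x" for c v
    using that GG_iff[OF vscale_in x, of v c] null_scale[of v x c] by (auto simp: GG_def)
qed

lemma domination:
  "\<exists>c>0. \<exists>\<tau>>0. \<forall>x\<in>Y. \<forall>u\<in>FF \<inter> fib x. \<forall>v\<in>GG \<inter> fib x. \<forall>n::nat.
     N u = 1 \<longrightarrow> N v = 1 \<longrightarrow> N ((\<Phi> ^^ n) v) \<le> c * exp (- \<tau> * real n) * N ((\<Phi> ^^ n) u)"
proof -
  obtain m where m: "0 < m" "\<And>x v. x \<in> Y \<Longrightarrow> v \<in> fib x \<Longrightarrow> (\<lambda>n. \<rho> n v) \<longlonglongrightarrow> 0 \<Longrightarrow> \<rho> m v \<le> 1 / 2 * N v"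
    by (rule uniform_contraction) blast
  let ?\<tau> = "ln 2 / real m"
  have main: "N ((\<Phi> ^^ n) v) \<le> 2 * exp (- ?\<tau> * real n) * N ((\<Phi> ^^ n) u)"
    if x: "x \<in> Y" and u: "u \<in> FF \<inter> fib x" "N u = 1" and v: "v \<in> GG \<inter> fib x" "N v = 1" for x u v n
  proof -
    \<comment> \<open>Only complete blocks of length \<open>m\<close> contribute a factor 1/2.
      Passing from \<open>n div m\<close> to \<open>n / m\<close> costs at most one more factor,
      which is the 2 in front, with rate \<open>?\<tau> = ln 2 / m\<close>.\<close>
    define a where "a = n div m"
    have "u \<in> bicalibrated" using u(1) by (simp add: FF_def)
    then have Nu: "N ((\<Phi> ^^ n) u) = L ^ n" using bicalibrated_calibrated[of u] u(2) by (simp add: calibrated_def)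
    have vf: "v \<in> fib x" using v(1) by simp
    have v0: "(\<lambda>n. \<rho> n v) \<longlonglongrightarrow> 0" using v(1) by (simp add: GG_def)
    have "\<rho> n v \<le> \<rho> (a * m) v" by (rule rho_antimono[OF vf]) (simp add: a_def)
    also have "\<dots> \<le> (1 / 2) ^ a * N v" by (rule contraction_iterate[OF m(2) x vf v0])
    also have "\<dots> = exp (- (ln 2 * real a))" unfolding v(2) by (simp add: exp_minus exp_of_nat2_mult power_one_over inverse_eq_divide)
    also have "\<dots> \<le> 2 * exp (- ?\<tau> * real n)"
    proof -
      have "n < Suc a * m" unfolding a_def using m(1) by (rule dividend_less_div_times[THEN order_less_le_trans]) simp
      then have "real n \<le> real (Suc a) * real m" by (metis less_imp_le of_nat_le_iff of_nat_mult)
      then have "real n / real m \<le> real (Suc a)" using m(1) by (simp add: pos_divide_le_eq)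
      then have "ln 2 * (real n / real m) \<le> ln 2 * real (Suc a)" by (intro mult_left_mono) auto
      then have "- (ln 2 * real a) \<le> ln 2 + - ?\<tau> * real n" by (simp add: distrib_left)
      then have "exp (- (ln 2 * real a)) \<le> exp (ln 2 + - ?\<tau> * real n)" by (simp only: exp_le_cancel_iff)
      also have "exp (ln 2 + - ?\<tau> * real n) = exp (ln 2) * exp (- ?\<tau> * real n)" by (rule exp_add)
      finally show ?thesis by simp
    qed
    finally have "\<rho> n v \<le> 2 * exp (- ?\<tau> * real n)" .
    then have "L ^ n * \<rho> n v \<le> L ^ n * (2 * exp (- ?\<tau> * real n))" using L_pos by (intro mult_left_mono) auto
    moreover have "L ^ n * \<rho> n v = N ((\<Phi> ^^ n) v)" using L_pos by (simp add: \<rho>_def)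
    ultimately show ?thesis unfolding Nu by (simp only: mult_ac)
  qed
  have "0 < ?\<tau>" using m(1) by simp
  then show ?thesis using main by (intro exI[of _ 2] exI[of _ ?\<tau>] conjI) auto
qed

theorem splitting: "dominated_splitting E T \<Phi> Y FF p GG (d - p)"
  unfolding dominated_splitting_def
proof (intro conjI ballI FF_subbundle GG_subbundle)
  fix x w assume x: "x \<in> Y" and w: "w \<in> fib x"
  obtain u where u: "calibrated_frame p x u" using frame_ex[OF x] by blast
  obtain c g where g: "g \<in> fib x" "(\<lambda>n. \<rho> n g) \<longlonglongrightarrow> 0" "w = vadd E (comb x p c u) g"
    using splitting_exists[OF x u w] by (elim exE conjE)
  have in_FF: "comb x p c u \<in> FF \<inter> fib x" for c
    using frame_span[OF u] FF_iff[OF frame_in_fib[OF u] x] frame_in_fib[OF u] by blast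
  show "\<exists>!(f, g). f \<in> FF \<inter> fib x \<and> g \<in> GG \<inter> fib x \<and> w = vadd E f g"
  proof (rule ex1I[of _ "(comb x p c u, g)"])
    show "case (comb x p c u, g) of (f, g) \<Rightarrow> f \<in> FF \<inter> fib x \<and> g \<in> GG \<inter> fib x \<and> w = vadd E f g"
      using in_FF g GG_iff[OF g(1) x] by simp
    fix q assume "case q of (f, g) \<Rightarrow> f \<in> FF \<inter> fib x \<and> g \<in> GG \<inter> fib x \<and> w = vadd E f g"
    then obtain f g' where q: "q = (f, g')" and f: "f \<in> FF" "f \<in> fib x" and g': "g' \<in> GG" "g' \<in> fib x"
      and w': "w = vadd E f g'" by (cases q) auto
    have "f \<in> bicalibrated" using f(1) by (simp add: FF_def)
    from FF_span[OF x u this f(2)] obtain c' where c': "f = comb x p c' u" by blast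
    have g'0: "(\<lambda>n. \<rho> n g') \<longlonglongrightarrow> 0" using g'(1) by (simp add: GG_def)
    have "vadd E (comb x p c' u) g' = vadd E (comb x p c u) g" using w' g(3) c' by simp
    from splitting_unique[OF x u g'(2) g'0 g(1,2) this] show "q = (comb x p c u, g)" using q c' by simp
  qed
next
  fix x assume x: "x \<in> Y"
  show "\<Phi> ` (FF \<inter> fib x) = FF \<inter> fib (T x)"
  proof (intro equalityI subsetI)
    fix w assume "w \<in> \<Phi> ` (FF \<inter> fib x)"
    then obtain v where v: "w = \<Phi> v" "v \<in> FF" "v \<in> fib x" by blast
    then have "\<Phi> v \<in> bicalibrated" by (intro bicalibrated_phi) (simp add: FF_def)
    then show "w \<in> FF \<inter> fib (T x)" using v(1) phi_in[OF v(3)] FF_iff[OF phi_in[OF v(3)] T_Y[OF x]] by simp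
  next
    fix w assume w: "w \<in> FF \<inter> fib (T x)"
    then obtain v where v: "v \<in> bicalibrated \<inter> fib x" "\<Phi> v = w" using bicalibrated_phi_surj[of w x] by (auto simp: FF_def)
    then show "w \<in> \<Phi> ` (FF \<inter> fib x)" using FF_iff[of v x] x by blast
  qed
  show "\<Phi> ` (GG \<inter> fib x) = GG \<inter> fib (T x)"
  proof (intro equalityI subsetI)
    fix w assume "w \<in> \<Phi> ` (GG \<inter> fib x)"
    then obtain v where v: "w = \<Phi> v" "v \<in> GG" "v \<in> fib x" by blast
    then have "(\<lambda>n. \<rho> n (\<Phi> v)) \<longlonglongrightarrow> 0" using null_phi_iff[OF v(3)] by (simp add: GG_def)
    then show "w \<in> GG \<inter> fib (T x)" using v(1) phi_in[OF v(3)] GG_iff[OF phi_in[OF v(3)] T_Y[OF x]] by simp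
  next
    fix w assume w: "w \<in> GG \<inter> fib (T x)"
    then obtain v where v: "v \<in> fib x" "\<Phi> v = w" using phi_surj[of w x] by blast
    have "(\<lambda>n. \<rho> n (\<Phi> v)) \<longlonglongrightarrow> 0" using w v(2) by (simp add: GG_def)
    then have "v \<in> GG" using null_phi_iff[OF v(1)] GG_iff[OF v(1) x] by simp
    then show "w \<in> \<Phi> ` (GG \<inter> fib x)" using v by blast
  qed
next
  show "\<exists>N. finsler_norm E N \<and> (\<exists>c>0. \<exists>\<tau>>0. \<forall>x\<in>Y. \<forall>u\<in>FF \<inter> fib x. \<forall>v\<in>GG \<inter> fib x. \<forall>n::nat.
     N u = 1 \<longrightarrow> N v = 1 \<longrightarrow> N ((\<Phi> ^^ n) v) \<le> c * exp (- \<tau> * real n) * N ((\<Phi> ^^ n) u))"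
    using finsler domination by (intro exI[of _ N] conjI)
qed

lemma FF_norm: "u \<in> FF \<Longrightarrow> N (\<Phi> u) = L * N u"
  using bicalibrated_calibrated[of u] by (auto simp: FF_def calibrated_def dest: spec[of _ "1::nat"])

end

section \<open>Specialization to an extremal norm\<close>

theorem theorem6p5:
  fixes E :: "('x::metric_space, 'e) vbundle"
    and T :: "'x \<Rightarrow> 'x" and \<Phi> :: "'e \<Rightarrow> 'e" and N :: "'e \<Rightarrow> real"
    and d p :: nat and Y :: "'x set"
  assumes "compact (UNIV :: 'x set)"
    and "\<exists>S. homeomorphism UNIV UNIV T S"
    and "base_set E = UNIV" and "vector_bundle E d"
    and "bundle_automorphism E T \<Phi>"
    and "extremal_norm E T \<Phi> N"
    and "p \<in> {1..d}"
    and "Y \<noteq> {}" and "compact Y" and "T ` Y = Y"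
    and "Y \<subseteq> mather_set E d T \<Phi> p - mather_set E d T \<Phi> (p + 1)"
  shows "\<exists>F G l. dominated_splitting E T \<Phi> Y F p G l \<and>
           (\<forall>u\<in>F. N (\<Phi> u) = exp (max_exponent E T \<Phi>) * N u)"
proof -
  obtain S where S: "homeomorphism UNIV UNIV T S" using assms(2) by blast
  interpret cocycle E d N T \<Phi>
    by unfold_locales (use assms(1,3-6) in \<open>auto simp: extremal_norm_def\<close>)
  define L where "L = (SUP x. fiber_opnorm E N \<Phi> x)"
  have max_L: "max_exponent E T \<Phi> = ln L" using assms(3,6) by (simp add: extremal_norm_def L_def)
  obtain B where B: "B > 0" "\<And>v. v \<in> tot \<Longrightarrow> N (\<Phi> v) \<le> B * N v" by (rule phi_bounded) blast
  have B1: "N (\<Phi> v) \<le> B" if "v \<in> fib x" "N v \<le> 1" for v x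
  proof -
    have "N (\<Phi> v) \<le> B * N v" by (rule B(2)[OF fib_tot[OF that(1)]])
    also have "\<dots> \<le> B * 1" using B(1) that(2) by (intro mult_left_mono) auto
    finally show ?thesis by simp
  qed
  have bdd: "bdd_above ((\<lambda>v. N (\<Phi> v)) ` {v \<in> fib x. N v \<le> 1})" for x
    using B1 by (intro bdd_aboveI2[where M = B]) auto
  have op: "N (\<Phi> v) \<le> fiber_opnorm E N \<Phi> x" if "v \<in> fib x" "N v \<le> 1" for v x
    unfolding fiber_opnorm_def using that by (intro cSUP_upper bdd) auto
  have ne: "{v \<in> fib x. N v \<le> 1} \<noteq> {}" for x
    using vzero_in[of x] norm_zero[of x] by (auto intro!: exI[of _ "vzero E x"])
  have opB: "fiber_opnorm E N \<Phi> x \<le> B" for x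
    unfolding fiber_opnorm_def by (rule cSUP_least[OF ne]) (use B1 in blast)
  have opL: "fiber_opnorm E N \<Phi> x \<le> L" for x
    unfolding L_def by (rule cSUP_upper) (use opB in \<open>auto intro!: bdd_aboveI2[where M = B]\<close>)
  have unit: "N (\<Phi> v) \<le> L" if "v \<in> fib x" "N v \<le> 1" for v x using op[OF that] opL[of x] by linarith
  have contr: "N (\<Phi> v) \<le> L * N v" if "v \<in> tot" for v
  proof -
    have v: "v \<in> fib (bproj E v)" by (rule tot_fib[OF that])
    show ?thesis
    proof (cases "N v = 0")
      case True
      then show ?thesis using B(2)[OF that] by simp
    next
      case False
      then have pos: "N v > 0" using norm_nonneg[OF v] by simp
      have "N (\<Phi> (vscale E (1 / N v) v)) \<le> L" using norm_scale[OF v] pos by (intro unit[OF vscale_in[OF v]]) simp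
      then show ?thesis using norm_scale[OF phi_in[OF v]] pos by (simp add: phi_scale[OF v] pos_divide_le_eq)
    qed
  qed
  have L_pos: "0 < L"
  proof -
    \<comment> \<open>Any point of the base serves, hence \<open>undefined\<close>. As
      \<open>1 \<le> p \<le> d\<close>, the fiber contains a nonzero vector, whose image is nonzero;
      positivity of \<open>L\<close> is what makes the exponential of \<open>ln L\<close> equal to
      \<open>L\<close>.\<close>
    obtain U h where ch: "undefined \<in> U" "chart U h" using chart_exists .
    let ?v = "frame E U h 0 undefined"
    have "indep undefined d (\<lambda>i. frame E U h i undefined)" by (rule frame_indep[OF ch(2,1)])
    then have "indep undefined 1 (\<lambda>i. frame E U h i undefined)" by (rule indep_prefix) (use assms(7) in simp)
    then obtain \<kappa> where "\<kappa> > 0" "\<And>c j. j < 1 \<Longrightarrow> \<kappa> * \<bar>c j\<bar> \<le> N (comb undefined 1 c (\<lambda>i. frame E U h i undefined))"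
      by (rule indep_norm_bound) blast
    from this(2)[of 0 "\<lambda>_. 1"] this(1) have pos: "0 < N (comb undefined 1 (\<lambda>_. 1) (\<lambda>i. frame E U h i undefined))" by simp
    define v where "v = comb undefined 1 (\<lambda>_. 1) (\<lambda>i. frame E U h i undefined)"
    have v: "v \<in> fib undefined" unfolding v_def
      by (rule comb_in) (use frame_in[OF ch(2,1)] assms(7) in auto)
    have "\<Phi> v \<noteq> vzero E (T undefined)"
      using phi_inj[OF v vzero_in] phi_zero pos norm_zero unfolding v_def[symmetric] by fastforce
    then have "0 < N (\<Phi> v)" using norm_eq_0[OF phi_in[OF v]] norm_nonneg[OF phi_in[OF v]] by simp
    then have "0 < L * N v" using contr[OF fib_tot[OF v]] by linarith
    then show ?thesis using pos unfolding v_def[symmetric] by (simp add: zero_less_mult_iff)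
  qed
  \<comment> \<open>The exponents are differences of consecutive sums, so the sums telescope,
    starting from the value 0 at index 0.\<close>
  have sums: "exponent_sum E d T \<Phi> \<mu> i = real i * ln L"
    if "\<forall>i\<in>{1..k}. lyapunov_exponent E d T \<Phi> \<mu> i = max_exponent E T \<Phi>" "i \<le> k" for \<mu> i k
    using that(2)
  proof (induction i)
    case (Suc i)
    have "lyapunov_exponent E d T \<Phi> \<mu> (Suc i) = ln L" using that(1) Suc.prems max_L by auto
    then show ?case using Suc by (simp add: lyapunov_exponent_def distrib_right)
  qed (simp add: exponent_sum_def)
  interpret extremal_splitting E d N T \<Phi> L S p Y
  proof unfold_locales
    show "0 < L" by (rule L_pos)
    show "N (\<Phi> v) \<le> L * N v" if "v \<in> tot" for v by (rule contr[OF that])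
    show "continuous_on UNIV T" "S (T x) = x" "T (S x) = x" for x using S by (auto simp: homeomorphism_def)
    show "p \<in> {1..d}" "compact Y" "T ` Y = Y" by fact+
  next
    fix x assume "x \<in> Y"
    then have "x \<in> mather_set E d T \<Phi> p" using assms(11) by blast
    then obtain \<mu> where \<mu>: "x \<in> measure_support \<mu>" "\<mu> \<in> invariant_measures T"
      "\<forall>i\<in>{1..p}. lyapunov_exponent E d T \<Phi> \<mu> i = max_exponent E T \<Phi>"
      unfolding mather_set_def by (auto split: if_splits)
    show "\<exists>\<mu>\<in>invariant_measures T. x \<in> measure_support \<mu> \<and> exponent_sum E d T \<Phi> \<mu> p = real p * ln L"
      using \<mu>(1,2) sums[OF \<mu>(3) order_refl] by blast
  next
    fix x \<mu> assume x: "x \<in> Y" and \<mu>: "\<mu> \<in> invariant_measures T" "x \<in> measure_support \<mu>" and pd: "p + 1 \<le> d"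
    show "\<exists>i\<in>{1..p + 1}. exponent_sum E d T \<Phi> \<mu> i \<noteq> real i * ln L"
    proof (rule ccontr)
      assume "\<not> ?thesis"
      then have full: "exponent_sum E d T \<Phi> \<mu> i = real i * ln L" if "i \<le> p + 1" for i
        using that by (cases "i = 0") (auto simp: exponent_sum_def)
      have "lyapunov_exponent E d T \<Phi> \<mu> i = max_exponent E T \<Phi>" if i': "i \<in> {1..p + 1}" for i
      proof -
        have i: "1 \<le> i" "i \<le> p + 1" using i' by auto
        have "exponent_sum E d T \<Phi> \<mu> i = real i * ln L" "exponent_sum E d T \<Phi> \<mu> (i - 1) = real (i - 1) * ln L"
          by (rule full; use i in linarith)+
        then have "lyapunov_exponent E d T \<Phi> \<mu> i = (real i - real (i - 1)) * ln L"
          unfolding lyapunov_exponent_def by (simp only: left_diff_distrib)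
        also have "real i - real (i - 1) = 1" using i by auto
        finally show ?thesis unfolding max_L by simp
      qed
      then have "\<forall>i\<in>{1..p + 1}. lyapunov_exponent E d T \<Phi> \<mu> i = max_exponent E T \<Phi>" by (intro ballI)
      then have "x \<in> mather_set E d T \<Phi> (p + 1)" unfolding mather_set_def if_P[OF pd] using \<mu> by blast
      then show False using x assms(11) by blast
    qed
  qed
  have "exp (max_exponent E T \<Phi>) = L" using max_L L_pos by simp
  then show ?thesis using splitting FF_norm by metis
qed

end
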